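(* Let $\rho_0\in L^\infty(\mathbb{T}^d)$ satisfy $\frac{1}{L^d}\int_{\mathbb{T}^d}\rho_0\,dx=0$ and $\|\rho_0\|_{L^\infty(\mathbb{T}^d)}=1$, and assume that $\rho_0$ depends only on one space variable. Set $H_{max}:=L^{\frac{d+2}{2}}/\sqrt{48}$. Then $\|\rho_0\|_{H^{-1}(\mathbb{T}^d)}\in[0,H_{max}]$ and $$T_{mix}(\rho_0)\ \geq\ E^{-\frac12}\,H_{max}\,\sqrt{2}\,S(\alpha(r_0)),$$ where $r_0:=\|\rho_0\|_{H^{-1}(\mathbb{T}^d)}/H_{max}\in[0,1]$ and $$S(\alpha):=\tfrac12\left(\arcsin(\alpha)+\alpha\sqrt{1-\alpha^2}\right),\qquad \alpha(r):=\left(1-\sqrt{1-r^2}\right)^{\frac12}.$$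
   Context: Fix $d\geq 2$, $L>0$, $E>0$. $\mathbb{T}^d$ is the $d$-dimensional flat torus with side length $L$, i.e. $(\mathbb{R}/L\mathbb{Z})^d$. For $f\in L^2(\mathbb{T}^d)$ with zero average, $\|f\|_{H^{-1}(\mathbb{T}^d)}:=\|\nabla\varphi\|_{L^2(\mathbb{T}^d)}$ where $\Delta\varphi=f$ on $\mathbb{T}^d$. Let $\rho_0\in L^\infty(\mathbb{T}^d)$ have zero average and $\|\rho_0\|_{L^\infty}=1$, and let $T\in(0,\infty]$. A velocity field $v$ is perfectly mixing $\rho_0$ at time $T$ iff $v\in\mathcal{C}^\infty([0,T)\times\mathbb{T}^d;\mathbb{R}^d)$, $\int_{\mathbb{T}^d}|v(t,x)|^2\,dx\leq E$ and $\mathrm{div}\,v(t,\cdot)=0$ for all $t\in[0,T)$, and the (unique) function $\rho\in L^\infty((0,T)\times\mathbb{T}^d)$ satisfying $$\int_0^T\int_{\mathbb{T}^d}\rho\,\partial_t\psi+\rho\, v\cdot\nabla\psi\,dx\,dt+\int_{\mathbb{T}^d}\rho_0\,\psi(0,\cdot)\,dx=0\quad\text{for all }\psi\in\mathcal{C}^\infty_c([0,T)\times\mathbb{T}^d)$$ (i.e. the weak solution of $\partial_t\rho+v\cdot\nabla\rho=0$, $\rho(0,\cdot)=\rho_0$, taken in its representative that is continuous in time with values in weak $L^2$) satisfies $\lim_{t\to T}\|\rho(t,\cdot)\|_{H^{-1}(\mathbb{T}^d)}=0$. The optimal mixing time $T_{mix}(\rho_0)\in[0,\infty]$ is the infimum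 of all $T>0$ for which there exists a velocity field $v$ that perfectly mixes $\rho_0$ at time $T$ (with $\inf\emptyset=+\infty$). *)

theory Defs
  imports "HOL-Analysis.Analysis" "HOL-Probability.Essential_Supremum"
begin

section \<open>The flat torus of side length L\<close>

text \<open>Functions on the torus are represented by functions on \<open>real ^ 'n\<close> that are \<open>L\<close>-periodic in each
  coordinate, with \<open>d = CARD('n)\<close>. Integrals over the torus are integrals over one closed period
  cell; its boundary is a null set.\<close>

definition periodic :: "real \<Rightarrow> (real ^ 'n \<Rightarrow> 'b) \<Rightarrow> bool" where
  "periodic L f \<longleftrightarrow> (\<forall>x i. f (x + axis i L) = f x)"

definition cell :: "real \<Rightarrow> (real ^ 'n) set" where
  "cell L = cbox 0 (\<chi> i. L)"

abbreviation torus :: "real \<Rightarrow> (real ^ 'n) measure" where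
  "torus L \<equiv> lebesgue_on (cell L)"

definition torus_Linf_norm :: "real \<Rightarrow> (real ^ 'n \<Rightarrow> real) \<Rightarrow> ereal" where
  "torus_Linf_norm L f = esssup (torus L) (\<lambda>x. ereal \<bar>f x\<bar>)"

definition torus_Linf :: "real \<Rightarrow> (real ^ 'n \<Rightarrow> real) \<Rightarrow> bool" where
  "torus_Linf L f \<longleftrightarrow> periodic L f \<and> f \<in> borel_measurable lebesgue \<and> torus_Linf_norm L f < \<infinity>"

definition torus_L2 :: "real \<Rightarrow> (real ^ 'n \<Rightarrow> 'b::euclidean_space) \<Rightarrow> bool" where
  "torus_L2 L f \<longleftrightarrow> periodic L f \<and> f \<in> borel_measurable lebesgue
     \<and> integrable (torus L) (\<lambda>x. (norm (f x))\<^sup>2)"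

definition torus_L2_norm :: "real \<Rightarrow> (real ^ 'n \<Rightarrow> 'b::euclidean_space) \<Rightarrow> real" where
  "torus_L2_norm L f = sqrt (LINT x|torus L. (norm (f x))\<^sup>2)"

section \<open>Smooth functions and differential operators\<close>

text \<open>Derivatives are taken within \<open>S\<close>. For \<open>S = [0,T) \<times> R^d\<close> this gives smoothness up to and
  including the initial time, with one-sided time derivatives there.\<close>

fun Ck_on :: "nat \<Rightarrow> 'a::euclidean_space set \<Rightarrow> ('a \<Rightarrow> 'b::real_normed_vector) \<Rightarrow> bool" where
  "Ck_on 0 S f \<longleftrightarrow> continuous_on S f"
| "Ck_on (Suc k) S f \<longleftrightarrow>
     (\<exists>f'. (\<forall>x\<in>S. (f has_derivative f' x) (at x within S)) \<and> (\<forall>h. Ck_on k S (\<lambda>x. f' x h)))"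

definition smooth_on :: "'a::euclidean_space set \<Rightarrow> ('a \<Rightarrow> 'b::real_normed_vector) \<Rightarrow> bool" where
  "smooth_on S f \<longleftrightarrow> (\<forall>k. Ck_on k S f)"

definition grad :: "(real ^ 'n \<Rightarrow> real) \<Rightarrow> real ^ 'n \<Rightarrow> real ^ 'n" where
  "grad f x = (\<chi> i. frechet_derivative f (at x) (axis i 1))"

definition divergence :: "(real ^ 'n \<Rightarrow> real ^ 'n) \<Rightarrow> real ^ 'n \<Rightarrow> real" where
  "divergence u x = (\<Sum>i\<in>UNIV. frechet_derivative u (at x) (axis i 1) $ i)"

section \<open>The negative Sobolev norm\<close>

definition weak_gradient :: "real \<Rightarrow> (real ^ 'n \<Rightarrow> real) \<Rightarrow> (real ^ 'n \<Rightarrow> real ^ 'n) \<Rightarrow> bool" where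
  "weak_gradient L \<phi> g \<longleftrightarrow> torus_L2 L \<phi> \<and> torus_L2 L g \<and>
     (\<forall>\<psi>::real ^ 'n \<Rightarrow> real. periodic L \<psi> \<and> smooth_on UNIV \<psi> \<longrightarrow>
        (LINT x|torus L. \<phi> x *\<^sub>R grad \<psi> x) = - (LINT x|torus L. \<psi> x *\<^sub>R g x))"

text \<open>\<open>\<phi>\<close> has the weak gradient \<open>g\<close> and solves \<open>\<Delta>\<phi> = f\<close> weakly on the torus.\<close>

definition poisson_solution ::
    "real \<Rightarrow> (real ^ 'n \<Rightarrow> real) \<Rightarrow> (real ^ 'n \<Rightarrow> real) \<Rightarrow> (real ^ 'n \<Rightarrow> real ^ 'n) \<Rightarrow> bool" where
  "poisson_solution L f \<phi> g \<longleftrightarrow> weak_gradient L \<phi> g \<and>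
     (\<forall>\<psi>::real ^ 'n \<Rightarrow> real. periodic L \<psi> \<and> smooth_on UNIV \<psi> \<longrightarrow>
        (LINT x|torus L. g x \<bullet> grad \<psi> x) = - (LINT x|torus L. f x * \<psi> x))"

text \<open>A square integrable \<open>f\<close> of zero average admits a solution \<open>\<phi>\<close>, unique up to additive constants and
  null sets, so the norm does not depend on the choice of \<open>g\<close>. The value \<open>\<infinity>\<close> is only taken by
  functions without any solution.\<close>

definition Hm1_norm :: "real \<Rightarrow> (real ^ 'n \<Rightarrow> real) \<Rightarrow> ereal" where
  "Hm1_norm L f =
     (if \<exists>\<phi> g. poisson_solution L f \<phi> g
      then ereal (torus_L2_norm L (SOME g. \<exists>\<phi>. poisson_solution L f \<phi> g)) else \<infinity>)"

section \<open>Perfect mixing and the optimal mixing time\<close>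

definition times_from0 :: "ereal \<Rightarrow> real set" where
  "times_from0 T = {t. 0 \<le> t \<and> ereal t < T}"

definition times_pos :: "ereal \<Rightarrow> real set" where
  "times_pos T = {t. 0 < t \<and> ereal t < T}"

definition admissible_velocity ::
    "real \<Rightarrow> real \<Rightarrow> ereal \<Rightarrow> (real \<Rightarrow> real ^ 'n \<Rightarrow> real ^ 'n) \<Rightarrow> bool" where
  "admissible_velocity L E T v \<longleftrightarrow>
     smooth_on (times_from0 T \<times> UNIV) (\<lambda>(t, x). v t x) \<and>
     (\<forall>t\<in>times_from0 T. periodic L (v t) \<and>
        (LINT x|torus L. (norm (v t x))\<^sup>2) \<le> E \<and>
        (\<forall>x. divergence (v t) x = 0))"

definition test_function :: "real \<Rightarrow> ereal \<Rightarrow> (real \<Rightarrow> real ^ 'n \<Rightarrow> real) \<Rightarrow> bool" where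
  "test_function L T \<psi> \<longleftrightarrow>
     smooth_on (times_from0 T \<times> UNIV) (\<lambda>(t, x). \<psi> t x) \<and>
     (\<forall>t\<in>times_from0 T. periodic L (\<psi> t)) \<and>
     (\<exists>T'\<in>times_from0 T. \<forall>t\<in>times_from0 T. \<forall>x. T' < t \<longrightarrow> \<psi> t x = 0)"

text \<open>The bounded weak solution of \<open>\<partial>\<^sub>t \<rho> + v \<bullet> \<nabla>\<rho> = 0\<close>, \<open>\<rho>(0) = \<rho>0\<close>. The last two conjuncts select the
  representative that is continuous in time with values in weak \<open>L^2\<close>.\<close>

definition transport_solution ::
    "real \<Rightarrow> ereal \<Rightarrow> (real \<Rightarrow> real ^ 'n \<Rightarrow> real ^ 'n) \<Rightarrow> (real ^ 'n \<Rightarrow> real) \<Rightarrow>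
     (real \<Rightarrow> real ^ 'n \<Rightarrow> real) \<Rightarrow> bool" where
  "transport_solution L T v \<rho>0 \<rho> \<longleftrightarrow>
     (\<lambda>(t, x). \<rho> t x) \<in> borel_measurable (lebesgue_on (times_pos T \<times> cell L)) \<and>
     esssup (lebesgue_on (times_pos T \<times> cell L)) (\<lambda>(t, x). ereal \<bar>\<rho> t x\<bar>) < \<infinity> \<and>
     (\<forall>\<psi>. test_function L T \<psi> \<longrightarrow>
        (LINT t|lebesgue_on (times_pos T). LINT x|torus L.
           \<rho> t x * deriv (\<lambda>s. \<psi> s x) t + \<rho> t x * (v t x \<bullet> grad (\<psi> t) x))
        + (LINT x|torus L. \<rho>0 x * \<psi> 0 x) = 0) \<and>
     (\<forall>t\<in>times_from0 T. torus_L2 L (\<rho> t)) \<and>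
     (\<forall>\<eta>. torus_L2 L \<eta> \<longrightarrow> continuous_on (times_from0 T) (\<lambda>t. LINT x|torus L. \<rho> t x * \<eta> x))"

text \<open>The limit \<open>t \<rightarrow> T\<close> is taken in the extended reals, since \<open>T = \<infinity>\<close> is allowed.\<close>

definition perfectly_mixing ::
    "real \<Rightarrow> real \<Rightarrow> ereal \<Rightarrow> (real ^ 'n \<Rightarrow> real) \<Rightarrow> (real \<Rightarrow> real ^ 'n \<Rightarrow> real ^ 'n) \<Rightarrow> bool" where
  "perfectly_mixing L E T \<rho>0 v \<longleftrightarrow> admissible_velocity L E T v \<and>
     (\<exists>\<rho>. transport_solution L T v \<rho>0 \<rho> \<and>
          ((\<lambda>t. Hm1_norm L (\<rho> (real_of_ereal t))) \<longlongrightarrow> 0) (at_left T))"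

definition T_mix :: "real \<Rightarrow> real \<Rightarrow> (real ^ 'n \<Rightarrow> real) \<Rightarrow> ereal" where
  "T_mix L E \<rho>0 = Inf {T. 0 < T \<and> (\<exists>v. perfectly_mixing L E T \<rho>0 v)}"

definition depends_on_one_variable :: "(real ^ 'n \<Rightarrow> real) \<Rightarrow> bool" where
  "depends_on_one_variable f \<longleftrightarrow> (\<exists>i. \<exists>g :: real \<Rightarrow> real. AE x in lebesgue. f x = g (x $ i))"

section \<open>The constants in the bound\<close>

definition H_max :: "real \<Rightarrow> nat \<Rightarrow> real" where
  "H_max L d = L powr ((real d + 2) / 2) / sqrt 48"

definition S_fun :: "real \<Rightarrow> real" where
  "S_fun a = (arcsin a + a * sqrt (1 - a\<^sup>2)) / 2"

definition alpha_fun :: "real \<Rightarrow> real" where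
  "alpha_fun r = sqrt (1 - sqrt (1 - r\<^sup>2))"

end

theory Submission imports Defs begin

text \<open>The proof follows one scalar quantity. For a direction \<open>i\<close>, let \<open>f\<close> be the antiderivative of mean zero of the means
  of \<open>\<rho>(t)\<close> over the slices \<open>x_i = const\<close>, and let \<open>Z\<close> be the integral of \<open>f(x_i)^2\<close> over the torus. Testing the Poisson
  equation with a function of \<open>x_i\<close> gives \<open>sqrt Z \<le> Hm1_norm L (\<rho> t)\<close> (\<open>Hm1_lower_bound\<close>), with equality for data depending on
  \<open>x_i\<close> only (\<open>Hm1_norm_eq\<close>). So \<open>Z\<close> starts at the square of the initial norm and has to tend to zero. Since \<open>f\<close> has slope
  at most one, \<open>Z\<close> is at most \<open>H_max^2 = L^(d+2)/48\<close>.

  The transport equation gives \<open>Z' = - 2 \<integral> \<rho> v_i f\<close>. As \<open>v\<close> is divergence-free, \<open>v_i f f'\<close> has integral zero, so \<open>\<rho>\<close> may be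
  replaced by \<open>\<rho> - f'\<close>. Because \<open>f'\<close> is the slice mean of \<open>\<rho>\<close> and \<open>\<bar>\<rho>\<bar> \<le> 1\<close>, the integral of \<open>(\<rho> - f')^2 f^2\<close> is at most that of
  \<open>f^2 (1 - f'^2)\<close>. A sharp inequality for periodic functions of slope at most one (\<open>weighted_slope_inequality\<close>, with optimal
  weight in \<open>slope_deficit\<close>) bounds this by \<open>H_max^2\<close> times \<open>slope_gap (Z / H_max^2)\<close>. With the energy bound for \<open>v\<close>,
  the ratio \<open>w = Z / H_max^2\<close> therefore satisfies \<open>\<bar>w'\<bar> \<le> 2 (sqrt E / H_max) sqrt (slope_gap w)\<close>. The function
  \<open>sqrt 2 S(\<alpha>(sqrt w))\<close> has derivative \<open>1 / (2 sqrt (slope_gap w))\<close> (\<open>mixing_potential_deriv\<close>), so it decreases at most at speed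
  \<open>sqrt E / H_max\<close>, and it has to reach zero at the mixing time.

  Two points make this rigorous for weak solutions. The slice means of a bounded \<open>\<rho>\<close> are not smooth, so all kernels are mollified at
  a scale \<open>\<epsilon>\<close> and the errors tend to zero with it (\<open>oscillation_bound\<close>, \<open>mixing_rate\<close>, \<open>mixing_time_bound\<close>). And the bound
  \<open>\<bar>\<rho>(t)\<bar> \<le> 1\<close> at later times has to be derived from the weak formulation; \<open>maximum_principle\<close> does so by duality,
  transporting nonnegative test functions backwards in small time steps.\<close>

section \<open>Calculus of smooth functions\<close>

lemma Ck_on_imp_continuous_on: "Ck_on k S f \<Longrightarrow> continuous_on S f"
proof (cases k)
  case (Suc n)
  assume "Ck_on k S f"
  then obtain f' where "\<forall>x\<in>S. (f has_derivative f' x) (at x within S)" using Suc by auto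
  then show ?thesis by (intro has_derivative_continuous_on[of S f f']) simp
qed auto

lemma Ck_on_SucI:
  "(\<And>x. x \<in> S \<Longrightarrow> (f has_derivative f' x) (at x within S)) \<Longrightarrow> (\<And>h. Ck_on k S (\<lambda>x. f' x h))
    \<Longrightarrow> Ck_on (Suc k) S f"
  unfolding Ck_on.simps by (rule exI[of _ f']) simp

lemma Ck_on_SucE:
  assumes "Ck_on (Suc k) S f"
  obtains f' where "\<And>x. x \<in> S \<Longrightarrow> (f has_derivative f' x) (at x within S)"
    "\<And>h. Ck_on k S (\<lambda>x. f' x h)"
  using assms unfolding Ck_on.simps by metis

declare Ck_on.simps(2)[simp del]

lemma Ck_on_SucD: "Ck_on (Suc k) S f \<Longrightarrow> Ck_on k S f"
proof (induction k arbitrary: f)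
  case 0
  then show ?case using Ck_on_imp_continuous_on by force
next
  case (Suc k)
  obtain f' where "\<forall>x\<in>S. (f has_derivative f' x) (at x within S)" "\<forall>h. Ck_on (Suc k) S (\<lambda>x. f' x h)"
    using Suc.prems by (auto simp: Ck_on.simps(2))
  note f' = this[rule_format]
  show ?case by (rule Ck_on_SucI[OF f'(1) Suc.IH[OF f'(2)]])
qed

lemma Ck_on_subset: "Ck_on k S f \<Longrightarrow> T \<subseteq> S \<Longrightarrow> Ck_on k T f"
proof (induction k arbitrary: f)
  case 0
  then show ?case by (auto intro: continuous_on_subset)
next
  case (Suc k)
  obtain f' where "\<forall>x\<in>S. (f has_derivative f' x) (at x within S)" "\<forall>h. Ck_on k S (\<lambda>x. f' x h)"
    using Suc.prems(1) by (auto simp: Ck_on.simps(2))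
  note f' = this[rule_format]
  show ?case
  proof (rule Ck_on_SucI)
    show "(f has_derivative f' x) (at x within T)" if "x \<in> T" for x
      using f'(1) that Suc.prems(2) has_derivative_subset by (metis subsetD)
  qed (rule Suc.IH[OF f'(2) Suc.prems(2)])
qed

lemma Ck_on_const: "Ck_on k S (\<lambda>x. c)"
proof (induction k arbitrary: c)
  case (Suc k)
  show ?case by (rule Ck_on_SucI[OF has_derivative_const Suc])
qed auto

lemma Ck_on_add: "Ck_on k S f \<Longrightarrow> Ck_on k S g \<Longrightarrow> Ck_on k S (\<lambda>x. f x + g x)"
proof (induction k arbitrary: f g)
  case 0
  then show ?case by (auto intro: continuous_intros)
next
  case (Suc k)
  obtain f' where "\<forall>x\<in>S. (f has_derivative f' x) (at x within S)" "\<forall>h. Ck_on k S (\<lambda>x. f' x h)"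
    using Suc.prems(1) by (auto simp: Ck_on.simps(2))
  note f' = this[rule_format]
  obtain g' where "\<forall>x\<in>S. (g has_derivative g' x) (at x within S)" "\<forall>h. Ck_on k S (\<lambda>x. g' x h)"
    using Suc.prems(2) by (auto simp: Ck_on.simps(2))
  note g' = this[rule_format]
  show ?case
    by (rule Ck_on_SucI[OF has_derivative_add[OF f'(1) g'(1)] Suc.IH[OF f'(2) g'(2)]])
qed

lemma Ck_on_bilinear:
  assumes "bounded_bilinear p"
  shows "Ck_on k S f \<Longrightarrow> Ck_on k S g \<Longrightarrow> Ck_on k S (\<lambda>x. p (f x) (g x))"
proof (induction k arbitrary: f g)
  case 0
  then show ?case by (auto intro: bounded_bilinear.continuous_on[OF assms])
next
  case (Suc k)
  obtain f' where "\<forall>x\<in>S. (f has_derivative f' x) (at x within S)" "\<forall>h. Ck_on k S (\<lambda>x. f' x h)"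
    using Suc.prems(1) by (auto simp: Ck_on.simps(2))
  note f' = this[rule_format]
  obtain g' where "\<forall>x\<in>S. (g has_derivative g' x) (at x within S)" "\<forall>h. Ck_on k S (\<lambda>x. g' x h)"
    using Suc.prems(2) by (auto simp: Ck_on.simps(2))
  note g' = this[rule_format]
  show ?case
    by (rule Ck_on_SucI[OF bounded_bilinear.FDERIV[OF assms f'(1) g'(1)]
          Ck_on_add[OF Suc.IH[OF Ck_on_SucD[OF Suc.prems(1)] g'(2)]
            Suc.IH[OF f'(2) Ck_on_SucD[OF Suc.prems(2)]]]])
qed

lemmas Ck_on_scaleR = Ck_on_bilinear[OF bounded_bilinear_scaleR]
lemmas Ck_on_mult = Ck_on_bilinear[OF bounded_bilinear_mult]

lemma Ck_on_sum: "(\<And>i. i \<in> I \<Longrightarrow> Ck_on k S (f i)) \<Longrightarrow> Ck_on k S (\<lambda>x. \<Sum>i\<in>I. f i x)"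
  by (induction I rule: infinite_finite_induct) (auto intro: Ck_on_const Ck_on_add)

lemma Ck_on_bounded_linear:
  assumes "bounded_linear A"
  shows "Ck_on k S f \<Longrightarrow> Ck_on k S (\<lambda>x. A (f x))"
proof (induction k arbitrary: f)
  case 0
  then show ?case by (auto intro: bounded_linear.continuous_on[OF assms])
next
  case (Suc k)
  obtain f' where "\<forall>x\<in>S. (f has_derivative f' x) (at x within S)" "\<forall>h. Ck_on k S (\<lambda>x. f' x h)"
    using Suc.prems(1) by (auto simp: Ck_on.simps(2))
  note f' = this[rule_format]
  show ?case
    by (rule Ck_on_SucI[OF bounded_linear.has_derivative[OF assms f'(1)] Suc.IH[OF f'(2)]])
qed

lemma Ck_on_ident: "Ck_on k S (\<lambda>x. x)"
proof (cases k)
  case (Suc n)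
  show ?thesis unfolding Suc by (rule Ck_on_SucI[OF has_derivative_ident Ck_on_const])
qed auto

lemma Ck_on_compose:
  fixes f :: "'a::euclidean_space \<Rightarrow> 'b::euclidean_space" and g :: "'b \<Rightarrow> 'c::real_normed_vector"
  shows "Ck_on k S f \<Longrightarrow> Ck_on k T g \<Longrightarrow> f ` S \<subseteq> T \<Longrightarrow> Ck_on k S (\<lambda>x. g (f x))"
proof (induction k arbitrary: g)
  case 0
  then show ?case by (auto intro: continuous_on_compose2)
next
  case (Suc k)
  obtain f' where "\<forall>x\<in>S. (f has_derivative f' x) (at x within S)" "\<forall>h. Ck_on k S (\<lambda>x. f' x h)"
    using Suc.prems(1) by (auto simp: Ck_on.simps(2))
  note f' = this[rule_format]
  obtain g' where "\<forall>x\<in>T. (g has_derivative g' x) (at x within T)" "\<forall>h. Ck_on k T (\<lambda>x. g' x h)"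
    using Suc.prems(2) by (auto simp: Ck_on.simps(2))
  note g' = this[rule_format]
  have f: "Ck_on k S f" using Suc.prems Ck_on_SucD by blast
  let ?D = "\<lambda>x h. \<Sum>i\<in>Basis. (f' x h \<bullet> i) *\<^sub>R g' (f x) i"
  show ?case
  proof (rule Ck_on_SucI)
    fix x assume x: "x \<in> S"
    then have fx: "f x \<in> T" using Suc.prems by blast
    have "(g has_derivative g' (f x)) (at (f x) within f ` S)"
      by (rule has_derivative_subset[OF g'(1)[OF fx] Suc.prems(3)])
    then have 1: "((\<lambda>x. g (f x)) has_derivative (\<lambda>h. g' (f x) (f' x h))) (at x within S)"
      by (rule has_derivative_in_compose[OF f'(1)[OF x]])
    have lin: "linear (g' (f x))"
      using g'(1)[OF fx] by (rule has_derivative_linear)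
    have "g' (f x) w = (\<Sum>i\<in>Basis. (w \<bullet> i) *\<^sub>R g' (f x) i)" for w
    proof -
      have "g' (f x) w = g' (f x) (\<Sum>i\<in>Basis. (w \<bullet> i) *\<^sub>R i)" by (simp add: euclidean_representation)
      also have "\<dots> = (\<Sum>i\<in>Basis. (w \<bullet> i) *\<^sub>R g' (f x) i)"
        by (simp add: linear_sum[OF lin] linear_scale[OF lin])
      finally show ?thesis .
    qed
    then have "(\<lambda>h. g' (f x) (f' x h)) = ?D x" by (intro ext)
    then show "((\<lambda>x. g (f x)) has_derivative ?D x) (at x within S)" using 1 by simp
  next
    fix h
    show "Ck_on k S (\<lambda>x. ?D x h)"
      by (intro Ck_on_sum Ck_on_scaleR Ck_on_bounded_linear[OF bounded_linear_inner_left] f'(2)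
          Suc.IH[OF f g'(2) Suc.prems(3)])
  qed
qed

lemma smooth_on_const: "smooth_on S (\<lambda>x. c)"
  and smooth_on_ident: "smooth_on S (\<lambda>x. x)"
  and smooth_on_add: "smooth_on S f \<Longrightarrow> smooth_on S g \<Longrightarrow> smooth_on S (\<lambda>x. f x + g x)"
  and smooth_on_scaleR: "smooth_on S a \<Longrightarrow> smooth_on S f \<Longrightarrow> smooth_on S (\<lambda>x. a x *\<^sub>R f x)"
  and smooth_on_bounded_linear: "bounded_linear A \<Longrightarrow> smooth_on S f \<Longrightarrow> smooth_on S (\<lambda>x. A (f x))"
  and smooth_on_subset: "smooth_on S f \<Longrightarrow> T \<subseteq> S \<Longrightarrow> smooth_on T f"
  unfolding smooth_on_def
  by (auto intro: Ck_on_const Ck_on_ident Ck_on_add Ck_on_scaleR Ck_on_bounded_linear Ck_on_subset)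

lemma smooth_on_mult:
  fixes f g :: "_ \<Rightarrow> 'b::real_normed_algebra"
  shows "smooth_on S f \<Longrightarrow> smooth_on S g \<Longrightarrow> smooth_on S (\<lambda>x. f x * g x)"
  unfolding smooth_on_def by (auto intro: Ck_on_mult)

lemma smooth_on_compose:
  fixes f :: "'a::euclidean_space \<Rightarrow> 'b::euclidean_space"
  shows "smooth_on S f \<Longrightarrow> smooth_on T g \<Longrightarrow> f ` S \<subseteq> T \<Longrightarrow> smooth_on S (\<lambda>x. g (f x))"
  unfolding smooth_on_def by (blast intro: Ck_on_compose)

lemma smooth_on_compose_UNIV:
  fixes f :: "'a::euclidean_space \<Rightarrow> 'b::euclidean_space"
  shows "smooth_on S f \<Longrightarrow> smooth_on UNIV g \<Longrightarrow> smooth_on S (\<lambda>x. g (f x))"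
  by (blast intro: smooth_on_compose)

lemma smooth_on_linear: "bounded_linear A \<Longrightarrow> smooth_on S A"
  using smooth_on_bounded_linear smooth_on_ident by blast

lemma smooth_on_imp_continuous_on: "smooth_on S f \<Longrightarrow> continuous_on S f"
  unfolding smooth_on_def using Ck_on_imp_continuous_on by blast

lemma smooth_on_derivative_exists:
  assumes "smooth_on S f"
  obtains f' where "\<And>x. x \<in> S \<Longrightarrow> (f has_derivative f' x) (at x within S)"
    "\<And>h. continuous_on S (\<lambda>x. f' x h)"
proof -
  have "Ck_on (Suc 0) S f" using assms unfolding smooth_on_def by blast
  from Ck_on_SucE[OF this] that show ?thesis by (metis Ck_on.simps(1))
qed

text \<open>Smoothness on the line by coinduction: a family of functions that is closed under differentiation
  consists of smooth functions.\<close>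

lemma smooth_on_real_coinduct:
  fixes f :: "real \<Rightarrow> real"
  assumes "P f" and step: "\<And>f. P f \<Longrightarrow> \<exists>f'. (\<forall>x. (f has_real_derivative f' x) (at x)) \<and> P f'"
  shows "smooth_on UNIV f"
proof -
  have "Ck_on k UNIV f" for k
    using \<open>P f\<close>
  proof (induction k arbitrary: f)
    case 0
    then obtain f' where "\<forall>x. (f has_real_derivative f' x) (at x)" using step by blast
    then show ?case by (auto intro!: DERIV_continuous_on[of UNIV f f'])
  next
    case (Suc k)
    then obtain f' where f': "\<forall>x. (f has_real_derivative f' x) (at x)" "P f'" using step by blast
    show ?case
    proof (rule Ck_on_SucI)
      show "(f has_derivative (\<lambda>h. f' x * h)) (at x within UNIV)" for x
        using f'(1) by (simp add: has_field_derivative_def)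
      show "Ck_on k UNIV (\<lambda>x. f' x * h)" for h
        by (intro Ck_on_mult Ck_on_const Suc.IH f')
    qed
  qed
  then show ?thesis unfolding smooth_on_def by blast
qed

lemma smooth_on_real_deriv:
  fixes f :: "real \<Rightarrow> real"
  assumes "smooth_on UNIV f"
  shows "(f has_real_derivative deriv f x) (at x)" "smooth_on UNIV (deriv f)"
proof -
  have *: "\<exists>f'. (\<forall>x. (f has_real_derivative f' x) (at x)) \<and> Ck_on k UNIV f'" for k
  proof -
    have "Ck_on (Suc k) UNIV f" using assms unfolding smooth_on_def by blast
    from Ck_on_SucE[OF this]
    obtain f' where f': "\<And>x. (f has_derivative f' x) (at x)" "\<And>h. Ck_on k UNIV (\<lambda>x. f' x h)"
      by (metis UNIV_I)
    have "f' x = (\<lambda>h. f' x 1 * h)" for x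
    proof
      show "f' x h = f' x 1 * h" for h
        using linear_scale[OF has_derivative_linear[OF f'(1)[of x]], of h 1] by simp
    qed
    then have "(f has_real_derivative f' x 1) (at x)" for x
      unfolding has_field_derivative_def using f'(1)[of x] by simp
    then show ?thesis using f'(2)[of 1] by (intro exI[of _ "\<lambda>x. f' x 1"]) simp
  qed
  then show d: "(f has_real_derivative deriv f x) (at x)" for x using DERIV_imp_deriv by metis
  have "Ck_on k UNIV (deriv f)" for k
  proof -
    obtain f' where f': "\<forall>x. (f has_real_derivative f' x) (at x)" "Ck_on k UNIV f'" using * by blast
    then have "f' = deriv f" by (intro ext) (metis DERIV_imp_deriv)
    then show ?thesis using f' by simp
  qed
  then show "smooth_on UNIV (deriv f)" unfolding smooth_on_def by blast
qed

lemma smooth_on_antiderivative: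
  fixes f :: "real \<Rightarrow> real"
  assumes "smooth_on UNIV f" "\<And>x. (F has_real_derivative f x) (at x)"
  shows "smooth_on UNIV F"
proof (rule smooth_on_real_coinduct[where P="\<lambda>g. g = F \<or> smooth_on UNIV g"])
  show "\<exists>f'. (\<forall>x. (g has_real_derivative f' x) (at x)) \<and> (f' = F \<or> smooth_on UNIV f')"
    if "g = F \<or> smooth_on UNIV g" for g
    using that assms smooth_on_real_deriv by metis
qed simp

lemma smooth_on_sin: "smooth_on UNIV (sin :: real \<Rightarrow> real)"
  and smooth_on_cos: "smooth_on UNIV (cos :: real \<Rightarrow> real)"
proof -
  have *: "smooth_on UNIV (\<lambda>x. a * sin x + b * cos x)" for a b :: real
  proof (rule smooth_on_real_coinduct[where P="\<lambda>f. \<exists>a b. f = (\<lambda>x. a * sin x + b * cos x)"])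
    fix f :: "real \<Rightarrow> real" assume "\<exists>a b. f = (\<lambda>x. a * sin x + b * cos x)"
    then obtain a b where f: "f = (\<lambda>x. a * sin x + b * cos x)" by blast
    have "\<forall>x. (f has_real_derivative ((-b) * sin x + a * cos x)) (at x)"
      unfolding f by (auto intro!: derivative_eq_intros)
    then show "\<exists>f'. (\<forall>x. (f has_real_derivative f' x) (at x)) \<and> (\<exists>a b. f' = (\<lambda>x. a * sin x + b * cos x))"
      by (intro exI[of _ "\<lambda>x. (-b) * sin x + a * cos x"]) blast
  qed blast
  show "smooth_on UNIV (sin :: real \<Rightarrow> real)" "smooth_on UNIV (cos :: real \<Rightarrow> real)"
    using *[of 1 0] *[of 0 1] by auto
qed

section \<open>Cutoffs, mollifiers and the sawtooth kernel\<close>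

lemma continuous_antiderivative:
  fixes f :: "real \<Rightarrow> real"
  assumes "continuous_on UNIV f"
  obtains F where "\<And>x. (F has_real_derivative f x) (at x)" "F 0 = 0"
proof -
  have "isCont f x" for x using assms by (simp add: continuous_on_eq_continuous_at)
  then obtain F where F: "\<And>x. (F has_vector_derivative f x) (at x)"
    using einterval_antiderivative[of "-\<infinity>" \<infinity> f] by auto
  have "((\<lambda>x. F x - F 0) has_real_derivative f x) (at x)" for x
    using F[of x] by (auto intro!: derivative_eq_intros simp: has_real_derivative_iff_has_vector_derivative)
  then show thesis using that by force
qed

lemma poly_div_exp_tendsto_0: "((\<lambda>y. poly q y / exp y) \<longlongrightarrow> (0::real)) at_top"
proof -
  have "((\<lambda>y. \<Sum>i\<le>degree q. coeff q i * (y ^ i / exp y)) \<longlongrightarrow> (\<Sum>i\<le>degree q. coeff q i * 0)) at_top"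
    by (intro tendsto_sum tendsto_mult tendsto_const tendsto_power_div_exp_0)
  then show ?thesis by (simp add: poly_altdef sum_divide_distrib)
qed

text \<open>All derivatives have the form of a polynomial in \<open>1/x\<close> times the exponential, and each of these vanishes
  at the origin to every order.\<close>

lemma smooth_on_flat:
  "smooth_on UNIV (\<lambda>x::real. if x > 0 then exp (- (1 / x)) else 0)"
proof -
  define e where "e = (\<lambda>p x::real. if x > 0 then poly p (1 / x) * exp (- (1 / x)) else 0)"
  have "smooth_on UNIV (e 1)"
  proof (rule smooth_on_real_coinduct[where P="\<lambda>f. \<exists>p. f = e p"])
    fix f assume "\<exists>p. f = e p"
    then obtain p where f: "f = e p" by blast
    define q where "q = [:0, 0, 1:] * (p - pderiv p)"
    have "(e p has_real_derivative e q x) (at x)" for x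
    proof (rule linorder_cases[of x 0])
      assume x: "x < 0"
      have "((\<lambda>x. 0) has_real_derivative e q x) (at x)" using x by (simp add: e_def)
      moreover have "eventually (\<lambda>y. e p y = 0) (nhds x)"
        using eventually_nhds_in_open[of "{..<0}" x] x by (auto elim!: eventually_mono simp: e_def)
      ultimately show ?thesis using DERIV_cong_ev[of x x "e p" "\<lambda>_. 0"] by simp
    next
      assume x: "x > 0"
      have "((\<lambda>x. poly p (1 / x) * exp (- (1 / x))) has_real_derivative
          (poly (pderiv p) (1 / x) * (- 1 / x\<^sup>2)) * exp (- (1 / x)) + poly p (1 / x) * (exp (- (1 / x)) * (1 / x\<^sup>2))) (at x)"
        using x by (auto intro!: derivative_eq_intros DERIV_chain2[OF poly_DERIV] simp: power2_eq_square field_simps)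
      also have "(poly (pderiv p) (1 / x) * (- 1 / x\<^sup>2)) * exp (- (1 / x)) + poly p (1 / x) * (exp (- (1 / x)) * (1 / x\<^sup>2)) = e q x"
        using x by (simp add: e_def q_def power2_eq_square field_simps)
      finally have 1: "((\<lambda>x. poly p (1 / x) * exp (- (1 / x))) has_real_derivative e q x) (at x)" .
      moreover have "eventually (\<lambda>y. e p y = poly p (1 / y) * exp (- (1 / y))) (nhds x)"
        using eventually_nhds_in_open[of "{0<..}" x] x by (auto elim!: eventually_mono simp: e_def)
      ultimately show ?thesis using DERIV_cong_ev[of x x "e p" "\<lambda>x. poly p (1 / x) * exp (- (1 / x))"] by simp
    next
      assume x: "x = 0"
      have R: "((\<lambda>h. e p h / h) \<longlongrightarrow> 0) (at_right 0)"
      proof -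
        have "((\<lambda>h. poly (pCons 0 p) (inverse h) / exp (inverse h)) \<longlongrightarrow> (0::real)) (at_right 0)"
          by (rule filterlim_compose[OF poly_div_exp_tendsto_0 filterlim_inverse_at_top_right])
        moreover have "eventually (\<lambda>h::real. poly (pCons 0 p) (inverse h) / exp (inverse h) = e p h / h) (at_right 0)"
          using eventually_at_right_less[of 0]
          by eventually_elim (auto simp: e_def exp_minus field_simps)
        ultimately show ?thesis using tendsto_cong by fast
      qed
      have Lf: "((\<lambda>h. e p h / h) \<longlongrightarrow> 0) (at_left 0)"
      proof -
        have "eventually (\<lambda>h::real. 0 = e p h / h) (at_left 0)"
          using eventually_at_left_real[of "-1" "0::real"] by (auto elim!: eventually_mono simp: e_def)
        then show ?thesis by (rule tendsto_eventually[OF eventually_mono]) simp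
      qed
      have "((\<lambda>h. e p h / h) \<longlongrightarrow> 0) (at 0)" by (rule filterlim_split_at[OF Lf R])
      then show ?thesis unfolding x DERIV_def by (simp add: e_def)
    qed
    then show "\<exists>f'. (\<forall>x. (f has_real_derivative f' x) (at x)) \<and> (\<exists>p. f' = e p)"
      unfolding f by blast
  qed blast
  moreover have "e 1 = (\<lambda>x::real. if x > 0 then exp (- (1 / x)) else 0)" by (auto simp: e_def)
  ultimately show ?thesis by simp
qed

lemma smooth_step_exists:
  obtains \<sigma> :: "real \<Rightarrow> real" where "smooth_on UNIV \<sigma>" "\<And>x. x \<le> 0 \<Longrightarrow> \<sigma> x = 1" "\<And>x. x \<ge> 1 \<Longrightarrow> \<sigma> x = 0"
    "\<And>x. deriv \<sigma> x \<le> 0" "\<And>x. 0 \<le> \<sigma> x"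
proof -
  define b where "b = (\<lambda>x::real. if x > 0 then exp (- (1 / x)) else 0)"
  define k where "k = (\<lambda>x. b x * b (1 - x))"
  have b: "smooth_on UNIV b" unfolding b_def by (rule smooth_on_flat)
  have "smooth_on UNIV (\<lambda>x::real. 1 - x)"
    using smooth_on_add[OF smooth_on_const[of UNIV 1] smooth_on_bounded_linear[OF bounded_linear_minus[OF bounded_linear_ident] smooth_on_ident]]
    by simp
  then have k: "smooth_on UNIV k" unfolding k_def
    by (intro smooth_on_mult b smooth_on_compose_UNIV[OF _ b])
  obtain S where S: "\<And>x. (S has_real_derivative k x) (at x)" "S 0 = 0"
    using continuous_antiderivative smooth_on_imp_continuous_on[OF k] by blast
  have k0: "k x \<ge> 0" for x by (auto simp: k_def b_def)
  have mono: "x \<le> y \<Longrightarrow> S x \<le> S y" for x y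
    using DERIV_nonneg_imp_nondecreasing[of x y S] S k0 by blast
  have const: "S x = S y" if "x \<le> y" "\<And>z. x < z \<Longrightarrow> z < y \<Longrightarrow> k z = 0" for x y
  proof (cases "x = y")
    case False
    then have "x < y" using that by simp
    have "continuous_on {x..y} S"
      by (meson DERIV_isCont S(1) continuous_at_imp_continuous_on)
    then show ?thesis
      using DERIV_isconst_end[OF \<open>x < y\<close>, of S] S(1) that(2) by metis
  qed simp
  have S1: "S 1 > 0"
  proof -
    have "\<exists>z. 0 < z \<and> z < 1 \<and> S 1 - S 0 = (1 - 0) * k z" using MVT2[of 0 1 S k] S by simp
    then show ?thesis using S(2) by (auto simp: k_def b_def)
  qed
  define \<sigma> where "\<sigma> = (\<lambda>x. 1 + (- 1 / S 1) * S x)"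
  have d: "(\<sigma> has_real_derivative (- 1 / S 1) * k x) (at x)" for x
    unfolding \<sigma>_def by (rule derivative_eq_intros S refl | simp)+
  show thesis
  proof
    show "smooth_on UNIV \<sigma>" unfolding \<sigma>_def
      by (intro smooth_on_add smooth_on_mult smooth_on_const smooth_on_antiderivative[OF k S(1)])
    show "\<sigma> x = 1" if "x \<le> 0" for x
      using const[of x 0] that S(2) by (auto simp: \<sigma>_def k_def b_def)
    show s1: "\<sigma> x = 0" if "x \<ge> 1" for x
      using const[of 1 x] that S1 by (auto simp: \<sigma>_def k_def b_def)
    show "0 \<le> \<sigma> x" for x
      using mono[of x 1] S1 s1[of x] by (cases "x \<le> 1") (auto simp: \<sigma>_def field_simps)
    show "deriv \<sigma> x \<le> 0" for x
      unfolding DERIV_imp_deriv[OF d] using k0[of x] S1 by (simp add: divide_nonneg_pos)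
  qed
qed

text \<open>Periodic and even bumps of mass one per period whose support lies within distance \<open>\<epsilon>\<close> of the multiples of \<open>L\<close>.\<close>

definition mollifier :: "real \<Rightarrow> real \<Rightarrow> (real \<Rightarrow> real) \<Rightarrow> bool" where
  "mollifier L \<epsilon> \<eta> \<longleftrightarrow> smooth_on UNIV \<eta> \<and> (\<forall>y. \<eta> (y + L) = \<eta> y) \<and> (\<forall>y. \<eta> (- y) = \<eta> y) \<and>
     (\<forall>y. 0 \<le> \<eta> y) \<and> (\<eta> has_integral 1) {0..L} \<and>
     (\<forall>y. \<eta> y \<noteq> 0 \<longrightarrow> (\<exists>k::int. \<bar>y - of_int k * L\<bar> \<le> \<epsilon>))"

lemma mollifier_exists:
  assumes "L > 0" "\<epsilon> > 0"
  obtains \<eta> where "mollifier L \<epsilon> \<eta>"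
proof -
  define e where "e = min \<epsilon> (L / 2)"
  have e: "0 < e" "e \<le> \<epsilon>" "e \<le> L / 2" using assms by (auto simp: e_def)
  define d where "d = sin (pi * e / L)"
  have ee: "0 < pi * e / L" "pi * e / L \<le> pi / 2" using e assms by (auto simp: field_simps)
  have d: "d > 0" unfolding d_def by (rule sin_gt_zero) (use ee pi_gt_zero in linarith)+
  obtain \<sigma> :: "real \<Rightarrow> real" where s: "smooth_on UNIV \<sigma>" "\<And>x. x \<le> 0 \<Longrightarrow> \<sigma> x = 1" "\<And>x. x \<ge> 1 \<Longrightarrow> \<sigma> x = 0"
    "\<And>x. 0 \<le> \<sigma> x" using smooth_step_exists by metis
  define h where "h = (\<lambda>y. \<sigma> ((1 / d\<^sup>2) * (sin ((pi / L) * y) * sin ((pi / L) * y))))"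
  have "smooth_on UNIV (\<lambda>y::real. sin ((pi / L) * y))"
    by (intro smooth_on_compose_UNIV[OF _ smooth_on_sin] smooth_on_mult smooth_on_const smooth_on_ident)
  then have h: "smooth_on UNIV h" unfolding h_def
    by (intro smooth_on_compose_UNIV[OF _ s(1)] smooth_on_mult smooth_on_const)
  have hc: "continuous_on S h" for S
    using smooth_on_imp_continuous_on[OF smooth_on_subset[OF h]] by simp
  have h0: "h y \<ge> 0" for y using s by (simp add: h_def)
  have "h 0 = 1" using s by (simp add: h_def)
  have per: "h (y + L) = h y" for y
  proof -
    have "(pi / L) * (y + L) = (pi / L) * y + pi" using assms by (simp add: field_simps)
    then show ?thesis by (simp add: h_def)
  qed
  define c where "c = integral {0..L} h"
  have "c \<ge> 0" unfolding c_def by (intro integral_nonneg integrable_continuous_real hc h0)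
  moreover have "c \<noteq> 0"
  proof
    assume "c = 0"
    then have "\<forall>x\<in>{0..L}. h x = 0"
      unfolding c_def using integral_eq_0_iff[OF hc] h0 assms by blast
    then show False using \<open>h 0 = 1\<close> assms by simp
  qed
  ultimately have c: "c > 0" by simp
  have "mollifier L \<epsilon> (\<lambda>y. (1 / c) * h y)"
    unfolding mollifier_def
  proof (intro conjI allI impI)
    show "smooth_on UNIV (\<lambda>y. (1 / c) * h y)" by (intro smooth_on_mult smooth_on_const h)
    have "(h has_integral c) {0..L}" unfolding c_def
      by (intro integrable_integral integrable_continuous_real hc)
    from has_integral_mult_right[OF this, of "1 / c"]
    show "((\<lambda>y. (1 / c) * h y) has_integral 1) {0..L}" using c by simp
    fix y
    show "(1 / c) * h (y + L) = (1 / c) * h y" by (simp add: per)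
    show "(1 / c) * h (- y) = (1 / c) * h y" by (simp add: h_def)
    show "0 \<le> (1 / c) * h y" using h0 c by simp
    assume nz: "(1 / c) * h y \<noteq> 0"
    define k where "k = round (y / L)"
    define y' where "y' = y - of_int k * L"
    have "\<bar>y' / L\<bar> \<le> 1 / 2"
      using of_int_round_abs_le[of "y / L"] assms by (simp add: y'_def k_def abs_minus_commute diff_divide_distrib)
    then have y': "\<bar>y'\<bar> \<le> L / 2" using assms by (simp add: field_simps)
    have "(pi / L) * y = (pi / L) * y' + of_int k * pi" using assms by (simp add: y'_def field_simps)
    moreover have s0: "sin (of_int k * pi) = (0::real)" by (auto simp: sin_zero_iff_int2)
    moreover have "(cos (of_int k * pi))\<^sup>2 = (1::real)" using sin_cos_squared_add[of "of_int k * pi"] s0 by simp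
    ultimately have sq: "(sin ((pi / L) * y))\<^sup>2 = (sin ((pi / L) * y'))\<^sup>2"
      by (simp only: sin_add s0 power_mult_distrib mult_zero_right add_0_right mult_1_right)
    have "(1 / d\<^sup>2) * (sin ((pi / L) * y))\<^sup>2 < 1"
    proof (rule ccontr)
      assume "\<not> ?thesis"
      then have "\<sigma> ((1 / d\<^sup>2) * (sin ((pi / L) * y))\<^sup>2) = 0" by (intro s(3)) simp
      then show False using nz by (simp add: h_def power2_eq_square)
    qed
    then have "\<bar>sin ((pi / L) * y')\<bar>\<^sup>2 < d\<^sup>2" unfolding sq using d by (simp add: divide_less_eq)
    then have lt: "\<bar>sin ((pi / L) * y')\<bar> < d" using d power2_less_imp_less by (metis less_imp_le)
    have "\<bar>y'\<bar> < e"
    proof (rule ccontr)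
      assume "\<not> \<bar>y'\<bar> < e"
      then have 1: "pi * e / L \<le> (pi / L) * \<bar>y'\<bar>" using assms by (simp add: field_simps)
      have 2: "(pi / L) * \<bar>y'\<bar> \<le> pi / 2" using y' assms by (simp add: field_simps)
      have "d \<le> sin ((pi / L) * \<bar>y'\<bar>)" unfolding d_def
        using 1 2 ee by (intro sin_monotone_2pi_le) auto
      also have "\<dots> \<le> \<bar>sin ((pi / L) * y')\<bar>" by (cases "y' \<ge> 0") auto
      finally show False using lt by simp
    qed
    then show "\<exists>k::int. \<bar>y - of_int k * L\<bar> \<le> \<epsilon>" using e by (intro exI[of _ k]) (simp add: y'_def)
  qed
  then show thesis using that by blast
qed

lemma periodic_int_multiple:
  fixes g :: "real \<Rightarrow> 'a"
  assumes "\<And>y. g (y + L) = g y"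
  shows "g (y + of_int k * L) = g y"
proof -
  have n: "g (y + real n * L) = g y" for n y
    by (induction n arbitrary: y) (auto simp: distrib_right assms add.assoc[symmetric] add.commute[of L])
  show ?thesis
  proof (cases "k \<ge> 0")
    case True
    then show ?thesis using n[of y "nat k"] by simp
  next
    case False
    then show ?thesis using n[of "y + of_int k * L" "nat (- k)"] by (simp add: algebra_simps)
  qed
qed

text \<open>Only differences of arguments that agree modulo the period up to \<open>\<epsilon>\<close> are seen by a mollifier.\<close>

lemma mollifier_lipschitz:
  assumes "mollifier L \<epsilon> \<eta>" "\<And>y. G (y + L) = G y" "\<And>y z. \<bar>G y - G z\<bar> \<le> K * \<bar>y - z\<bar>" "K \<ge> 0"
    and "\<eta> (y - z) \<noteq> 0"
  shows "\<bar>G y - G z\<bar> \<le> K * \<epsilon>"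
proof -
  obtain k :: int where k: "\<bar>(y - z) - of_int k * L\<bar> \<le> \<epsilon>"
    using assms unfolding mollifier_def by blast
  have "G z = G (z + of_int k * L)" using periodic_int_multiple[of G L z k] assms(2) by simp
  then have "\<bar>G y - G z\<bar> \<le> K * \<bar>y - (z + of_int k * L)\<bar>" using assms(3) by simp
  also have "\<dots> \<le> K * \<epsilon>" using k assms(4) by (intro mult_left_mono) (auto simp: algebra_simps)
  finally show ?thesis .
qed

text \<open>Where the mollifier vanishes this is the kernel \<open>1/2 - y/L\<close>, which inverts differentiation on the circle
  for functions of mean zero. Oddness fixes the additive constant.\<close>

lemma sawtooth_exists:
  assumes "L > 0" "mollifier L \<epsilon> \<eta>"
  obtains \<Lambda> where "\<And>y. (\<Lambda> has_real_derivative \<eta> y - 1 / L) (at y)" "smooth_on UNIV \<Lambda>"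
    "\<And>y. \<Lambda> (y + L) = \<Lambda> y" "\<And>y. \<Lambda> (- y) = - \<Lambda> y" "\<And>y. \<bar>\<Lambda> y\<bar> \<le> 1"
    "\<And>y. \<epsilon> < y \<Longrightarrow> y < L - \<epsilon> \<Longrightarrow> \<Lambda> y = 1 / 2 - y / L"
proof -
  have eta: "smooth_on UNIV \<eta>" "\<And>y. \<eta> (y + L) = \<eta> y" "\<And>y. \<eta> (- y) = \<eta> y" "\<And>y. 0 \<le> \<eta> y"
    "(\<eta> has_integral 1) {0..L}" "\<And>y. \<eta> y \<noteq> 0 \<Longrightarrow> \<exists>k::int. \<bar>y - of_int k * L\<bar> \<le> \<epsilon>"
    using assms(2) unfolding mollifier_def by auto
  obtain F where F: "\<And>x. (F has_real_derivative \<eta> x) (at x)" "F 0 = 0"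
    using continuous_antiderivative[OF smooth_on_imp_continuous_on[OF eta(1)]] by metis
  define \<Lambda> where "\<Lambda> = (\<lambda>y. F y - y / L)"
  have d: "(\<Lambda> has_real_derivative \<eta> y - 1 / L) (at y)" for y
    using DERIV_diff[OF F(1)[of y] DERIV_cdivide[OF DERIV_ident, of L]] by (simp add: \<Lambda>_def)
  have "smooth_on UNIV (\<lambda>y. \<eta> y + - 1 / L)" by (intro smooth_on_add eta smooth_on_const)
  then have sm: "smooth_on UNIV \<Lambda>"
    using smooth_on_antiderivative[of "\<lambda>y. \<eta> y + - 1 / L" \<Lambda>] d by simp
  have FL: "F L = 1"
  proof -
    have "(\<eta> has_integral (F L - F 0)) {0..L}"
    proof (rule fundamental_theorem_of_calculus)
      show "(F has_vector_derivative \<eta> x) (at x within {0..L})" for x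
        using has_field_derivative_at_within[OF F(1)[of x]]
        by (simp add: has_real_derivative_iff_has_vector_derivative)
    qed (use assms(1) in simp)
    from has_integral_unique[OF this eta(5)] show ?thesis using F(2) by simp
  qed
  have zero: "g x = g 0" if "\<And>y. (g has_real_derivative 0) (at y)" for g :: "real \<Rightarrow> real" and x
    by (rule DERIV_isconst_all) (rule allI, rule that)
  have per: "\<Lambda> (y + L) = \<Lambda> y" for y
  proof -
    have "((\<lambda>y. \<Lambda> (y + L) - \<Lambda> y) has_real_derivative 0) (at y)" for y
    proof -
      have "((\<lambda>y. \<Lambda> (y + L)) has_real_derivative \<eta> (y + L) - 1 / L) (at y)"
        using DERIV_shift[of \<Lambda> "\<eta> (y + L) - 1 / L" y L] d by blast
      from DERIV_diff[OF this d] show ?thesis by (simp add: eta)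
    qed
    from zero[OF this, of y] show ?thesis using F FL assms by (simp add: \<Lambda>_def)
  qed
  have odd: "\<Lambda> (- y) = - \<Lambda> y" for y
  proof -
    have "((\<lambda>y. \<Lambda> (- y) + \<Lambda> y) has_real_derivative 0) (at y)" for y
    proof -
      have "((\<lambda>y. \<Lambda> (- y)) has_real_derivative (\<eta> (- y) - 1 / L) * (- 1)) (at y)"
        by (rule DERIV_chain2[OF d]) (auto intro!: derivative_eq_intros)
      from DERIV_add[OF this d] show ?thesis by (simp add: eta)
    qed
    from zero[OF this, of y] show ?thesis using F by (simp add: \<Lambda>_def)
  qed
  have Fmono: "F x \<le> F y" if "x \<le> y" for x y
    using DERIV_nonneg_imp_nondecreasing[of x y F] F eta(4) that by blast
  have bd: "\<bar>\<Lambda> y\<bar> \<le> 1" for y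
  proof -
    define k where "k = \<lfloor>y / L\<rfloor>"
    define z where "z = y - of_int k * L"
    have "of_int k \<le> y / L" "y / L \<le> of_int k + 1" unfolding k_def by linarith+
    then have z: "0 \<le> z" "z \<le> L"
      unfolding z_def using assms(1) by (auto simp: pos_le_divide_eq pos_divide_le_eq algebra_simps)
    have "\<Lambda> y = \<Lambda> z" using periodic_int_multiple[of \<Lambda> L z k] per by (simp add: z_def)
    moreover have "0 \<le> F z" "F z \<le> 1" using Fmono[of 0 z] Fmono[of z L] z FL F(2) by auto
    moreover have "0 \<le> z / L" "z / L \<le> 1" using z assms(1) by auto
    ultimately show ?thesis by (simp add: \<Lambda>_def abs_le_iff)
  qed
  have lin: "\<Lambda> y = 1 / 2 - y / L" if y: "\<epsilon> < y" "y < L - \<epsilon>" for y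
  proof -
    have F0: "\<eta> z = 0" if "\<epsilon> < z" "z < L - \<epsilon>" for z
    proof (rule ccontr)
      assume "\<eta> z \<noteq> 0"
      then obtain k :: int where k: "\<bar>z - of_int k * L\<bar> \<le> \<epsilon>" using eta(6) by blast
      show False
      proof (cases "k \<le> 0")
        case True
        then have "of_int k * L \<le> 0" using assms(1) by (simp add: mult_nonpos_nonneg)
        then show False using k that by linarith
      next
        case False
        then have "1 * L \<le> of_int k * L" using assms(1) by (intro mult_right_mono) auto
        then show False using k that by linarith
      qed
    qed
    have "F y = F (L - y)"
    proof -
      have "F a = F b" if ab: "\<epsilon> < a" "a < b" "b < L - \<epsilon>" for a b
      proof -
        obtain z where "a < z" "z < b" "F b - F a = (b - a) * \<eta> z"
          using MVT2[of a b F \<eta>] ab F(1) by auto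
        then show ?thesis using F0 ab by simp
      qed
      from this[of y "L - y"] this[of "L - y" y] show ?thesis using y by (cases y "L - y" rule: linorder_cases) auto
    qed
    moreover have "\<Lambda> (L - y) = - \<Lambda> y" using per[of "- y"] odd[of y] by simp
    ultimately show ?thesis using assms(1) by (simp add: \<Lambda>_def field_simps)
  qed
  show thesis by (rule that[OF d sm per odd bd lin])
qed

section \<open>A sharp weighted inequality for periodic functions of slope at most one\<close>

lemma lipschitz_of_derivative_bound:
  fixes g g' :: "real \<Rightarrow> real"
  assumes "\<And>y. (g has_real_derivative g' y) (at y)" "\<And>y. \<bar>g' y\<bar> \<le> K"
  shows "\<bar>g y - g z\<bar> \<le> K * \<bar>y - z\<bar>"
  using field_differentiable_bound[of UNIV g g' K y z] assms
  by (auto simp: has_field_derivative_at_within)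

lemma constant_if_derivative_zero:
  fixes f :: "real \<Rightarrow> real"
  assumes "p \<le> q" "\<And>x. p \<le> x \<Longrightarrow> x \<le> q \<Longrightarrow> (f has_real_derivative 0) (at x)"
  shows "f p = f q"
proof (rule antisym)
  show "f p \<le> f q"
    by (rule DERIV_nonneg_imp_nondecreasing[OF assms(1)]) (use assms(2) in blast)
  show "f q \<le> f p"
    by (rule DERIV_nonpos_imp_nonincreasing[OF assms(1)]) (use assms(2) in blast)
qed

text \<open>The minimum over \<open>\<bar>p\<bar> \<le> d\<close> of \<open>(1 - b) p^2 - 2 b m p\<close>, where \<open>\<bar>m\<bar> = a - d\<close>. The two cases are a minimum on the boundary
  and one in the interior.\<close>

definition arc_bound :: "real \<Rightarrow> real \<Rightarrow> real \<Rightarrow> real" where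
  "arc_bound a b d = (if d < a * b then (1 - b) * d\<^sup>2 - 2 * b * (a - d) * d else - (b\<^sup>2 * (a - d)\<^sup>2 / (1 - b)))"

lemma arc_bound_pointwise:
  assumes "b < 1" "0 \<le> b" "\<bar>p\<bar> \<le> d" "d = a - \<bar>m\<bar>"
  shows "(1 - b) * p\<^sup>2 - 2 * b * m * p \<ge> arc_bound a b d"
proof -
  define P where "P = \<bar>p\<bar>"
  have P: "0 \<le> P" "P \<le> d" using assms by (auto simp: P_def)
  have "m * p \<le> \<bar>m\<bar> * P" unfolding P_def by (metis abs_ge_self abs_mult)
  then have "2 * b * (m * p) \<le> 2 * b * (\<bar>m\<bar> * P)" using assms by (intro mult_left_mono) auto
  then have 1: "(1 - b) * p\<^sup>2 - 2 * b * m * p \<ge> (1 - b) * P\<^sup>2 - 2 * b * \<bar>m\<bar> * P"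
    by (simp add: P_def mult.assoc)
  also have "(1 - b) * P\<^sup>2 - 2 * b * \<bar>m\<bar> * P \<ge> arc_bound a b d"
  proof (cases "d < a * b")
    case True
    have "(1 - b) * (P + d) \<le> (1 - b) * (2 * d)" using assms P by (intro mult_left_mono) auto
    then have "2 * b * (a - d) - (1 - b) * (P + d) \<ge> 0" using True by (simp add: algebra_simps)
    then have "(d - P) * (2 * b * (a - d) - (1 - b) * (P + d)) \<ge> 0"
      using P by (intro mult_nonneg_nonneg) auto
    also have "(d - P) * (2 * b * (a - d) - (1 - b) * (P + d))
        = (1 - b) * P\<^sup>2 - 2 * b * (a - d) * P - ((1 - b) * d\<^sup>2 - 2 * b * (a - d) * d)"
      by (simp add: power2_eq_square algebra_simps)
    finally show ?thesis using True assms(4) by (simp add: arc_bound_def)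
  next
    case False
    have m: "\<bar>m\<bar> = a - d" using assms(4) by simp
    have "(1 - b) * P\<^sup>2 - 2 * b * \<bar>m\<bar> * P + b\<^sup>2 * (a - d)\<^sup>2 / (1 - b) = ((1 - b) * P - b * \<bar>m\<bar>)\<^sup>2 / (1 - b)"
      unfolding m using assms(1) by (simp add: power2_eq_square field_simps)
    also have "\<dots> \<ge> 0" using assms(1) by simp
    finally show ?thesis using False by (simp add: arc_bound_def)
  qed
  finally show ?thesis .
qed

text \<open>Two arcs with \<open>a = L/4\<close> together contribute the constant \<open>b^2 L^3/48\<close> of the slope inequality.
  The antiderivative exists because both branches of \<open>arc_bound\<close> agree at \<open>d = a b\<close>.\<close>

lemma arc_bound_antiderivative:
  assumes "a > 0" "0 \<le> b" "b < 1"
  obtains X where "\<And>t. (X has_real_derivative arc_bound a b (min t (2 * a - t))) (at t)"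
    "X (2 * a) - X 0 = - (2 * a ^ 3 * b\<^sup>2 / 3)"
proof -
  let ?x1 = "\<lambda>d. (1 - b) * d\<^sup>2 - 2 * b * (a - d) * d"
  let ?x2 = "\<lambda>d. - (b\<^sup>2 * (a - d)\<^sup>2 / (1 - b))"
  have at: "?x1 (a * b) = ?x2 (a * b)" using assms by (simp add: power2_eq_square field_simps)
  have ab: "0 \<le> a * b" "a * b \<le> a" using assms by auto
  have "continuous_on UNIV (\<lambda>d. if d \<le> a * b then ?x1 d else ?x2 d)"
  proof -
    have "continuous_on ({..a * b} \<union> {a * b..}) (\<lambda>d. if d \<in> {..a * b} then ?x1 d else ?x2 d)"
      using assms at by (intro continuous_on_cases continuous_intros) auto
    moreover have "{..a * b} \<union> {a * b..} = (UNIV :: real set)" by auto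
    ultimately show ?thesis by simp
  qed
  moreover have e: "(if d \<le> a * b then ?x1 d else ?x2 d) = arc_bound a b d" for d
    using at by (auto simp: arc_bound_def)
  ultimately have "continuous_on UNIV (arc_bound a b)" by simp
  then have "continuous_on UNIV (\<lambda>t. arc_bound a b (min t (2 * a - t)))"
    by (rule continuous_on_compose2) (auto intro!: continuous_intros)
  then obtain X where X: "\<And>t. (X has_real_derivative arc_bound a b (min t (2 * a - t))) (at t)"
    using continuous_antiderivative by metis
  have "X 0 - ((1 - b) * 0 ^ 3 / 3 - b * a * 0\<^sup>2 + 2 * b * 0 ^ 3 / 3)
      = X (a * b) - ((1 - b) * (a * b) ^ 3 / 3 - b * a * (a * b)\<^sup>2 + 2 * b * (a * b) ^ 3 / 3)"
  proof (rule constant_if_derivative_zero[OF ab(1)])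
    fix t assume t: "0 \<le> t" "t \<le> a * b"
    have A: "((\<lambda>t. (1 - b) * t ^ 3 / 3 - b * a * t\<^sup>2 + 2 * b * t ^ 3 / 3) has_real_derivative ?x1 t) (at t)"
      by (auto intro!: derivative_eq_intros simp: power2_eq_square field_simps)
    have B: "arc_bound a b (min t (2 * a - t)) = ?x1 t"
      using t ab e[of t] by (simp add: min_def)
    show "((\<lambda>t. X t - ((1 - b) * t ^ 3 / 3 - b * a * t\<^sup>2 + 2 * b * t ^ 3 / 3)) has_real_derivative 0) (at t)"
      using DERIV_diff[OF X[of t] A] B by simp
  qed
  then have X1: "X (a * b) - X 0 = (1 - b) * (a * b) ^ 3 / 3 - b * a * (a * b)\<^sup>2 + 2 * b * (a * b) ^ 3 / 3"
    by simp
  have "X (a * b) - b\<^sup>2 / (1 - b) * (a - a * b) ^ 3 / 3 = X a - b\<^sup>2 / (1 - b) * (a - a) ^ 3 / 3"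
  proof (rule constant_if_derivative_zero[OF ab(2)])
    fix t assume t: "a * b \<le> t" "t \<le> a"
    have "((\<lambda>t. c * (a - t) ^ 3 / 3) has_real_derivative - (c * (a - t)\<^sup>2)) (at t)" for c
      by (auto intro!: derivative_eq_intros)
    from this[of "b\<^sup>2 / (1 - b)"]
    have A: "((\<lambda>t. b\<^sup>2 / (1 - b) * (a - t) ^ 3 / 3) has_real_derivative ?x2 t) (at t)" by simp
    have B: "arc_bound a b (min t (2 * a - t)) = ?x2 t"
      using t ab e[of t] by (simp add: min_def arc_bound_def)
    show "((\<lambda>t. X t - b\<^sup>2 / (1 - b) * (a - t) ^ 3 / 3) has_real_derivative 0) (at t)"
      using DERIV_diff[OF X[of t] A] B by simp
  qed
  moreover have "b\<^sup>2 / (1 - b) * (a - a * b) ^ 3 / 3 = b\<^sup>2 * a ^ 3 * (1 - b)\<^sup>2 / 3"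
  proof -
    have "(a - a * b) ^ 3 = a ^ 3 * (1 - b)\<^sup>2 * (1 - b)"
      by (simp add: power2_eq_square power3_eq_cube algebra_simps)
    then show ?thesis using assms by simp
  qed
  moreover have "b\<^sup>2 / (1 - b) * (a - a) ^ 3 / 3 = 0" by simp
  ultimately have X2: "X a - X (a * b) = - (b\<^sup>2 * a ^ 3 * (1 - b)\<^sup>2 / 3)" by linarith
  have "X 0 + X (2 * a - 0) = X a + X (2 * a - a)"
  proof (rule constant_if_derivative_zero[of 0 a "\<lambda>t. X t + X (2 * a - t)"])
    fix t :: real
    have "((\<lambda>t. X (2 * a - t)) has_real_derivative arc_bound a b (min (2 * a - t) (2 * a - (2 * a - t))) * (-1)) (at t)"
      by (rule DERIV_chain2[OF X]) (auto intro!: derivative_eq_intros)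
    from DERIV_add[OF X[of t] this]
    show "((\<lambda>t. X t + X (2 * a - t)) has_real_derivative 0) (at t)" by (simp add: min.commute)
  qed (use assms in simp)
  then have "X (2 * a) - X 0 = 2 * ((X a - X (a * b)) + (X (a * b) - X 0))" by simp
  also have "\<dots> = - (2 * a ^ 3 * b\<^sup>2 / 3)"
    unfolding X1 X2 by (simp add: power2_eq_square power3_eq_cube field_simps)
  finally show thesis using that X by blast
qed

text \<open>The integrals of \<open>g\<close> over the two complementary half periods add up to zero, so the mean of
  \<open>g(y + L/2) + g(y)\<close> over half a period vanishes, and the function itself must vanish somewhere.\<close>

lemma antiperiodic_point_exists:
  fixes g :: "real \<Rightarrow> real"
  assumes "L > 0" "continuous_on UNIV g" "\<And>y. g (y + L) = g y" "integral {0..L} g = 0"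
  obtains x where "g (x + L / 2) = - g x"
proof -
  obtain K where K: "\<And>x. (K has_real_derivative g x) (at x)"
    using continuous_antiderivative[OF assms(2)] by metis
  have FTC: "integral {0..L} g = K L - K 0"
  proof (rule integral_unique, rule fundamental_theorem_of_calculus)
    show "(K has_vector_derivative g x) (at x within {0..L})" for x
      using has_field_derivative_at_within[OF K[of x]]
      by (simp add: has_real_derivative_iff_has_vector_derivative)
  qed (use assms in simp)
  have "K (L / 2 + L) - K (L / 2) = K (0 + L) - K 0"
  proof (rule constant_if_derivative_zero[of 0 "L / 2" "\<lambda>x. K (x + L) - K x", symmetric])
    fix x
    have "((\<lambda>x. K (x + L)) has_real_derivative g (x + L)) (at x)"
      using DERIV_shift K by blast
    from DERIV_diff[OF this K[of x]] assms(3)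
    show "((\<lambda>x. K (x + L) - K x) has_real_derivative 0) (at x)" by simp
  qed (use assms in simp)
  moreover
  have "\<exists>x. 0 < x \<and> x < L \<and> (K (L + L / 2) + K L) - (K (0 + L / 2) + K 0) = (L - 0) * (g (x + L / 2) + g x)"
  proof (rule MVT2)
    fix x
    have "((\<lambda>x. K (x + L / 2)) has_real_derivative g (x + L / 2)) (at x)"
      using DERIV_shift K by blast
    from DERIV_add[OF this K[of x]]
    show "((\<lambda>x. K (x + L / 2) + K x) has_real_derivative g (x + L / 2) + g x) (at x)" .
  qed (use assms in simp)
  then obtain x where "(K (L + L / 2) + K L) - (K (0 + L / 2) + K 0) = L * (g (x + L / 2) + g x)" by auto
  ultimately have "L * (g (x + L / 2) + g x) = 0" using FTC assms(4) by (simp add: add.commute)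
  then show thesis using that[of x] assms(1) by (simp add: add_eq_0_iff)
qed

text \<open>An antiperiodic point splits the period into two arcs of length \<open>L/2\<close> on which \<open>g\<close> ends at the negative of its starting
  value. There \<open>g\<close> has a zero, and its slope bound puts \<open>\<bar>g\<bar>\<close> below a tent of height \<open>L/4\<close>. Adding the exact derivative
  of a multiple of \<open>g^2\<close> turns the integrand into a quadratic polynomial in \<open>g g'\<close>, which is minimised pointwise under the tent.\<close>

lemma weighted_slope_inequality_aux:
  fixes g g' :: "real \<Rightarrow> real"
  assumes L: "L > 0" and d: "\<And>y. (g has_real_derivative g' y) (at y)" and c: "continuous_on UNIV g'"
    and per: "\<And>y. g (y + L) = g y" and mean: "integral {0..L} g = 0" and bd: "\<And>y. \<bar>g' y\<bar> \<le> 1"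
    and b: "0 \<le> b" "b < 1"
  shows "(1 - b) * integral {0..L} (\<lambda>y. (g y * g' y)\<^sup>2) - b * integral {0..L} (\<lambda>y. (g y)\<^sup>2) + b\<^sup>2 * L ^ 3 / 48 \<ge> 0"
proof -
  have cg: "continuous_on UNIV g" using d by (meson DERIV_isCont continuous_at_imp_continuous_on)
  have lip: "\<bar>g y - g z\<bar> \<le> \<bar>y - z\<bar>" for y z using lipschitz_of_derivative_bound[OF d bd] by simp
  define a where "a = L / 4"
  have a: "a > 0" "L = 4 * a" using L by (auto simp: a_def)
  define h where "h = (\<lambda>y. (1 - b) * (g y * g' y)\<^sup>2 - b * (g y)\<^sup>2)"
  have "continuous_on UNIV h" unfolding h_def by (intro continuous_intros c cg)
  then obtain N where N: "\<And>x. (N has_real_derivative h x) (at x)"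
    using continuous_antiderivative by metis
  obtain X where X: "\<And>t. (X has_real_derivative arc_bound a b (min t (2 * a - t))) (at t)"
    "X (2 * a) - X 0 = - (2 * a ^ 3 * b\<^sup>2 / 3)"
    using arc_bound_antiderivative[OF a(1) b] by metis
  \<comment> \<open>Up to the correction \<open>b (a - t) g^2\<close>, the antiderivative of the integrand grows at least like \<open>X\<close>.\<close>
  have piece: "N q - X (q - s) - b * (a - (q - s)) * (g q)\<^sup>2 \<ge> N p - X (p - s) - b * (a - (p - s)) * (g p)\<^sup>2"
    if pq: "p \<le> q" and bnd: "\<And>x. p \<le> x \<Longrightarrow> x \<le> q \<Longrightarrow> \<bar>g x\<bar> \<le> min (x - s) (2 * a - (x - s))" for p q s
  proof (rule DERIV_nonneg_imp_nondecreasing[OF pq])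
    fix x assume x: "p \<le> x" "x \<le> q"
    let ?t = "x - s"
    let ?D = "h x - arc_bound a b (min ?t (2 * a - ?t)) - (b * (a - ?t) * (2 * g x * g' x) + b * (-1) * (g x)\<^sup>2)"
    have 1: "((\<lambda>x. X (x - s)) has_real_derivative arc_bound a b (min ?t (2 * a - ?t))) (at x)"
      using DERIV_shift[of X _ x "- s"] X(1)[of ?t] by simp
    have 2: "((\<lambda>x. b * (a - (x - s)) * (g x)\<^sup>2) has_real_derivative b * (a - ?t) * (2 * g x * g' x) + b * (-1) * (g x)\<^sup>2) (at x)"
      by (auto intro!: derivative_eq_intros d)
    have 3: "((\<lambda>x. N x - X (x - s) - b * (a - (x - s)) * (g x)\<^sup>2) has_real_derivative ?D) (at x)"
      by (intro DERIV_diff N 1 2)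
    have "?D = (1 - b) * (g x * g' x)\<^sup>2 - 2 * b * (a - ?t) * (g x * g' x) - arc_bound a b (min ?t (2 * a - ?t))"
      by (simp add: h_def)
    also have "\<dots> \<ge> 0"
    proof -
      have "\<bar>g x\<bar> * \<bar>g' x\<bar> \<le> \<bar>g x\<bar> * 1" using bd[of x] by (intro mult_left_mono) auto
      then have "\<bar>g x * g' x\<bar> \<le> min ?t (2 * a - ?t)"
        using bnd[OF x] by (simp add: abs_mult)
      moreover have "min ?t (2 * a - ?t) = a - \<bar>a - ?t\<bar>" by (auto simp: min_def abs_if)
      ultimately have "arc_bound a b (min ?t (2 * a - ?t))
          \<le> (1 - b) * (g x * g' x)\<^sup>2 - 2 * b * (a - ?t) * (g x * g' x)"
        by (rule arc_bound_pointwise[OF b(2,1)])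
      then show ?thesis by linarith
    qed
    finally show "\<exists>y. ((\<lambda>x. N x - X (x - s) - b * (a - (x - s)) * (g x)\<^sup>2) has_real_derivative y) (at x) \<and> 0 \<le> y"
      using 3 by blast
  qed
  \<comment> \<open>From the zero the arc is followed to its end, and the rest is shifted by a half period; the corrections cancel.\<close>
  have arc: "N (x0 + 2 * a) - N x0 \<ge> - (2 * a ^ 3 * b\<^sup>2 / 3)" if anti: "g (x0 + 2 * a) = - g x0" for x0
  proof -
    have "\<exists>z. x0 \<le> z \<and> z \<le> x0 + 2 * a \<and> g z = 0"
    proof (cases "g x0 \<le> 0")
      case True
      then show ?thesis using IVT'[of g x0 0 "x0 + 2 * a"] anti a cg
        by (auto intro: continuous_on_subset)
    next
      case False
      then show ?thesis using IVT2'[of g "x0 + 2 * a" 0 x0] anti a cg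
        by (auto intro: continuous_on_subset)
    qed
    then obtain z where z: "x0 \<le> z" "z \<le> x0 + 2 * a" "g z = 0" by blast
    have u: "(g (x0 + 2 * a))\<^sup>2 = (g x0)\<^sup>2" using anti by simp
    have 1: "N (x0 + 2 * a) - X (x0 + 2 * a - z) - b * (a - (x0 + 2 * a - z)) * (g (x0 + 2 * a))\<^sup>2
        \<ge> N z - X (z - z) - b * (a - (z - z)) * (g z)\<^sup>2"
    proof (rule piece[OF z(2)])
      fix x assume "z \<le> x" "x \<le> x0 + 2 * a"
      then show "\<bar>g x\<bar> \<le> min (x - z) (2 * a - (x - z))"
        using lip[of x z] lip[of x "x0 + 2 * a"] lip[of x0 z] z anti by auto
    qed
    have 2: "N z - X (z - (z - 2 * a)) - b * (a - (z - (z - 2 * a))) * (g z)\<^sup>2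
        \<ge> N x0 - X (x0 - (z - 2 * a)) - b * (a - (x0 - (z - 2 * a))) * (g x0)\<^sup>2"
    proof (rule piece[OF z(1)])
      fix x assume "x0 \<le> x" "x \<le> z"
      then show "\<bar>g x\<bar> \<le> min (x - (z - 2 * a)) (2 * a - (x - (z - 2 * a)))"
        using lip[of x z] lip[of x x0] lip[of "x0 + 2 * a" z] z anti by auto
    qed
    have e: "x0 - (z - 2 * a) = x0 + 2 * a - z" by simp
    show ?thesis using 1 2 X(2) z(3) u unfolding e by simp
  qed
  obtain x where x: "g (x + L / 2) = - g x"
    using antiperiodic_point_exists[OF L cg per mean] .
  have "N (x + 2 * a) - N x \<ge> - (2 * a ^ 3 * b\<^sup>2 / 3)" using arc[of x] x a by simp
  moreover have "N (x + 2 * a + 2 * a) - N (x + 2 * a) \<ge> - (2 * a ^ 3 * b\<^sup>2 / 3)"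
    using arc[of "x + 2 * a"] x per[of x] a by (simp add: add.assoc)
  ultimately have "N (x + L) - N x \<ge> - (4 * a ^ 3 * b\<^sup>2 / 3)" using a by (simp add: add.assoc)
  moreover have eqN: "N (x + L) - N x = N (0 + L) - N 0"
  proof -
    have "((\<lambda>x. N (x + L) - N x) has_real_derivative 0) (at y)" for y
    proof -
      have "g' (y + L) = g' y"
        using DERIV_unique[OF _ d[of y]] DERIV_shift[of g "g' (y + L)" y L] d per by simp
      then have "h (y + L) = h y" using per by (simp add: h_def)
      moreover have "((\<lambda>x. N (x + L)) has_real_derivative h (y + L)) (at y)" using DERIV_shift N by blast
      ultimately show ?thesis using DERIV_diff[OF _ N[of y], of "\<lambda>x. N (x + L)" "h (y + L)"] by simp
    qed
    then show ?thesis using DERIV_isconst_all[of "\<lambda>x. N (x + L) - N x" x 0] by simp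
  qed
  moreover have "4 * a ^ 3 * b\<^sup>2 / 3 = b\<^sup>2 * L ^ 3 / 48" by (simp add: a_def power3_eq_cube)
  ultimately have int: "N L - N 0 + b\<^sup>2 * L ^ 3 / 48 \<ge> 0" by simp
  have "(h has_integral (N L - N 0)) {0..L}"
  proof (rule fundamental_theorem_of_calculus)
    show "(N has_vector_derivative h x) (at x within {0..L})" for x
      using has_field_derivative_at_within[OF N[of x]]
      by (simp add: has_real_derivative_iff_has_vector_derivative)
  qed (use L in simp)
  moreover have "(h has_integral ((1 - b) * integral {0..L} (\<lambda>y. (g y * g' y)\<^sup>2) - b * integral {0..L} (\<lambda>y. (g y)\<^sup>2))) {0..L}"
    unfolding h_def
    by (intro has_integral_diff has_integral_mult_right integrable_integral integrable_continuous_real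
        continuous_intros continuous_on_subset[OF c] continuous_on_subset[OF cg]) auto
  ultimately have "(1 - b) * integral {0..L} (\<lambda>y. (g y * g' y)\<^sup>2) - b * integral {0..L} (\<lambda>y. (g y)\<^sup>2) = N L - N 0"
    by (metis has_integral_unique)
  then show ?thesis using int by simp
qed

text \<open>The endpoint \<open>b = 1\<close> follows by continuity; it says that \<open>L^3/48\<close> bounds the square integral of a mean-free
  function of slope at most one. The other values of \<open>b\<close> trade this integral against that of \<open>(g g')^2\<close>.\<close>

lemma weighted_slope_inequality:
  fixes g g' :: "real \<Rightarrow> real"
  assumes L: "L > 0" and d: "\<And>y. (g has_real_derivative g' y) (at y)" and c: "continuous_on UNIV g'"
    and per: "\<And>y. g (y + L) = g y" and mean: "integral {0..L} g = 0" and bd: "\<And>y. \<bar>g' y\<bar> \<le> 1"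
    and b: "0 \<le> b" "b \<le> 1"
  shows "(1 - b) * integral {0..L} (\<lambda>y. (g y * g' y)\<^sup>2) - b * integral {0..L} (\<lambda>y. (g y)\<^sup>2) + b\<^sup>2 * L ^ 3 / 48 \<ge> 0"
    (is "?Q b \<ge> 0")
proof (cases "b = 1")
  case True
  have "(?Q \<longlongrightarrow> ?Q 1) (at_left 1)" by (intro tendsto_intros) simp
  moreover have "eventually (\<lambda>b. 0 \<le> ?Q b) (at_left 1)"
    using eventually_at_left_real[OF zero_less_one]
    by eventually_elim (use weighted_slope_inequality_aux[OF L d c per mean bd] in auto)
  ultimately have "0 \<le> ?Q 1" by (rule tendsto_lowerbound) simp
  then show ?thesis using True by simp
qed (use weighted_slope_inequality_aux[OF L d c per mean bd] b in auto)

section \<open>Integration over the torus\<close>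

subsection \<open>Basic facts\<close>

lemma finite_measure_torus: "finite_measure (torus L :: (real^'n) measure)"
  unfolding cell_def by (intro finite_measure_lebesgue_on lmeasurable_cbox)

lemma sets_cell [simp]: "cell L \<in> sets lebesgue"
  unfolding cell_def by simp

lemma cell_not_empty: "L > 0 \<Longrightarrow> (cell L :: (real^'n) set) \<noteq> {}"
  unfolding cell_def by (auto simp: interval_eq_empty_cart not_less less_imp_le)

lemma measure_torus:
  assumes "L > 0"
  shows "measure (torus L) (cell L :: (real^'n) set) = L ^ CARD('n)"
proof -
  have "measure (torus L) (cell L :: (real^'n) set) = measure lebesgue (cell L :: (real^'n) set)"
    by (subst measure_restrict_space) auto
  also have "\<dots> = measure lborel (cbox 0 (\<chi> i. L) :: (real^'n) set)"
    unfolding cell_def by simp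
  also have "\<dots> = (\<Prod>i\<in>(UNIV::'n set). (\<chi> i. L) $ i - (0::real^'n) $ i)"
    using cell_not_empty[OF assms] unfolding cell_def by (rule content_cbox_cart)
  finally show ?thesis by simp
qed

lemma torus_integral_const: "L > 0 \<Longrightarrow> (LINT x|(torus L :: (real^'n) measure). c) = L ^ CARD('n) * c" for c :: real
  by (simp add: measure_torus)

lemma integrable_torus_continuous:
  "continuous_on UNIV f \<Longrightarrow> integrable (torus L) f" for f :: "real^'n \<Rightarrow> 'b::euclidean_space"
  unfolding cell_def by (intro continuous_imp_integrable) (auto intro: continuous_on_subset)

lemma measurable_torus_continuous:
  "continuous_on UNIV f \<Longrightarrow> f \<in> borel_measurable (torus L)" for f :: "real^'n \<Rightarrow> 'b::euclidean_space"
  by (rule borel_measurable_integrable[OF integrable_torus_continuous])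

lemma LINT_torus_eq_integral:
  "integrable (torus L) f \<Longrightarrow> (LINT x|torus L. f x) = integral (cell L) f" for f :: "real^'n \<Rightarrow> 'b::euclidean_space"
  by (intro lebesgue_integral_eq_integral) auto

lemma periodic_bounded:
  fixes k :: "real \<Rightarrow> real"
  assumes "L > 0" "\<And>y. k (y + L) = k y" "continuous_on UNIV k"
  obtains B where "\<And>y. \<bar>k y\<bar> \<le> B" "B \<ge> 0"
proof -
  have "compact (k ` {0..L})"
    using assms(3) by (intro compact_continuous_image) (auto intro: continuous_on_subset)
  then have "bounded (k ` {0..L})" by (rule compact_imp_bounded)
  then obtain B where B: "\<And>y. y \<in> {0..L} \<Longrightarrow> \<bar>k y\<bar> \<le> B"
    unfolding bounded_iff real_norm_def by blast
  have "\<bar>k y\<bar> \<le> B" for y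
  proof -
    define m where "m = \<lfloor>y / L\<rfloor>"
    have "of_int m \<le> y / L" "y / L \<le> of_int m + 1" unfolding m_def by linarith+
    then have "y - of_int m * L \<in> {0..L}"
      using assms(1) by (auto simp: pos_le_divide_eq pos_divide_le_eq algebra_simps)
    moreover have "k y = k (y - of_int m * L)"
      using periodic_int_multiple[of k L "y - of_int m * L" m] assms(2) by simp
    ultimately show ?thesis using B by simp
  qed
  moreover have "B \<ge> 0" using B[of 0] assms(1) by (auto intro: order_trans[OF abs_ge_zero])
  ultimately show thesis using that by blast
qed

lemma integrable_torus_bounded_mult:
  fixes r k :: "real^'n \<Rightarrow> real"
  assumes "integrable (torus L) r" "k \<in> borel_measurable (torus L)" "\<And>x. x \<in> cell L \<Longrightarrow> \<bar>k x\<bar> \<le> B"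
  shows "integrable (torus L) (\<lambda>x. r x * k x)"
proof (rule Bochner_Integration.integrable_bound)
  show "integrable (torus L) (\<lambda>x. B * r x)" using assms by simp
  show "(\<lambda>x. r x * k x) \<in> borel_measurable (torus L)" using assms by (intro borel_measurable_times) auto
  show "AE x in torus L. norm (r x * k x) \<le> norm (B * r x)"
  proof (rule AE_I2)
    fix x assume "x \<in> space (torus L :: (real^'n) measure)"
    then have "\<bar>k x\<bar> \<le> \<bar>B\<bar>" using assms(3)[of x] by force
    then have "\<bar>k x\<bar> * \<bar>r x\<bar> \<le> \<bar>B\<bar> * \<bar>r x\<bar>" by (intro mult_right_mono) auto
    then show "norm (r x * k x) \<le> norm (B * r x)" by (simp add: abs_mult mult.commute)
  qed
qed

lemma continuous_bounded_on_cell: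
  fixes k :: "real^'n \<Rightarrow> real"
  assumes "continuous_on UNIV k"
  obtains B where "\<And>x. x \<in> cell L \<Longrightarrow> \<bar>k x\<bar> \<le> B" "B \<ge> 0"
proof -
  have "bounded (k ` cell L)" unfolding cell_def
    using assms by (intro compact_imp_bounded compact_continuous_image) (auto intro: continuous_on_subset)
  then obtain B where "\<And>x. x \<in> cell L \<Longrightarrow> \<bar>k x\<bar> \<le> B" by (auto simp: bounded_iff)
  then have "\<And>x. x \<in> cell L \<Longrightarrow> \<bar>k x\<bar> \<le> max B 0" by (simp add: le_max_iff_disj)
  then show thesis using that by (metis max.cobounded2)
qed

lemma integrable_torus_continuous_mult:
  fixes r k :: "real^'n \<Rightarrow> real"
  assumes "integrable (torus L) r" "continuous_on UNIV k"
  shows "integrable (torus L) (\<lambda>x. r x * k x)"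
  using continuous_bounded_on_cell[OF assms(2), of L]
    integrable_torus_bounded_mult[OF assms(1) measurable_torus_continuous[OF assms(2)]] by metis

lemma torus_integral_mult_bound:
  fixes r k :: "real^'n \<Rightarrow> real"
  assumes "integrable (torus L) r" "\<And>x. x \<in> cell L \<Longrightarrow> \<bar>k x\<bar> \<le> B"
  shows "\<bar>LINT x|torus L. r x * k x\<bar> \<le> B * (LINT x|torus L. \<bar>r x\<bar>)"
proof -
  have "\<bar>LINT x|torus L. r x * k x\<bar> \<le> (LINT x|torus L. \<bar>r x * k x\<bar>)"
    by (rule integral_abs_bound)
  also have "\<dots> \<le> (LINT x|torus L. B * \<bar>r x\<bar>)"
  proof (rule integral_mono')
    fix x assume "x \<in> space (torus L :: (real^'n) measure)"
    then show "\<bar>r x * k x\<bar> \<le> B * \<bar>r x\<bar>"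
      using assms(2)[of x] mult_left_mono[of "\<bar>k x\<bar>" B "\<bar>r x\<bar>"] by (simp add: abs_mult mult.commute)
    then show "0 \<le> B * \<bar>r x\<bar>" using abs_ge_zero[of "r x * k x"] by linarith
  qed (use assms(1) in auto)
  finally show ?thesis by simp
qed

subsection \<open>Translation invariance and the divergence theorem\<close>

lemma cbox_split_coordinate:
  fixes a b :: "real^'n"
  shows "cbox a b \<inter> {x. x $ k \<le> c} = cbox a (\<chi> i. if i = k then min (b $ k) c else b $ i)"
    and "cbox a b \<inter> {x. x $ k \<ge> c} = cbox (\<chi> i. if i = k then max (a $ k) c else a $ i) b"
  unfolding set_eq_iff Int_iff mem_box_cart mem_Collect_eq vec_lambda_beta by auto

lemma periodic_translate_coordinate:
  fixes f :: "real^'n \<Rightarrow> real"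
  assumes per: "periodic L f" and s: "0 \<le> s" "s \<le> L" and I: "(f has_integral I) (cell L)"
  shows "((\<lambda>x. f (x + axis i s)) has_integral I) (cell L)"
proof -
  let ?lo = "cbox 0 (\<chi> j. if j = i then s else L) :: (real^'n) set"
  let ?hi = "cbox (axis i s) (\<chi> j. L) :: (real^'n) set"
  let ?sh = "cbox (axis i L) (axis i s + (\<chi> j. L)) :: (real^'n) set"
  let ?all = "cbox (axis i s) (axis i s + (\<chi> j. L)) :: (real^'n) set"
  have b: "axis i 1 \<in> (Basis :: (real^'n) set)" by (simp add: axis_in_Basis_iff)
  have ax: "x \<bullet> axis i 1 = x $ i" for x :: "real^'n" by (simp add: inner_axis)
  have lo: "cell L \<inter> {x. x \<bullet> axis i 1 \<le> s} = ?lo"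
  proof -
    have eq: "(\<chi> j. if j = i then min ((\<chi> j. L) $ i) s else (\<chi> j. L) $ j) = ((\<chi> j. if j = i then s else L) :: real^'n)"
      using s by (auto simp: vec_eq_iff)
    show ?thesis by (simp only: cell_def ax cbox_split_coordinate eq)
  qed
  have hi: "cell L \<inter> {x. x \<bullet> axis i 1 \<ge> s} = ?hi"
  proof -
    have eq: "(\<chi> j. if j = i then max ((0 :: real^'n) $ i) s else (0 :: real^'n) $ j) = axis i s"
      using s by (auto simp: vec_eq_iff axis_def)
    show ?thesis by (simp only: cell_def ax cbox_split_coordinate eq)
  qed
  have alo: "?all \<inter> {x. x \<bullet> axis i 1 \<le> L} = ?hi"
  proof -
    have eq: "(\<chi> j. if j = i then min ((axis i s + (\<chi> j. L)) $ i) L else (axis i s + (\<chi> j. L)) $ j) = ((\<chi> j. L) :: real^'n)"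
      using s by (auto simp: vec_eq_iff axis_def)
    show ?thesis by (simp only: ax cbox_split_coordinate eq)
  qed
  have ahi: "?all \<inter> {x. x \<bullet> axis i 1 \<ge> L} = ?sh"
  proof -
    have eq: "(\<chi> j. if j = i then max ((axis i s :: real^'n) $ i) L else (axis i s :: real^'n) $ j) = axis i L"
      using s by (auto simp: vec_eq_iff axis_def)
    show ?thesis by (simp only: ax cbox_split_coordinate eq)
  qed
  have fi: "f integrable_on cbox 0 (\<chi> j. L)" using I unfolding cell_def by blast
  obtain I1 where I1: "(f has_integral I1) ?lo"
    using integrable_split(1)[OF fi b, of s] lo unfolding cell_def by auto
  obtain I2 where I2: "(f has_integral I2) ?hi"
    using integrable_split(2)[OF fi b, of s] hi unfolding cell_def by auto
  have "(f has_integral (I1 + I2)) (cbox 0 (\<chi> j. L))"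
    using has_integral_split[of f I1 0 "\<chi> j. L" "axis i 1" s I2] I1 I2 lo hi b unfolding cell_def by simp
  then have eq: "I = I1 + I2" using I has_integral_unique unfolding cell_def by blast
  have "((\<lambda>x. f (x + (- axis i L))) has_integral I1) (cbox (0 - (- axis i L)) ((\<chi> j. if j = i then s else L) - (- axis i L)))"
    by (rule has_integral_shift_cbox[OF I1])
  moreover have "f (x + (- axis i L)) = f x" for x
    using per unfolding periodic_def by (metis diff_add_cancel uminus_add_conv_diff add.commute)
  moreover have "cbox (0 - (- axis i L)) ((\<chi> j. if j = i then s else L) - (- axis i L)) = ?sh"
    by (intro arg_cong2[where f=cbox]) (auto simp: vec_eq_iff axis_def)
  ultimately have I1': "(f has_integral I1) ?sh" by simp
  have "(f has_integral (I2 + I1)) ?all"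
    using has_integral_split[of f I2 "axis i s" "axis i s + (\<chi> j. L)" "axis i 1" L I1] I1' I2 alo ahi b by simp
  then have "((\<lambda>x. f (x + axis i s)) has_integral I) (cbox (axis i s - axis i s) (axis i s + (\<chi> j. L) - axis i s))"
    unfolding eq by (intro has_integral_shift_cbox) (simp add: add.commute)
  then show ?thesis by (simp add: cell_def)
qed

lemma absolutely_integrable_torus:
  fixes f :: "real^'n \<Rightarrow> real"
  shows "integrable (torus L) f \<longleftrightarrow> f integrable_on cell L \<and> (\<lambda>x. \<bar>f x\<bar>) integrable_on cell L"
proof
  assume i: "integrable (torus L) f"
  show "f integrable_on cell L \<and> (\<lambda>x. \<bar>f x\<bar>) integrable_on cell L"
    using integrable_on_lebesgue_on[OF i] integrable_on_lebesgue_on[OF integrable_abs[OF i]] by simp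
next
  assume "f integrable_on cell L \<and> (\<lambda>x. \<bar>f x\<bar>) integrable_on cell L"
  then have "f absolutely_integrable_on cell L" by (auto intro: absolutely_integrable_onI)
  then show "integrable (torus L) f" by (intro absolutely_integrable_imp_integrable) auto
qed

lemma periodic_axis_multiple:
  fixes f :: "real^'n \<Rightarrow> 'b"
  assumes "periodic L f"
  shows "f (x + axis i (of_int k * L)) = f x"
proof -
  have "f (x + axis i (t + L)) = f (x + axis i t)" for t
  proof -
    have "x + axis i (t + L) = (x + axis i t) + axis i L" by (simp add: vec_eq_iff axis_def)
    then show ?thesis using assms unfolding periodic_def by metis
  qed
  from periodic_int_multiple[of "\<lambda>t. f (x + axis i t)" L 0 k, OF this] show ?thesis
    by (simp add: axis_def zero_vec_def[symmetric])
qed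

lemma periodic_shift: "periodic L f \<Longrightarrow> periodic L (\<lambda>x. f (x + w))"
  unfolding periodic_def by (metis add.assoc add.commute)

text \<open>A shift along one axis by less than a period moves a slab across the cell and periodicity puts it back;
  general shifts are composed of these.\<close>

lemma torus_has_integral_translate:
  fixes f :: "real^'n \<Rightarrow> real"
  assumes L: "L > 0" and per: "periodic L f" and I: "(f has_integral I) (cell L)"
  shows "((\<lambda>x. f (x + w)) has_integral I) (cell L)"
proof -
  have coord: "((\<lambda>x. f (x + axis i t)) has_integral I) (cell L)"
    if per: "periodic L f" and I: "(f has_integral I) (cell L)" for f :: "real^'n \<Rightarrow> real" and i t
  proof -
    define m where "m = \<lfloor>t / L\<rfloor>"
    define s where "s = t - of_int m * L"
    have "of_int m \<le> t / L" "t / L \<le> of_int m + 1" unfolding m_def by linarith+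
    then have s: "0 \<le> s" "s \<le> L"
      using L by (auto simp: s_def pos_le_divide_eq pos_divide_le_eq algebra_simps)
    have "f (x + axis i t) = f (x + axis i s)" for x
    proof -
      have "x + axis i t = (x + axis i s) + axis i (of_int m * L)" by (simp add: s_def vec_eq_iff axis_def)
      then show ?thesis using periodic_axis_multiple[OF per] by metis
    qed
    then show ?thesis using periodic_translate_coordinate[OF per s I] by simp
  qed
  have "((\<lambda>x. f (x + (\<Sum>i\<in>J. axis i (w $ i)))) has_integral I) (cell L)" if "finite J" for J
    using that
  proof (induction J)
    case empty
    then show ?case using I by simp
  next
    case (insert i J)
    from coord[OF periodic_shift[OF per] insert.IH, of i "w $ i"]
    show ?case using insert.hyps by (simp add: add.assoc)
  qed
  moreover have "(\<Sum>i\<in>UNIV. axis i (w $ i)) = w"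
    by (simp add: vec_eq_iff axis_def sum_component if_distrib cong: if_cong)
  ultimately show ?thesis by (metis finite)
qed

lemma torus_integral_translate:
  fixes f :: "real^'n \<Rightarrow> real"
  assumes L: "L > 0" and per: "periodic L f" and i: "integrable (torus L) f"
  shows "integrable (torus L) (\<lambda>x. f (x + w))" "(LINT x|torus L. f (x + w)) = (LINT x|torus L. f x)"
proof -
  have I: "(f has_integral (LINT x|torus L. f x)) (cell L)"
    using has_integral_integral_lebesgue_on[OF i] by simp
  have A: "((\<lambda>x. \<bar>f x\<bar>) has_integral (LINT x|torus L. \<bar>f x\<bar>)) (cell L)"
    using has_integral_integral_lebesgue_on[OF integrable_abs[OF i]] by simp
  have pA: "periodic L (\<lambda>x. \<bar>f x\<bar>)" using per unfolding periodic_def by simp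
  have I': "((\<lambda>x. f (x + w)) has_integral (LINT x|torus L. f x)) (cell L)"
    by (rule torus_has_integral_translate[OF L per I])
  have A': "((\<lambda>x. \<bar>f (x + w)\<bar>) has_integral (LINT x|torus L. \<bar>f x\<bar>)) (cell L)"
    by (rule torus_has_integral_translate[OF L pA A])
  show i': "integrable (torus L) (\<lambda>x. f (x + w))"
    unfolding absolutely_integrable_torus using I' A' by blast
  show "(LINT x|torus L. f (x + w)) = (LINT x|torus L. f x)"
    using LINT_torus_eq_integral[OF i'] integral_unique[OF I'] by simp
qed

text \<open>By periodicity all translates of the function have the same integral; differentiating in the shift gives the claim.\<close>

lemma torus_integral_partial_derivative:
  fixes G :: "real^'n \<Rightarrow> real"
  assumes L: "L > 0" and d: "\<And>x. (G has_derivative G' x) (at x)"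
    and c: "continuous_on UNIV (\<lambda>x. G' x (axis j 1))" and per: "periodic L G"
  shows "(LINT x|torus L. G' x (axis j 1)) = 0"
proof -
  have cG: "continuous_on UNIV G"
    using d by (intro has_derivative_continuous_on[of UNIV G G']) auto
  have lin: "x + axis j s = x + s *\<^sub>R axis j 1" for x :: "real^'n" and s
    by (simp add: vec_eq_iff axis_def)
  have D: "((\<lambda>s. G (x + s *\<^sub>R axis j 1)) has_field_derivative G' (x + s *\<^sub>R axis j 1) (axis j 1)) (at s)" for x s
  proof -
    have "((\<lambda>s. x + s *\<^sub>R axis j 1) has_derivative (\<lambda>h. h *\<^sub>R axis j 1)) (at s)"
      by (auto intro!: derivative_eq_intros)
    from has_derivative_compose[OF this d]
    have "((\<lambda>s. G (x + s *\<^sub>R axis j 1)) has_derivative (\<lambda>h. G' (x + s *\<^sub>R axis j 1) (h *\<^sub>R axis j 1))) (at s)" .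
    moreover have "(\<lambda>h. G' (x + s *\<^sub>R axis j 1) (h *\<^sub>R axis j 1)) = (*) (G' (x + s *\<^sub>R axis j 1) (axis j 1))"
      using linear_scale[OF has_derivative_linear[OF d]] by (auto simp: mult.commute)
    ultimately show ?thesis by (simp add: has_field_derivative_def)
  qed
  have "((\<lambda>s. integral (cbox 0 (\<chi> j. L)) (\<lambda>x. G (x + s *\<^sub>R axis j 1))) has_field_derivative
      integral (cbox 0 (\<chi> j. L)) (\<lambda>x. G' (x + 0 *\<^sub>R axis j 1) (axis j 1))) (at 0 within UNIV)"
  proof (rule leibniz_rule_field_derivative)
    show "(\<lambda>x. G (x + s *\<^sub>R axis j 1)) integrable_on cbox 0 (\<chi> j. L)" for s
      by (intro integrable_continuous continuous_on_compose2[OF cG]) (auto intro!: continuous_intros)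
    show "continuous_on (UNIV \<times> cbox 0 (\<chi> j. L)) (\<lambda>(s, x). G' (x + s *\<^sub>R axis j 1) (axis j 1))"
      unfolding split_beta by (intro continuous_on_compose2[OF c]) (auto intro!: continuous_intros)
  qed (use D in \<open>auto intro: has_field_derivative_at_within\<close>)
  moreover have "integral (cbox 0 (\<chi> j. L)) (\<lambda>x. G (x + s *\<^sub>R axis j 1)) = integral (cbox 0 (\<chi> j. L)) G" for s
  proof -
    have "(G has_integral integral (cell L) G) (cell L)" unfolding cell_def
      by (intro integrable_integral integrable_continuous continuous_on_subset[OF cG]) auto
    from integral_unique[OF torus_has_integral_translate[OF L per this, of "s *\<^sub>R axis j 1"]]
    show ?thesis unfolding cell_def by simp
  qed
  ultimately have "((\<lambda>s. integral (cbox 0 (\<chi> j. L)) G) has_field_derivative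
      integral (cbox 0 (\<chi> j. L)) (\<lambda>x. G' x (axis j 1))) (at (0::real))" by simp
  from DERIV_unique[OF this DERIV_const]
  have "integral (cbox 0 (\<chi> j. L)) (\<lambda>x. G' x (axis j 1)) = 0" .
  then show ?thesis using LINT_torus_eq_integral[OF integrable_torus_continuous[OF c], of L] by (simp add: cell_def)
qed

lemma has_derivative_axis_expansion:
  fixes u :: "real^'n"
  assumes "(f has_derivative f') (at x)"
  shows "f' u = (\<Sum>i\<in>UNIV. u $ i *\<^sub>R f' (axis i 1))"
proof -
  have "u = (\<Sum>i\<in>UNIV. u $ i *\<^sub>R axis i 1)" by (simp add: basis_expansion[symmetric] scalar_mult_eq_scaleR[symmetric])
  then have "f' u = f' (\<Sum>i\<in>UNIV. u $ i *\<^sub>R axis i 1)" by simp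
  also have "\<dots> = (\<Sum>i\<in>UNIV. u $ i *\<^sub>R f' (axis i 1))"
    using has_derivative_linear[OF assms] by (simp add: linear_sum linear_scale)
  finally show ?thesis .
qed

lemma inner_grad:
  fixes g :: "real^'n \<Rightarrow> real"
  assumes "(g has_derivative D) (at x)"
  shows "u \<bullet> grad g x = D u" "grad g x $ i = D (axis i 1)"
proof -
  have "frechet_derivative g (at x) = D" using frechet_derivative_at[OF assms] by simp
  then show "grad g x $ i = D (axis i 1)" for i unfolding grad_def by simp
  then show "u \<bullet> grad g x = D u"
    unfolding has_derivative_axis_expansion[OF assms, of u] by (simp add: inner_vec_def)
qed

text \<open>This is the weak form of incompressibility: \<open>g' v\<close> is the divergence of \<open>g v\<close>.\<close>

lemma torus_integral_divergence_free:
  fixes v :: "real^'n \<Rightarrow> real^'n" and g :: "real^'n \<Rightarrow> real"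
  assumes L: "L > 0"
    and v: "\<And>x. (v has_derivative v' x) (at x)" "\<And>h. continuous_on UNIV (\<lambda>x. v' x h)"
    and div: "\<And>x. divergence v x = 0" and pv: "periodic L v"
    and g: "\<And>x. (g has_derivative g' x) (at x)" "\<And>h. continuous_on UNIV (\<lambda>x. g' x h)" and pg: "periodic L g"
  shows "(LINT x|torus L. g' x (v x)) = 0"
proof -
  have cv: "continuous_on UNIV v" and cg: "continuous_on UNIV g"
    by (rule has_derivative_continuous_on[OF v(1)], rule has_derivative_continuous_on[OF g(1)])
  let ?D = "\<lambda>i x h. g x * (v' x h $ i) + g' x h * (v x $ i)"
  have dD: "((\<lambda>x. g x * (v x $ i)) has_derivative ?D i x) (at x)" for i x
    by (intro has_derivative_mult g bounded_linear.has_derivative[OF bounded_linear_vec_nth v(1)])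
  have cD: "continuous_on UNIV (\<lambda>x. ?D i x (axis i 1))" for i
    by (intro continuous_intros v g cv cg)
  have "(LINT x|torus L. ?D i x (axis i 1)) = 0" for i
    by (rule torus_integral_partial_derivative[OF L dD cD]) (use pv pg in \<open>auto simp: periodic_def\<close>)
  note zero = this
  have e: "(\<Sum>i\<in>UNIV. ?D i x (axis i 1)) = g' x (v x)" for x
  proof -
    have "(\<Sum>i\<in>UNIV. v' x (axis i 1) $ i) = 0"
      using div[of x] frechet_derivative_at[OF v(1)] unfolding divergence_def by simp
    moreover have "g' x (v x) = (\<Sum>i\<in>UNIV. v x $ i * g' x (axis i 1))"
      using has_derivative_axis_expansion[OF g(1)[of x], of "v x"] by (simp only: real_scaleR_def)
    ultimately show ?thesis
      by (simp add: sum.distrib sum_distrib_left[symmetric] mult.commute)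
  qed
  from zero have "0 = (\<Sum>i\<in>UNIV. LINT x|torus L. ?D i x (axis i 1))" by simp
  also have "\<dots> = (LINT x|torus L. (\<Sum>i\<in>UNIV. ?D i x (axis i 1)))"
    by (rule Bochner_Integration.integral_sum[symmetric]) (rule integrable_torus_continuous[OF cD])
  also have "\<dots> = (LINT x|torus L. g' x (v x))" by (simp only: e)
  finally show ?thesis by simp
qed

lemma has_derivative_coordinate:
  fixes g :: "real \<Rightarrow> real"
  assumes "(g has_real_derivative g' (x $ i)) (at (x $ i))"
  shows "((\<lambda>x::real^'n. g (x $ i)) has_derivative (\<lambda>h. g' (x $ i) * h $ i)) (at x)"
proof -
  have "((\<lambda>x::real^'n. x $ i) has_derivative (\<lambda>h. h $ i)) (at x)"
    by (intro bounded_linear.has_derivative[OF bounded_linear_vec_nth] has_derivative_ident)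
  from has_derivative_compose[OF this] assms show ?thesis by (simp add: has_field_derivative_def)
qed

lemma periodic_coordinate: "(\<And>y. g (y + L) = g y) \<Longrightarrow> periodic L (\<lambda>x::real^'n. g (x $ i))"
  unfolding periodic_def by (auto simp: axis_def)

lemma continuous_on_coordinate:
  "continuous_on UNIV g \<Longrightarrow> continuous_on UNIV (\<lambda>x::real^'n. g (x $ i))" for g :: "real \<Rightarrow> 'b::topological_space"
  by (rule continuous_on_compose2[of UNIV g]) (auto intro!: continuous_intros)

text \<open>A periodic function of mean zero is the derivative of a periodic function, so its integral over the
  torus vanishes by the divergence theorem; subtracting the mean gives the general case.\<close>

lemma torus_integral_coordinate:
  fixes G :: "real \<Rightarrow> real"
  assumes L: "L > 0" and c: "continuous_on UNIV G" and per: "\<And>y. G (y + L) = G y"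
  shows "(LINT x|torus L. G ((x::real^'n) $ i)) = L ^ CARD('n) / L * integral {0..L} G"
proof -
  define m where "m = integral {0..L} G / L"
  have "continuous_on UNIV (\<lambda>y. G y - m)" by (intro continuous_intros c)
  then obtain A where A: "\<And>x. (A has_real_derivative G x - m) (at x)"
    using continuous_antiderivative by metis
  have "((\<lambda>y. G y - m) has_integral (A L - A 0)) {0..L}"
  proof (rule fundamental_theorem_of_calculus)
    show "(A has_vector_derivative (G x - m)) (at x within {0..L})" for x
      using has_field_derivative_at_within[OF A[of x]]
      by (simp add: has_real_derivative_iff_has_vector_derivative)
  qed (use L in simp)
  moreover have "((\<lambda>y. G y - m) has_integral (integral {0..L} G - (L - 0) *\<^sub>R m)) {0..L}"
    using L has_integral_const_real[of m 0 L]
    by (intro has_integral_diff integrable_integral integrable_continuous_real continuous_on_subset[OF c]) auto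
  ultimately have "A L - A 0 = integral {0..L} G - (L - 0) *\<^sub>R m" by (rule has_integral_unique)
  then have AL: "A L = A 0" using L by (simp add: m_def)
  have diff: "A (y + L) - A y = A (0 + L) - A 0" for y
  proof -
    have "((\<lambda>y. A (y + L) - A y) has_real_derivative 0) (at y)" for y
    proof -
      have 1: "((\<lambda>y. A (y + L)) has_real_derivative G (y + L) - m) (at y)"
        using DERIV_shift[of A "G (y + L) - m" y L] A by blast
      show ?thesis using DERIV_diff[OF 1 A[of y]] by (simp add: per)
    qed
    then show ?thesis using DERIV_isconst_all[of "\<lambda>y. A (y + L) - A y" y 0] by simp
  qed
  have pA: "A (y + L) = A y" for y using diff[of y] AL by simp
  have "(LINT x|torus L. (G ((x::real^'n) $ i) - m) * axis i 1 $ i) = 0"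
  proof (rule torus_integral_partial_derivative[OF L, of "\<lambda>x. A (x $ i)"])
    show "((\<lambda>x::real^'n. A (x $ i)) has_derivative (\<lambda>h. (G (x $ i) - m) * h $ i)) (at x)" for x
      using has_derivative_coordinate[of A "\<lambda>y. G y - m" x i] A by simp
  qed (auto intro!: continuous_intros continuous_on_coordinate c periodic_coordinate pA)
  then have "(LINT x|torus L. G ((x::real^'n) $ i) - m) = 0" by simp
  moreover have "(LINT x|torus L. G ((x::real^'n) $ i) - m)
      = (LINT x|torus L. G ((x::real^'n) $ i)) - (LINT x|(torus L :: (real^'n) measure). m)"
    by (intro Bochner_Integration.integral_diff integrable_torus_continuous continuous_on_coordinate c) simp
  ultimately show ?thesis using torus_integral_const[OF L, of m, where 'n='n] by (simp add: m_def)
qed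

subsection \<open>Exchanging integrals\<close>

lemma torus_Fubini:
  fixes q r :: "real^'n \<Rightarrow> real" and k :: "real^'n \<Rightarrow> real^'n \<Rightarrow> real"
  assumes q: "integrable (torus L) q" and r: "integrable (torus L) r"
    and k: "continuous_on UNIV (\<lambda>(x, y). k x y)"
  shows "(LINT x|torus L. q x * (LINT y|torus L. r y * k x y)) = (LINT y|torus L. r y * (LINT x|torus L. q x * k x y))"
proof -
  let ?M = "torus L :: (real^'n) measure"
  interpret finite_measure ?M by (rule finite_measure_torus)
  interpret P: pair_sigma_finite ?M ?M ..
  have id: "(\<lambda>x. x) \<in> ?M \<rightarrow>\<^sub>M borel"
    by (rule measurable_torus_continuous) (intro continuous_intros)
  have "(\<lambda>p. (fst p, snd p)) \<in> ?M \<Otimes>\<^sub>M ?M \<rightarrow>\<^sub>M borel \<Otimes>\<^sub>M borel"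
    by (intro measurable_Pair measurable_compose[OF measurable_fst id] measurable_compose[OF measurable_snd id])
  then have pm: "(\<lambda>p. (fst p, snd p)) \<in> ?M \<Otimes>\<^sub>M ?M \<rightarrow>\<^sub>M borel"
    unfolding borel_prod .
  have km: "(\<lambda>(x, y). k x y) \<in> borel_measurable (?M \<Otimes>\<^sub>M ?M)"
    using measurable_compose[OF pm borel_measurable_continuous_onI[OF k]] by (simp add: split_beta)
  have bdd: "bounded ((\<lambda>(x, y). k x y) ` (cell L \<times> cell L))"
    unfolding cell_def by (intro compact_imp_bounded compact_continuous_image compact_Times compact_cbox)
      (auto intro: continuous_on_subset[OF k])
  then obtain B where B: "\<And>x y. x \<in> cell L \<Longrightarrow> y \<in> cell L \<Longrightarrow> \<bar>k x y\<bar> \<le> B"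
    unfolding bounded_iff by auto
  have qm: "(\<lambda>p. q (fst p)) \<in> borel_measurable (?M \<Otimes>\<^sub>M ?M)"
    by (rule measurable_compose[OF measurable_fst borel_measurable_integrable[OF q]])
  have rm: "(\<lambda>p. r (snd p)) \<in> borel_measurable (?M \<Otimes>\<^sub>M ?M)"
    by (rule measurable_compose[OF measurable_snd borel_measurable_integrable[OF r]])
  have qr: "integrable (?M \<Otimes>\<^sub>M ?M) (\<lambda>p. q (fst p) * r (snd p))"
  proof (rule P.Fubini_integrable)
    show "(\<lambda>p. q (fst p) * r (snd p)) \<in> borel_measurable (?M \<Otimes>\<^sub>M ?M)"
      by (intro borel_measurable_times qm rm)
    show "integrable ?M (\<lambda>x. LINT y|?M. norm (q (fst (x, y)) * r (snd (x, y))))"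
      using q by (simp add: abs_mult)
  qed (use r in auto)
  have int: "integrable (?M \<Otimes>\<^sub>M ?M) (\<lambda>(x, y). q x * r y * k x y)"
  proof (rule Bochner_Integration.integrable_bound)
    show "integrable (?M \<Otimes>\<^sub>M ?M) (\<lambda>p. B * (q (fst p) * r (snd p)))" using qr by simp
    show "(\<lambda>(x, y). q x * r y * k x y) \<in> borel_measurable (?M \<Otimes>\<^sub>M ?M)"
      using borel_measurable_times[OF borel_measurable_times[OF qm rm] km] by (simp add: split_beta)
    show "AE p in ?M \<Otimes>\<^sub>M ?M. norm (case p of (x, y) \<Rightarrow> q x * r y * k x y) \<le> norm (B * (q (fst p) * r (snd p)))"
    proof (rule AE_I2)
      fix p assume "p \<in> space (?M \<Otimes>\<^sub>M ?M)"
      then have "\<bar>k (fst p) (snd p)\<bar> \<le> \<bar>B\<bar>" using B[of "fst p" "snd p"] by (auto simp: space_pair_measure)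
      then have "\<bar>k (fst p) (snd p)\<bar> * \<bar>q (fst p) * r (snd p)\<bar> \<le> \<bar>B\<bar> * \<bar>q (fst p) * r (snd p)\<bar>"
        by (intro mult_right_mono) auto
      then show "norm (case p of (x, y) \<Rightarrow> q x * r y * k x y) \<le> norm (B * (q (fst p) * r (snd p)))"
        by (simp add: split_beta abs_mult mult.commute)
    qed
  qed
  from P.Fubini_integral[OF int]
  have "(LINT y|?M. LINT x|?M. q x * r y * k x y) = (LINT x|?M. LINT y|?M. q x * r y * k x y)" .
  moreover have "(LINT x|?M. q x * r y * k x y) = r y * (LINT x|?M. q x * k x y)" for y
    by (subst integral_mult_right_zero[symmetric]) (simp add: mult_ac)
  moreover have "(LINT y|?M. q x * r y * k x y) = q x * (LINT y|?M. r y * k x y)" for x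
    by (subst integral_mult_right_zero[symmetric]) (simp add: mult_ac)
  ultimately show ?thesis by simp
qed

section \<open>Sign detection by trigonometric polynomials\<close>

text \<open>Products of waves are sums of waves, so real linear combinations of phase-shifted sines already form an algebra.\<close>

inductive trig :: "real \<Rightarrow> (real^'n \<Rightarrow> real) \<Rightarrow> bool" for L where
  wave: "(\<And>i. \<exists>m::int. \<kappa> $ i = 2 * pi * of_int m / L) \<Longrightarrow> trig L (\<lambda>x. sin (\<kappa> \<bullet> x + \<theta>))"
| add: "trig L p \<Longrightarrow> trig L q \<Longrightarrow> trig L (\<lambda>x. p x + q x)"
| scale: "trig L p \<Longrightarrow> trig L (\<lambda>x. c * p x)"

lemma trig_const: "trig L (\<lambda>x::real^'n. c)"
proof -
  have "trig L (\<lambda>x::real^'n. sin (0 \<bullet> x + pi / 2))" by (rule trig.wave) (auto intro: exI[of _ 0])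
  from trig.scale[OF this, of c] show ?thesis by simp
qed

lemma trig_cos_coordinate: "trig L (\<lambda>x::real^'n. cos (2 * pi * (x $ i - m) / L))"
proof -
  have "trig L (\<lambda>x::real^'n. sin (axis i (2 * pi / L) \<bullet> x + (pi / 2 - 2 * pi * m / L)))"
  proof (rule trig.wave)
    fix j
    show "\<exists>n::int. (axis i (2 * pi / L) :: real^'n) $ j = 2 * pi * of_int n / L"
      by (cases "j = i") (auto simp: axis_def intro: exI[of _ 1] exI[of _ 0])
  qed
  moreover have "axis i (2 * pi / L) \<bullet> x + (pi / 2 - 2 * pi * m / L) = pi / 2 + 2 * pi * (x $ i - m) / L" for x :: "real^'n"
    by (simp add: inner_axis' right_diff_distrib diff_divide_distrib)
  ultimately have "trig L (\<lambda>x::real^'n. sin (pi / 2 + 2 * pi * (x $ i - m) / L))" by (simp only:)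
  then show ?thesis by (simp add: sin_add)
qed

lemma trig_mult_wave:
  assumes k: "\<And>i. \<exists>m::int. \<kappa> $ i = 2 * pi * of_int m / L" and "trig L q"
  shows "trig L (\<lambda>x. sin (\<kappa> \<bullet> x + \<theta>) * q x)"
  using assms(2)
proof induction
  case (wave l u)
  have 1: "trig L (\<lambda>x. sin ((\<kappa> - l) \<bullet> x + (\<theta> - u + pi / 2)))"
  proof (rule trig.wave)
    fix i
    obtain m n :: int where "\<kappa> $ i = 2 * pi * of_int m / L" "l $ i = 2 * pi * of_int n / L" using k wave by metis
    then show "\<exists>m::int. (\<kappa> - l) $ i = 2 * pi * of_int m / L"
      by (intro exI[of _ "m - n"]) (simp add: algebra_simps diff_divide_distrib)
  qed
  have 2: "trig L (\<lambda>x. sin ((\<kappa> + l) \<bullet> x + (\<theta> + u + pi / 2)))"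
  proof (rule trig.wave)
    fix i
    obtain m n :: int where "\<kappa> $ i = 2 * pi * of_int m / L" "l $ i = 2 * pi * of_int n / L" using k wave by metis
    then show "\<exists>m::int. (\<kappa> + l) $ i = 2 * pi * of_int m / L"
      by (intro exI[of _ "m + n"]) (simp add: algebra_simps add_divide_distrib)
  qed
  have "sin (\<kappa> \<bullet> x + \<theta>) * sin (l \<bullet> x + u)
      = (1/2) * sin ((\<kappa> - l) \<bullet> x + (\<theta> - u + pi / 2)) + (- 1/2) * sin ((\<kappa> + l) \<bullet> x + (\<theta> + u + pi / 2))" for x
  proof -
    have "(\<kappa> - l) \<bullet> x + (\<theta> - u + pi / 2) = ((\<kappa> \<bullet> x + \<theta>) - (l \<bullet> x + u)) + pi / 2"
      "(\<kappa> + l) \<bullet> x + (\<theta> + u + pi / 2) = ((\<kappa> \<bullet> x + \<theta>) + (l \<bullet> x + u)) + pi / 2"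
      by (simp_all add: inner_diff_left inner_add_left)
    moreover have "sin A * sin B = (1/2) * sin ((A - B) + pi / 2) + (- 1/2) * sin ((A + B) + pi / 2)" for A B :: real
      by (simp add: sin_add cos_add cos_diff) (simp add: field_simps)
    ultimately show ?thesis by (simp only:)
  qed
  then show ?case using trig.add[OF trig.scale[OF 1] trig.scale[OF 2], of "1/2" "-1/2"] by simp
next
  case (add p q)
  then show ?case using trig.add by (simp add: distrib_left)
next
  case (scale p c)
  then show ?case using trig.scale[of L "\<lambda>x. sin (\<kappa> \<bullet> x + \<theta>) * p x" c] by (simp add: mult.left_commute)
qed

lemma trig_mult: "trig L p \<Longrightarrow> trig L q \<Longrightarrow> trig L (\<lambda>x. p x * q x)"
proof (induction rule: trig.induct)
  case (wave k u)
  then show ?case by (intro trig_mult_wave) auto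
next
  case (add p p')
  then show ?case using trig.add[of L "\<lambda>x. p x * q x" "\<lambda>x. p' x * q x"] by (simp add: distrib_right)
next
  case (scale p c)
  then show ?case using trig.scale[of L "\<lambda>x. p x * q x" c] by (simp add: mult.assoc)
qed

lemma trig_prod: "(\<And>i. i \<in> I \<Longrightarrow> trig L (p i)) \<Longrightarrow> trig L (\<lambda>x. \<Prod>i\<in>I. p i x)"
  by (induction I rule: infinite_finite_induct) (auto intro: trig_const trig_mult)

lemma trig_sum: "(\<And>i. i \<in> I \<Longrightarrow> trig L (p i)) \<Longrightarrow> trig L (\<lambda>x. \<Sum>i\<in>I. p i x)"
  by (induction I rule: infinite_finite_induct) (auto intro: trig_const trig.add)

lemma trig_power: "trig L p \<Longrightarrow> trig L (\<lambda>x. p x ^ k)"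
  by (induction k) (auto intro: trig_const trig_mult)

lemma smooth_on_wave: "smooth_on UNIV (\<lambda>x::real^'n. sin (\<kappa> \<bullet> x + \<theta>))"
  by (intro smooth_on_compose_UNIV[OF _ smooth_on_sin] smooth_on_add smooth_on_const
      smooth_on_linear bounded_linear_inner_right)

lemma periodic_wave:
  fixes \<kappa> :: "real^'n"
  assumes "L > 0" "\<And>i. \<exists>m::int. \<kappa> $ i = 2 * pi * of_int m / L"
  shows "periodic L (\<lambda>x. sin (\<kappa> \<bullet> x + \<theta>))"
  unfolding periodic_def
proof (intro allI)
  fix x i
  obtain m :: int where m: "\<kappa> $ i = 2 * pi * of_int m / L" using assms by metis
  have "\<kappa> \<bullet> (x + axis i L) + \<theta> = (\<kappa> \<bullet> x + \<theta>) + 2 * pi * of_int m"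
    using m assms(1) by (simp add: inner_add_right inner_axis)
  moreover have "sin (2 * pi * of_int m) = (0::real)" "cos (2 * pi * of_int m) = (1::real)"
    by (simp_all add: sin_int_2pin cos_int_2pin)
  ultimately show "sin (\<kappa> \<bullet> (x + axis i L) + \<theta>) = sin (\<kappa> \<bullet> x + \<theta>)"
    by (simp only: sin_add) simp
qed

lemma trig_smooth: "trig L p \<Longrightarrow> smooth_on UNIV p"
  by (induction rule: trig.induct)
    (auto intro: smooth_on_wave smooth_on_add smooth_on_mult smooth_on_const)

lemma trig_periodic: "trig L p \<Longrightarrow> L > 0 \<Longrightarrow> periodic L p"
proof (induction rule: trig.induct)
  case (wave k u)
  then show ?case by (intro periodic_wave) auto
qed (simp_all add: periodic_def)

text \<open>The cosine recognises an interval inside one period as a superlevel set.\<close>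

lemma cos_interval_iff:
  fixes L s a b :: real
  assumes L: "L > 0" and ab: "0 \<le> a" "a \<le> b" "b \<le> L" and s: "0 \<le> s" "s \<le> L"
  shows "cos (2 * pi * (s - (a + b) / 2) / L) > cos (pi * (b - a) / L) \<longleftrightarrow> a < s \<and> s < b"
proof -
  define u where "u = 2 * pi * \<bar>s - (a + b) / 2\<bar> / L"
  define h where "h = pi * (b - a) / L"
  have "pi * (b - a) / L \<le> pi * L / L" using L ab by (intro divide_right_mono mult_left_mono) auto
  then have h: "0 \<le> h" "h \<le> pi" using L ab by (auto simp: h_def)
  have u0: "0 \<le> u" using L by (simp add: u_def)
  have c: "cos (2 * pi * (s - (a + b) / 2) / L) = cos u"
  proof -
    have "u = \<bar>2 * pi * (s - (a + b) / 2) / L\<bar>" using L by (simp add: u_def abs_mult)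
    then show ?thesis by (simp only: cos_abs_real)
  qed
  have uh: "u < h \<longleftrightarrow> a < s \<and> s < b"
  proof -
    have "u < h \<longleftrightarrow> 2 * \<bar>s - (a + b) / 2\<bar> < b - a"
      using L by (simp add: u_def h_def divide_less_cancel)
    then show ?thesis by (auto simp: abs_if field_simps)
  qed
  have big: "u \<le> 2 * pi - h"
  proof -
    have "2 * \<bar>s - (a + b) / 2\<bar> + (b - a) \<le> 2 * L" using ab s by (auto simp: abs_if field_simps)
    then have "pi * (2 * \<bar>s - (a + b) / 2\<bar> + (b - a)) / L \<le> pi * (2 * L) / L"
      using L by (intro divide_right_mono mult_left_mono) auto
    then show ?thesis using L by (simp add: u_def h_def algebra_simps add_divide_distrib diff_divide_distrib)
  qed
  show ?thesis
  proof (cases "u \<le> pi")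
    case True
    then show ?thesis using cos_mono_less_eq[of h u] h u0 uh c by (simp add: h_def)
  next
    case False
    then have "cos u = cos (2 * pi - u)" by (simp add: cos_diff)
    also have "\<not> cos (2 * pi - u) > cos h"
      using cos_mono_less_eq[of h "2 * pi - u"] h u0 False big by auto
    finally show ?thesis using False h c uh by (auto simp: h_def)
  qed
qed

text \<open>Bernstein polynomials of a clipped ramp turn that superlevel set into trigonometric
  polynomials with values in the unit interval.\<close>

lemma step_polynomials:
  fixes c :: real
  obtains P :: "nat \<Rightarrow> real \<Rightarrow> real" where
    "\<And>n (f :: real^'n \<Rightarrow> real) L. trig L f \<Longrightarrow> trig L (\<lambda>x. P n (f x))"
    "\<And>n u. - 1 \<le> u \<Longrightarrow> u \<le> 1 \<Longrightarrow> 0 \<le> P n u \<and> P n u \<le> 1"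
    "\<And>u. - 1 \<le> u \<Longrightarrow> u \<le> 1 \<Longrightarrow> (\<lambda>n. P n u) \<longlonglongrightarrow> (if u > c then 1 else 0)"
proof -
  define H where "H = (\<lambda>n::nat. \<lambda>w::real. max 0 (min 1 (real n * ((2 * w - 1) - c))))"
  have H01: "0 \<le> H n w" "H n w \<le> 1" for n w by (auto simp: H_def)
  have "\<exists>N. \<forall>m w. N \<le> m \<and> w \<in> {0..1} \<longrightarrow> \<bar>H n w - (\<Sum>k\<le>m. H n (k/m) * Bernstein m k w)\<bar> < 1 / real (Suc n)" for n
    by (rule Bernstein_Weierstrass) (auto simp: H_def intro!: continuous_intros)
  then obtain N where N: "\<And>n w. w \<in> {0..1} \<Longrightarrow> \<bar>H n w - (\<Sum>k\<le>N n. H n (k/N n) * Bernstein (N n) k w)\<bar> < 1 / real (Suc n)"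
    by (metis order_refl)
  define P where "P = (\<lambda>n u. \<Sum>k\<le>N n. H n (k/N n) * Bernstein (N n) k ((1 + u) / 2))"
  show thesis
  proof
    fix n :: nat and f :: "real^'n \<Rightarrow> real" and L assume f: "trig L f"
    have 1: "trig L (\<lambda>x. (1 + f x) / 2)"
      using trig.scale[OF trig.add[OF trig_const[of L 1] f], of "1/2"] by simp
    have 2: "trig L (\<lambda>x. 1 - (1 + f x) / 2)"
    proof -
      have "(\<lambda>x. 1 - (1 + f x) / 2) = (\<lambda>x. 1 + (- 1) * ((1 + f x) / 2))" by (simp add: fun_eq_iff field_simps)
      then show ?thesis using trig.add[OF trig_const[of L 1] trig.scale[OF 1, of "-1"]] by (simp only:)
    qed
    show "trig L (\<lambda>x. P n (f x))" unfolding P_def Bernstein_def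
      by (intro trig_sum trig.scale trig_mult trig_const trig_power 1 2)
  next
    fix n and u :: real assume u: "- 1 \<le> u" "u \<le> 1"
    have B0: "0 \<le> Bernstein (N n) k ((1 + u) / 2)" for k
      using u by (intro Bernstein_nonneg) auto
    have "P n u \<le> (\<Sum>k\<le>N n. 1 * Bernstein (N n) k ((1 + u) / 2))"
      unfolding P_def by (intro sum_mono mult_right_mono H01 B0)
    then show "0 \<le> P n u \<and> P n u \<le> 1"
      unfolding P_def by (auto intro!: sum_nonneg mult_nonneg_nonneg H01 B0)
  next
    fix u :: real assume u: "- 1 \<le> u" "u \<le> 1"
    let ?w = "(1 + u) / 2"
    have w: "?w \<in> {0..1}" using u by auto
    have w2: "2 * ?w - 1 = u" by (simp add: field_simps)
    have lim: "(\<lambda>n. H n ?w) \<longlonglongrightarrow> (if u > c then 1 else 0)"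
    proof (cases "u > c")
      case True
      obtain n0 :: nat where n0: "1 / (u - c) < real n0" using reals_Archimedean2 by blast
      have "H n ?w = 1" if "n \<ge> n0" for n
      proof -
        have "1 / (u - c) \<le> real n" using n0 that by linarith
        then have "1 \<le> real n * (u - c)" using True by (simp add: divide_le_eq)
        then show ?thesis unfolding H_def w2 by simp
      qed
      then have "(\<lambda>n. H n ?w) \<longlonglongrightarrow> 1" by (intro tendsto_eventually eventually_sequentiallyI)
      then show ?thesis using True by simp
    next
      case False
      then have z: "real n * (u - c) \<le> 0" for n by (simp add: mult_nonneg_nonpos)
      have "H n ?w = 0" for n unfolding H_def w2 using z[of n] by simp
      then show ?thesis using False by simp
    qed
    have "(\<lambda>n. H n ?w - P n u) \<longlonglongrightarrow> 0"
    proof (rule Lim_null_comparison)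
      show "\<forall>\<^sub>F n in sequentially. norm (H n ?w - P n u) \<le> 1 / real (Suc n)"
        using N[OF w] by (auto simp: P_def intro!: always_eventually less_imp_le)
      show "(\<lambda>n. 1 / real (Suc n)) \<longlonglongrightarrow> 0" by (rule LIMSEQ_Suc[OF lim_1_over_n])
    qed
    from tendsto_diff[OF lim this] show "(\<lambda>n. P n u) \<longlonglongrightarrow> (if u > c then 1 else 0)" by simp
  qed
qed

lemma AE_torus: "AE x in lebesgue. P x \<Longrightarrow> AE x in torus L. P (x :: real^'n)"
  by (subst AE_restrict_space_iff) (auto elim: eventually_mono)

lemma trig_box_nonneg:
  fixes h :: "real^'n \<Rightarrow> real"
  assumes L: "L > 0" and h: "integrable (torus L) h"
    and nn: "\<And>p. trig L p \<Longrightarrow> (\<And>x. 0 \<le> p x) \<Longrightarrow> 0 \<le> (LINT x|torus L. h x * p x)"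
    and ab: "\<And>i. 0 \<le> a $ i" "\<And>i. a $ i \<le> b $ i" "\<And>i. b $ i \<le> L"
  shows "0 \<le> (LINT x|torus L. indicator (box a b) x * h x)"
proof -
  have "\<exists>P :: nat \<Rightarrow> real \<Rightarrow> real. (\<forall>n (f :: real^'n \<Rightarrow> real) L. trig L f \<longrightarrow> trig L (\<lambda>x. P n (f x))) \<and>
    (\<forall>n u. - 1 \<le> u \<longrightarrow> u \<le> 1 \<longrightarrow> 0 \<le> P n u \<and> P n u \<le> 1) \<and>
    (\<forall>u. - 1 \<le> u \<longrightarrow> u \<le> 1 \<longrightarrow> (\<lambda>n. P n u) \<longlonglongrightarrow> (if u > cos (pi * (b $ i - a $ i) / L) then 1 else 0))" for i
    by (rule step_polynomials[where 'n='n, of "cos (pi * (b $ i - a $ i) / L)"]) blast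
  then obtain P :: "'n \<Rightarrow> nat \<Rightarrow> real \<Rightarrow> real" where
    P1: "\<And>i n f. trig L (f :: real^'n \<Rightarrow> real) \<Longrightarrow> trig L (\<lambda>x. P i n (f x))"
    and P2: "\<And>i n u. - 1 \<le> u \<Longrightarrow> u \<le> 1 \<Longrightarrow> 0 \<le> P i n u \<and> P i n u \<le> 1"
    and P3: "\<And>i u. - 1 \<le> u \<Longrightarrow> u \<le> 1 \<Longrightarrow> (\<lambda>n. P i n u) \<longlonglongrightarrow> (if u > cos (pi * (b $ i - a $ i) / L) then 1 else 0)"
    by metis
  define C where "C = (\<lambda>i (x::real^'n). cos (2 * pi * (x $ i - (a $ i + b $ i) / 2) / L))"
  define p where "p = (\<lambda>n x. \<Prod>i\<in>UNIV. P i n (C i x))"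
  have C: "- 1 \<le> C i x" "C i x \<le> 1" for i x by (auto simp: C_def)
  have tp: "trig L (p n)" for n
    unfolding p_def by (intro trig_prod P1) (simp add: C_def trig_cos_coordinate)
  have p0: "0 \<le> p n x" for n x unfolding p_def using P2 C by (intro prod_nonneg) auto
  have p1: "p n x \<le> 1" for n x unfolding p_def using P2 C by (intro prod_le_1) auto
  have lim: "(\<lambda>n. p n x) \<longlonglongrightarrow> indicator (box a b) x" if x: "x \<in> cell L" for x
  proof -
    have "(\<lambda>n. p n x) \<longlonglongrightarrow> (\<Prod>i\<in>UNIV. if C i x > cos (pi * (b $ i - a $ i) / L) then 1 else 0)"
      unfolding p_def by (intro tendsto_prod P3 C)
    moreover have "C i x > cos (pi * (b $ i - a $ i) / L) \<longleftrightarrow> a $ i < x $ i \<and> x $ i < b $ i" for i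
      unfolding C_def using x ab by (intro cos_interval_iff L) (auto simp: cell_def mem_box_cart)
    moreover have "(\<Prod>i\<in>UNIV. if a $ i < x $ i \<and> x $ i < b $ i then 1 else 0) = (indicator (box a b) x :: real)"
      by (auto simp: indicator_def mem_box_cart prod_zero_iff)
    ultimately show ?thesis by simp
  qed
  have "(\<lambda>n. LINT x|torus L. h x * p n x) \<longlonglongrightarrow> (LINT x|torus L. h x * indicator (box a b) x)"
  proof (rule integral_dominated_convergence[where w="\<lambda>x. \<bar>h x\<bar>"])
    show "(\<lambda>x. h x * indicator (box a b) x) \<in> borel_measurable (torus L)"
    proof (intro borel_measurable_times borel_measurable_integrable[OF h])
      have "(indicator (box a b) :: real^'n \<Rightarrow> real) \<in> borel_measurable lebesgue"
        by (intro borel_measurable_indicator) auto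
      then show "(indicator (box a b) :: real^'n \<Rightarrow> real) \<in> borel_measurable (torus L)"
        by (rule measurable_restrict_space1)
    qed
    show "(\<lambda>x. h x * p n x) \<in> borel_measurable (torus L)" for n
      by (intro borel_measurable_integrable integrable_torus_continuous_mult h
          smooth_on_imp_continuous_on trig_smooth[OF tp])
    show "integrable (torus L) (\<lambda>x. \<bar>h x\<bar>)" using h by simp
    show "AE x in torus L. (\<lambda>n. h x * p n x) \<longlonglongrightarrow> h x * indicator (box a b) x"
      by (rule AE_I2) (auto intro!: tendsto_mult lim)
    show "AE x in torus L. norm (h x * p n x) \<le> \<bar>h x\<bar>" for n
      using p0 p1 by (intro AE_I2) (auto simp: abs_mult intro!: mult_left_le)
  qed
  then have "0 \<le> (LINT x|torus L. h x * indicator (box a b) x)"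
    by (rule LIMSEQ_le_const) (use nn[OF tp p0] in auto)
  then show ?thesis by (simp add: mult.commute)
qed

text \<open>Products over the coordinates of the step polynomials approximate indicators of boxes from nonnegative trigonometric
  polynomials, so \<open>h\<close> has nonnegative integral over boxes. The set where \<open>h\<close> is negative is covered by countably many
  boxes of almost the same measure, and truncating \<open>h\<close> from above controls the excess.\<close>

lemma AE_nonneg_if_trig_nonneg:
  fixes h :: "real^'n \<Rightarrow> real"
  assumes L: "L > 0" and h: "integrable (torus L) h"
    and nn: "\<And>p. trig L p \<Longrightarrow> (\<And>x. 0 \<le> p x) \<Longrightarrow> 0 \<le> (LINT x|torus L. h x * p x)"
  shows "AE x in torus L. 0 \<le> h x"
proof -
  let ?M = "torus L :: (real^'n) measure"
  have hm: "h \<in> borel_measurable ?M" using h by (rule borel_measurable_integrable)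
  define S where "S = {x \<in> cell L. h x < 0}"
  have "{x \<in> space ?M. h x < 0} \<in> sets ?M" using hm by measurable
  then have SM: "S \<in> sets ?M" by (simp add: S_def)
  then have Sl: "S \<in> sets lebesgue" by (auto simp: sets_restrict_space)
  have Sc: "S \<subseteq> cell L" by (auto simp: S_def)
  have SL: "S \<in> lmeasurable"
    by (rule fmeasurableI2[OF lmeasurable_cbox, of S 0 "\<chi> i. L"]) (use Sc Sl in \<open>auto simp: cell_def\<close>)
  define I where "I = (\<lambda>A. LINT x|?M. indicator A x * h x)"
  have int: "integrable ?M (\<lambda>x. indicator A x * h x)" if "A \<in> sets lebesgue" for A
  proof (rule Bochner_Integration.integrable_bound[OF h])
    have "(indicator A :: real^'n \<Rightarrow> real) \<in> borel_measurable ?M"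
      using that by (intro measurable_restrict_space1 borel_measurable_indicator)
    then show "(\<lambda>x. indicator A x * h x) \<in> borel_measurable ?M" using hm by (intro borel_measurable_times)
  qed (auto simp: indicator_def)
  have Iadd: "I (X \<union> Y) = I X + I Y" if "X \<in> sets lebesgue" "Y \<in> sets lebesgue" "X \<inter> Y = {}" for X Y
  proof -
    have "I (X \<union> Y) = (LINT x|?M. indicator X x * h x + indicator Y x * h x)"
      unfolding I_def using that(3) by (intro Bochner_Integration.integral_cong) (auto simp: indicator_def)
    also have "\<dots> = I X + I Y"
      unfolding I_def using that by (intro Bochner_Integration.integral_add int)
    finally show ?thesis .
  qed
  have Ile: "I X \<le> (LINT x|?M. \<bar>h x\<bar>)" if "X \<in> sets lebesgue" for X
    unfolding I_def using h by (intro integral_mono int that) (auto simp: indicator_def)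
  define \<tau> where "\<tau> = (\<lambda>m::nat. LINT x|?M. h x - min (h x) (real m))"
  have tau_int: "integrable ?M (\<lambda>x. h x - min (h x) (real m))" for m
  proof (rule Bochner_Integration.integrable_bound[OF h])
    show "(\<lambda>x. h x - min (h x) (real m)) \<in> borel_measurable ?M" using hm by measurable
  qed (auto simp: min_def)
  have tau: "\<tau> \<longlonglongrightarrow> (LINT x|?M. 0)"
    unfolding \<tau>_def
  proof (rule integral_dominated_convergence[where w="\<lambda>x. \<bar>h x\<bar>"])
    show "(\<lambda>x. h x - min (h x) (real m)) \<in> borel_measurable ?M" for m using hm by measurable
    show "AE x in ?M. (\<lambda>m. h x - min (h x) (real m)) \<longlonglongrightarrow> 0"
    proof (rule AE_I2)
      fix x
      obtain m0 :: nat where "h x \<le> real m0" using real_arch_simple by blast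
      then have "h x - min (h x) (real m) = 0" if "m \<ge> m0" for m using that by (simp add: min_def)
      then show "(\<lambda>m. h x - min (h x) (real m)) \<longlonglongrightarrow> 0"
        by (intro tendsto_eventually eventually_sequentiallyI)
    qed
    show "AE x in ?M. norm (h x - min (h x) (real m)) \<le> \<bar>h x\<bar>" for m by (auto simp: min_def)
  qed (use h in auto)
  \<comment> \<open>Here \<open>m\<close> is the truncation level and \<open>e\<close> the excess measure of the cover.\<close>
  have key: "- (real m * e) - \<tau> m \<le> I S" if e: "e > 0" for m :: nat and e :: real
  proof -
    obtain \<D> where D: "countable \<D>"
        "\<And>K. K \<in> \<D> \<Longrightarrow> K \<subseteq> cbox 0 (\<chi> i. L) \<and> K \<noteq> {} \<and> (\<exists>c d. K = cbox c d)"
        "pairwise (\<lambda>A B. interior A \<inter> interior B = {}) \<D>"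
        "S \<subseteq> \<Union>\<D>" "\<Union>\<D> \<in> lmeasurable" "measure lebesgue (\<Union>\<D>) \<le> measure lebesgue S + e"
      using measurable_outer_intervals_bounded[OF SL _ e, of 0 "\<chi> i. L"] Sc unfolding cell_def by metis
    define A where "A = (\<lambda>n. if n \<in> to_nat_on \<D> ` \<D> then interior (from_nat_into \<D> n) else {})"
    have AK: "A n = {} \<or> (\<exists>K\<in>\<D>. n = to_nat_on \<D> K \<and> A n = interior K)" for n
      using D(1) by (auto simp: A_def)
    have Ao: "open (A n)" for n using AK[of n] by auto
    then have Al: "A n \<in> sets lebesgue" for n by (intro sets_completionI_sets) auto
    have VU: "(\<Union>n. A n) = (\<Union>K\<in>\<D>. interior K)"
      using D(1) by (auto simp: A_def) 
    define V where "V = (\<Union>n. A n)"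
    have Vl: "V \<in> sets lebesgue" unfolding V_def using Al by blast
    have Vsub: "V \<subseteq> \<Union>\<D>" unfolding V_def VU using interior_subset by blast
    have neg: "negligible (\<Union>\<D> - V)"
    proof (rule negligible_subset)
      show "negligible (\<Union>K\<in>\<D>. K - interior K)"
      proof (rule negligible_countable_Union)
        show "countable ((\<lambda>K. K - interior K) ` \<D>)" using D(1) by blast
        fix B assume "B \<in> (\<lambda>K. K - interior K) ` \<D>"
        then obtain K where K: "K \<in> \<D>" "B = K - interior K" by blast
        then obtain c d where "K = cbox c d" using D(2) by blast
        then have "B = cbox c d - box c d" using K(2) by (simp add: interior_cbox)
        then show "negligible B" using negligible_frontier_interval by simp
      qed
      show "\<Union>\<D> - V \<subseteq> (\<Union>K\<in>\<D>. K - interior K)" unfolding V_def VU by blast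
    qed
    have A0: "0 \<le> I (A n)" for n
    proof (cases "A n = {}")
      case False
      then obtain c d where cd: "A n = box c d" "cbox c d \<subseteq> cbox 0 (\<chi> i. L)" "cbox c d \<noteq> {}"
        using AK[of n] D(2) by (metis interior_cbox)
      then have "0 \<le> c $ i \<and> c $ i \<le> d $ i \<and> d $ i \<le> L" for i
        using subset_interval_cart(1)[of c d 0 "\<chi> i. L"] by (auto simp: interval_ne_empty_cart)
      then show ?thesis unfolding I_def cd(1) by (intro trig_box_nonneg[OF L h nn]) auto
    qed (simp add: I_def)
    have Adisj: "A m \<inter> A n = {}" if "m \<noteq> n" for m n
    proof (cases "A m = {} \<or> A n = {}")
      case False
      then obtain K K' where "K \<in> \<D>" "m = to_nat_on \<D> K" "A m = interior K"
        "K' \<in> \<D>" "n = to_nat_on \<D> K'" "A n = interior K'" using AK[of m] AK[of n] by blast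
      then show ?thesis using pairwiseD[OF D(3), of K K'] that by auto
    qed auto
    have "I V = (\<Sum>n. I (A n))"
    proof -
      have "(LINT x:(\<Union>n. A n \<inter> cell L)|?M. h x) = (\<Sum>n. LINT x:(A n \<inter> cell L)|?M. h x)"
      proof (rule lebesgue_integral_countable_add)
        show "A n \<inter> cell L \<in> sets ?M" for n 
          by (subst sets_restrict_space_iff) (use Al[of n] in \<open>auto intro: sets.Int\<close>)
        show "A m \<inter> cell L \<inter> (A n \<inter> cell L) = {}" if "m \<noteq> n" for m n
          using Adisj[OF that] by blast
        show "set_integrable ?M (\<Union>n. A n \<inter> cell L) h"
          unfolding set_integrable_def real_scaleR_def
          by (intro int sets.countable_UN sets.Int) (use Al in auto)
      qed
      moreover have "(LINT x:(B \<inter> cell L)|?M. h x) = I B" for B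
        unfolding I_def set_lebesgue_integral_def by (intro Bochner_Integration.integral_cong) (auto simp: indicator_def)
      moreover have "(\<Union>n. A n \<inter> cell L) = V \<inter> cell L" by (auto simp: V_def)
      ultimately show ?thesis by (simp only:)
    qed
    also have "\<dots> \<ge> 0"
    proof (rule suminf_nonneg[OF summableI_nonneg_bounded A0])
      show "(\<Sum>n<N. I (A n)) \<le> (LINT x|?M. \<bar>h x\<bar>)" for N
      proof -
        have "(\<Sum>n<N. I (A n)) = I (\<Union>n<N. A n)"
        proof (induction N)
          case (Suc N)
          have "(\<Union>n<N. A n) \<inter> A N = {}" using Adisj[of _ N] by force
          then have "I ((\<Union>n<N. A n) \<union> A N) = I (\<Union>n<N. A n) + I (A N)"
            using Al by (intro Iadd) auto
          moreover have "(\<Union>n<Suc N. A n) = (\<Union>n<N. A n) \<union> A N" by (auto simp: less_Suc_eq)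
          ultimately show ?case using Suc by simp
        qed (simp add: I_def)
        then show ?thesis using Ile[of "\<Union>n<N. A n"] Al by auto
      qed
    qed (rule A0)
    finally have IV: "0 \<le> I V" .
    have "I V = I (V \<inter> S) + I (V - S)"
      using Iadd[of "V \<inter> S" "V - S"] Vl Sl by (auto simp: Int_Diff_Un)
    moreover have "I (V \<inter> S) = I S"
    proof -
      have "AE x in lebesgue. x \<notin> \<Union>\<D> - V" 
        by (rule AE_not_in) (use neg in \<open>simp add: negligible_iff_null_sets\<close>)
      then have "AE x in ?M. x \<notin> \<Union>\<D> - V" by (rule AE_torus)
      then have "AE x in ?M. indicator (V \<inter> S) x * h x = indicator S x * h x"
        by eventually_elim (use D(4) in \<open>auto simp: indicator_def\<close>)
      then show ?thesis unfolding I_def using int Vl Sl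
        by (intro integral_cong_AE borel_measurable_integrable int) auto
    qed
    moreover have "I (V - S) \<le> real m * e + \<tau> m"
    proof -
      have "I (V - S) \<le> (LINT x|?M. real m * indicator (V - S) x + (h x - min (h x) (real m)))"
        unfolding I_def
      proof (rule integral_mono[OF int])
        show "integrable ?M (\<lambda>x. real m * indicator (V - S) x + (h x - min (h x) (real m)))"
        proof (rule Bochner_Integration.integrable_add[OF _ tau_int])
          show "integrable ?M (\<lambda>x. real m * indicator (V - S) x)"
          proof (rule finite_measure.integrable_const_bound[OF finite_measure_torus, where B="real m"])
            show "(\<lambda>x. real m * indicator (V - S) x) \<in> borel_measurable ?M"
              using Vl Sl by (intro measurable_restrict_space1 borel_measurable_times borel_measurable_indicator) auto
          qed (auto simp: indicator_def)
        qed
      qed (use Vl Sl in \<open>auto simp: indicator_def min_def\<close>)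
      also have "\<dots> = real m * measure ?M ((V - S) \<inter> cell L) + \<tau> m"
      proof -
        have i1: "integrable ?M (\<lambda>x. real m * indicator (V - S) x)"
        proof (rule finite_measure.integrable_const_bound[OF finite_measure_torus, where B="real m"])
          show "(\<lambda>x. real m * indicator (V - S) x) \<in> borel_measurable ?M"
            using Vl Sl by (intro measurable_restrict_space1 borel_measurable_times borel_measurable_indicator) auto
        qed (auto simp: indicator_def)
        show ?thesis unfolding \<tau>_def using Bochner_Integration.integral_add[OF i1 tau_int] by simp
      qed
      also have "measure ?M ((V - S) \<inter> cell L) \<le> e"
      proof -
        have "measure ?M ((V - S) \<inter> cell L) = measure lebesgue ((V - S) \<inter> cell L)"
          using Vl Sl by (intro measure_restrict_space) auto
        also have "\<dots> \<le> measure lebesgue (\<Union>\<D> - S)"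
          using Vl Sl D(5) Vsub by (intro measure_mono_fmeasurable fmeasurable_Diff) auto
        also have "\<dots> = measure lebesgue (\<Union>\<D>) - measure lebesgue S"
          using D(4,5) Sl by (intro measurable_measure_Diff) auto
        finally show ?thesis using D(6) by simp
      qed
      finally show ?thesis by (simp add: mult_left_mono)
    qed
    ultimately show ?thesis using IV by simp
  qed
  have "- \<tau> m \<le> I S" for m
  proof (rule field_le_epsilon)
    fix e :: real assume "e > 0"
    then have "e / (real m + 1) > 0" by simp
    from key[OF this, of m] have "- \<tau> m \<le> I S + real m * (e / (real m + 1))" by simp
    also have "real m * (e / (real m + 1)) \<le> e" using \<open>e > 0\<close> by (simp add: field_simps)
    finally show "- \<tau> m \<le> I S + e" by simp
  qed
  moreover have "(\<lambda>m. - \<tau> m) \<longlonglongrightarrow> 0" using tendsto_minus[OF tau] by simp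
  ultimately have "0 \<le> I S" by (intro LIMSEQ_le_const2[of "\<lambda>m. - \<tau> m" 0 "I S"]) auto
  moreover have "0 \<le> (LINT x|?M. - (indicator S x * h x))"
    by (intro Bochner_Integration.integral_nonneg) (auto simp: S_def indicator_def)
  ultimately have "(LINT x|?M. - (indicator S x * h x)) = 0" by (simp add: I_def)
  moreover have "integrable ?M (\<lambda>x. - (indicator S x * h x))" using int[OF Sl] by simp
  ultimately have "AE x in ?M. - (indicator S x * h x) = 0"
    by (subst integral_nonneg_eq_0_iff_AE[symmetric]) (auto simp: S_def indicator_def)
  moreover have "AE x in ?M. x \<in> cell L" by (rule AE_I2) simp
  ultimately show ?thesis by eventually_elim (auto simp: S_def indicator_def split: if_splits)
qed

section \<open>Smoothed slice means and their antiderivative\<close>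

lemma taylor_remainder_bound:
  fixes k k' :: "real \<Rightarrow> real"
  assumes d: "\<And>y. (k has_real_derivative k' y) (at y)" and K: "\<And>y z. \<bar>k' y - k' z\<bar> \<le> K * \<bar>y - z\<bar>" "K \<ge> 0"
  shows "\<bar>k (y + h) - k y - h * k' y\<bar> \<le> K * h\<^sup>2"
proof -
  have "\<bar>(k (y + h) - (y + h) * k' y) - (k y - y * k' y)\<bar> \<le> (K * \<bar>h\<bar>) * \<bar>(y + h) - y\<bar>"
  proof -
    have "norm ((\<lambda>u. k u - u * k' y) (y + h) - (\<lambda>u. k u - u * k' y) y) \<le> (K * \<bar>h\<bar>) * norm ((y + h) - y)"
    proof (rule field_differentiable_bound[of "cball y \<bar>h\<bar>"])
      fix u assume u: "u \<in> cball y \<bar>h\<bar>"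
      have "((\<lambda>u. u * k' y) has_real_derivative k' y) (at u)" by (auto intro!: derivative_eq_intros)
      from DERIV_diff[OF d this]
      show "((\<lambda>u. k u - u * k' y) has_real_derivative (k' u - k' y)) (at u within cball y \<bar>h\<bar>)"
        by (rule has_field_derivative_at_within)
      have "K * \<bar>u - y\<bar> \<le> K * \<bar>h\<bar>" using u K(2) by (intro mult_left_mono) (auto simp: dist_real_def)
      then show "norm (k' u - k' y) \<le> K * \<bar>h\<bar>" using K(1)[of u y] by simp
    qed (auto simp: dist_real_def)
    then show ?thesis by simp
  qed
  then show ?thesis by (simp add: algebra_simps power2_eq_square)
qed

lemma smooth_periodic_derivative:
  fixes k :: "real \<Rightarrow> real"
  assumes L: "L > 0" and k: "smooth_on UNIV k" "\<And>y. k (y + L) = k y"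
  shows "deriv k (y + L) = deriv k y" "\<exists>B\<ge>0. \<forall>y. \<bar>deriv k y\<bar> \<le> B" "\<exists>K\<ge>0. \<forall>y z. \<bar>k y - k z\<bar> \<le> K * \<bar>y - z\<bar>"
proof -
  show p: "deriv k (y + L) = deriv k y" for y
  proof (rule DERIV_unique)
    show "(k has_real_derivative deriv k y) (at y)" by (rule smooth_on_real_deriv[OF k(1)])
    show "(k has_real_derivative deriv k (y + L)) (at y)"
      using DERIV_shift[of k "deriv k (y + L)" y L] smooth_on_real_deriv(1)[OF k(1), of "y + L"] k(2) by simp
  qed
  obtain B where B: "\<And>y. \<bar>deriv k y\<bar> \<le> B" "B \<ge> 0"
    using periodic_bounded[OF L p smooth_on_imp_continuous_on[OF smooth_on_real_deriv(2)[OF k(1)]]] by metis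
  then show "\<exists>B\<ge>0. \<forall>y. \<bar>deriv k y\<bar> \<le> B" by blast
  have "\<bar>k y - k z\<bar> \<le> B * \<bar>y - z\<bar>" for y z
    by (rule lipschitz_of_derivative_bound[OF smooth_on_real_deriv(1)[OF k(1)] B(1)])
  then show "\<exists>K\<ge>0. \<forall>y z. \<bar>k y - k z\<bar> \<le> K * \<bar>y - z\<bar>" using B(2) by blast
qed

lemma continuous_on_lipschitz_real:
  fixes f :: "real \<Rightarrow> real"
  assumes "\<And>y z. \<bar>f y - f z\<bar> \<le> K * \<bar>y - z\<bar>"
  shows "continuous_on UNIV f"
proof (cases "K \<ge> 0")
  case True
  then have "K-lipschitz_on UNIV f" using assms by (auto intro!: lipschitz_onI simp: dist_real_def)
  then show ?thesis by (rule lipschitz_on_continuous_on)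
next
  case False
  have "f y = f z" for y z
    using assms[of y z] mult_nonpos_nonneg[of K "\<bar>y - z\<bar>"] False by auto
  then have "f = (\<lambda>_. f 0)" by auto
  then show ?thesis by (metis continuous_on_const)
qed

text \<open>The kernel \<open>\<Lambda>\<close> is a smoothed sawtooth with derivative \<open>\<eta> - 1/L\<close>. The direction \<open>i\<close> only enters the operators
  built from these kernels.\<close>

locale smoothing =
  fixes L \<epsilon> :: real and i :: "'n::finite" and \<eta> \<Lambda> :: "real \<Rightarrow> real"
  assumes L: "L > 0" and moll: "mollifier L \<epsilon> \<eta>"
    and Lam_deriv: "\<And>y. (\<Lambda> has_real_derivative \<eta> y - 1 / L) (at y)"
    and Lam_smooth: "smooth_on UNIV \<Lambda>"
    and Lam_per: "\<And>y. \<Lambda> (y + L) = \<Lambda> y" and Lam_odd: "\<And>y. \<Lambda> (- y) = - \<Lambda> y"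
    and Lam_bd: "\<And>y. \<bar>\<Lambda> y\<bar> \<le> 1"
begin

lemma eta_smooth: "smooth_on UNIV \<eta>" and eta_per: "\<eta> (y + L) = \<eta> y" and eta_even: "\<eta> (- y) = \<eta> y"
  and eta_nn: "0 \<le> \<eta> y" and eta_int: "(\<eta> has_integral 1) {0..L}"
  using moll unfolding mollifier_def by auto

lemma eta_cont: "continuous_on UNIV \<eta>" and Lam_cont: "continuous_on UNIV \<Lambda>"
  by (rule smooth_on_imp_continuous_on[OF eta_smooth], rule smooth_on_imp_continuous_on[OF Lam_smooth])

lemma eps_nonneg: "\<epsilon> \<ge> 0"
proof (rule ccontr)
  assume "\<not> \<epsilon> \<ge> 0"
  then have "\<eta> y = 0" for y
    using moll unfolding mollifier_def by (metis abs_ge_zero order_trans)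
  then have "\<eta> = (\<lambda>_. 0)" by blast
  then show False using eta_int has_integral_0[of "{0..L}"] has_integral_unique by (metis zero_neq_one)
qed

text \<open>The convolution on the circle of the kernel with the means of \<open>r\<close> over the slices \<open>x_i = const\<close>. A single integral over the torus
  expresses it, so slice means of a merely integrable \<open>r\<close> never have to be formed.\<close>

definition conv :: "(real \<Rightarrow> real) \<Rightarrow> (real^'n \<Rightarrow> real) \<Rightarrow> real \<Rightarrow> real" where
  "conv k r s = L / L ^ CARD('n) * (LINT x|torus L. r x * k (s - x $ i))"

lemma kernel_cont: "continuous_on UNIV k \<Longrightarrow> continuous_on UNIV (\<lambda>x::real^'n. k (s - x $ i))" for k :: "real \<Rightarrow> real"
  by (rule continuous_on_compose2[of UNIV k]) (auto intro!: continuous_intros)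

lemma kernel_cont2: "continuous_on UNIV k \<Longrightarrow> continuous_on UNIV (\<lambda>(x::real^'n, y::real^'n). k (x $ i - y $ i))" for k :: "real \<Rightarrow> real"
  unfolding split_beta by (rule continuous_on_compose2[of UNIV k]) (auto intro!: continuous_intros)

lemma conv_int: "integrable (torus L) r \<Longrightarrow> continuous_on UNIV k \<Longrightarrow> integrable (torus L) (\<lambda>x. r x * k (s - x $ i))"
  for r :: "real^'n \<Rightarrow> real" and k :: "real \<Rightarrow> real"
  by (rule integrable_torus_continuous_mult[OF _ kernel_cont])

lemma conv_per: "(\<And>y. k (y + L) = k y) \<Longrightarrow> conv k r (s + L) = conv k r s"
  unfolding conv_def using arg_cong[of _ _ k] by (metis (no_types, lifting) add_diff_eq diff_add_eq)

lemma conv_diff: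
  "integrable (torus L) r \<Longrightarrow> continuous_on UNIV k \<Longrightarrow> continuous_on UNIV l \<Longrightarrow>
    conv (\<lambda>y. k y - l y) r s = conv k r s - conv l r s"
  unfolding conv_def
  by (subst right_diff_distrib[symmetric], subst Bochner_Integration.integral_diff[symmetric])
    (auto intro!: conv_int simp: right_diff_distrib)

text \<open>A quadratic Taylor bound for the kernel is integrated against \<open>r\<close>, so differentiation passes under the integral.\<close>

lemma conv_deriv_lipschitz:
  assumes r: "integrable (torus L) r" and d: "\<And>y. (k has_real_derivative k' y) (at y)"
    and K: "\<And>y z. \<bar>k' y - k' z\<bar> \<le> K * \<bar>y - z\<bar>" "K \<ge> 0"
  shows "(conv k r has_real_derivative conv k' r s) (at s)"
proof -
  let ?C = "L / L ^ CARD('n) * (K * (LINT x|torus L. \<bar>r x\<bar>))"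
  have ck: "continuous_on UNIV k" using d by (meson DERIV_isCont continuous_at_imp_continuous_on)
  have ck': "continuous_on UNIV k'" by (rule continuous_on_lipschitz_real[OF K(1)])
  have bd: "\<bar>conv k r (s + h) - conv k r s - h * conv k' r s\<bar> \<le> ?C * h\<^sup>2" for h
  proof -
    have "conv k r (s + h) - conv k r s - h * conv k' r s
       = L / L ^ CARD('n) * (LINT x|torus L. r x * (k ((s - x $ i) + h) - k (s - x $ i) - h * k' (s - x $ i)))"
    proof -
      have 1: "integrable (torus L) (\<lambda>x. r x * k (s + h - x $ i))" "integrable (torus L) (\<lambda>x. r x * k (s - x $ i))"
        "integrable (torus L) (\<lambda>x. h * (r x * k' (s - x $ i)))"
        using conv_int[OF r ck] conv_int[OF r ck'] by auto
      have "(LINT x|torus L. r x * (k ((s - x $ i) + h) - k (s - x $ i) - h * k' (s - x $ i)))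
        = (LINT x|torus L. (r x * k (s + h - x $ i) - r x * k (s - x $ i)) - h * (r x * k' (s - x $ i)))"
        by (intro Bochner_Integration.integral_cong refl) (simp add: algebra_simps)
      also have "\<dots> = (LINT x|torus L. r x * k (s + h - x $ i)) - (LINT x|torus L. r x * k (s - x $ i))
          - h * (LINT x|torus L. r x * k' (s - x $ i))"
        using 1 by (simp add: Bochner_Integration.integral_diff)
      finally have e: "(LINT x|torus L. r x * (k ((s - x $ i) + h) - k (s - x $ i) - h * k' (s - x $ i)))
        = (LINT x|torus L. r x * k (s + h - x $ i)) - (LINT x|torus L. r x * k (s - x $ i))
          - h * (LINT x|torus L. r x * k' (s - x $ i))" .
      show ?thesis unfolding conv_def e by (simp add: right_diff_distrib)
    qed
    moreover have "\<bar>LINT x|torus L. r x * (k ((s - x $ i) + h) - k (s - x $ i) - h * k' (s - x $ i))\<bar>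
        \<le> (K * h\<^sup>2) * (LINT x|torus L. \<bar>r x\<bar>)"
      by (intro torus_integral_mult_bound r taylor_remainder_bound[OF d K])
    ultimately have "\<bar>conv k r (s + h) - conv k r s - h * conv k' r s\<bar> \<le> L / L ^ CARD('n) * ((K * h\<^sup>2) * (LINT x|torus L. \<bar>r x\<bar>))"
      using L by (simp add: abs_mult mult_left_mono divide_right_mono)
    then show ?thesis by (simp add: mult_ac)
  qed
  have "((\<lambda>h. (conv k r (s + h) - conv k r s) / h - conv k' r s) \<longlongrightarrow> 0) (at 0)"
  proof (rule Lim_null_comparison)
    show "\<forall>\<^sub>F h in at 0. norm ((conv k r (s + h) - conv k r s) / h - conv k' r s) \<le> ?C * \<bar>h\<bar>"
    proof (rule eventually_at_filter[THEN iffD2], rule always_eventually, intro allI impI)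
      fix h :: real assume h: "h \<noteq> 0"
      have "norm ((conv k r (s + h) - conv k r s) / h - conv k' r s) = \<bar>conv k r (s + h) - conv k r s - h * conv k' r s\<bar> / \<bar>h\<bar>"
        using h by (simp add: abs_divide[symmetric] diff_divide_distrib)
      also have "\<dots> \<le> (?C * h\<^sup>2) / \<bar>h\<bar>" by (intro divide_right_mono bd) simp
      also have "h\<^sup>2 = \<bar>h\<bar> * \<bar>h\<bar>" by (simp add: power2_eq_square)
      also have "(?C * (\<bar>h\<bar> * \<bar>h\<bar>)) / \<bar>h\<bar> = ?C * \<bar>h\<bar>"
      proof -
        have "(c * (a * a)) / a = c * a" if "a \<noteq> 0" for a c :: real using that by simp
        note c = this[of "\<bar>h\<bar>" ?C]
        have "\<bar>h\<bar> \<noteq> 0" using h by simp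
        from c[OF this] show ?thesis .
      qed
      finally show "norm ((conv k r (s + h) - conv k r s) / h - conv k' r s) \<le> ?C * \<bar>h\<bar>" .
    qed
    have "((\<lambda>h::real. ?C * \<bar>h\<bar>) \<longlongrightarrow> ?C * \<bar>0\<bar>) (at 0)" by (intro tendsto_intros)
    then show "((\<lambda>h::real. ?C * \<bar>h\<bar>) \<longlongrightarrow> 0) (at 0)" by simp
  qed
  then show ?thesis unfolding DERIV_def by (rule LIM_zero_cancel)
qed

lemma conv_deriv:
  assumes "integrable (torus L) r" "smooth_on UNIV k" "\<And>y. k (y + L) = k y"
  shows "(conv k r has_real_derivative conv (deriv k) r s) (at s)"
proof -
  note k' = smooth_on_real_deriv(2)[OF assms(2)] smooth_periodic_derivative(1)[OF L assms(2,3)]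
  obtain K where "K \<ge> 0" "\<forall>y z. \<bar>deriv k y - deriv k z\<bar> \<le> K * \<bar>y - z\<bar>"
    using smooth_periodic_derivative(3)[OF L k'] by blast
  then show ?thesis using conv_deriv_lipschitz[OF assms(1) smooth_on_real_deriv(1)[OF assms(2)]] by blast
qed

lemma conv_smooth:
  assumes "integrable (torus L) r" "smooth_on UNIV k" "\<And>y. k (y + L) = k y"
  shows "smooth_on UNIV (conv k r)"
proof (rule smooth_on_real_coinduct[where P="\<lambda>f. \<exists>k. f = conv k r \<and> smooth_on UNIV k \<and> (\<forall>y. k (y + L) = k y)"])
  show "\<exists>k'. conv k r = conv k' r \<and> smooth_on UNIV k' \<and> (\<forall>y. k' (y + L) = k' y)" using assms by blast
  fix f assume "\<exists>k. f = conv k r \<and> smooth_on UNIV k \<and> (\<forall>y. k (y + L) = k y)"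
  then obtain k where k: "f = conv k r" "smooth_on UNIV k" "\<And>y. k (y + L) = k y" by blast
  show "\<exists>f'. (\<forall>x. (f has_real_derivative f' x) (at x)) \<and> (\<exists>k. f' = conv k r \<and> smooth_on UNIV k \<and> (\<forall>y. k (y + L) = k y))"
  proof (intro exI conjI allI)
    show "(f has_real_derivative conv (deriv k) r x) (at x)" for x
      unfolding k(1) by (rule conv_deriv[OF assms(1) k(2,3)])
    show "conv (deriv k) r = conv (deriv k) r" ..
    show "smooth_on UNIV (deriv k)" by (rule smooth_on_real_deriv(2)[OF k(2)])
    show "deriv k (y + L) = deriv k y" for y by (rule smooth_periodic_derivative(1)[OF L k(2,3)])
  qed
qed

lemma eta_integral: "(LINT x|torus L. \<eta> (s - (x::real^'n) $ i)) = L ^ CARD('n) / L"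
proof -
  have "periodic L (\<lambda>x::real^'n. \<eta> (x $ i))" by (rule periodic_coordinate[of \<eta>]) (rule eta_per)
  moreover have "integrable (torus L) (\<lambda>x::real^'n. \<eta> (x $ i))"
    by (intro integrable_torus_continuous continuous_on_coordinate eta_cont)
  ultimately have "(LINT x|torus L. \<eta> ((x + axis i (- s)) $ i)) = (LINT x|torus L. \<eta> ((x::real^'n) $ i))"
    by (rule torus_integral_translate(2)[OF L])
  also have "\<dots> = L ^ CARD('n) / L" using torus_integral_coordinate[OF L eta_cont eta_per, of i] eta_int
    by (simp add: integral_unique)
  finally have "(LINT x|torus L. \<eta> ((x + axis i (- s)) $ i)) = L ^ CARD('n) / L" .
  moreover have "\<eta> ((x + axis i (- s)) $ i) = \<eta> (s - x $ i)" for x :: "real^'n"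
    using eta_even[of "s - x $ i"] by simp
  ultimately show ?thesis by simp
qed

lemma conv_eta_bound:
  assumes r: "integrable (torus L) r" and b: "AE x in torus L. \<bar>r x\<bar> \<le> B"
  shows "\<bar>conv \<eta> r s\<bar> \<le> B"
proof -
  have "\<bar>LINT x|torus L. r x * \<eta> (s - x $ i)\<bar> \<le> (LINT x|torus L. \<bar>r x * \<eta> (s - x $ i)\<bar>)"
    by (rule integral_abs_bound)
  also have "\<dots> \<le> (LINT x|torus L. B * \<eta> (s - x $ i))"
  proof (rule integral_mono_AE)
    show "AE x in torus L. \<bar>r x * \<eta> (s - x $ i)\<bar> \<le> B * \<eta> (s - x $ i)"
      using b by eventually_elim (auto simp: abs_mult eta_nn intro!: mult_right_mono)
  qed (use conv_int[OF r eta_cont] integrable_torus_continuous[OF kernel_cont[OF eta_cont]] in auto)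
  also have "\<dots> = B * (L ^ CARD('n) / L)" by (simp add: eta_integral)
  finally have "L / L ^ CARD('n) * \<bar>LINT x|torus L. r x * \<eta> (s - x $ i)\<bar> \<le> L / L ^ CARD('n) * (B * (L ^ CARD('n) / L))"
    using L by (intro mult_left_mono) auto
  then show ?thesis unfolding conv_def using L by (simp add: abs_mult)
qed

lemma Lam_mean: "(LINT x|torus L. \<Lambda> ((x::real^'n) $ i)) = 0"
proof -
  have "integral {0..L} \<Lambda> = integral {- L..0} \<Lambda>"
  proof -
    have "integral {0 - L..L - L} (\<lambda>y. \<Lambda> (y + L)) = integral {0..L} \<Lambda>"
      by (rule integral_shift_real_ivl)
    then show ?thesis by (simp add: Lam_per)
  qed
  also have "\<dots> = integral {0..L} (\<lambda>y. \<Lambda> (- y))" 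
    using Henstock_Kurzweil_Integration.integral_reflect_real[of L 0 "\<lambda>y. \<Lambda> (- y)"] by simp
  also have "\<dots> = - integral {0..L} \<Lambda>" by (simp add: Lam_odd)
  finally have "integral {0..L} \<Lambda> = 0" by simp
  then show ?thesis using torus_integral_coordinate[OF L Lam_cont Lam_per, of i] by simp
qed

lemma Lam_mean_shift: "(LINT x|torus L. \<Lambda> ((x::real^'n) $ i - s)) = 0"
proof -
  have "(LINT x|torus L. \<Lambda> ((x + axis i (- s)) $ i)) = (LINT x|torus L. \<Lambda> ((x::real^'n) $ i))"
    by (intro torus_integral_translate(2) L periodic_coordinate Lam_per integrable_torus_continuous
        continuous_on_coordinate Lam_cont)
  then show ?thesis by (simp add: Lam_mean)
qed

lemma conv_ibp:
  assumes f: "\<And>y. (f has_real_derivative f' y) (at y)" "continuous_on UNIV f'" "\<And>y. f (y + L) = f y"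
    and k: "\<And>y. (k has_real_derivative k' y) (at y)" "continuous_on UNIV k'" "\<And>y. k (y + L) = k y"
  shows "conv k' (\<lambda>z. f (z $ i)) s = conv k (\<lambda>z. f' (z $ i)) s"
proof -
  have cf: "continuous_on UNIV f" and ck: "continuous_on UNIV k"
    using f(1) k(1) by (meson DERIV_isCont continuous_at_imp_continuous_on)+
  let ?G = "\<lambda>y. f y * k (s - y)"
  have d: "(?G has_real_derivative f' y * k (s - y) - f y * k' (s - y)) (at y)" for y
  proof -
    have "((\<lambda>y. k (s - y)) has_real_derivative k' (s - y) * (- 1)) (at y)"
      by (rule DERIV_chain2[OF k(1)]) (auto intro!: derivative_eq_intros)
    from DERIV_mult[OF f(1) this] show ?thesis by (simp add: algebra_simps)
  qed
  have c1: "continuous_on UNIV (\<lambda>y. k (s - y))" and c2: "continuous_on UNIV (\<lambda>y. k' (s - y))"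
    by (auto intro!: continuous_on_compose2[OF ck] continuous_on_compose2[OF k(2)] continuous_intros)
  have p: "?G (y + L) = ?G y" for y
    using k(3)[of "s - (y + L)"] f(3)[of y] by (simp add: algebra_simps)
  have "(LINT x|torus L. (f' ((x::real^'n) $ i) * k (s - x $ i) - f (x $ i) * k' (s - x $ i)) * axis i 1 $ i) = 0"
  proof (rule torus_integral_partial_derivative[OF L, of "\<lambda>x. ?G (x $ i)"])
    show "((\<lambda>x::real^'n. ?G (x $ i)) has_derivative (\<lambda>h. (f' (x $ i) * k (s - x $ i) - f (x $ i) * k' (s - x $ i)) * h $ i)) (at x)" for x
      using has_derivative_coordinate[of ?G "\<lambda>y. f' y * k (s - y) - f y * k' (s - y)" x i] d by simp
    show "periodic L (\<lambda>x::real^'n. ?G (x $ i))" by (rule periodic_coordinate[of ?G]) (rule p)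
  qed (auto intro!: continuous_intros continuous_on_coordinate f(2) cf c1 c2)
  then have "(LINT x|torus L. f' ((x::real^'n) $ i) * k (s - x $ i) - f (x $ i) * k' (s - x $ i)) = 0" by simp
  moreover have "(LINT x|torus L. f' ((x::real^'n) $ i) * k (s - x $ i) - f (x $ i) * k' (s - x $ i))
     = (LINT x|torus L. f' ((x::real^'n) $ i) * k (s - x $ i)) - (LINT x|torus L. f ((x::real^'n) $ i) * k' (s - x $ i))"
    by (intro Bochner_Integration.integral_diff integrable_torus_continuous continuous_intros
        continuous_on_coordinate f(2) cf kernel_cont ck k(2))
  ultimately show ?thesis by (simp add: conv_def)
qed

end

context smoothing
begin

lemma int_coord: "continuous_on UNIV G \<Longrightarrow> integrable (torus L) (\<lambda>x::real^'n. G (x $ i))" for G :: "real \<Rightarrow> real"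
  by (intro integrable_torus_continuous continuous_on_coordinate)

lemma int_one: "integrable (torus L) (\<lambda>x::real^'n. 1 :: real)"
  by (intro integrable_torus_continuous continuous_intros)

lemma conv_eta_one: "conv \<eta> (\<lambda>x. 1) s = 1"
  unfolding conv_def using L by (simp add: eta_integral)

text \<open>Fubini and the parity of the kernel: convolution with an even kernel is self-adjoint, and with an odd one it is skew-adjoint.\<close>

lemma conv_even_adjoint:
  assumes w: "integrable (torus L) w" and u: "integrable (torus L) u"
    and k: "continuous_on UNIV k" "\<And>y. k (- y) = c * k y"
  shows "(LINT x|torus L. w x * conv k u (x $ i)) = c * (LINT z|torus L. u z * conv k w (z $ i))"
proof -
  have "(LINT x|torus L. w x * (LINT y|torus L. u y * k (x $ i - y $ i)))
      = (LINT y|torus L. u y * (LINT x|torus L. w x * k (x $ i - y $ i)))"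
    by (rule torus_Fubini[OF w u kernel_cont2[OF k(1)]])
  also have "\<dots> = (LINT y|torus L. c * (u y * (LINT x|torus L. w x * k (y $ i - x $ i))))"
  proof (intro Bochner_Integration.integral_cong refl)
    fix y :: "real^'n"
    have "k (x $ i - y $ i) = c * k (y $ i - x $ i)" for x :: "real^'n" using k(2)[of "y $ i - x $ i"] by simp
    then have "(LINT x|torus L. w x * k (x $ i - y $ i)) = (LINT x|torus L. c * (w x * k (y $ i - x $ i)))"
      by (simp add: mult_ac)
    then show "u y * (LINT x|torus L. w x * k (x $ i - y $ i)) = c * (u y * (LINT x|torus L. w x * k (y $ i - x $ i)))"
      by simp
  qed
  finally have e: "(LINT x|torus L. w x * (LINT y|torus L. u y * k (x $ i - y $ i)))
      = c * (LINT y|torus L. u y * (LINT x|torus L. w x * k (y $ i - x $ i)))" by simp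
  have "(LINT x|torus L. w x * conv k u (x $ i)) = L / L ^ CARD('n) * (LINT x|torus L. w x * (LINT y|torus L. u y * k (x $ i - y $ i)))"
    unfolding conv_def by (subst integral_mult_right_zero[symmetric]) (simp add: mult_ac)
  moreover have "(LINT z|torus L. u z * conv k w (z $ i)) = L / L ^ CARD('n) * (LINT y|torus L. u y * (LINT x|torus L. w x * k (y $ i - x $ i)))"
    unfolding conv_def by (subst integral_mult_right_zero[symmetric]) (simp add: mult_ac)
  ultimately show ?thesis unfolding e by simp
qed

lemmas conv_eta_adjoint = conv_even_adjoint[of _ _ \<eta> 1, OF _ _ eta_cont, simplified eta_even mult_1, OF _ _ refl]

text \<open>A mollifier of width \<open>\<epsilon>\<close> commutes with multiplication by a Lipschitz function up to an error of order \<open>\<epsilon>\<close>.\<close>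

lemma conv_eta_commute:
  assumes r: "integrable (torus L) r" and b: "AE x in torus L. \<bar>r x\<bar> \<le> 1"
    and G: "\<And>y. G (y + L) = G y" "\<And>y z. \<bar>G y - G z\<bar> \<le> K * \<bar>y - z\<bar>" "K \<ge> 0"
  shows "\<bar>conv \<eta> (\<lambda>x. r x * G (x $ i)) s - G s * conv \<eta> r s\<bar> \<le> K * \<epsilon>"
proof -
  have cG: "continuous_on UNIV G" by (rule continuous_on_lipschitz_real[OF G(2)])
  have rG: "integrable (torus L) (\<lambda>x. r x * G (x $ i))"
    by (rule integrable_torus_continuous_mult[OF r continuous_on_coordinate[OF cG]])
  have i1: "integrable (torus L) (\<lambda>x. r x * G (x $ i) * \<eta> (s - x $ i))" by (rule conv_int[OF rG eta_cont])
  have i2: "integrable (torus L) (\<lambda>x. G s * (r x * \<eta> (s - x $ i)))" using conv_int[OF r eta_cont] by simp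
  have e: "(LINT x|torus L. r x * G (x $ i) * \<eta> (s - x $ i)) - G s * (LINT x|torus L. r x * \<eta> (s - x $ i))
    = (LINT x|torus L. r x * G (x $ i) * \<eta> (s - x $ i) - G s * (r x * \<eta> (s - x $ i)))"
    using Bochner_Integration.integral_diff[OF i1 i2] by simp
  have "\<bar>LINT x|torus L. r x * G (x $ i) * \<eta> (s - x $ i) - G s * (r x * \<eta> (s - x $ i))\<bar>
      \<le> (LINT x|torus L. \<bar>r x * G (x $ i) * \<eta> (s - x $ i) - G s * (r x * \<eta> (s - x $ i))\<bar>)"
    by (rule integral_abs_bound)
  also have "\<dots> \<le> (LINT x|torus L. (K * \<epsilon>) * \<eta> (s - x $ i))"
  proof (rule integral_mono_AE)
    show "AE x in torus L. \<bar>r x * G (x $ i) * \<eta> (s - x $ i) - G s * (r x * \<eta> (s - x $ i))\<bar> \<le> (K * \<epsilon>) * \<eta> (s - x $ i)"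
      using b
    proof eventually_elim
      fix x assume rx: "\<bar>r x\<bar> \<le> 1"
      have 1: "r x * G (x $ i) * \<eta> (s - x $ i) - G s * (r x * \<eta> (s - x $ i)) = r x * ((G (x $ i) - G s) * \<eta> (s - x $ i))"
        by (simp add: algebra_simps)
      have "\<bar>(G (x $ i) - G s) * \<eta> (s - x $ i)\<bar> \<le> (K * \<epsilon>) * \<eta> (s - x $ i)"
      proof (cases "\<eta> (s - x $ i) = 0")
        case False
        from mollifier_lipschitz[OF moll G this] have "\<bar>G (x $ i) - G s\<bar> \<le> K * \<epsilon>" by (simp add: abs_minus_commute)
        then show ?thesis by (simp add: abs_mult eta_nn mult_right_mono)
      qed simp
      moreover have "\<bar>r x\<bar> * \<bar>(G (x $ i) - G s) * \<eta> (s - x $ i)\<bar> \<le> 1 * \<bar>(G (x $ i) - G s) * \<eta> (s - x $ i)\<bar>"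
        using rx by (intro mult_right_mono) auto
      ultimately show "\<bar>r x * G (x $ i) * \<eta> (s - x $ i) - G s * (r x * \<eta> (s - x $ i))\<bar> \<le> (K * \<epsilon>) * \<eta> (s - x $ i)"
        unfolding 1 abs_mult by linarith
    qed
  qed (use i1 i2 integrable_torus_continuous[OF kernel_cont[OF eta_cont]] in auto)
  also have "\<dots> = K * \<epsilon> * (L ^ CARD('n) / L)" by (simp add: eta_integral)
  finally have "L / L ^ CARD('n) * \<bar>(LINT x|torus L. r x * G (x $ i) * \<eta> (s - x $ i)) - G s * (LINT x|torus L. r x * \<eta> (s - x $ i))\<bar>
      \<le> L / L ^ CARD('n) * (K * \<epsilon> * (L ^ CARD('n) / L))"
    unfolding e using L by (intro mult_left_mono) auto
  then have "\<bar>L / L ^ CARD('n) * ((LINT x|torus L. r x * G (x $ i) * \<eta> (s - x $ i)) - G s * (LINT x|torus L. r x * \<eta> (s - x $ i)))\<bar> \<le> K * \<epsilon>"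
    using L by (simp add: abs_mult)
  then show ?thesis unfolding conv_def by (simp add: right_diff_distrib mult.left_commute)
qed

lemma conv_eta_close:
  assumes G: "\<And>y. G (y + L) = G y" "\<And>y z. \<bar>G y - G z\<bar> \<le> K * \<bar>y - z\<bar>" "K \<ge> 0"
  shows "\<bar>conv \<eta> (\<lambda>x. G (x $ i)) s - G s\<bar> \<le> K * \<epsilon>"
  using conv_eta_commute[OF int_one _ G, of s] by (simp add: conv_eta_one)

lemma conv_eta_Jensen:
  assumes u: "continuous_on UNIV u"
  shows "(conv \<eta> (\<lambda>z. u (z $ i)) s)\<^sup>2 \<le> conv \<eta> (\<lambda>z. (u (z $ i))\<^sup>2) s"
proof -
  let ?m = "conv \<eta> (\<lambda>z. u (z $ i)) s"
  have i1: "integrable (torus L) (\<lambda>z::real^'n. (u (z $ i))\<^sup>2 * \<eta> (s - z $ i))"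
    and i2: "integrable (torus L) (\<lambda>z::real^'n. u (z $ i) * \<eta> (s - z $ i))"
    and i3: "integrable (torus L) (\<lambda>z::real^'n. \<eta> (s - z $ i))"
    by (intro integrable_torus_continuous continuous_intros continuous_on_coordinate u kernel_cont eta_cont)+
  have "0 \<le> (LINT z|torus L. (u ((z::real^'n) $ i) - ?m)\<^sup>2 * \<eta> (s - z $ i))"
    by (intro Bochner_Integration.integral_nonneg) (simp add: eta_nn)
  also have "\<dots> = (LINT z|torus L. (u ((z::real^'n) $ i))\<^sup>2 * \<eta> (s - z $ i) - (2 * ?m) * (u (z $ i) * \<eta> (s - z $ i)) + ?m\<^sup>2 * \<eta> (s - z $ i))"
    by (intro Bochner_Integration.integral_cong refl) (simp add: power2_diff algebra_simps)
  also have "\<dots> = (LINT z|torus L. (u ((z::real^'n) $ i))\<^sup>2 * \<eta> (s - z $ i)) - (2 * ?m) * (LINT z|torus L. u ((z::real^'n) $ i) * \<eta> (s - z $ i)) + ?m\<^sup>2 * (L ^ CARD('n) / L)"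
    using i1 i2 i3 by (simp add: Bochner_Integration.integral_add Bochner_Integration.integral_diff eta_integral)
  finally have "0 \<le> L / L ^ CARD('n) * ((LINT z|torus L. (u ((z::real^'n) $ i))\<^sup>2 * \<eta> (s - z $ i)) - (2 * ?m) * (LINT z|torus L. u ((z::real^'n) $ i) * \<eta> (s - z $ i)) + ?m\<^sup>2 * (L ^ CARD('n) / L))"
    using L by (intro mult_nonneg_nonneg) auto
  also have "\<dots> = conv \<eta> (\<lambda>z. (u (z $ i))\<^sup>2) s - 2 * ?m * ?m + ?m\<^sup>2"
  proof -
    have "L / L ^ CARD('n) * (a - (2 * ?m) * b + ?m\<^sup>2 * (L ^ CARD('n) / L)) = L / L ^ CARD('n) * a - 2 * ?m * (L / L ^ CARD('n) * b) + ?m\<^sup>2" for a b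
      using L by (simp add: algebra_simps)
    then show ?thesis by (simp only: conv_def)
  qed
  finally show ?thesis by (simp add: power2_eq_square)
qed

text \<open>Here \<open>L^(d+2)/48\<close> appears; it is the square of the largest possible mixing norm.\<close>

lemma slope_inequality_torus:
  assumes d: "\<And>y. (u has_real_derivative u' y) (at y)" and c: "continuous_on UNIV u'"
    and per: "\<And>y. u (y + L) = u y" and mean: "(LINT x|torus L. u ((x::real^'n) $ i)) = 0"
    and bd: "\<And>y. \<bar>u' y\<bar> \<le> 1" and b: "0 \<le> b" "b \<le> 1"
  shows "(1 - b) * (LINT x|torus L. (u ((x::real^'n) $ i) * u' (x $ i))\<^sup>2) - b * (LINT x|torus L. (u ((x::real^'n) $ i))\<^sup>2)
    + b\<^sup>2 * (L ^ CARD('n) * L\<^sup>2 / 48) \<ge> 0"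
proof -
  have cu: "continuous_on UNIV u" using d by (meson DERIV_isCont continuous_at_imp_continuous_on)
  have per': "u' (y + L) = u' y" for y
    using DERIV_unique[OF _ d[of y]] DERIV_shift[of u "u' (y + L)" y L] d per by simp
  have m: "integral {0..L} u = 0" using torus_integral_coordinate[OF L cu per, of i] mean L by simp
  have c1: "continuous_on UNIV (\<lambda>y. (u y * u' y)\<^sup>2)" and c2: "continuous_on UNIV (\<lambda>y. (u y)\<^sup>2)"
    by (intro continuous_intros c cu)+
  have "0 \<le> L ^ CARD('n) / L * ((1 - b) * integral {0..L} (\<lambda>y. (u y * u' y)\<^sup>2) - b * integral {0..L} (\<lambda>y. (u y)\<^sup>2) + b\<^sup>2 * L ^ 3 / 48)"
    using L weighted_slope_inequality[OF L d c per m bd b] by (intro mult_nonneg_nonneg) auto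
  also have "\<dots> = (1 - b) * (L ^ CARD('n) / L * integral {0..L} (\<lambda>y. (u y * u' y)\<^sup>2)) - b * (L ^ CARD('n) / L * integral {0..L} (\<lambda>y. (u y)\<^sup>2))
     + b\<^sup>2 * (L ^ CARD('n) * L\<^sup>2 / 48)"
    using L by (simp add: field_simps power2_eq_square power3_eq_cube)
  finally show ?thesis
    using torus_integral_coordinate[OF L c1, of i] torus_integral_coordinate[OF L c2, of i] per per' by simp
qed

end

text \<open>\<open>q\<close> is the smoothed slice mean of \<open>\<rho>\<close> and \<open>f\<close> its antiderivative of mean zero. Both are smoothed once more to \<open>g'\<close> and \<open>g\<close>,
  since the time derivative of \<open>Z\<close>, the square integral of \<open>f\<close>, is a flux paired with \<open>g\<close>.\<close>

locale profile = smoothing L \<epsilon> i \<eta> \<Lambda> for L \<epsilon> :: real and i :: "'n::finite" and \<eta> \<Lambda> +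
  fixes \<rho> :: "real^'n \<Rightarrow> real"
  assumes rho: "integrable (torus L) \<rho>" and rho_bd: "AE x in torus L. \<bar>\<rho> x\<bar> \<le> 1"
    and rho_mean: "(LINT x|torus L. \<rho> x) = 0"
begin

definition f :: "real \<Rightarrow> real" where "f = conv \<Lambda> \<rho>"
definition q :: "real \<Rightarrow> real" where "q = conv \<eta> \<rho>"
definition g :: "real \<Rightarrow> real" where "g = conv \<eta> (\<lambda>z. f (z $ i))"
definition g' :: "real \<Rightarrow> real" where "g' = conv \<eta> (\<lambda>z. q (z $ i))"
definition Z :: real where "Z = (LINT x|torus L. (f ((x::real^'n) $ i))\<^sup>2)"
definition Zg :: real where "Zg = (LINT x|torus L. (g ((x::real^'n) $ i))\<^sup>2)"

lemma conv_sawtooth_derivative: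
  assumes "integrable (torus L) r" "(LINT x|torus L. r x) = 0"
  shows "(conv \<Lambda> r has_real_derivative conv \<eta> r s) (at s)"
proof -
  have "deriv \<Lambda> = (\<lambda>y. \<eta> y - 1 / L)" using Lam_deriv by (auto intro: DERIV_imp_deriv)
  then have "conv (deriv \<Lambda>) r s = conv \<eta> r s - conv (\<lambda>_. 1 / L) r s"
    using conv_diff[OF assms(1) eta_cont, of "\<lambda>_. 1 / L"] by simp
  also have "conv (\<lambda>_. 1 / L) r s = 0" using assms(2) by (simp add: conv_def)
  finally have e: "conv (deriv \<Lambda>) r s = conv \<eta> r s" by simp
  show ?thesis using conv_deriv[OF assms(1) Lam_smooth Lam_per, of s] unfolding e .
qed

lemma f_deriv: "(f has_real_derivative q s) (at s)"
  unfolding f_def q_def by (rule conv_sawtooth_derivative[OF rho rho_mean])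

lemma f_per: "f (s + L) = f s" and q_per: "q (s + L) = q s"
  unfolding f_def q_def by (rule conv_per, rule Lam_per, rule conv_per, rule eta_per)

lemma f_cont: "continuous_on UNIV f" using f_deriv by (meson DERIV_isCont continuous_at_imp_continuous_on)

lemma q_cont: "continuous_on UNIV q"
  unfolding q_def by (rule smooth_on_imp_continuous_on[OF conv_smooth[OF rho eta_smooth eta_per]])

lemma q_bd: "\<bar>q s\<bar> \<le> 1" unfolding q_def by (rule conv_eta_bound[OF rho rho_bd])

lemma f_lip: "\<bar>f y - f z\<bar> \<le> 1 * \<bar>y - z\<bar>" by (rule lipschitz_of_derivative_bound[OF f_deriv q_bd])

lemma rho_abs: "(LINT x|torus L. \<bar>\<rho> x\<bar>) \<le> L ^ CARD('n)"
proof -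
  have "(LINT x|torus L. \<bar>\<rho> x\<bar>) \<le> (LINT x|(torus L :: (real^'n) measure). 1)"
  proof (rule integral_mono_AE)
    show "integrable (torus L :: (real^'n) measure) (\<lambda>x. 1 :: real)"
      by (intro integrable_torus_continuous continuous_intros)
  qed (use rho rho_bd in auto)
  then show ?thesis using torus_integral_const[OF L, of 1, where 'n='n] by simp
qed

lemma f_bd: "\<bar>f s\<bar> \<le> L"
proof -
  have "\<bar>LINT x|torus L. \<rho> x * \<Lambda> (s - x $ i)\<bar> \<le> 1 * (LINT x|torus L. \<bar>\<rho> x\<bar>)"
    by (rule torus_integral_mult_bound[OF rho Lam_bd])
  then have "\<bar>LINT x|torus L. \<rho> x * \<Lambda> (s - x $ i)\<bar> \<le> L ^ CARD('n)" using rho_abs by simp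
  then have "L / L ^ CARD('n) * \<bar>LINT x|torus L. \<rho> x * \<Lambda> (s - x $ i)\<bar> \<le> L / L ^ CARD('n) * L ^ CARD('n)"
    using L by (intro mult_left_mono) auto
  then show ?thesis unfolding f_def conv_def using L by (simp add: abs_mult)
qed

lemma f_mean: "(LINT x|torus L. f ((x::real^'n) $ i)) = 0"
proof -
  have "(LINT x|torus L. 1 * conv \<Lambda> \<rho> ((x::real^'n) $ i)) = (-1) * (LINT z|torus L. \<rho> z * conv \<Lambda> (\<lambda>_. 1) (z $ i))"
    by (rule conv_even_adjoint[OF int_one rho Lam_cont]) (simp add: Lam_odd)
  moreover have "conv \<Lambda> (\<lambda>_. 1) s = 0" for s
  proof -
    have "(LINT x|torus L. \<Lambda> (s - (x::real^'n) $ i)) = (LINT x|torus L. - \<Lambda> ((x::real^'n) $ i - s))"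
      using Lam_odd[of "s - _"] by (intro Bochner_Integration.integral_cong refl) (metis Lam_odd minus_diff_eq)
    then show ?thesis by (simp add: conv_def Lam_mean_shift)
  qed
  ultimately show ?thesis by (simp add: f_def)
qed

lemma g_deriv: "(g has_real_derivative g' s) (at s)"
proof -
  have "(g has_real_derivative conv (deriv \<eta>) (\<lambda>z. f (z $ i)) s) (at s)"
    unfolding g_def by (rule conv_deriv[OF int_coord[OF f_cont] eta_smooth eta_per])
  also have "conv (deriv \<eta>) (\<lambda>z. f (z $ i)) s = g' s"
    unfolding g'_def
    by (rule conv_ibp[OF f_deriv q_cont f_per smooth_on_real_deriv(1)[OF eta_smooth]
        smooth_on_imp_continuous_on[OF smooth_on_real_deriv(2)[OF eta_smooth]] eta_per])
  finally show ?thesis .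
qed

lemma g_per: "g (s + L) = g s" unfolding g_def by (rule conv_per, rule eta_per)

lemma g_cont: "continuous_on UNIV g" using g_deriv by (meson DERIV_isCont continuous_at_imp_continuous_on)

lemma g'_cont: "continuous_on UNIV g'"
  unfolding g'_def by (rule smooth_on_imp_continuous_on[OF conv_smooth[OF int_coord[OF q_cont] eta_smooth eta_per]])

lemma g'_bd: "\<bar>g' s\<bar> \<le> 1"
  unfolding g'_def by (rule conv_eta_bound[OF int_coord[OF q_cont]]) (simp add: q_bd)

lemma g_bd: "\<bar>g s\<bar> \<le> L"
  unfolding g_def by (rule conv_eta_bound[OF int_coord[OF f_cont]]) (simp add: f_bd)

lemma g_lip: "\<bar>g y - g z\<bar> \<le> 1 * \<bar>y - z\<bar>" by (rule lipschitz_of_derivative_bound[OF g_deriv g'_bd])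

lemma f_g_close: "\<bar>g s - f s\<bar> \<le> \<epsilon>"
  unfolding g_def using conv_eta_close[OF f_per f_lip, of s] by simp

lemma g_mean: "(LINT x|torus L. g ((x::real^'n) $ i)) = 0"
proof -
  show ?thesis using conv_eta_adjoint[OF int_one int_coord[OF f_cont]] by (simp add: g_def conv_eta_one f_mean)
qed

lemma square_lip:
  assumes "\<bar>a\<bar> \<le> L" "\<bar>b\<bar> \<le> L" "\<bar>a - b\<bar> \<le> c"
  shows "\<bar>a\<^sup>2 - b\<^sup>2\<bar> \<le> 2 * L * c"
proof -
  have "\<bar>a\<^sup>2 - b\<^sup>2\<bar> = \<bar>a + b\<bar> * \<bar>a - b\<bar>" by (simp add: power2_eq_square abs_mult[symmetric] algebra_simps)
  also have "\<dots> \<le> (2 * L) * c" using assms by (intro mult_mono) auto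
  finally show ?thesis .
qed

lemma Zg_le_Z: "Zg \<le> Z"
proof -
  have c2: "continuous_on UNIV (\<lambda>y. (f y)\<^sup>2)" by (intro continuous_intros f_cont)
  have cc: "continuous_on UNIV (conv \<eta> (\<lambda>z. (f (z $ i))\<^sup>2))"
    by (rule smooth_on_imp_continuous_on[OF conv_smooth[OF int_coord[OF c2] eta_smooth eta_per]])
  have "Zg \<le> (LINT x|torus L. conv \<eta> (\<lambda>z. (f (z $ i))\<^sup>2) ((x::real^'n) $ i))"
    unfolding Zg_def g_def
    using int_coord[OF continuous_on_power[OF g_cont, of 2]] int_coord[OF cc]
    by (intro integral_mono conv_eta_Jensen f_cont) (auto simp: g_def)
  also have "\<dots> = Z" using conv_eta_adjoint[OF int_one int_coord[OF c2]] by (simp add: conv_eta_one Z_def)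
  finally show ?thesis .
qed

lemma Z_diff: "Z - Zg \<le> 2 * L * \<epsilon> * L ^ CARD('n)"
proof -
  have "Z - Zg = (LINT x|torus L. (f ((x::real^'n) $ i))\<^sup>2 - (g (x $ i))\<^sup>2)"
    unfolding Z_def Zg_def
    by (intro Bochner_Integration.integral_diff[symmetric] integrable_torus_continuous continuous_intros
        continuous_on_coordinate f_cont g_cont)
  also have "\<dots> \<le> (LINT x|(torus L :: (real^'n) measure). 2 * L * \<epsilon>)"
  proof (rule integral_mono)
    show "(f (x $ i))\<^sup>2 - (g (x $ i))\<^sup>2 \<le> 2 * L * \<epsilon>" for x :: "real^'n"
      using square_lip[OF f_bd[of "x $ i"] g_bd[of "x $ i"], of \<epsilon>] f_g_close[of "x $ i"] by (simp add: abs_minus_commute)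
  qed (intro integrable_torus_continuous continuous_intros continuous_on_coordinate f_cont g_cont)+
  also have "\<dots> = L ^ CARD('n) * (2 * L * \<epsilon>)" by (rule torus_integral_const[OF L])
  finally show ?thesis by (simp add: mult_ac)
qed

lemma f_slope: "0 \<le> b \<Longrightarrow> b \<le> 1 \<Longrightarrow>
   (1 - b) * (LINT x|torus L. (f ((x::real^'n) $ i) * q (x $ i))\<^sup>2) - b * Z + b\<^sup>2 * (L ^ CARD('n) * L\<^sup>2 / 48) \<ge> 0"
  unfolding Z_def by (rule slope_inequality_torus[OF f_deriv q_cont f_per f_mean q_bd])

lemma g_slope: "0 \<le> b \<Longrightarrow> b \<le> 1 \<Longrightarrow>
   (1 - b) * (LINT x|torus L. (g ((x::real^'n) $ i) * g' (x $ i))\<^sup>2) - b * Zg + b\<^sup>2 * (L ^ CARD('n) * L\<^sup>2 / 48) \<ge> 0"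
  unfolding Zg_def by (rule slope_inequality_torus[OF g_deriv g'_cont g_per g_mean g'_bd])

lemma Z_le: "Z \<le> L ^ CARD('n) * L\<^sup>2 / 48"
  using f_slope[of 1] by simp

lemma Z_nonneg: "0 \<le> Z" and Zg_nonneg: "0 \<le> Zg"
  unfolding Z_def Zg_def by simp_all

text \<open>Without smoothing, \<open>g'\<close> would be the slice mean of \<open>\<rho>\<close>, and expanding the square together with \<open>\<bar>\<rho>\<bar> \<le> 1\<close> would give
  the bound with no error term. With smoothing, both the mixed term and the square of \<open>g'\<close> are compared with the
  integral of \<open>q^2 g^2\<close>, using that mollification almost commutes with the Lipschitz function \<open>g^2\<close>.\<close>

lemma oscillation_bound:
  "(LINT x|torus L. ((\<rho> x - g' (x $ i)) * g (x $ i))\<^sup>2)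
    \<le> Zg - (LINT x|torus L. (g ((x::real^'n) $ i) * g' (x $ i))\<^sup>2) + 8 * L * \<epsilon> * L ^ CARD('n)"
proof -
  let ?e = "2 * L * \<epsilon>"
  let ?V = "L ^ CARD('n)"
  let ?J = "LINT x|torus L. (q ((x::real^'n) $ i))\<^sup>2 * (g (x $ i))\<^sup>2"
  have lip2: "\<bar>(g y)\<^sup>2 - (g z)\<^sup>2\<bar> \<le> 2 * L * \<bar>y - z\<bar>" for y z
    using square_lip[OF g_bd g_bd, of y z] g_lip[of y z] by simp
  have per2: "(g (y + L))\<^sup>2 = (g y)\<^sup>2" for y by (simp add: g_per)
  have L2: "2 * L \<ge> 0" using L by simp
  have cg2: "continuous_on UNIV (\<lambda>y. (g y)\<^sup>2)" and cq2: "continuous_on UNIV (\<lambda>y. (q y)\<^sup>2)"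
    by (intro continuous_intros g_cont q_cont)+
  have rg: "integrable (torus L) (\<lambda>x. \<rho> x * (g (x $ i))\<^sup>2)"
    by (rule integrable_torus_continuous_mult[OF rho continuous_on_coordinate[OF cg2]])
  have A: "(LINT x|torus L. \<rho> x * (g (x $ i))\<^sup>2 * g' (x $ i)) \<ge> ?J - ?e * ?V"
  proof -
    have "(LINT x|torus L. \<rho> x * (g (x $ i))\<^sup>2 * g' (x $ i))
        = (LINT z|torus L. q (z $ i) * conv \<eta> (\<lambda>x. \<rho> x * (g (x $ i))\<^sup>2) (z $ i))"
      unfolding g'_def by (rule conv_eta_adjoint[OF rg int_coord[OF q_cont]])
    also have "\<dots> \<ge> (LINT z|torus L. (q ((z::real^'n) $ i))\<^sup>2 * (g (z $ i))\<^sup>2 - ?e)"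
    proof (rule integral_mono)
      fix z :: "real^'n"
      let ?c = "conv \<eta> (\<lambda>x. \<rho> x * (g (x $ i))\<^sup>2) (z $ i)"
      have "\<bar>?c - (g (z $ i))\<^sup>2 * q (z $ i)\<bar> \<le> ?e"
        unfolding q_def by (rule conv_eta_commute[OF rho rho_bd per2 lip2 L2])
      then have "\<bar>q (z $ i)\<bar> * \<bar>?c - (g (z $ i))\<^sup>2 * q (z $ i)\<bar> \<le> 1 * ?e"
        using q_bd by (intro mult_mono) auto
      then have "\<bar>q (z $ i) * ?c - (q (z $ i))\<^sup>2 * (g (z $ i))\<^sup>2\<bar> \<le> ?e"
        by (simp add: abs_mult[symmetric] algebra_simps power2_eq_square)
      then show "(q (z $ i))\<^sup>2 * (g (z $ i))\<^sup>2 - ?e \<le> q (z $ i) * ?c" by linarith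
    next
      have "continuous_on UNIV (conv \<eta> (\<lambda>x. \<rho> x * (g (x $ i))\<^sup>2))"
        by (rule smooth_on_imp_continuous_on[OF conv_smooth[OF rg eta_smooth eta_per]])
      then show "integrable (torus L) (\<lambda>z::real^'n. q (z $ i) * conv \<eta> (\<lambda>x. \<rho> x * (g (x $ i))\<^sup>2) (z $ i))"
        by (intro integrable_torus_continuous continuous_intros continuous_on_coordinate q_cont)
    qed (intro integrable_torus_continuous continuous_intros continuous_on_coordinate q_cont g_cont)
    also have "(LINT z|torus L. (q ((z::real^'n) $ i))\<^sup>2 * (g (z $ i))\<^sup>2 - ?e) = ?J - ?V * ?e"
      using torus_integral_const[OF L, of ?e, where 'n='n]
      by (subst Bochner_Integration.integral_diff)
        (auto intro!: integrable_torus_continuous continuous_intros continuous_on_coordinate q_cont g_cont)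
    finally show ?thesis by (simp add: mult.commute)
  qed
  have B: "(LINT x|torus L. (g' ((x::real^'n) $ i))\<^sup>2 * (g (x $ i))\<^sup>2) \<le> ?J + ?e * ?V"
  proof -
    have cc: "continuous_on UNIV (conv \<eta> (\<lambda>z. (q (z $ i))\<^sup>2))"
      by (rule smooth_on_imp_continuous_on[OF conv_smooth[OF int_coord[OF cq2] eta_smooth eta_per]])
    have cd: "continuous_on UNIV (conv \<eta> (\<lambda>z. (g (z $ i))\<^sup>2))"
      by (rule smooth_on_imp_continuous_on[OF conv_smooth[OF int_coord[OF cg2] eta_smooth eta_per]])
    have "(LINT x|torus L. (g' ((x::real^'n) $ i))\<^sup>2 * (g (x $ i))\<^sup>2)
        \<le> (LINT x|torus L. (g ((x::real^'n) $ i))\<^sup>2 * conv \<eta> (\<lambda>z. (q (z $ i))\<^sup>2) (x $ i))"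
    proof (rule integral_mono)
      fix x :: "real^'n"
      show "(g' (x $ i))\<^sup>2 * (g (x $ i))\<^sup>2 \<le> (g (x $ i))\<^sup>2 * conv \<eta> (\<lambda>z. (q (z $ i))\<^sup>2) (x $ i)"
        using mult_left_mono[OF conv_eta_Jensen[OF q_cont, of "x $ i"], of "(g (x $ i))\<^sup>2"]
        by (simp add: g'_def mult.commute)
    qed (intro integrable_torus_continuous continuous_intros continuous_on_coordinate g'_cont g_cont cc)+
    also have "\<dots> = (LINT z|torus L. (q ((z::real^'n) $ i))\<^sup>2 * conv \<eta> (\<lambda>x. (g (x $ i))\<^sup>2) (z $ i))"
      by (rule conv_eta_adjoint[OF int_coord[OF cg2] int_coord[OF cq2]])
    also have "\<dots> \<le> (LINT z|torus L. (q ((z::real^'n) $ i))\<^sup>2 * (g (z $ i))\<^sup>2 + ?e)"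
    proof (rule integral_mono)
      fix z :: "real^'n"
      have "conv \<eta> (\<lambda>x. (g (x $ i))\<^sup>2) (z $ i) \<le> (g (z $ i))\<^sup>2 + ?e"
        using conv_eta_close[OF per2 lip2 L2, of "z $ i"] by linarith
      then have "(q (z $ i))\<^sup>2 * conv \<eta> (\<lambda>x. (g (x $ i))\<^sup>2) (z $ i) \<le> (q (z $ i))\<^sup>2 * ((g (z $ i))\<^sup>2 + ?e)"
        by (intro mult_left_mono) auto
      also have "\<dots> \<le> (q (z $ i))\<^sup>2 * (g (z $ i))\<^sup>2 + 1 * ?e"
        unfolding distrib_left using q_bd[of "z $ i"] L eps_nonneg
        by (intro add_left_mono mult_right_mono) (auto simp: abs_square_le_1)
      finally show "(q (z $ i))\<^sup>2 * conv \<eta> (\<lambda>x. (g (x $ i))\<^sup>2) (z $ i) \<le> (q (z $ i))\<^sup>2 * (g (z $ i))\<^sup>2 + ?e" by simp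
    qed (intro integrable_torus_continuous continuous_intros continuous_on_coordinate q_cont g_cont cd)+
    also have "\<dots> = ?J + ?V * ?e"
      using torus_integral_const[OF L, of ?e, where 'n='n]
      by (subst Bochner_Integration.integral_add)
        (auto intro!: integrable_torus_continuous continuous_intros continuous_on_coordinate q_cont g_cont)
    finally show ?thesis by (simp add: mult.commute)
  qed
  have i1: "integrable (torus L) (\<lambda>x::real^'n. (g (x $ i))\<^sup>2)"
    and i3: "integrable (torus L) (\<lambda>x::real^'n. (g' (x $ i))\<^sup>2 * (g (x $ i))\<^sup>2)"
    by (intro integrable_torus_continuous continuous_intros continuous_on_coordinate g'_cont g_cont)+
  have i2: "integrable (torus L) (\<lambda>x. \<rho> x * (g (x $ i))\<^sup>2 * g' (x $ i))"
    by (rule integrable_torus_continuous_mult[OF rg continuous_on_coordinate[OF g'_cont]])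
  let ?R = "\<lambda>x. (g (x $ i))\<^sup>2 - 2 * (\<rho> x * (g (x $ i))\<^sup>2 * g' (x $ i)) + (g' (x $ i))\<^sup>2 * (g (x $ i))\<^sup>2"
  have iR: "integrable (torus L) ?R" using i1 i2 i3 by (intro Bochner_Integration.integrable_add Bochner_Integration.integrable_diff) auto
  have "(LINT x|torus L. ((\<rho> x - g' (x $ i)) * g (x $ i))\<^sup>2) \<le> (LINT x|torus L. ?R x)"
  proof (rule integral_mono_AE'[OF iR])
    show le: "AE x in torus L. ((\<rho> x - g' (x $ i)) * g (x $ i))\<^sup>2 \<le> ?R x"
      using rho_bd
    proof eventually_elim
      fix x :: "real^'n" assume "\<bar>\<rho> x\<bar> \<le> 1"
      then have "(\<rho> x)\<^sup>2 * (g (x $ i))\<^sup>2 \<le> 1 * (g (x $ i))\<^sup>2"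
        by (intro mult_right_mono) (auto simp: abs_square_le_1)
      then show "((\<rho> x - g' (x $ i)) * g (x $ i))\<^sup>2 \<le> ?R x"
        by (simp add: power2_eq_square algebra_simps)
    qed
    show "AE x in torus L. 0 \<le> ?R x"
      using le by eventually_elim (meson order_trans zero_le_power2)
  qed
  also have "(LINT x|torus L. ?R x) = Zg - 2 * (LINT x|torus L. \<rho> x * (g (x $ i))\<^sup>2 * g' (x $ i)) + (LINT x|torus L. (g' ((x::real^'n) $ i))\<^sup>2 * (g (x $ i))\<^sup>2)"
    unfolding Zg_def using i1 i2 i3 by (simp add: Bochner_Integration.integral_add Bochner_Integration.integral_diff)
  also have "(LINT x|torus L. (g' ((x::real^'n) $ i))\<^sup>2 * (g (x $ i))\<^sup>2) = (LINT x|torus L. (g ((x::real^'n) $ i) * g' (x $ i))\<^sup>2)"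
    by (simp add: power_mult_distrib mult.commute)
  finally show ?thesis using A B by (simp add: power_mult_distrib mult.commute algebra_simps)
qed

text \<open>Testing with \<open>\<Psi>(x_i)\<close> turns the profile energy into a pairing with \<open>\<rho>\<close>, because \<open>\<Lambda>\<close> is an odd kernel.\<close>

definition \<Psi> :: "real \<Rightarrow> real" where "\<Psi> = conv \<Lambda> (\<lambda>z. f (z $ i))"

lemma Psi_deriv: "(\<Psi> has_real_derivative g s) (at s)"
  unfolding \<Psi>_def g_def by (rule conv_sawtooth_derivative[OF int_coord[OF f_cont] f_mean])

lemma Psi_smooth: "smooth_on UNIV \<Psi>"
  unfolding \<Psi>_def by (rule conv_smooth[OF int_coord[OF f_cont] Lam_smooth Lam_per])

lemma Psi_per: "\<Psi> (s + L) = \<Psi> s"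
  unfolding \<Psi>_def by (rule conv_per, rule Lam_per)

lemma rho_Psi: "(LINT x|torus L. \<rho> x * \<Psi> (x $ i)) = - Z"
proof -
  have "(LINT x|torus L. \<rho> x * conv \<Lambda> (\<lambda>z. f (z $ i)) (x $ i)) = (-1) * (LINT z|torus L. f (z $ i) * conv \<Lambda> \<rho> (z $ i))"
    by (rule conv_even_adjoint[OF rho int_coord[OF f_cont] Lam_cont]) (simp add: Lam_odd)
  then show ?thesis by (simp add: \<Psi>_def Z_def f_def power2_eq_square)
qed

text \<open>The kernel is the derivative of \<open>\<Lambda>\<close>. Its even part is moved to \<open>f\<close>, and the constant drops out because \<open>f\<close> has mean zero.\<close>

lemma flux_adjoint:
  assumes w: "integrable (torus L) w"
  shows "(LINT z|torus L. f (z $ i) * conv (\<lambda>y. \<eta> y - 1 / L) w (z $ i)) = (LINT x|torus L. w x * g (x $ i))"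
proof -
  have c: "conv (\<lambda>y. \<eta> y - 1 / L) w s = conv \<eta> w s - conv (\<lambda>_. 1 / L) w 0" for s
    using conv_diff[OF w eta_cont, of "\<lambda>_. 1 / L" s] by (simp add: conv_def)
  have i1: "integrable (torus L) (\<lambda>z::real^'n. f (z $ i) * conv \<eta> w (z $ i))"
    by (intro integrable_torus_continuous continuous_intros continuous_on_coordinate f_cont
        smooth_on_imp_continuous_on[OF conv_smooth[OF w eta_smooth eta_per]])
  have i2: "integrable (torus L) (\<lambda>z::real^'n. f (z $ i) * conv (\<lambda>_. 1 / L) w 0)"
    using int_coord[OF f_cont] by simp
  have "(LINT z|torus L. f (z $ i) * conv (\<lambda>y. \<eta> y - 1 / L) w (z $ i))
     = (LINT z|torus L. f (z $ i) * conv \<eta> w (z $ i)) - (LINT z|torus L. f ((z::real^'n) $ i) * conv (\<lambda>_. 1 / L) w 0)"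
    unfolding c right_diff_distrib by (rule Bochner_Integration.integral_diff[OF i1 i2])
  also have "\<dots> = (LINT x|torus L. w x * g (x $ i))"
    using conv_eta_adjoint[OF int_coord[OF f_cont] w] f_mean by (simp add: g_def)
  finally show ?thesis .
qed

end

section \<open>The profile bounds the negative Sobolev norm from below\<close>

lemma measurable_torus: "f \<in> borel_measurable lebesgue \<Longrightarrow> f \<in> borel_measurable (torus L)"
  by (rule measurable_restrict_space1)

lemma torus_L2_integrable:
  fixes f :: "real^'n \<Rightarrow> 'b::euclidean_space"
  assumes "torus_L2 L f"
  shows "integrable (torus L) f"
proof (rule Bochner_Integration.integrable_bound)
  show "integrable (torus L) (\<lambda>x. 1 + (norm (f x))\<^sup>2)"
    using assms Bochner_Integration.integrable_add[OF integrable_torus_continuous[OF continuous_on_const]]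
    by (auto simp: torus_L2_def)
  show "f \<in> borel_measurable (torus L)" using assms by (auto simp: torus_L2_def intro: measurable_torus)
  show "AE x in torus L. norm (f x) \<le> norm (1 + (norm (f x))\<^sup>2)"
  proof (rule AE_I2)
    fix x
    have "0 \<le> (norm (f x) - 1)\<^sup>2" by simp
    then have "2 * norm (f x) \<le> 1 + (norm (f x))\<^sup>2" by (simp add: power2_diff)
    moreover have "norm (f x) \<ge> 0" by simp
    ultimately have "norm (f x) \<le> 1 + (norm (f x))\<^sup>2" by linarith
    then show "norm (f x) \<le> norm (1 + (norm (f x))\<^sup>2)" by simp
  qed
qed

lemma integrable_mult_square:
  fixes a b :: "'a \<Rightarrow> real"
  assumes "a \<in> borel_measurable M" "b \<in> borel_measurable M"
    "integrable M (\<lambda>x. (a x)\<^sup>2)" "integrable M (\<lambda>x. (b x)\<^sup>2)"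
  shows "integrable M (\<lambda>x. a x * b x)"
proof (rule Bochner_Integration.integrable_bound)
  show "integrable M (\<lambda>x. (a x)\<^sup>2 + (b x)\<^sup>2)" using assms by simp
  show "AE x in M. norm (a x * b x) \<le> norm ((a x)\<^sup>2 + (b x)\<^sup>2)"
  proof (rule AE_I2)
    fix x
    have "0 \<le> (\<bar>a x\<bar> - \<bar>b x\<bar>)\<^sup>2" by simp
    then have "2 * \<bar>a x * b x\<bar> \<le> (a x)\<^sup>2 + (b x)\<^sup>2" by (simp add: power2_diff abs_mult)
    then show "norm (a x * b x) \<le> norm ((a x)\<^sup>2 + (b x)\<^sup>2)" by simp
  qed
qed (use assms in measurable)

lemma Cauchy_Schwarz_integral:
  fixes a b :: "'a \<Rightarrow> real"
  assumes m: "a \<in> borel_measurable M" "b \<in> borel_measurable M"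
    and i: "integrable M (\<lambda>x. (a x)\<^sup>2)" "integrable M (\<lambda>x. (b x)\<^sup>2)"
  shows "(integral\<^sup>L M (\<lambda>x. a x * b x))\<^sup>2 \<le> integral\<^sup>L M (\<lambda>x. (a x)\<^sup>2) * integral\<^sup>L M (\<lambda>x. (b x)\<^sup>2)"
proof -
  define A B P where "A = integral\<^sup>L M (\<lambda>x. (a x)\<^sup>2)" and "B = integral\<^sup>L M (\<lambda>x. (b x)\<^sup>2)"
    and "P = integral\<^sup>L M (\<lambda>x. a x * b x)"
  note ab = integrable_mult_square[OF m i]
  have nn: "0 \<le> B" unfolding B_def by simp
  have q: "0 \<le> A - 2 * t * P + t\<^sup>2 * B" for t
  proof -
    have "0 \<le> integral\<^sup>L M (\<lambda>x. (a x - t * b x)\<^sup>2)" by simp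
    also have "\<dots> = integral\<^sup>L M (\<lambda>x. (a x)\<^sup>2 - 2 * t * (a x * b x) + t\<^sup>2 * (b x)\<^sup>2)"
      by (intro Bochner_Integration.integral_cong refl) (simp add: power2_eq_square algebra_simps)
    also have "\<dots> = A - 2 * t * P + t\<^sup>2 * B"
      using i ab by (simp add: A_def B_def P_def Bochner_Integration.integral_add Bochner_Integration.integral_diff)
    finally show ?thesis .
  qed
  show ?thesis
  proof (cases "B = 0")
    case True
    have "P = 0"
    proof (rule ccontr)
      assume "P \<noteq> 0"
      then show False using q[of "(A + 1) / (2 * P)"] True by simp
    qed
    then show ?thesis using True by (simp add: P_def[symmetric] B_def[symmetric])
  next
    case False
    then have "B > 0" using nn by simp
    then have "0 \<le> A - P\<^sup>2 / B" using q[of "P / B"] by (simp add: power2_eq_square field_simps)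
    then have "P\<^sup>2 \<le> A * B" using \<open>B > 0\<close> by (simp add: divide_le_eq)
    then show ?thesis by (simp add: A_def B_def P_def)
  qed
qed

text \<open>Together with \<open>periodic_reduce\<close> this transfers statements on the closed cell to the whole space.\<close>

lemma periodic_lattice:
  fixes f :: "real^'n \<Rightarrow> 'b"
  assumes "periodic L f"
  shows "f (x + (\<Sum>j\<in>UNIV. axis j (of_int (m j) * L))) = f x"
proof -
  have "f (x + (\<Sum>j\<in>J. axis j (of_int (m j) * L))) = f x" if "finite J" for J
    using that
  proof (induction J)
    case (insert j J)
    have "x + (\<Sum>j\<in>insert j J. axis j (of_int (m j) * L)) = (x + (\<Sum>j\<in>J. axis j (of_int (m j) * L))) + axis j (of_int (m j) * L)"
      using insert.hyps by (simp add: add_ac)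
    then show ?case using periodic_axis_multiple[OF assms] insert.IH by metis
  qed simp
  then show ?thesis by simp
qed

lemma periodic_reduce:
  fixes x :: "real^'n"
  assumes L: "L > 0"
  obtains m :: "'n \<Rightarrow> int" where "x + (\<Sum>j\<in>UNIV. axis j (of_int (m j) * L)) \<in> cell L"
proof
  define m where "m = (\<lambda>j. - \<lfloor>x $ j / L\<rfloor>)"
  have "(x + (\<Sum>j\<in>UNIV. axis j (of_int (m j) * L))) $ k = x $ k + of_int (m k) * L" for k
    by (simp add: sum_component axis_def if_distrib cong: if_cong)
  moreover have "0 \<le> x $ k + of_int (m k) * L" "x $ k + of_int (m k) * L \<le> L" for k
  proof -
    define l where "l = \<lfloor>x $ k / L\<rfloor>"
    have "of_int l \<le> x $ k / L" "x $ k / L \<le> of_int l + 1" unfolding l_def by linarith+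
    moreover have "m k = - l" by (simp add: m_def l_def)
    ultimately show "0 \<le> x $ k + of_int (m k) * L" "x $ k + of_int (m k) * L \<le> L"
      using L by (auto simp: pos_le_divide_eq pos_divide_le_eq algebra_simps)
  qed
  ultimately show "x + (\<Sum>j\<in>UNIV. axis j (of_int (m j) * L)) \<in> cell L"
    by (simp add: cell_def mem_box_cart)
qed

lemma periodic_bounded_torus:
  fixes k :: "real^'n \<Rightarrow> real"
  assumes L: "L > 0" and p: "periodic L k" and c: "continuous_on UNIV k"
  obtains B where "\<And>x. \<bar>k x\<bar> \<le> B" "B \<ge> 0"
proof -
  obtain B where B: "\<And>x. x \<in> cell L \<Longrightarrow> \<bar>k x\<bar> \<le> B" "B \<ge> 0" using continuous_bounded_on_cell[OF c] by metis
  have "\<bar>k x\<bar> \<le> B" for x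
    using periodic_reduce[OF L, of x] periodic_lattice[OF p, of x] B(1) by metis
  then show thesis using that B(2) by blast
qed

lemma periodic_has_derivative:
  fixes k :: "real^'n \<Rightarrow> 'b::real_normed_vector"
  assumes p: "periodic L k" and d: "\<And>x. (k has_derivative k' x) (at x)"
  shows "periodic L (\<lambda>x. k' x h)"
  unfolding periodic_def
proof (intro allI)
  fix x :: "real^'n" and j
  have "((\<lambda>x. x + axis j L) has_derivative (\<lambda>h. h)) (at x)" by (auto intro!: derivative_eq_intros)
  from has_derivative_compose[OF this d]
  have "((\<lambda>x. k (x + axis j L)) has_derivative k' (x + axis j L)) (at x)" by simp
  moreover have "(\<lambda>x. k (x + axis j L)) = k" using p by (auto simp: periodic_def)
  ultimately have "k' (x + axis j L) = k' x" using has_derivative_unique d by metis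
  then show "k' (x + axis j L) h = k' x h" by simp
qed

text \<open>The pairing of \<open>\<rho>\<close> with \<open>\<Psi>(x_i)\<close> is \<open>- Z\<close>, so the Poisson equation pairs \<open>G\<close> with \<open>g(x_i) e_i\<close>. Cauchy and Schwarz and
  \<open>Zg \<le> Z\<close> give the claim. This is the dual characterisation of the norm with one test function.\<close>

lemma (in profile) Z_le_poisson:
  assumes "poisson_solution L \<rho> \<phi> G"
  shows "Z \<le> (LINT x|torus L. (norm (G x))\<^sup>2)"
proof -
  have G: "torus_L2 L G" using assms by (auto simp: poisson_solution_def weak_gradient_def)
  have Gm: "G \<in> borel_measurable (torus L)" and G2: "integrable (torus L) (\<lambda>x. (norm (G x))\<^sup>2)"
    using G by (auto simp: torus_L2_def intro: measurable_torus)
  have "(\<lambda>x. G x \<bullet> axis i 1) \<in> borel_measurable (torus L)"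
    by (intro borel_measurable_inner Gm borel_measurable_const)
  then have Gim: "(\<lambda>x. G x $ i) \<in> borel_measurable (torus L)" by (simp add: inner_axis)
  have le: "(G x $ i)\<^sup>2 \<le> (norm (G x))\<^sup>2" for x
    using power_mono[OF component_le_norm_cart[of "G x" i], of 2] by simp
  have Gi2: "integrable (torus L) (\<lambda>x. (G x $ i)\<^sup>2)"
    by (rule Bochner_Integration.integrable_bound[OF G2]) (use Gim le in auto)
  have dP: "((\<lambda>x::real^'n. \<Psi> (x $ i)) has_derivative (\<lambda>h. g (x $ i) * h $ i)) (at x)" for x
    by (rule has_derivative_coordinate) (rule Psi_deriv)
  have sm: "smooth_on UNIV (\<lambda>x::real^'n. \<Psi> (x $ i))"
    by (intro smooth_on_compose_UNIV[OF _ Psi_smooth] smooth_on_linear bounded_linear_vec_nth)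
  have "periodic L (\<lambda>x::real^'n. \<Psi> (x $ i))" by (rule periodic_coordinate[of \<Psi>]) (rule Psi_per)
  then have "(LINT x|torus L. G x \<bullet> grad (\<lambda>x. \<Psi> (x $ i)) x) = - (LINT x|torus L. \<rho> x * \<Psi> (x $ i))"
    using assms sm unfolding poisson_solution_def by blast
  then have Ze: "Z = (LINT x|torus L. g (x $ i) * G x $ i)"
    using rho_Psi by (simp add: inner_grad[OF dP])
  have "Z\<^sup>2 \<le> Zg * (LINT x|torus L. (G x $ i)\<^sup>2)"
    unfolding Ze Zg_def
    by (rule Cauchy_Schwarz_integral[OF _ Gim _ Gi2])
      (intro measurable_torus_continuous integrable_torus_continuous continuous_intros continuous_on_coordinate g_cont)+
  also have "\<dots> \<le> Z * (LINT x|torus L. (norm (G x))\<^sup>2)"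
    using Zg_le_Z Z_nonneg integral_mono[OF Gi2 G2 le] by (intro mult_mono) auto
  finally have "Z * Z \<le> Z * (LINT x|torus L. (norm (G x))\<^sup>2)" by (simp add: power2_eq_square)
  then show ?thesis
    using Z_nonneg by (cases "Z = 0") (auto simp: mult_le_cancel_left)
qed

lemma (in profile) Hm1_lower_bound: "ereal (sqrt Z) \<le> Hm1_norm L \<rho>"
proof (cases "\<exists>\<phi> G. poisson_solution L \<rho> \<phi> G")
  case True
  then have "\<exists>G. \<exists>\<phi>. poisson_solution L \<rho> \<phi> G" by blast
  then have "\<exists>\<phi>. poisson_solution L \<rho> \<phi> (SOME G. \<exists>\<phi>. poisson_solution L \<rho> \<phi> G)" by (rule someI_ex)
  then have "Z \<le> (LINT x|torus L. (norm ((SOME G. \<exists>\<phi>. poisson_solution L \<rho> \<phi> G) x))\<^sup>2)" using Z_le_poisson by blast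
  then have "sqrt Z \<le> torus_L2_norm L (SOME G. \<exists>\<phi>. poisson_solution L \<rho> \<phi> G)"
    unfolding torus_L2_norm_def by simp
  then show ?thesis using True unfolding Hm1_norm_def by simp
qed (simp add: Hm1_norm_def)

subsection \<open>Uniqueness\<close>

lemma torus_L2_diff:
  fixes f g :: "real^'n \<Rightarrow> 'b::euclidean_space"
  assumes "torus_L2 L f" "torus_L2 L g"
  shows "torus_L2 L (\<lambda>x. f x - g x)"
  unfolding torus_L2_def
proof (intro conjI)
  show "periodic L (\<lambda>x. f x - g x)" using assms by (auto simp: torus_L2_def periodic_def)
  show m: "(\<lambda>x. f x - g x) \<in> borel_measurable lebesgue" using assms by (auto simp: torus_L2_def)
  show "integrable (torus L) (\<lambda>x. (norm (f x - g x))\<^sup>2)"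
  proof (rule Bochner_Integration.integrable_bound)
    show "integrable (torus L) (\<lambda>x. 2 * (norm (f x))\<^sup>2 + 2 * (norm (g x))\<^sup>2)"
      using assms by (auto simp: torus_L2_def)
    show "(\<lambda>x. (norm (f x - g x))\<^sup>2) \<in> borel_measurable (torus L)"
      using measurable_torus[OF m, of L] by measurable
    show "AE x in torus L. norm ((norm (f x - g x))\<^sup>2) \<le> norm (2 * (norm (f x))\<^sup>2 + 2 * (norm (g x))\<^sup>2)"
    proof (rule AE_I2)
      fix x
      have "(norm (f x - g x))\<^sup>2 \<le> (norm (f x) + norm (g x))\<^sup>2" by (intro power_mono norm_triangle_ineq4) auto
      also have "\<dots> \<le> 2 * (norm (f x))\<^sup>2 + 2 * (norm (g x))\<^sup>2"
        using zero_le_power2[of "norm (f x) - norm (g x)"] by (simp add: power2_diff power2_sum)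
      finally show "norm ((norm (f x - g x))\<^sup>2) \<le> norm (2 * (norm (f x))\<^sup>2 + 2 * (norm (g x))\<^sup>2)" by simp
    qed
  qed
qed

lemma integrable_scaleR_continuous:
  fixes f :: "real^'n \<Rightarrow> 'b::euclidean_space" and k :: "real^'n \<Rightarrow> real"
  assumes f: "integrable (torus L) f" and k: "continuous_on UNIV k"
  shows "integrable (torus L) (\<lambda>x. k x *\<^sub>R f x)"
proof -
  obtain B where B: "\<And>x. x \<in> cell L \<Longrightarrow> \<bar>k x\<bar> \<le> B" using continuous_bounded_on_cell[OF k] by metis
  show ?thesis
  proof (rule Bochner_Integration.integrable_bound)
    show "integrable (torus L) (\<lambda>x. B *\<^sub>R f x)" using f by simp
    show "(\<lambda>x. k x *\<^sub>R f x) \<in> borel_measurable (torus L)"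
      by (intro borel_measurable_scaleR measurable_torus_continuous k borel_measurable_integrable f)
    show "AE x in torus L. norm (k x *\<^sub>R f x) \<le> norm (B *\<^sub>R f x)"
      using B by (intro AE_I2) (force intro!: mult_right_mono)
  qed
qed

lemma grad_wave: "grad (\<lambda>x::real^'n. sin (\<kappa> \<bullet> x + \<theta>)) x = cos (\<kappa> \<bullet> x + \<theta>) *\<^sub>R \<kappa>"
proof -
  have d: "((\<lambda>x::real^'n. sin (\<kappa> \<bullet> x + \<theta>)) has_derivative (\<lambda>h. cos (\<kappa> \<bullet> x + \<theta>) * (\<kappa> \<bullet> h))) (at x)"
    by (auto intro!: derivative_eq_intros)
  show ?thesis by (simp add: vec_eq_iff inner_grad(2)[OF d] inner_axis)
qed

text \<open>All Fourier coefficients of \<open>e\<close> vanish: the weak gradient makes them parallel to the frequency vector, and the vanishing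
  divergence makes them orthogonal to it. Sign detection by trigonometric polynomials concludes.\<close>

lemma weak_gradient_divergence_free_zero:
  fixes \<phi> :: "real^'n \<Rightarrow> real" and e :: "real^'n \<Rightarrow> real^'n"
  assumes L: "L > 0" and p: "torus_L2 L \<phi>" and e: "torus_L2 L e"
    and wg: "\<And>\<psi>. periodic L \<psi> \<Longrightarrow> smooth_on UNIV \<psi> \<Longrightarrow>
        (LINT x|torus L. \<phi> x *\<^sub>R grad \<psi> x) = - (LINT x|torus L. \<psi> x *\<^sub>R e x)"
    and df: "\<And>\<psi>. periodic L \<psi> \<Longrightarrow> smooth_on UNIV \<psi> \<Longrightarrow> (LINT x|torus L. e x \<bullet> grad \<psi> x) = 0"
  shows "AE x in torus L. e x = 0"
proof -
  have ei: "integrable (torus L) e" and pi: "integrable (torus L) \<phi>"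
    using e p by (auto intro: torus_L2_integrable)
  have wave_zero: "(LINT x|torus L. sin (\<kappa> \<bullet> x + \<theta>) *\<^sub>R e x) = 0"
    if k: "\<And>i. \<exists>m::int. \<kappa> $ i = 2 * pi * of_int m / L" for \<kappa> \<theta>
  proof -
    let ?a = "LINT x|torus L. sin (\<kappa> \<bullet> x + \<theta>) *\<^sub>R e x"
    have ci: "integrable (torus L) (\<lambda>x. cos (\<kappa> \<bullet> x + \<theta>) *\<^sub>R \<phi> x)"
      by (intro integrable_scaleR_continuous pi continuous_intros)
    have "(LINT x|torus L. \<phi> x *\<^sub>R grad (\<lambda>x. sin (\<kappa> \<bullet> x + \<theta>)) x) = - ?a"
      by (rule wg[OF periodic_wave[OF L k] smooth_on_wave])
    moreover have "(LINT x|torus L. \<phi> x *\<^sub>R grad (\<lambda>x. sin (\<kappa> \<bullet> x + \<theta>)) x) = (LINT x|torus L. (cos (\<kappa> \<bullet> x + \<theta>) *\<^sub>R \<phi> x) *\<^sub>R \<kappa>)"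
      by (simp add: grad_wave mult.commute)
    moreover have "\<dots> = (LINT x|torus L. cos (\<kappa> \<bullet> x + \<theta>) *\<^sub>R \<phi> x) *\<^sub>R \<kappa>"
      by (rule integral_scaleR_left) (use ci in blast)
    ultimately have "- ?a = (LINT x|torus L. cos (\<kappa> \<bullet> x + \<theta>) *\<^sub>R \<phi> x) *\<^sub>R \<kappa>" by (simp only:)
    then have "?a = (- (LINT x|torus L. cos (\<kappa> \<bullet> x + \<theta>) *\<^sub>R \<phi> x)) *\<^sub>R \<kappa>"
      unfolding scaleR_minus_left by (rule minus_equation_iff[THEN iffD1, symmetric])
    then obtain c where c: "?a = c *\<^sub>R \<kappa>" by (rule that)
    have "(LINT x|torus L. e x \<bullet> grad (\<lambda>x. sin (\<kappa> \<bullet> x + (\<theta> + pi / 2))) x) = 0"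
      by (rule df[OF periodic_wave[OF L k] smooth_on_wave])
    moreover have "e x \<bullet> grad (\<lambda>x. sin (\<kappa> \<bullet> x + (\<theta> + pi / 2))) x = - ((sin (\<kappa> \<bullet> x + \<theta>) *\<^sub>R e x) \<bullet> \<kappa>)" for x
    proof -
      have "cos (\<kappa> \<bullet> x + (\<theta> + pi / 2)) = - sin (\<kappa> \<bullet> x + \<theta>)"
        using cos_add[of "\<kappa> \<bullet> x + \<theta>" "pi / 2"] by (simp add: add.assoc)
      then show ?thesis by (simp add: grad_wave)
    qed
    ultimately have "(LINT x|torus L. (sin (\<kappa> \<bullet> x + \<theta>) *\<^sub>R e x) \<bullet> \<kappa>) = 0" by simp
    moreover have "(LINT x|torus L. (sin (\<kappa> \<bullet> x + \<theta>) *\<^sub>R e x) \<bullet> \<kappa>) = ?a \<bullet> \<kappa>"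
      by (rule integral_inner_left) (intro impI integrable_scaleR_continuous ei continuous_intros)
    ultimately have "c * (\<kappa> \<bullet> \<kappa>) = 0" using c by simp
    then show ?thesis using c by auto
  qed
  have tr: "(LINT x|torus L. p x *\<^sub>R e x) = 0" if "trig L p" for p
    using that
  proof induction
    case (wave k u)
    show ?case by (rule wave_zero) (rule wave)
  next
    case (add p q)
    have "integrable (torus L) (\<lambda>x. p x *\<^sub>R e x)" "integrable (torus L) (\<lambda>x. q x *\<^sub>R e x)"
      using add.hyps by (auto intro!: integrable_scaleR_continuous ei smooth_on_imp_continuous_on trig_smooth)
    then show ?case using add.IH by (simp add: scaleR_add_left)
  next
    case (scale p c)
    have "(LINT x|torus L. (c * p x) *\<^sub>R e x) = (LINT x|torus L. c *\<^sub>R (p x *\<^sub>R e x))" by simp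
    also have "\<dots> = c *\<^sub>R (LINT x|torus L. p x *\<^sub>R e x)" by (rule integral_scaleR_right)
    finally show ?case using scale.IH by simp
  qed
  have comp: "AE x in torus L. 0 \<le> c * e x $ j" for c j
  proof (rule AE_nonneg_if_trig_nonneg[OF L])
    have lin: "bounded_linear (\<lambda>v::real^'n. c * v $ j)"
      by (intro bounded_linear_compose[OF bounded_linear_mult_right bounded_linear_vec_nth])
    show "integrable (torus L) (\<lambda>x. c * e x $ j)" by (rule integrable_bounded_linear[OF lin ei])
    fix p :: "real^'n \<Rightarrow> real" assume p: "trig L p"
    have "integrable (torus L) (\<lambda>x. p x *\<^sub>R e x)"
      by (intro integrable_scaleR_continuous ei smooth_on_imp_continuous_on trig_smooth[OF p])
    from integral_bounded_linear[OF lin this] tr[OF p]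
    have "(LINT x|torus L. c * (p x *\<^sub>R e x) $ j) = 0" by simp
    then show "0 \<le> (LINT x|torus L. (c * e x $ j) * p x)" by (auto simp: mult_ac)
  qed
  have "AE x in torus L. \<forall>j\<in>UNIV. 0 \<le> 1 * e x $ j \<and> 0 \<le> (-1) * e x $ j"
    by (intro AE_finite_allI AE_conjI comp) auto
  then show ?thesis by eventually_elim (auto simp: vec_eq_iff intro: antisym)
qed

text \<open>The norm is defined by choosing some solution; this shows that the value does not depend on the choice.\<close>

lemma poisson_solution_unique_norm:
  fixes f :: "real^'n \<Rightarrow> real"
  assumes L: "L > 0" and f: "integrable (torus L) f"
    and 1: "poisson_solution L f \<phi>1 g1" and 2: "poisson_solution L f \<phi>2 g2"
  shows "torus_L2_norm L g1 = torus_L2_norm L g2"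
proof -
  have L2: "torus_L2 L \<phi>1" "torus_L2 L g1" "torus_L2 L \<phi>2" "torus_L2 L g2"
    using 1 2 by (auto simp: poisson_solution_def weak_gradient_def)
  note int = L2[THEN torus_L2_integrable]
  have "AE x in torus L. g1 x - g2 x = 0"
  proof (rule weak_gradient_divergence_free_zero[OF L torus_L2_diff[OF L2(1,3)] torus_L2_diff[OF L2(2,4)]])
    fix \<psi> :: "real^'n \<Rightarrow> real" assume p: "periodic L \<psi>" and s: "smooth_on UNIV \<psi>"
    obtain D where D: "\<And>x. (\<psi> has_derivative D x) (at x)" "\<And>h. continuous_on UNIV (\<lambda>x. D x h)"
      using smooth_on_derivative_exists[OF s] by (metis UNIV_I)
    have cg: "continuous_on UNIV (grad \<psi>)"
      unfolding grad_def frechet_derivative_at[OF D(1), symmetric] by (intro continuous_on_vec_lambda D(2))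
    have cs: "continuous_on UNIV \<psi>" by (rule smooth_on_imp_continuous_on[OF s])
    have i: "integrable (torus L) (\<lambda>x. u x *\<^sub>R grad \<psi> x)" if "integrable (torus L) u" for u :: "real^'n \<Rightarrow> real"
    proof -
      obtain B where B: "\<And>x. x \<in> cell L \<Longrightarrow> norm (grad \<psi> x) \<le> B"
        using continuous_bounded_on_cell[OF continuous_on_norm[OF cg], of L] by (metis abs_norm_cancel)
      show ?thesis
      proof (rule Bochner_Integration.integrable_bound)
        show "integrable (torus L) (\<lambda>x. B * u x)" using that by simp
        show "(\<lambda>x. u x *\<^sub>R grad \<psi> x) \<in> borel_measurable (torus L)"
          by (intro borel_measurable_scaleR measurable_torus_continuous cg borel_measurable_integrable that)
        show "AE x in torus L. norm (u x *\<^sub>R grad \<psi> x) \<le> norm (B * u x)"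
        proof (rule AE_I2)
          fix x assume "x \<in> space (torus L :: (real^'n) measure)"
          then have "norm (grad \<psi> x) \<le> \<bar>B\<bar>" using B[of x] by force
          then show "norm (u x *\<^sub>R grad \<psi> x) \<le> norm (B * u x)"
            using mult_left_mono[of "norm (grad \<psi> x)" "\<bar>B\<bar>" "\<bar>u x\<bar>"] by (simp add: abs_mult mult.commute)
        qed
      qed
    qed
    have j: "integrable (torus L) (\<lambda>x. u x \<bullet> grad \<psi> x)" if "integrable (torus L) u" for u :: "real^'n \<Rightarrow> real^'n"
    proof -
      obtain B where B: "\<And>x. x \<in> cell L \<Longrightarrow> norm (grad \<psi> x) \<le> B"
        using continuous_bounded_on_cell[OF continuous_on_norm[OF cg], of L] by (metis abs_norm_cancel)
      show ?thesis
      proof (rule Bochner_Integration.integrable_bound)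
        show "integrable (torus L) (\<lambda>x. B * norm (u x))" using that by simp
        show "(\<lambda>x. u x \<bullet> grad \<psi> x) \<in> borel_measurable (torus L)"
          by (intro borel_measurable_inner measurable_torus_continuous cg borel_measurable_integrable that)
        show "AE x in torus L. norm (u x \<bullet> grad \<psi> x) \<le> norm (B * norm (u x))"
        proof (rule AE_I2)
          fix x assume "x \<in> space (torus L :: (real^'n) measure)"
          then have "norm (grad \<psi> x) \<le> \<bar>B\<bar>" using B[of x] by force
          then have "norm (u x) * norm (grad \<psi> x) \<le> norm (u x) * \<bar>B\<bar>" by (intro mult_left_mono) auto
          then show "norm (u x \<bullet> grad \<psi> x) \<le> norm (B * norm (u x))"
            using Cauchy_Schwarz_ineq2[of "u x" "grad \<psi> x"] by (simp add: abs_mult mult.commute)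
        qed
      qed
    qed
    have w1: "(LINT x|torus L. \<phi>1 x *\<^sub>R grad \<psi> x) = - (LINT x|torus L. \<psi> x *\<^sub>R g1 x)"
      and w2: "(LINT x|torus L. \<phi>2 x *\<^sub>R grad \<psi> x) = - (LINT x|torus L. \<psi> x *\<^sub>R g2 x)"
      using 1 2 p s unfolding poisson_solution_def weak_gradient_def by blast+
    have v1: "(LINT x|torus L. g1 x \<bullet> grad \<psi> x) = - (LINT x|torus L. f x * \<psi> x)"
      and v2: "(LINT x|torus L. g2 x \<bullet> grad \<psi> x) = - (LINT x|torus L. f x * \<psi> x)"
      using 1 2 p s unfolding poisson_solution_def by blast+
    show "(LINT x|torus L. (\<phi>1 x - \<phi>2 x) *\<^sub>R grad \<psi> x) = - (LINT x|torus L. \<psi> x *\<^sub>R (g1 x - g2 x))"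
      unfolding scaleR_diff_left scaleR_diff_right
      using Bochner_Integration.integral_diff[OF i[OF int(1)] i[OF int(3)]] w1 w2
        Bochner_Integration.integral_diff[OF integrable_scaleR_continuous[OF int(2) cs] integrable_scaleR_continuous[OF int(4) cs]]
      by simp
    show "(LINT x|torus L. (g1 x - g2 x) \<bullet> grad \<psi> x) = 0"
      unfolding inner_diff_left using Bochner_Integration.integral_diff[OF j[OF int(2)] j[OF int(4)]] v1 v2 by simp
  qed
  then have "AE x in torus L. (norm (g1 x))\<^sup>2 = (norm (g2 x))\<^sup>2" by eventually_elim simp
  then have "(LINT x|torus L. (norm (g1 x))\<^sup>2) = (LINT x|torus L. (norm (g2 x))\<^sup>2)"
    using L2 by (intro integral_cong_AE) (auto simp: torus_L2_def)
  then show ?thesis by (simp add: torus_L2_norm_def)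
qed

section \<open>The norm of data depending on one coordinate\<close>

lemma periodic_mult: "periodic L f \<Longrightarrow> periodic L g \<Longrightarrow> periodic L (\<lambda>x. f x * g x)"
  by (simp add: periodic_def)

text \<open>A density depending on one coordinate, with kernels of width tending to zero. Property \<open>lin\<close> says that the kernels
  converge to the exact sawtooth.\<close>

locale initial_profile =
  fixes L :: real and i :: "'n::finite" and \<epsilon> :: "nat \<Rightarrow> real" and \<eta> \<Lambda> :: "nat \<Rightarrow> real \<Rightarrow> real"
    and \<rho> :: "real^'n \<Rightarrow> real" and \<gamma> :: "real \<Rightarrow> real"
  assumes P: "\<And>n. profile L (\<epsilon> n) (\<eta> n) (\<Lambda> n) \<rho>"
    and eps: "\<epsilon> \<longlonglongrightarrow> 0"
    and lin: "\<And>n y. \<epsilon> n < y \<Longrightarrow> y < L - \<epsilon> n \<Longrightarrow> \<Lambda> n y = 1 / 2 - y / L"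
    and per: "periodic L \<rho>" and dep: "AE x in lebesgue. \<rho> x = \<gamma> (x $ i)"
begin

lemma S: "smoothing L (\<epsilon> n) (\<eta> n) (\<Lambda> n)" using P unfolding profile_def by blast

lemma L: "L > 0" by (rule smoothing.L[OF S])

lemma rho: "integrable (torus L) \<rho>" by (rule profile.rho[OF P])

abbreviation F :: "nat \<Rightarrow> real \<Rightarrow> real" where "F n \<equiv> profile.f L i (\<Lambda> n) \<rho>"
abbreviation Q :: "nat \<Rightarrow> real \<Rightarrow> real" where "Q n \<equiv> profile.q L i (\<eta> n) \<rho>"

lemma Lam_convergent: "convergent (\<lambda>n. \<Lambda> n y)"
proof -
  define m where "m = \<lfloor>y / L\<rfloor>"
  define z where "z = y - of_int m * L"
  have m: "of_int m \<le> y / L" "y / L < of_int m + 1" unfolding m_def by linarith+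
  have z: "0 \<le> z" "z < L"
    using m L by (auto simp: z_def pos_le_divide_eq pos_divide_less_eq algebra_simps)
  have yz: "\<Lambda> n y = \<Lambda> n z" for n
    using periodic_int_multiple[of "\<Lambda> n" L z m] smoothing.Lam_per[OF S] by (simp add: z_def)
  show ?thesis
  proof (cases "z = 0")
    case True
    have "\<Lambda> n y = 0" for n using smoothing.Lam_odd[OF S, of n 0] yz[of n] True by simp
    then show ?thesis by (simp add: convergent_const)
  next
    case False
    have "0 < min z (L - z)" using z False by simp
    then have "eventually (\<lambda>n. \<epsilon> n < min z (L - z)) sequentially"
      by (rule order_tendstoD(2)[OF eps])
    then have "eventually (\<lambda>n. \<Lambda> n y = 1 / 2 - z / L) sequentially"
      by eventually_elim (use lin yz in auto)
    then have "(\<lambda>n. \<Lambda> n y) \<longlonglongrightarrow> 1 / 2 - z / L" by (rule tendsto_eventually)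
    then show ?thesis by (rule convergentI)
  qed
qed

definition \<Lambda>0 :: "real \<Rightarrow> real" where "\<Lambda>0 y = lim (\<lambda>n. \<Lambda> n y)"
definition F0 :: "real \<Rightarrow> real" where "F0 s = L / L ^ CARD('n) * (LINT x|torus L. \<rho> x * \<Lambda>0 (s - x $ i))"

lemma Lam_lim: "(\<lambda>n. \<Lambda> n y) \<longlonglongrightarrow> \<Lambda>0 y"
  unfolding \<Lambda>0_def using Lam_convergent convergent_LIMSEQ_iff by blast

lemma F_lim: "(\<lambda>n. F n s) \<longlonglongrightarrow> F0 s"
  unfolding profile.f_def[OF P] smoothing.conv_def[OF S] F0_def
proof (intro tendsto_mult tendsto_const integral_dominated_convergence[where w="\<lambda>x. \<bar>\<rho> x\<bar>"])
  have m: "(\<lambda>x. \<rho> x * \<Lambda> n (s - x $ i)) \<in> borel_measurable (torus L)" for n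
    by (rule borel_measurable_integrable[OF smoothing.conv_int[OF S rho smoothing.Lam_cont[OF S]]])
  then show "(\<lambda>x. \<rho> x * \<Lambda> n (s - x $ i)) \<in> borel_measurable (torus L)" for n .
  show "(\<lambda>x. \<rho> x * \<Lambda>0 (s - x $ i)) \<in> borel_measurable (torus L)"
    by (rule borel_measurable_LIMSEQ_real[of _ "\<lambda>n x. \<rho> x * \<Lambda> n (s - x $ i)", OF _ m]) (intro tendsto_mult tendsto_const Lam_lim)
  show "AE x in torus L. (\<lambda>n. \<rho> x * \<Lambda> n (s - x $ i)) \<longlonglongrightarrow> \<rho> x * \<Lambda>0 (s - x $ i)"
    by (intro AE_I2 tendsto_mult tendsto_const Lam_lim)
  show "AE x in torus L. norm (\<rho> x * \<Lambda> n (s - x $ i)) \<le> \<bar>\<rho> x\<bar>" for n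
    by (rule AE_I2) (simp add: abs_mult mult_left_le smoothing.Lam_bd[OF S])
qed (use rho in auto)

lemma F0_lip: "\<bar>F0 y - F0 z\<bar> \<le> 1 * \<bar>y - z\<bar>"
proof (rule LIMSEQ_le_const2)
  show "(\<lambda>n. \<bar>F n y - F n z\<bar>) \<longlonglongrightarrow> \<bar>F0 y - F0 z\<bar>" by (intro tendsto_intros F_lim)
  show "\<exists>N. \<forall>n\<ge>N. \<bar>F n y - F n z\<bar> \<le> 1 * \<bar>y - z\<bar>" using profile.f_lip[OF P] by blast
qed

lemma F0_cont: "continuous_on UNIV F0" by (rule continuous_on_lipschitz_real[OF F0_lip])

lemma F0_per: "F0 (y + L) = F0 y"
  using LIMSEQ_unique[OF F_lim[of "y + L"]] F_lim[of y] by (simp add: profile.f_per[OF P])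

lemma F_integral_lim:
  assumes k: "continuous_on UNIV k"
  shows "(\<lambda>n. LINT x|torus L. F n ((x::real^'n) $ i) ^ p * k x) \<longlonglongrightarrow> (LINT x|torus L. F0 (x $ i) ^ p * k x)"
proof (rule integral_dominated_convergence[where w="\<lambda>x. L ^ p * \<bar>k x\<bar>"])
  show "(\<lambda>x. F0 (x $ i) ^ p * k x) \<in> borel_measurable (torus L)"
    by (intro measurable_torus_continuous continuous_intros k continuous_on_coordinate F0_cont)
  show "(\<lambda>x. F n (x $ i) ^ p * k x) \<in> borel_measurable (torus L)" for n
    by (intro measurable_torus_continuous continuous_intros k continuous_on_coordinate profile.f_cont[OF P])
  show "integrable (torus L) (\<lambda>x. L ^ p * \<bar>k x\<bar>)"
    by (intro integrable_torus_continuous continuous_intros k)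
  show "AE x in torus L. (\<lambda>n. F n (x $ i) ^ p * k x) \<longlonglongrightarrow> F0 (x $ i) ^ p * k x"
    by (intro AE_I2 tendsto_intros F_lim)
  show "AE x in torus L. norm (F n (x $ i) ^ p * k x) \<le> L ^ p * \<bar>k x\<bar>" for n
    by (rule AE_I2) (auto simp: abs_mult power_abs intro!: mult_right_mono power_mono profile.f_bd[OF P])
qed

lemma Z_lim: "(\<lambda>n. profile.Z L i (\<Lambda> n) \<rho>) \<longlonglongrightarrow> (LINT x|torus L. (F0 ((x::real^'n) $ i))\<^sup>2)"
  using F_integral_lim[of "\<lambda>_. 1" 2] by (simp add: profile.Z_def[OF P])

lemma F0_mean: "(LINT x|torus L. F0 ((x::real^'n) $ i)) = 0"
  using F_integral_lim[of "\<lambda>_. 1" 1] by (simp add: profile.f_mean[OF P] LIMSEQ_const_iff)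

text \<open>Translations orthogonal to the direction \<open>i\<close> leave \<open>\<rho>\<close> unchanged almost everywhere.\<close>

lemma transversal_invariance:
  fixes \<psi> :: "real^'n \<Rightarrow> real"
  assumes c: "continuous_on UNIV \<psi>" and p: "periodic L \<psi>"
  shows "(LINT z|torus L. \<rho> z * \<psi> (z + x)) = (LINT z|torus L. \<rho> z * \<psi> (z + axis i (x $ i)))"
proof -
  define w where "w = axis i (x $ i) - x"
  have c': "continuous_on UNIV (\<lambda>z. \<psi> (z + y))" for y
    by (rule continuous_on_compose2[OF c]) (auto intro!: continuous_intros)
  have int: "integrable (torus L) (\<lambda>z. \<rho> z * \<psi> (z + y))" for y
    by (rule integrable_torus_continuous_mult[OF rho c'])
  have pH: "periodic L (\<lambda>z. \<rho> z * \<psi> (z + x))"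
    using per periodic_shift[OF p, of x] by (simp add: periodic_def)
  note tr = torus_integral_translate[OF L pH int, of w]
  have e: "z + w + x = z + axis i (x $ i)" for z by (simp add: w_def)
  have "AE z in lebesgue. \<rho> (z + w) = \<gamma> ((z + w) $ i)"
  proof -
    obtain N where N: "negligible N" "{x. \<not> \<rho> x = \<gamma> (x $ i)} \<subseteq> N"
      using dep unfolding eventually_ae_filter_negligible by blast
    have "negligible ((+) (- w) ` N)" using N(1) by (rule negligible_translation)
    moreover have "{z. \<not> \<rho> (z + w) = \<gamma> ((z + w) $ i)} \<subseteq> (+) (- w) ` N"
    proof
      fix z assume "z \<in> {z. \<not> \<rho> (z + w) = \<gamma> ((z + w) $ i)}"
      then have "z + w \<in> N" using N(2) by blast
      then show "z \<in> (+) (- w) ` N" by (rule rev_image_eqI) simp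
    qed
    ultimately show ?thesis unfolding eventually_ae_filter_negligible by blast
  qed
  then have "AE z in lebesgue. \<rho> (z + w) * \<psi> (z + w + x) = \<rho> z * \<psi> (z + axis i (x $ i))"
    using dep by eventually_elim (simp add: e, simp add: w_def)
  then have "AE z in torus L. \<rho> (z + w) * \<psi> (z + w + x) = \<rho> z * \<psi> (z + axis i (x $ i))" by (rule AE_torus)
  then have "(LINT z|torus L. \<rho> (z + w) * \<psi> (z + w + x)) = (LINT z|torus L. \<rho> z * \<psi> (z + axis i (x $ i)))"
    by (intro integral_cong_AE borel_measurable_integrable int tr(1))
  then show ?thesis using tr(2) by simp
qed

text \<open>Mollification in direction \<open>i\<close> alone acts on test functions averaged against \<open>\<rho>\<close>; transversal invariance removes the
  other coordinates.\<close>

lemma Q_tested: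
  fixes \<psi> :: "real^'n \<Rightarrow> real"
  assumes c: "continuous_on UNIV \<psi>" and p: "periodic L \<psi>"
  shows "(LINT x|torus L. Q n ((x::real^'n) $ i) * \<psi> x)
    = smoothing.conv L i (\<eta> n) (\<lambda>x. (LINT z|torus L. \<rho> z * \<psi> (z + axis i (x $ i)))) 0"
proof -
  interpret profile L "\<epsilon> n" i "\<eta> n" "\<Lambda> n" \<rho> by (rule P)
  have psi: "integrable (torus L) \<psi>" by (rule integrable_torus_continuous[OF c])
  have "(LINT x|torus L. Q n ((x::real^'n) $ i) * \<psi> x) = (LINT x|torus L. \<psi> x * conv (\<eta> n) \<rho> (x $ i))"
    by (simp add: q_def mult.commute)
  also have "\<dots> = (LINT z|torus L. \<rho> z * conv (\<eta> n) \<psi> (z $ i))"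
    by (rule conv_eta_adjoint[OF psi rho])
  also have "\<dots> = (LINT z|torus L. \<rho> z * (L / L ^ CARD('n) * (LINT x|torus L. \<eta> n (x $ i) * \<psi> (z + x))))"
  proof (intro Bochner_Integration.integral_cong refl arg_cong2[where f="(*)"])
    fix z :: "real^'n"
    have pp: "periodic L (\<lambda>x::real^'n. \<psi> x * \<eta> n (z $ i - x $ i))"
      unfolding periodic_def
    proof (intro allI)
      fix x :: "real^'n" and j
      have "\<eta> n (z $ i - (x + axis j L) $ i) = \<eta> n (z $ i - x $ i)"
        using eta_per[of "z $ i - x $ i - L"] by (cases "j = i") (auto simp: axis_def diff_diff_eq)
      then show "\<psi> (x + axis j L) * \<eta> n (z $ i - (x + axis j L) $ i) = \<psi> x * \<eta> n (z $ i - x $ i)"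
        using p by (simp add: periodic_def)
    qed
    have ii: "integrable (torus L) (\<lambda>x::real^'n. \<psi> x * \<eta> n (z $ i - x $ i))"
      by (intro integrable_torus_continuous continuous_intros c kernel_cont eta_cont)
    have "(LINT x|torus L. \<psi> x * \<eta> n (z $ i - x $ i)) = (LINT x|torus L. \<psi> (x + z) * \<eta> n (z $ i - (x + z) $ i))"
      by (rule torus_integral_translate(2)[OF L pp ii, symmetric])
    also have "\<dots> = (LINT x|torus L. \<eta> n (x $ i) * \<psi> (z + x))"
      by (simp add: eta_even add.commute mult.commute)
    finally show "conv (\<eta> n) \<psi> (z $ i) = L / L ^ CARD('n) * (LINT x|torus L. \<eta> n (x $ i) * \<psi> (z + x))"
      by (simp add: conv_def)
  qed
  also have "\<dots> = L / L ^ CARD('n) * (LINT z|torus L. \<rho> z * (LINT x|torus L. \<eta> n (x $ i) * \<psi> (z + x)))"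
    by (subst integral_mult_right_zero[symmetric]) (simp add: mult_ac)
  also have "(LINT z|torus L. \<rho> z * (LINT x|torus L. \<eta> n (x $ i) * \<psi> (z + x)))
      = (LINT x|torus L. \<eta> n (x $ i) * (LINT z|torus L. \<rho> z * \<psi> (z + x)))"
  proof (rule torus_Fubini[OF rho int_coord[OF eta_cont], where k="\<lambda>z x. \<psi> (z + x)"])
    show "continuous_on UNIV (\<lambda>(z, x). \<psi> (z + x))"
      unfolding split_beta by (rule continuous_on_compose2[OF c]) (auto intro!: continuous_intros)
  qed
  also have "\<dots> = (LINT x|torus L. (LINT z|torus L. \<rho> z * \<psi> (z + axis i (x $ i))) * \<eta> n (0 - x $ i))"
  proof (intro Bochner_Integration.integral_cong refl)
    fix x :: "real^'n"
    have "\<eta> n (0 - x $ i) = \<eta> n (x $ i)" using eta_even[of "x $ i"] by simp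
    then show "\<eta> n (x $ i) * (LINT z|torus L. \<rho> z * \<psi> (z + x))
        = (LINT z|torus L. \<rho> z * \<psi> (z + axis i (x $ i))) * \<eta> n (0 - x $ i)"
      using transversal_invariance[OF c p, of x] by (simp only: mult.commute)
  qed
  finally show ?thesis by (simp add: conv_def)
qed

text \<open>The smoothed slice means recover \<open>\<rho>\<close> weakly.\<close>

lemma Q_lim:
  fixes \<psi> :: "real^'n \<Rightarrow> real"
  assumes s: "smooth_on UNIV \<psi>" and p: "periodic L \<psi>"
  shows "(\<lambda>n. LINT x|torus L. Q n ((x::real^'n) $ i) * \<psi> x) \<longlonglongrightarrow> (LINT z|torus L. \<rho> z * \<psi> z)"
proof -
  define h where "h = (\<lambda>t. LINT z|torus L. \<rho> z * \<psi> (z + axis i t))"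
  have c: "continuous_on UNIV \<psi>" by (rule smooth_on_imp_continuous_on[OF s])
  obtain D where D: "\<And>x. (\<psi> has_derivative D x) (at x)" "\<And>h. continuous_on UNIV (\<lambda>x. D x h)"
    using smooth_on_derivative_exists[OF s] by (metis UNIV_I)
  define a where "a = (axis i 1 :: real^'n)"
  have ax: "axis i r = r *\<^sub>R a" for r by (simp add: a_def vec_eq_iff axis_def)
  obtain B where B: "\<And>x. \<bar>D x a\<bar> \<le> B" "B \<ge> 0"
    using periodic_bounded_torus[OF L periodic_has_derivative[OF p D(1)] D(2)] by metis
  have lip: "\<bar>\<psi> (z + axis i s) - \<psi> (z + axis i t)\<bar> \<le> B * \<bar>s - t\<bar>" for z s t
    unfolding ax
  proof (rule lipschitz_of_derivative_bound[of "\<lambda>s. \<psi> (z + s *\<^sub>R a)" "\<lambda>s. D (z + s *\<^sub>R a) a"])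
    fix s
    have "((\<lambda>s. z + s *\<^sub>R a) has_derivative (\<lambda>h. h *\<^sub>R a)) (at s)"
      by (auto intro!: derivative_eq_intros)
    from has_derivative_compose[OF this D(1)]
    have "((\<lambda>s. \<psi> (z + s *\<^sub>R a)) has_derivative (\<lambda>h. D (z + s *\<^sub>R a) (h *\<^sub>R a))) (at s)" .
    moreover have "(\<lambda>h. D (z + s *\<^sub>R a) (h *\<^sub>R a)) = (*) (D (z + s *\<^sub>R a) a)"
      using linear_scale[OF has_derivative_linear[OF D(1)]] by (auto simp: mult.commute)
    ultimately show "((\<lambda>s. \<psi> (z + s *\<^sub>R a)) has_real_derivative D (z + s *\<^sub>R a) a) (at s)"
      by (simp add: has_field_derivative_def)
  qed (rule B)
  have c': "continuous_on UNIV (\<lambda>z. \<psi> (z + y))" for y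
    by (rule continuous_on_compose2[OF c]) (auto intro!: continuous_intros)
  have int: "integrable (torus L) (\<lambda>z. \<rho> z * \<psi> (z + y))" for y
    by (rule integrable_torus_continuous_mult[OF rho c'])
  let ?K = "B * (LINT z|torus L. \<bar>\<rho> z\<bar>)"
  have hlip: "\<bar>h s - h t\<bar> \<le> ?K * \<bar>s - t\<bar>" for s t
  proof -
    have "h s - h t = (LINT z|torus L. \<rho> z * (\<psi> (z + axis i s) - \<psi> (z + axis i t)))"
      unfolding h_def right_diff_distrib by (rule Bochner_Integration.integral_diff[OF int int, symmetric])
    moreover have "\<bar>LINT z|torus L. \<rho> z * (\<psi> (z + axis i s) - \<psi> (z + axis i t))\<bar> \<le> (B * \<bar>s - t\<bar>) * (LINT z|torus L. \<bar>\<rho> z\<bar>)"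
      by (rule torus_integral_mult_bound[OF rho lip])
    ultimately show ?thesis by (simp add: mult_ac)
  qed
  have hper: "h (t + L) = h t" for t
  proof -
    have "z + axis i (t + L) = (z + axis i t) + axis i L" for z :: "real^'n" by (simp add: vec_eq_iff axis_def)
    then show ?thesis using p unfolding h_def periodic_def by metis
  qed
  have K0: "?K \<ge> 0" using B(2) by simp
  have h0: "h 0 = (LINT z|torus L. \<rho> z * \<psi> z)"
    unfolding h_def by (simp add: axis_def zero_vec_def[symmetric])
  have close: "\<bar>(LINT x|torus L. Q n ((x::real^'n) $ i) * \<psi> x) - h 0\<bar> \<le> ?K * \<epsilon> n" for n
    using smoothing.conv_eta_close[OF S[of n] hper hlip K0, where i=i and s=0] Q_tested[OF c p, of n] by (simp add: h_def)
  have "(\<lambda>n. (LINT x|torus L. Q n ((x::real^'n) $ i) * \<psi> x) - h 0) \<longlonglongrightarrow> 0"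
  proof (rule Lim_null_comparison)
    show "\<forall>\<^sub>F n in sequentially. norm ((LINT x|torus L. Q n ((x::real^'n) $ i) * \<psi> x) - h 0) \<le> ?K * \<epsilon> n"
      using close by simp
    show "(\<lambda>n. ?K * \<epsilon> n) \<longlonglongrightarrow> 0" using tendsto_mult[OF tendsto_const eps] by fastforce
  qed
  then show ?thesis unfolding h0 by (rule LIM_zero_cancel)
qed

text \<open>The explicit solution: its potential is an antiderivative of \<open>F0\<close> in the coordinate \<open>x_i\<close>. The Poisson equation holds at each
  smoothing level with \<open>Q n\<close> on the right, and passes to the limit.\<close>

lemma poisson_exists:
  obtains \<phi> where "poisson_solution L \<rho> \<phi> (\<lambda>x. F0 (x $ i) *\<^sub>R axis i 1)"
proof -
  obtain A where A: "\<And>y. (A has_real_derivative F0 y) (at y)"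
    using continuous_antiderivative[OF F0_cont] by metis
  have cA: "continuous_on UNIV A" using A by (meson DERIV_isCont continuous_at_imp_continuous_on)
  have AL: "A L - A 0 = 0"
  proof -
    have "(F0 has_integral (A L - A 0)) {0..L}"
    proof (rule fundamental_theorem_of_calculus)
      show "(A has_vector_derivative F0 x) (at x within {0..L})" for x
        using has_field_derivative_at_within[OF A[of x]]
        by (simp add: has_real_derivative_iff_has_vector_derivative)
    qed (use L in simp)
    then have "integral {0..L} F0 = A L - A 0" by (rule integral_unique)
    then show ?thesis using torus_integral_coordinate[OF L F0_cont F0_per, of i] F0_mean L by simp
  qed
  have Aper: "A (y + L) = A y" for y
  proof -
    have d: "((\<lambda>y. A (y + L) - A y) has_real_derivative 0) (at y)" for y
    proof -
      have 1: "((\<lambda>y. A (y + L)) has_real_derivative F0 (y + L)) (at y)"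
        using DERIV_shift[of A "F0 (y + L)" y L] A by blast
      show ?thesis using DERIV_diff[OF 1 A[of y]] by (simp add: F0_per)
    qed
    show ?thesis using DERIV_isconst_all[of "\<lambda>y. A (y + L) - A y" y 0] d AL by simp
  qed
  let ?phi = "\<lambda>x::real^'n. A (x $ i)" and ?g = "\<lambda>x::real^'n. F0 (x $ i) *\<^sub>R axis i 1 :: real^'n"
  have cphi: "continuous_on UNIV ?phi" by (rule continuous_on_coordinate[OF cA])
  have cg: "continuous_on UNIV ?g" by (intro continuous_intros continuous_on_coordinate F0_cont)
  have L2: "torus_L2 L u" if "continuous_on UNIV u" "periodic L u" for u :: "real^'n \<Rightarrow> 'b::euclidean_space"
    unfolding torus_L2_def
  proof (intro conjI that)
    have "u \<in> borel_measurable borel" using that(1) by (rule borel_measurable_continuous_onI)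
    then show "u \<in> borel_measurable lebesgue" by (intro measurable_completion) simp
  qed (intro integrable_torus_continuous continuous_intros that)
  have pphi: "periodic L ?phi" by (rule periodic_coordinate[of A]) (rule Aper)
  have pg: "periodic L ?g" using periodic_coordinate[of F0, OF F0_per] by (simp add: periodic_def)
  have dphi: "(?phi has_derivative (\<lambda>h. F0 (x $ i) * h $ i)) (at x)" for x
    by (rule has_derivative_coordinate) (rule A)
  have "poisson_solution L \<rho> ?phi ?g"
    unfolding poisson_solution_def weak_gradient_def
  proof (intro conjI allI impI)
    show "torus_L2 L ?phi" by (rule L2[OF cphi pphi])
    show "torus_L2 L ?g" by (rule L2[OF cg pg])
    fix \<psi> :: "real^'n \<Rightarrow> real" assume "periodic L \<psi> \<and> smooth_on UNIV \<psi>"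
    then have p: "periodic L \<psi>" and s: "smooth_on UNIV \<psi>" by auto
    obtain D where D: "\<And>x. (\<psi> has_derivative D x) (at x)" "\<And>h. continuous_on UNIV (\<lambda>x. D x h)"
      using smooth_on_derivative_exists[OF s] by (metis UNIV_I)
    have cs: "continuous_on UNIV \<psi>" by (rule smooth_on_imp_continuous_on[OF s])
    have gr: "grad \<psi> x $ j = D x (axis j 1)" for x j by (rule inner_grad(2)[OF D(1)])
    have cgr: "continuous_on UNIV (grad \<psi>)"
      unfolding grad_def frechet_derivative_at[OF D(1), symmetric] by (intro continuous_on_vec_lambda D(2))
    show "(LINT x|torus L. ?phi x *\<^sub>R grad \<psi> x) = - (LINT x|torus L. \<psi> x *\<^sub>R ?g x)"
    proof (simp only: vec_eq_iff, intro allI)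
      fix j
      have comp: "(LINT x|torus L. u x) $ j = (LINT x|torus L. u x $ j)" if "continuous_on UNIV u" for u :: "real^'n \<Rightarrow> real^'n"
        by (rule integral_bounded_linear[OF bounded_linear_vec_nth integrable_torus_continuous[OF that], symmetric])
      let ?G' = "\<lambda>x h. ?phi x * D x h + (F0 (x $ i) * h $ i) * \<psi> x"
      have i1: "integrable (torus L) (\<lambda>x. ?phi x * D x (axis j 1))"
        by (intro integrable_torus_continuous continuous_intros cphi D(2))
      have i2: "integrable (torus L) (\<lambda>x. (F0 (x $ i) * axis j 1 $ i) * \<psi> x)"
        by (intro integrable_torus_continuous continuous_intros cs continuous_on_coordinate F0_cont)
      have "(LINT x|torus L. ?G' x (axis j 1)) = 0"
      proof (rule torus_integral_partial_derivative[OF L, of "\<lambda>x. ?phi x * \<psi> x"])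
        show "((\<lambda>x. ?phi x * \<psi> x) has_derivative ?G' x) (at x)" for x
          by (rule has_derivative_mult[OF dphi D(1)])
        show "continuous_on UNIV (\<lambda>x. ?G' x (axis j 1))"
          by (intro continuous_intros cphi D(2) cs continuous_on_coordinate F0_cont)
        show "periodic L (\<lambda>x. ?phi x * \<psi> x)" using p pphi by (simp add: periodic_def)
      qed
      then have "(LINT x|torus L. ?phi x * D x (axis j 1)) = - (LINT x|torus L. (F0 (x $ i) * axis j 1 $ i) * \<psi> x)"
        using Bochner_Integration.integral_add[OF i1 i2] by simp
      moreover have "(LINT x|torus L. ?phi x *\<^sub>R grad \<psi> x) $ j = (LINT x|torus L. ?phi x * D x (axis j 1))"
        by (subst comp) (auto simp: gr intro!: continuous_intros cphi cgr)
      moreover have "(LINT x|torus L. \<psi> x *\<^sub>R ?g x) $ j = (LINT x|torus L. (F0 (x $ i) * axis j 1 $ i) * \<psi> x)"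
        by (subst comp) (auto simp: axis_def mult.commute intro!: continuous_intros cs continuous_on_coordinate F0_cont Bochner_Integration.integral_cong)
      ultimately show "(LINT x|torus L. ?phi x *\<^sub>R grad \<psi> x) $ j = (- (LINT x|torus L. \<psi> x *\<^sub>R ?g x)) $ j"
        by simp
    qed
    have eq: "(LINT x|torus L. F n ((x::real^'n) $ i) ^ 1 * D x (axis i 1)) = - (LINT x|torus L. Q n ((x::real^'n) $ i) * \<psi> x)" for n
    proof -
      let ?G' = "\<lambda>x h. F n (x $ i) * D x h + (Q n (x $ i) * h $ i) * \<psi> x"
      have i1: "integrable (torus L) (\<lambda>x. F n (x $ i) * D x (axis i 1))"
        by (intro integrable_torus_continuous continuous_intros D(2) continuous_on_coordinate profile.f_cont[OF P])
      have i2: "integrable (torus L) (\<lambda>x. (Q n (x $ i) * axis i 1 $ i) * \<psi> x)"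
        by (intro integrable_torus_continuous continuous_intros cs continuous_on_coordinate profile.q_cont[OF P])
      have "(LINT x|torus L. ?G' x (axis i 1)) = 0"
      proof (rule torus_integral_partial_derivative[OF L, of "\<lambda>x. F n (x $ i) * \<psi> x"])
        show "((\<lambda>x. F n (x $ i) * \<psi> x) has_derivative ?G' x) (at x)" for x
          by (rule has_derivative_mult[OF has_derivative_coordinate D(1)]) (rule profile.f_deriv[OF P])
        show "continuous_on UNIV (\<lambda>x. ?G' x (axis i 1))"
          by (intro continuous_intros D(2) cs continuous_on_coordinate profile.f_cont[OF P] profile.q_cont[OF P])
        show "periodic L (\<lambda>x. F n (x $ i) * \<psi> x)"
          by (rule periodic_mult[OF periodic_coordinate[of "F n"] p]) (rule profile.f_per[OF P])
      qed
      then show ?thesis using Bochner_Integration.integral_add[OF i1 i2] by simp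
    qed
    have "(\<lambda>n. - (LINT x|torus L. Q n ((x::real^'n) $ i) * \<psi> x)) \<longlonglongrightarrow> (LINT x|torus L. F0 (x $ i) ^ 1 * D x (axis i 1))"
      using F_integral_lim[OF D(2), of 1 "axis i 1"] unfolding eq .
    then have "(LINT x|torus L. F0 (x $ i) ^ 1 * D x (axis i 1)) = - (LINT z|torus L. \<rho> z * \<psi> z)"
      using LIMSEQ_unique tendsto_minus[OF Q_lim[OF s p]] by blast
    then show "(LINT x|torus L. ?g x \<bullet> grad \<psi> x) = - (LINT x|torus L. \<rho> x * \<psi> x)"
      by (simp add: inner_axis' gr)
  qed
  then show thesis by (rule that)
qed

lemma Hm1_norm_eq: "Hm1_norm L \<rho> = ereal (sqrt (LINT x|torus L. (F0 ((x::real^'n) $ i))\<^sup>2))"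
proof -
  obtain \<phi> where p: "poisson_solution L \<rho> \<phi> (\<lambda>x. F0 (x $ i) *\<^sub>R axis i 1)" by (rule poisson_exists)
  then have ex: "\<exists>\<phi> g. poisson_solution L \<rho> \<phi> g" by blast
  then have "\<exists>g. \<exists>\<phi>. poisson_solution L \<rho> \<phi> g" by blast
  then have "\<exists>\<phi>. poisson_solution L \<rho> \<phi> (SOME g. \<exists>\<phi>. poisson_solution L \<rho> \<phi> g)" by (rule someI_ex)
  then obtain \<phi>' where "poisson_solution L \<rho> \<phi>' (SOME g. \<exists>\<phi>. poisson_solution L \<rho> \<phi> g)" by blast
  from poisson_solution_unique_norm[OF L rho this p] ex
  show ?thesis unfolding Hm1_norm_def torus_L2_norm_def by (simp add: norm_axis_1)
qed

end

section \<open>Transported densities and the weak identity in time\<close>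

lemma times_from0_ereal: "times_from0 (ereal \<tau>) = {0..<\<tau>}"
  and times_pos_ereal: "times_pos (ereal \<tau>) = {0<..<\<tau>}"
  by (auto simp: times_from0_def times_pos_def)

lemma torus_L2_continuous:
  fixes u :: "real^'n \<Rightarrow> real"
  assumes "continuous_on UNIV u" "periodic L u"
  shows "torus_L2 L u"
  unfolding torus_L2_def
proof (intro conjI assms)
  have "u \<in> borel_measurable borel" using assms(1) by (rule borel_measurable_continuous_onI)
  then show "u \<in> borel_measurable lebesgue" by (intro measurable_completion) simp
qed (intro integrable_torus_continuous continuous_intros assms)

lemma AE_real_dense:
  fixes a b :: real
  assumes "AE t in lborel. P t" "a < b"
  obtains t where "a < t" "t < b" "P t"
proof -
  have "\<exists>t. a < t \<and> t < b \<and> P t"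
  proof (rule ccontr)
    assume "\<not> ?thesis"
    then have "AE t in lborel. t \<notin> {a<..<b}" using assms(1) by (auto elim!: eventually_mono)
    then have "emeasure lborel {a<..<b} = 0"
      by (subst (asm) AE_iff_measurable[of "{a<..<b}"]) auto
    then show False using assms(2) by simp
  qed
  then show thesis using that by blast
qed

text \<open>A set of full measure in space-time has full slices for almost every time.\<close>

lemma AE_slices_bounded:
  fixes r :: "real \<Rightarrow> real^'n \<Rightarrow> real"
  assumes "esssup (lebesgue_on (T \<times> cell L)) (\<lambda>(t, x). ereal \<bar>r t x\<bar>) < \<infinity>"
    and T: "T \<in> sets borel"
  obtains M where "M \<ge> 0" "AE t in lborel. t \<in> T \<longrightarrow> (AE x in torus L. \<bar>r t x\<bar> \<le> M)"
proof -
  let ?S = "T \<times> (cell L :: (real^'n) set)"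
  obtain M where M: "esssup (lebesgue_on ?S) (\<lambda>(t, x). ereal \<bar>r t x\<bar>) \<le> ereal M" "M \<ge> 0"
  proof (cases "esssup (lebesgue_on ?S) (\<lambda>(t, x). ereal \<bar>r t x\<bar>)")
    case (real m)
    then show ?thesis by (intro that[of "max m 0"]) auto
  qed (use assms that[of 0] in auto)
  have cb: "(cell L :: (real^'n) set) \<in> sets borel" unfolding cell_def by simp
  have Sb: "?S \<in> sets borel" using pair_measureI[OF T cb] by (simp only: borel_prod)
  have "AE p in lebesgue_on ?S. \<bar>r (fst p) (snd p)\<bar> \<le> M"
    using esssup_AE[of "\<lambda>(t, x). ereal \<bar>r t x\<bar>" "lebesgue_on ?S"]
    by eventually_elim (use M(1) in \<open>auto simp: split_beta dest: order_trans\<close>)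
  then have "AE p in lebesgue. p \<in> ?S \<longrightarrow> \<bar>r (fst p) (snd p)\<bar> \<le> M"
    using Sb by (subst (asm) AE_restrict_space_iff) auto
  then have "AE p in lborel. p \<in> ?S \<longrightarrow> \<bar>r (fst p) (snd p)\<bar> \<le> M" by (simp only: AE_completion_iff)
  then have "AE p in lborel \<Otimes>\<^sub>M lborel. p \<in> ?S \<longrightarrow> \<bar>r (fst p) (snd p)\<bar> \<le> M" by (simp only: lborel_prod)
  from lborel_pair.AE_pair[OF this]
  have "AE t in lborel. AE x in lborel. (t, x) \<in> ?S \<longrightarrow> \<bar>r t x\<bar> \<le> M" by simp
  then have "AE t in lborel. t \<in> T \<longrightarrow> (AE x in torus L. \<bar>r t x\<bar> \<le> M)"
  proof eventually_elim
    case (elim t)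
    show ?case
    proof
      assume "t \<in> T"
      with elim have "AE x in lborel. x \<in> cell L \<longrightarrow> \<bar>r t x\<bar> \<le> M" by (auto elim!: eventually_mono)
      then have "AE x in lebesgue. x \<in> cell L \<longrightarrow> \<bar>r t x\<bar> \<le> M" by (rule AE_completion)
      then show "AE x in torus L. \<bar>r t x\<bar> \<le> M" by (subst AE_restrict_space_iff) auto
    qed
  qed
  then show thesis using that M(2) by blast
qed

lemma continuous_on_slice:
  assumes c: "continuous_on (U \<times> UNIV) (\<lambda>(p, x). c p x)" and p: "p \<in> U"
  shows "continuous_on UNIV (c p)"
proof -
  have 1: "continuous_on UNIV (Pair p)" by (intro continuous_intros)
  have 2: "Pair p ` UNIV \<subseteq> U \<times> UNIV" using p by auto
  from continuous_on_compose2[OF c 1 2] show ?thesis by simp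
qed

text \<open>The bound by one and the vanishing mean are assumed at the initial time; at later times they are consequences of
  the weak formulation.\<close>

locale transport =
  fixes L E \<tau> :: real and v :: "real \<Rightarrow> real^'n \<Rightarrow> real^'n" and \<rho>0 :: "real^'n \<Rightarrow> real"
    and \<rho> :: "real \<Rightarrow> real^'n \<Rightarrow> real"
  assumes L: "L > 0" and tau: "\<tau> > 0" and adm: "admissible_velocity L E (ereal \<tau>) v"
    and sol: "transport_solution L (ereal \<tau>) v \<rho>0 \<rho>"
    and rho0: "integrable (torus L) \<rho>0" and rho0_bd: "AE x in torus L. \<bar>\<rho>0 x\<bar> \<le> 1"
    and rho0_mean: "(LINT x|torus L. \<rho>0 x) = 0"
begin

lemma v_smooth: "smooth_on ({0..<\<tau>} \<times> UNIV) (\<lambda>(t, x). v t x)"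
  and v_per: "0 \<le> t \<Longrightarrow> t < \<tau> \<Longrightarrow> periodic L (v t)"
  and v_energy: "0 \<le> t \<Longrightarrow> t < \<tau> \<Longrightarrow> (LINT x|torus L. (norm (v t x))\<^sup>2) \<le> E"
  and v_div: "0 \<le> t \<Longrightarrow> t < \<tau> \<Longrightarrow> divergence (v t) x = 0"
  using adm unfolding admissible_velocity_def times_from0_ereal by auto

lemma rho_L2: "0 \<le> t \<Longrightarrow> t < \<tau> \<Longrightarrow> torus_L2 L (\<rho> t)"
  and rho_weak_cont: "torus_L2 L k \<Longrightarrow> continuous_on {0..<\<tau>} (\<lambda>t. LINT x|torus L. \<rho> t x * k x)"
  using sol unfolding transport_solution_def times_from0_ereal by auto

lemma rho_int: "0 \<le> t \<Longrightarrow> t < \<tau> \<Longrightarrow> integrable (torus L) (\<rho> t)"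
  by (rule torus_L2_integrable[OF rho_L2])

lemma v_cont: "continuous_on ({0..<\<tau>} \<times> UNIV) (\<lambda>(t, x). v t x)"
  by (rule smooth_on_imp_continuous_on[OF v_smooth])

lemma v_cont_space: "0 \<le> t \<Longrightarrow> t < \<tau> \<Longrightarrow> continuous_on UNIV (v t)"
  by (rule continuous_on_slice[OF v_cont]) simp

lemma v_smooth_space: "0 \<le> t \<Longrightarrow> t < \<tau> \<Longrightarrow> smooth_on UNIV (v t)"
proof -
  assume t: "0 \<le> t" "t < \<tau>"
  have "smooth_on UNIV (\<lambda>x::real^'n. (t, 0) + (0 :: real, x))"
    by (intro smooth_on_add smooth_on_const smooth_on_linear bounded_linear_Pair bounded_linear_zero bounded_linear_ident)
  then have "smooth_on UNIV (\<lambda>x::real^'n. (t, x))" by simp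
  moreover have "range (Pair t) \<subseteq> {0..<\<tau>} \<times> (UNIV :: (real^'n) set)" using t by auto
  ultimately have "smooth_on UNIV (\<lambda>x. (\<lambda>(t, x). v t x) (t, x))" by (rule smooth_on_compose[OF _ v_smooth])
  then show ?thesis by simp
qed

lemma v_derivative:
  obtains v' where "\<And>t x. 0 \<le> t \<Longrightarrow> t < \<tau> \<Longrightarrow> (v t has_derivative v' t x) (at x)"
    "\<And>h. continuous_on ({0..<\<tau>} \<times> UNIV) (\<lambda>(t, x). v' t x h)"
proof -
  obtain D where D: "\<And>p. p \<in> {0..<\<tau>} \<times> UNIV \<Longrightarrow> ((\<lambda>(t, x). v t x) has_derivative D p) (at p within {0..<\<tau>} \<times> UNIV)"
    "\<And>h. continuous_on ({0..<\<tau>} \<times> UNIV) (\<lambda>p. D p h)"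
    using smooth_on_derivative_exists[OF v_smooth] by metis
  show thesis
  proof (rule that[of "\<lambda>t x h. D (t, x) (0, h)"])
    fix t x assume t: "0 \<le> t" "t < \<tau>"
    have "((\<lambda>x::real^'n. (t, x)) has_derivative (\<lambda>h. (0, h))) (at x)" by (auto intro!: derivative_eq_intros)
    moreover have "((\<lambda>(t, x). v t x) has_derivative D (t, x)) (at (t, x) within range (\<lambda>x. (t, x)))"
      by (rule has_derivative_subset[OF D(1)]) (use t in auto)
    ultimately have "((\<lambda>x. (\<lambda>(t, x). v t x) (t, x)) has_derivative (\<lambda>h. D (t, x) (0, h))) (at x)"
      by (rule has_derivative_in_compose)
    then show "(v t has_derivative (\<lambda>h. D (t, x) (0, h))) (at x)" by simp
  next
    show "continuous_on ({0..<\<tau>} \<times> UNIV) (\<lambda>(t, x). D (t, x) (0, h))" for h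
      using D(2)[of "(0, h)"] by (simp add: split_beta)
  qed
qed

text \<open>The essential bound holds at almost every time. Weak continuity, tested with the sign of \<open>\<rho>\<close> at the given time, extends the
  resulting bound of the total mass to every time.\<close>

lemma rho_mass_bound:
  obtains C where "C \<ge> 0" "\<And>t. 0 \<le> t \<Longrightarrow> t < \<tau> \<Longrightarrow> (LINT x|torus L. \<bar>\<rho> t x\<bar>) \<le> C"
proof -
  have "esssup (lebesgue_on ({0<..<\<tau>} \<times> cell L)) (\<lambda>(t, x). ereal \<bar>\<rho> t x\<bar>) < \<infinity>"
    using sol unfolding transport_solution_def times_pos_ereal by blast
  then obtain M where M: "M \<ge> 0" "AE t in lborel. t \<in> {0<..<\<tau>} \<longrightarrow> (AE x in torus L. \<bar>\<rho> t x\<bar> \<le> M)"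
    by (rule AE_slices_bounded) auto
  have "(LINT x|torus L. \<bar>\<rho> t x\<bar>) \<le> M * L ^ CARD('n)" if t: "0 \<le> t" "t < \<tau>" for t
  proof -
    define k where "k = (\<lambda>x. sgn (\<rho> t x))"
    have k1: "\<bar>k x\<bar> \<le> 1" for x by (simp add: k_def sgn_real_def)
    have km: "k \<in> borel_measurable lebesgue"
    proof -
      have "\<rho> t \<in> borel_measurable lebesgue" using rho_L2[OF t] by (simp add: torus_L2_def)
      then show ?thesis unfolding k_def by measurable
    qed
    have k: "torus_L2 L k"
      unfolding torus_L2_def
    proof (intro conjI km)
      show "periodic L k" using rho_L2[OF t] by (simp add: torus_L2_def periodic_def k_def)
      show "integrable (torus L) (\<lambda>x. (norm (k x))\<^sup>2)"
      proof (rule finite_measure.integrable_const_bound[OF finite_measure_torus, where B=1])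
        show "(\<lambda>x. (norm (k x))\<^sup>2) \<in> borel_measurable (torus L)" using measurable_torus[OF km] by measurable
      qed (auto simp: k_def sgn_real_def)
    qed
    have good: "\<bar>LINT x|torus L. \<rho> s x * k x\<bar> \<le> M * L ^ CARD('n)" if s: "0 \<le> s" "s < \<tau>" "AE x in torus L. \<bar>\<rho> s x\<bar> \<le> M" for s
    proof -
      have "\<bar>LINT x|torus L. \<rho> s x * k x\<bar> \<le> (LINT x|torus L. \<bar>\<rho> s x * k x\<bar>)" by (rule integral_abs_bound)
      also have "\<dots> \<le> (LINT x|(torus L :: (real^'n) measure). M)"
      proof (rule integral_mono_AE)
        show "integrable (torus L) (\<lambda>x. \<bar>\<rho> s x * k x\<bar>)"
          by (intro integrable_abs integrable_torus_bounded_mult[OF rho_int[OF s(1,2)] measurable_torus[OF km] k1])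
        show "integrable (torus L :: (real^'n) measure) (\<lambda>x. M)" by (intro integrable_torus_continuous continuous_intros)
        show "AE x in torus L. \<bar>\<rho> s x * k x\<bar> \<le> M"
          using s(3)
        proof eventually_elim
          case (elim x)
          have "\<bar>\<rho> s x\<bar> * \<bar>k x\<bar> \<le> M * 1" using elim k1 M(1) by (intro mult_mono) auto
          then show ?case by (simp add: abs_mult)
        qed
      qed
      also have "\<dots> = M * L ^ CARD('n)" by (simp only: torus_integral_const[OF L] mult.commute)
      finally show ?thesis .
    qed
    have "\<bar>LINT x|torus L. \<rho> t x * k x\<bar> \<le> M * L ^ CARD('n)"
    proof (rule ccontr)
      define d where "d = \<bar>LINT x|torus L. \<rho> t x * k x\<bar> - M * L ^ CARD('n)"
      assume "\<not> ?thesis"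
      then have d: "d > 0" by (simp add: d_def)
      obtain \<delta> where \<delta>: "\<delta> > 0" "\<And>s. s \<in> {0..<\<tau>} \<Longrightarrow> dist s t < \<delta> \<Longrightarrow>
          dist (LINT x|torus L. \<rho> s x * k x) (LINT x|torus L. \<rho> t x * k x) < d"
      proof -
        have "t \<in> {0..<\<tau>}" using t by simp
        from bspec[OF rho_weak_cont[OF k, unfolded continuous_on_iff] this] d that show ?thesis by blast
      qed
      obtain s where s: "t < s" "s < min (t + \<delta>) \<tau>" "s \<in> {0<..<\<tau>} \<longrightarrow> (AE x in torus L. \<bar>\<rho> s x\<bar> \<le> M)"
        using AE_real_dense[OF M(2), of t "min (t + \<delta>) \<tau>"] \<delta>(1) t by auto
      then have "\<bar>LINT x|torus L. \<rho> s x * k x\<bar> \<le> M * L ^ CARD('n)" using good[of s] t by auto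
      moreover have "dist (LINT x|torus L. \<rho> s x * k x) (LINT x|torus L. \<rho> t x * k x) < d"
        using s t by (intro \<delta>(2)) (auto simp: dist_real_def)
      ultimately show False unfolding d_def dist_real_def by linarith
    qed
    moreover have "\<rho> t x * k x = \<bar>\<rho> t x\<bar>" for x by (simp add: k_def sgn_real_def)
    ultimately show ?thesis by simp
  qed
  then show thesis using that[of "M * L ^ CARD('n)"] M(1) L by simp
qed

text \<open>Weak continuity of \<open>\<rho>\<close> is combined with uniform continuity of the test function on the cell through the mass bound.\<close>

lemma pairing_continuous:
  fixes c :: "'p::metric_space \<Rightarrow> real^'n \<Rightarrow> real"
  assumes c: "continuous_on (U \<times> UNIV) (\<lambda>(p, x). c p x)" and per: "\<And>p. p \<in> U \<Longrightarrow> periodic L (c p)"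
    and T: "continuous_on U T" "T ` U \<subseteq> {0..<\<tau>}"
  shows "continuous_on U (\<lambda>p. LINT x|torus L. \<rho> (T p) x * c p x)"
  unfolding continuous_on_iff
proof (intro ballI allI impI)
  fix p0 and e :: real assume p0: "p0 \<in> U" and e: "e > 0"
  obtain C where C: "C \<ge> 0" "\<And>t. 0 \<le> t \<Longrightarrow> t < \<tau> \<Longrightarrow> (LINT x|torus L. \<bar>\<rho> t x\<bar>) \<le> C" using rho_mass_bound by metis
  have cs: "continuous_on UNIV (c p)" if "p \<in> U" for p
    by (rule continuous_on_slice[OF c that])
  have Tp: "0 \<le> T p" "T p < \<tau>" if "p \<in> U" for p using T(2) that by auto
  have cc: "continuous_on (U \<times> cell L) (\<lambda>(p, x). c p x)" by (rule continuous_on_subset[OF c]) auto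
  have e2: "e / (2 * (C + 1)) > 0" using e C by simp
  obtain X where X: "p0 \<in> X" "open X" "\<forall>p\<in>X \<inter> U. \<forall>x\<in>cell L. dist ((\<lambda>(p, x). c p x) (p, x)) ((\<lambda>(p, x). c p x) (p0, x)) \<le> e / (2 * (C + 1))"
    using continuous_on_prod_compactE[OF cc _ p0 e2] unfolding cell_def by (metis compact_cbox)
  obtain d1 where d1: "d1 > 0" "\<And>p. dist p p0 < d1 \<Longrightarrow> p \<in> X" using X(1,2) unfolding open_dist by metis
  have "continuous_on U (\<lambda>p. LINT x|torus L. \<rho> (T p) x * c p0 x)"
    using continuous_on_compose2[OF rho_weak_cont[OF torus_L2_continuous[OF cs[OF p0] per[OF p0]]] T(1)] T(2) by simp
  then obtain d2 where d2: "d2 > 0" "\<And>p. p \<in> U \<Longrightarrow> dist p p0 < d2 \<Longrightarrow>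
      dist (LINT x|torus L. \<rho> (T p) x * c p0 x) (LINT x|torus L. \<rho> (T p0) x * c p0 x) < e / 2"
  proof -
    assume c0: "continuous_on U (\<lambda>p. LINT x|torus L. \<rho> (T p) x * c p0 x)"
    from bspec[OF c0[unfolded continuous_on_iff] p0] half_gt_zero[OF e] that show ?thesis by blast
  qed
  show "\<exists>d>0. \<forall>p\<in>U. dist p p0 < d \<longrightarrow> dist (LINT x|torus L. \<rho> (T p) x * c p x) (LINT x|torus L. \<rho> (T p0) x * c p0 x) < e"
  proof (intro exI[of _ "min d1 d2"] conjI ballI impI)
    fix p assume p: "p \<in> U" "dist p p0 < min d1 d2"
    have i: "integrable (torus L) (\<lambda>x. \<rho> (T p) x * c q x)" if "q \<in> U" for q
      by (rule integrable_torus_continuous_mult[OF rho_int[OF Tp[OF p(1)]] cs[OF that]])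
    have "\<bar>LINT x|torus L. \<rho> (T p) x * (c p x - c p0 x)\<bar> \<le> e / (2 * (C + 1)) * (LINT x|torus L. \<bar>\<rho> (T p) x\<bar>)"
      using X(3) d1(2)[of p] p by (intro torus_integral_mult_bound rho_int Tp) (auto simp: dist_real_def)
    also have "\<dots> \<le> e / (2 * (C + 1)) * (C + 1)"
      using C(2)[OF Tp[OF p(1)]] e2 by (intro mult_left_mono) auto
    also have "\<dots> = e / 2" using C(1) by (simp add: field_simps)
    finally have "\<bar>(LINT x|torus L. \<rho> (T p) x * c p x) - (LINT x|torus L. \<rho> (T p) x * c p0 x)\<bar> \<le> e / 2"
      unfolding right_diff_distrib Bochner_Integration.integral_diff[OF i[OF p(1)] i[OF p0]] .
    moreover have "\<bar>(LINT x|torus L. \<rho> (T p) x * c p0 x) - (LINT x|torus L. \<rho> (T p0) x * c p0 x)\<bar> < e / 2"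
      using d2(2)[OF p(1)] p(2) by (simp add: dist_real_def)
    ultimately show "dist (LINT x|torus L. \<rho> (T p) x * c p x) (LINT x|torus L. \<rho> (T p0) x * c p0 x) < e"
      unfolding dist_real_def by linarith
  qed (use d1 d2 in auto)
qed

end

lemma LINT_compact_support:
  fixes H :: "real \<Rightarrow> real"
  assumes t1: "0 < t1" "t1 < \<tau>" and c: "continuous_on {0..t1} H" and z: "\<And>t. t1 < t \<Longrightarrow> t < \<tau> \<Longrightarrow> H t = 0"
  shows "(LINT t|lebesgue_on {0<..<\<tau>}. H t) = integral {0..t1} H"
proof -
  have "(LINT t|lebesgue_on {0<..<\<tau>}. H t) = (LINT t|lebesgue_on {0<..<\<tau>}. (if t \<in> {0<..t1} then H t else 0))"
    using z by (intro Bochner_Integration.integral_cong) auto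
  also have "\<dots> = integral\<^sup>L (lebesgue_on {0<..t1}) H"
    using t1 by (intro integral_restrict) auto
  also have "\<dots> = integral {0<..t1} H"
  proof (rule lebesgue_integral_eq_integral)
    have "set_integrable lebesgue {0<..t1} H"
      by (rule set_integrable_subset[OF absolutely_integrable_continuous_real[OF c]]) auto
    then show "integrable (lebesgue_on {0<..t1}) H" by (rule absolutely_integrable_imp_integrable) simp
  qed simp
  also have "\<dots> = integral {0..t1} H"
    by (rule integral_spike_set) (rule negligible_subset[of "{0}"]; auto)+
  finally show ?thesis .
qed

lemma integral_abs_le:
  fixes f g :: "real \<Rightarrow> real"
  assumes "continuous_on {a..b} f" "continuous_on {a..b} g" "\<And>t. t \<in> {a..b} \<Longrightarrow> \<bar>f t\<bar> \<le> g t"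
  shows "\<bar>integral {a..b} f\<bar> \<le> integral {a..b} g"
  using integral_norm_bound_integral[of f "{a..b}" g] assms by (simp add: integrable_continuous_real)

text \<open>Cutting off in time: testing with \<open>\<theta>\<close> that drops from one to zero just after \<open>t0\<close> recovers
  the value at \<open>t0\<close>.\<close>

lemma cutoff_identity:
  fixes A B :: "real \<Rightarrow> real"
  assumes t0: "0 \<le> t0" "t0 < \<tau>" and A: "continuous_on {0..<\<tau>} A" and B: "continuous_on {0..<\<tau>} B"
    and test: "\<And>\<theta> T'. smooth_on UNIV \<theta> \<Longrightarrow> \<theta> 0 = 1 \<Longrightarrow> 0 < T' \<Longrightarrow> T' < \<tau> \<Longrightarrow> (\<And>t. T' < t \<Longrightarrow> \<theta> t = 0) \<Longrightarrow>
        (LINT t|lebesgue_on {0<..<\<tau>}. deriv \<theta> t * A t + \<theta> t * B t) + a = 0"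
  shows "integral {0..t0} B = A t0 - a"
proof -
  have "\<bar>integral {0..t0} B - A t0 + a\<bar> \<le> 0 + e" if e: "e > 0" for e
  proof -
    have e2: "e / 2 > 0" using e by simp
    have t0': "t0 \<in> {0..<\<tau>}" using t0 by simp
    obtain d1 where d1: "d1 > 0" "\<And>t. t \<in> {0..<\<tau>} \<Longrightarrow> dist t t0 < d1 \<Longrightarrow> dist (A t) (A t0) < e / 2"
      using bspec[OF A[unfolded continuous_on_iff] t0'] e2 by blast
    obtain d2 where d2: "d2 > 0" "\<And>t. t \<in> {0..<\<tau>} \<Longrightarrow> dist t t0 < d2 \<Longrightarrow> dist (B t) (B t0) < 1"
      using bspec[OF B[unfolded continuous_on_iff] t0'] zero_less_one by blast
    define K where "K = \<bar>B t0\<bar> + 1"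
    have K: "K > 0" by (simp add: K_def)
    define \<epsilon> where "\<epsilon> = min (min (d1 / 2) (d2 / 2)) (min ((\<tau> - t0) / 2) (e / 2 / K))"
    have eps: "\<epsilon> > 0" "\<epsilon> < d1" "\<epsilon> < d2" "\<epsilon> < \<tau> - t0" "\<epsilon> * K \<le> e / 2"
    proof -
      show "\<epsilon> > 0" using d1(1) d2(1) t0 e K by (simp add: \<epsilon>_def)
      have l1: "\<epsilon> \<le> d1 / 2" unfolding \<epsilon>_def by (rule min.coboundedI1, rule min.cobounded1)
      have l2: "\<epsilon> \<le> d2 / 2" unfolding \<epsilon>_def by (rule min.coboundedI1, rule min.cobounded2)
      have l3: "\<epsilon> \<le> (\<tau> - t0) / 2" unfolding \<epsilon>_def by (rule min.coboundedI2, rule min.cobounded1)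
      show "\<epsilon> < d1" using l1 d1(1) by linarith
      show "\<epsilon> < d2" using l2 d2(1) by linarith
      show "\<epsilon> < \<tau> - t0" using l3 t0(2) by (simp add: field_simps)
      have "\<epsilon> \<le> e / 2 / K" by (simp add: \<epsilon>_def)
      then show "\<epsilon> * K \<le> e / 2" using K by (simp add: le_divide_eq)
    qed
    define t1 where "t1 = t0 + \<epsilon>"
    obtain \<sigma> :: "real \<Rightarrow> real" where s: "smooth_on UNIV \<sigma>" "\<And>x. x \<le> 0 \<Longrightarrow> \<sigma> x = 1" "\<And>x. x \<ge> 1 \<Longrightarrow> \<sigma> x = 0"
      "\<And>x. deriv \<sigma> x \<le> 0" "\<And>x. 0 \<le> \<sigma> x" using smooth_step_exists by metis
    have s1: "\<sigma> x \<le> 1" for x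
    proof (cases "x \<ge> 0")
      case True
      have "\<sigma> x \<le> \<sigma> 0"
        by (rule DERIV_nonpos_imp_nonincreasing[OF True]) (use smooth_on_real_deriv(1)[OF s(1)] s(4) in blast)
      then show ?thesis using s(2)[of 0] by simp
    qed (use s(2)[of x] in auto)
    define \<theta> where "\<theta> = (\<lambda>t. \<sigma> ((1 / \<epsilon>) * (t + - t0)))"
    have th_s: "smooth_on UNIV \<theta>" unfolding \<theta>_def
      by (intro smooth_on_compose_UNIV[OF _ s(1)] smooth_on_mult smooth_on_add smooth_on_const smooth_on_ident)
    have th1: "\<theta> t = 1" if "t \<le> t0" for t
      unfolding \<theta>_def using that eps(1) by (intro s(2)) (simp add: divide_nonpos_pos)
    have th0: "\<theta> t = 0" if "t \<ge> t1" for t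
      unfolding \<theta>_def using that eps(1) by (intro s(3)) (simp add: t1_def field_simps)
    have thb: "0 \<le> \<theta> t" "\<theta> t \<le> 1" for t by (simp_all add: \<theta>_def s(5) s1)
    have th_d: "(\<theta> has_real_derivative deriv \<sigma> ((1 / \<epsilon>) * (t + - t0)) * (1 / \<epsilon>)) (at t)" for t
    proof -
      have "((\<lambda>t. (1 / \<epsilon>) * (t + - t0)) has_real_derivative (1 / \<epsilon>) * (1 + 0)) (at t)"
        by (intro DERIV_cmult DERIV_add DERIV_ident DERIV_const)
      from DERIV_chain2[OF smooth_on_real_deriv(1)[OF s(1)] this] show ?thesis by (simp add: \<theta>_def)
    qed
    have th_neg: "deriv \<theta> t \<le> 0" for t
      unfolding DERIV_imp_deriv[OF th_d] using s(4) eps(1) by (simp add: mult_nonpos_nonneg divide_nonpos_pos)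
    have th_cont: "continuous_on S (deriv \<theta>)" "continuous_on S \<theta>" for S
      using smooth_on_imp_continuous_on[OF smooth_on_real_deriv(2)[OF th_s]] smooth_on_imp_continuous_on[OF th_s]
      by (auto intro: continuous_on_subset)
    have dz: "deriv \<theta> t = 0" if "t < t0" for t
    proof (rule DERIV_imp_deriv)
      show "(\<theta> has_real_derivative 0) (at t)"
        by (rule has_field_derivative_transform_within_open[OF DERIV_const[of 1], of "{..<t0}"]) (use that th1 in auto)
    qed
    have dz1: "deriv \<theta> t = 0" if "t > t1" for t
    proof (rule DERIV_imp_deriv)
      show "(\<theta> has_real_derivative 0) (at t)"
        by (rule has_field_derivative_transform_within_open[OF DERIV_const[of 0], of "{t1<..}"]) (use that th0 in auto)
    qed
    have t1: "0 < t1" "t1 < \<tau>" "t0 \<le> t1" using eps t0 by (auto simp: t1_def)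
    let ?H = "\<lambda>t. deriv \<theta> t * A t + \<theta> t * B t"
    have sub: "{0..t1} \<subseteq> {0..<\<tau>}" "{t0..t1} \<subseteq> {0..<\<tau>}" using t0 t1 by auto
    have cH: "continuous_on {0..t1} ?H"
      by (intro continuous_intros th_cont continuous_on_subset[OF A sub(1)] continuous_on_subset[OF B sub(1)])
    have "(LINT t|lebesgue_on {0<..<\<tau>}. ?H t) + a = 0"
      by (rule test[OF th_s th1 t1(1,2)]) (use t0 th0 in auto)
    then have "integral {0..t1} ?H + a = 0"
      using LINT_compact_support[OF t1(1,2) cH] dz1 th0 by simp
    moreover have "integral {0..t0} ?H + integral {t0..t1} ?H = integral {0..t1} ?H"
      using t0 t1 cH by (intro Henstock_Kurzweil_Integration.integral_combine integrable_continuous_real) auto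
    moreover have "integral {0..t0} ?H = integral {0..t0} B"
      by (rule integral_spike[of "{t0}"]) (use dz th1 in auto)
    moreover have "integral {t0..t1} ?H = integral {t0..t1} (\<lambda>t. deriv \<theta> t * A t) + integral {t0..t1} (\<lambda>t. \<theta> t * B t)"
      by (intro Henstock_Kurzweil_Integration.integral_add integrable_continuous_real continuous_intros th_cont
          continuous_on_subset[OF A sub(2)] continuous_on_subset[OF B sub(2)])
    moreover have "\<bar>integral {t0..t1} (\<lambda>t. \<theta> t * B t)\<bar> \<le> e / 2"
    proof -
      have "\<bar>integral {t0..t1} (\<lambda>t. \<theta> t * B t)\<bar> \<le> integral {t0..t1} (\<lambda>t. K)"
      proof (rule integral_abs_le)
        fix t assume t: "t \<in> {t0..t1}"
        have "dist (B t) (B t0) < 1" using t eps t1 t0 by (intro d2(2)) (auto simp: t1_def dist_real_def)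
        then have "\<bar>B t\<bar> \<le> K" by (simp add: K_def dist_real_def)
        then have "\<bar>\<theta> t\<bar> * \<bar>B t\<bar> \<le> 1 * K" using thb[of t] by (intro mult_mono) auto
        then show "\<bar>\<theta> t * B t\<bar> \<le> K" by (simp add: abs_mult)
      qed (intro continuous_intros th_cont continuous_on_subset[OF B sub(2)])+
      also have "\<dots> = \<epsilon> * K" using eps(1) by (simp add: t1_def)
      finally show ?thesis using eps(5) by simp
    qed
    moreover have "\<bar>integral {t0..t1} (\<lambda>t. deriv \<theta> t * A t) + A t0\<bar> \<le> e / 2"
    proof -
      have dint: "(deriv \<theta> has_integral (\<theta> t1 - \<theta> t0)) {t0..t1}"
      proof (rule fundamental_theorem_of_calculus[OF t1(3)])
        show "(\<theta> has_vector_derivative deriv \<theta> x) (at x within {t0..t1})" for x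
          using has_field_derivative_at_within[OF smooth_on_real_deriv(1)[OF th_s, of x]]
          by (simp add: has_real_derivative_iff_has_vector_derivative)
      qed
      then have di: "integral {t0..t1} (deriv \<theta>) = - 1"
        using th0[of t1] th1[of t0] by (simp add: integral_unique)
      have c1: "continuous_on {t0..t1} (\<lambda>t. deriv \<theta> t * A t)" and c2: "continuous_on {t0..t1} (\<lambda>t. deriv \<theta> t * (A t - A t0))"
        by (intro continuous_intros th_cont continuous_on_subset[OF A sub(2)])+
      have "integral {t0..t1} (\<lambda>t. deriv \<theta> t * (A t - A t0)) = integral {t0..t1} (\<lambda>t. deriv \<theta> t * A t - A t0 * deriv \<theta> t)"
        by (simp add: algebra_simps)
      also have "\<dots> = integral {t0..t1} (\<lambda>t. deriv \<theta> t * A t) - integral {t0..t1} (\<lambda>t. A t0 * deriv \<theta> t)"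
        by (intro Henstock_Kurzweil_Integration.integral_diff integrable_continuous_real c1 continuous_intros th_cont)
      also have "\<dots> = integral {t0..t1} (\<lambda>t. deriv \<theta> t * A t) + A t0" by (simp add: di)
      finally have eq: "integral {t0..t1} (\<lambda>t. deriv \<theta> t * A t) + A t0 = integral {t0..t1} (\<lambda>t. deriv \<theta> t * (A t - A t0))" by simp
      have "\<bar>integral {t0..t1} (\<lambda>t. deriv \<theta> t * (A t - A t0))\<bar> \<le> integral {t0..t1} (\<lambda>t. (- (e / 2)) * deriv \<theta> t)"
      proof (rule integral_abs_le[OF c2])
        fix t assume t: "t \<in> {t0..t1}"
        have "dist (A t) (A t0) < e / 2" using t eps t1 t0 by (intro d1(2)) (auto simp: t1_def dist_real_def)
        then have "(- deriv \<theta> t) * \<bar>A t - A t0\<bar> \<le> (- deriv \<theta> t) * (e / 2)"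
          using th_neg[of t] by (intro mult_left_mono) (auto simp: dist_real_def)
        then show "\<bar>deriv \<theta> t * (A t - A t0)\<bar> \<le> (- (e / 2)) * deriv \<theta> t"
          using th_neg[of t] by (simp add: abs_mult mult.commute)
      qed (intro continuous_intros th_cont)
      then show ?thesis unfolding eq by (simp add: di)
    qed
    ultimately show ?thesis by linarith
  qed
  then have "\<bar>integral {0..t0} B - A t0 + a\<bar> \<le> 0" by (rule field_le_epsilon)
  then show ?thesis by simp
qed

text \<open>Smoothness is asked on all of space-time, so that a cutoff in time alone makes these functions
  admissible in the weak formulation.\<close>

locale spacetime_test =
  fixes L :: real and c :: "real \<Rightarrow> real^'n \<Rightarrow> real" and ct :: "real \<Rightarrow> real^'n \<Rightarrow> real"
    and cx :: "real \<Rightarrow> real^'n \<Rightarrow> real^'n \<Rightarrow> real"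
  assumes sm: "smooth_on UNIV (\<lambda>(t, x). c t x)" and cper: "\<And>t. periodic L (c t)"
    and dt: "\<And>t x. ((\<lambda>s. c s x) has_real_derivative ct t x) (at t)"
    and dx: "\<And>t x. (c t has_derivative cx t x) (at x)"
    and ct_cont: "continuous_on UNIV (\<lambda>(t, x). ct t x)"
    and cx_cont: "\<And>h. continuous_on UNIV (\<lambda>(t, x). cx t x h)"
begin

lemma ct_per: "periodic L (ct t)"
  unfolding periodic_def
proof (intro allI)
  fix x i
  have "(\<lambda>s. c s (x + axis i L)) = (\<lambda>s. c s x)" using cper by (auto simp: periodic_def)
  then show "ct t (x + axis i L) = ct t x" using DERIV_unique dt by metis
qed

lemma c_cont: "continuous_on UNIV (\<lambda>(t, x). c t x)" by (rule smooth_on_imp_continuous_on[OF sm])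

end

lemma (in transport) material_derivative_continuous:
  assumes "spacetime_test L c ct cx"
  shows "continuous_on ({0..<\<tau>} \<times> UNIV) (\<lambda>(t, x). ct t x + cx t x (v t x))"
    "0 \<le> t \<Longrightarrow> t < \<tau> \<Longrightarrow> periodic L (\<lambda>x. ct t x + cx t x (v t x))"
proof -
  interpret spacetime_test L c ct cx by (rule assms)
  have e: "cx t x (v t x) = (\<Sum>i\<in>UNIV. v t x $ i * cx t x (axis i 1))" for t x
    using has_derivative_axis_expansion[OF dx[of t x], of "v t x"] by (simp only: real_scaleR_def)
  have vc: "continuous_on ({0..<\<tau>} \<times> UNIV) (\<lambda>p. v (fst p) (snd p) $ i)" for i
    using continuous_on_component[OF v_cont] by (simp add: split_beta)
  have "continuous_on ({0..<\<tau>} \<times> UNIV) (\<lambda>p. ct (fst p) (snd p) + (\<Sum>i\<in>UNIV. v (fst p) (snd p) $ i * cx (fst p) (snd p) (axis i 1)))"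
    using ct_cont cx_cont by (intro continuous_on_add continuous_on_sum continuous_on_mult vc)
      (auto simp: split_beta intro: continuous_on_subset)
  then show "continuous_on ({0..<\<tau>} \<times> UNIV) (\<lambda>(t, x). ct t x + cx t x (v t x))"
    by (simp add: case_prod_unfold e)
  show "periodic L (\<lambda>x. ct t x + cx t x (v t x))" if "0 \<le> t" "t < \<tau>"
    using ct_per[of t] v_per[OF that] periodic_has_derivative[OF cper dx, of t] by (simp add: periodic_def)
qed

text \<open>The weak formulation tested with \<open>\<theta>(t) c(t, x)\<close> and a cutoff \<open>\<theta>\<close> in time; the time derivative of \<open>c\<close> along the flow appears.\<close>

lemma (in transport) weak_identity:
  assumes "spacetime_test L c ct cx" and t0: "0 \<le> t0" "t0 < \<tau>"
  shows "integral {0..t0} (\<lambda>t. LINT x|torus L. \<rho> t x * (ct t x + cx t x (v t x)))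
    = (LINT x|torus L. \<rho> t0 x * c t0 x) - (LINT x|torus L. \<rho>0 x * c 0 x)"
    (is "integral _ ?B = ?A t0 - ?a")
    and "continuous_on {0..<\<tau>} (\<lambda>t. LINT x|torus L. \<rho> t x * (ct t x + cx t x (v t x)))"
proof -
  interpret spacetime_test L c ct cx by (rule assms)
  note md = material_derivative_continuous[OF assms(1)]
  show cB: "continuous_on {0..<\<tau>} ?B"
    by (rule pairing_continuous[of "{0..<\<tau>}" "\<lambda>t x. ct t x + cx t x (v t x)" "\<lambda>t. t"])
      (use md in \<open>auto intro!: continuous_intros\<close>)
  have cA: "continuous_on {0..<\<tau>} ?A"
    by (rule pairing_continuous[of "{0..<\<tau>}" c "\<lambda>t. t"])
      (use cper in \<open>auto intro!: continuous_intros continuous_on_subset[OF c_cont]\<close>)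
  show "integral {0..t0} ?B = ?A t0 - ?a"
  proof (rule cutoff_identity[OF t0 cA cB])
    fix \<theta> :: "real \<Rightarrow> real" and T'
    assume th: "smooth_on UNIV \<theta>" "\<theta> 0 = 1" "0 < T'" "T' < \<tau>" "\<And>t. T' < t \<Longrightarrow> \<theta> t = 0"
    have "smooth_on UNIV (\<lambda>p::real \<times> (real^'n). \<theta> (fst p))"
      by (intro smooth_on_compose_UNIV[OF _ th(1)] smooth_on_linear bounded_linear_fst)
    from smooth_on_mult[OF this sm]
    have "smooth_on UNIV (\<lambda>(t, x). \<theta> t * c t x)" by (simp add: case_prod_unfold)
    then have "test_function L (ereal \<tau>) (\<lambda>t x. \<theta> t * c t x)"
      unfolding test_function_def times_from0_ereal
      using th cper by (auto intro: smooth_on_subset simp: periodic_def intro!: bexI[of _ T'])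
    then have w: "(LINT t|lebesgue_on {0<..<\<tau>}. LINT x|torus L.
           \<rho> t x * deriv (\<lambda>s. \<theta> s * c s x) t + \<rho> t x * (v t x \<bullet> grad (\<lambda>x. \<theta> t * c t x) x))
        + (LINT x|torus L. \<rho>0 x * (\<theta> 0 * c 0 x)) = 0"
      using sol unfolding transport_solution_def times_pos_ereal by blast
    have inner: "(LINT x|torus L. \<rho> t x * deriv (\<lambda>s. \<theta> s * c s x) t + \<rho> t x * (v t x \<bullet> grad (\<lambda>x. \<theta> t * c t x) x))
        = deriv \<theta> t * ?A t + \<theta> t * ?B t" if t: "0 < t" "t < \<tau>" for t
    proof -
      have t': "0 \<le> t" "t < \<tau>" using t by auto
      have "deriv (\<lambda>s. \<theta> s * c s x) t = deriv \<theta> t * c t x + ct t x * \<theta> t" for x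
        by (rule DERIV_imp_deriv, rule DERIV_mult[OF smooth_on_real_deriv(1)[OF th(1)] dt])
      moreover have "v t x \<bullet> grad (\<lambda>x. \<theta> t * c t x) x = \<theta> t * cx t x (v t x)" for x
        by (rule inner_grad(1)) (rule has_derivative_mult_right[OF dx])
      ultimately have "(LINT x|torus L. \<rho> t x * deriv (\<lambda>s. \<theta> s * c s x) t + \<rho> t x * (v t x \<bullet> grad (\<lambda>x. \<theta> t * c t x) x))
        = (LINT x|torus L. deriv \<theta> t * (\<rho> t x * c t x) + \<theta> t * (\<rho> t x * (ct t x + cx t x (v t x))))"
        by (intro Bochner_Integration.integral_cong refl) (simp add: algebra_simps)
      also have "\<dots> = deriv \<theta> t * ?A t + \<theta> t * ?B t"
      proof -
        have "integrable (torus L) (\<lambda>x. \<rho> t x * c t x)"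
          by (rule integrable_torus_continuous_mult[OF rho_int[OF t']])
            (rule has_derivative_continuous_on[OF dx])
        moreover have "integrable (torus L) (\<lambda>x. \<rho> t x * (ct t x + cx t x (v t x)))"
          by (rule integrable_torus_continuous_mult[OF rho_int[OF t']])
            (rule continuous_on_slice[OF md(1)], use t' in simp)
        ultimately show ?thesis by (simp add: Bochner_Integration.integral_add)
      qed
      finally show ?thesis .
    qed
    have "(LINT t|lebesgue_on {0<..<\<tau>}. deriv \<theta> t * ?A t + \<theta> t * ?B t)
      = (LINT t|lebesgue_on {0<..<\<tau>}. LINT x|torus L.
           \<rho> t x * deriv (\<lambda>s. \<theta> s * c s x) t + \<rho> t x * (v t x \<bullet> grad (\<lambda>x. \<theta> t * c t x) x))"
      by (rule Bochner_Integration.integral_cong[OF refl], rule inner[symmetric]) auto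
    then show "(LINT t|lebesgue_on {0<..<\<tau>}. deriv \<theta> t * ?A t + \<theta> t * ?B t) + ?a = 0"
      using w th(2) by simp
  qed
qed

definition (in transport) vx :: "real \<Rightarrow> real^'n \<Rightarrow> real^'n \<Rightarrow> real^'n" where
  "vx = (SOME v'. (\<forall>t x. 0 \<le> t \<longrightarrow> t < \<tau> \<longrightarrow> (v t has_derivative v' t x) (at x)) \<and>
     (\<forall>h. continuous_on ({0..<\<tau>} \<times> UNIV) (\<lambda>(t, x). v' t x h)))"

lemma (in transport) vx_deriv: "0 \<le> t \<Longrightarrow> t < \<tau> \<Longrightarrow> (v t has_derivative vx t x) (at x)"
  and vx_cont: "continuous_on ({0..<\<tau>} \<times> UNIV) (\<lambda>(t, x). vx t x h)"
proof -
  have "\<exists>v'. (\<forall>t x. 0 \<le> t \<longrightarrow> t < \<tau> \<longrightarrow> (v t has_derivative v' t x) (at x)) \<and>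
     (\<forall>h. continuous_on ({0..<\<tau>} \<times> UNIV) (\<lambda>(t, x). v' t x h))"
  proof (rule v_derivative)
    fix v' assume a: "\<And>t x. 0 \<le> t \<Longrightarrow> t < \<tau> \<Longrightarrow> (v t has_derivative v' t x) (at x)"
      "\<And>h. continuous_on ({0..<\<tau>} \<times> UNIV) (\<lambda>(t, x). v' t x h)"
    show ?thesis by (intro exI[of _ v'] conjI allI impI a)
  qed
  from someI_ex[OF this, folded vx_def]
  show "0 \<le> t \<Longrightarrow> t < \<tau> \<Longrightarrow> (v t has_derivative vx t x) (at x)"
    "continuous_on ({0..<\<tau>} \<times> UNIV) (\<lambda>(t, x). vx t x h)" by simp_all
qed

text \<open>Divergence-free fields transport the constant one. This is the identity that \<open>weak_identity\<close> is combined with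
  to test \<open>1 - s \<rho>\<close> instead of \<open>\<rho>\<close>.\<close>

lemma (in transport) volume_identity:
  assumes "spacetime_test L c ct cx" and t0: "0 \<le> t0" "t0 < \<tau>"
  shows "integral {0..t0} (\<lambda>t. LINT x|torus L. ct t x + cx t x (v t x)) = (LINT x|torus L. c t0 x) - (LINT x|torus L. c 0 x)"
proof -
  interpret spacetime_test L c ct cx by (rule assms)
  have cs: "continuous_on UNIV (c t)" "continuous_on UNIV (ct t)" "continuous_on UNIV (\<lambda>x. cx t x h)" for t h
    by (rule continuous_on_slice[of UNIV, unfolded UNIV_Times_UNIV, OF c_cont UNIV_I], rule continuous_on_slice[of UNIV, unfolded UNIV_Times_UNIV, OF ct_cont UNIV_I],
        rule continuous_on_slice[of UNIV, unfolded UNIV_Times_UNIV, OF cx_cont UNIV_I])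
  have "((\<lambda>t. LINT x|torus L. c t x) has_real_derivative (LINT x|torus L. ct t x + cx t x (v t x))) (at t within {0..t0})"
    if t: "t \<in> {0..t0}" for t
  proof -
    have tt: "0 \<le> t" "t < \<tau>" using t t0 by auto
    have "((\<lambda>t. integral (cbox 0 (\<chi> i. L)) (c t)) has_field_derivative integral (cbox 0 (\<chi> i. L)) (ct t)) (at t within UNIV)"
    proof (rule leibniz_rule_field_derivative)
      show "c t integrable_on cbox 0 (\<chi> i. L)" for t by (intro integrable_continuous continuous_on_subset[OF cs(1)]) auto
      show "continuous_on (UNIV \<times> cbox 0 (\<chi> i. L)) (\<lambda>(t, x). ct t x)" by (rule continuous_on_subset[OF ct_cont]) auto
    qed (use dt in simp_all)
    then have "((\<lambda>t. LINT x|torus L. c t x) has_field_derivative (LINT x|torus L. ct t x)) (at t)"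
      using LINT_torus_eq_integral[OF integrable_torus_continuous[OF cs(1)], of L]
        LINT_torus_eq_integral[OF integrable_torus_continuous[OF cs(2)], of L] by (simp add: cell_def)
    moreover have "(LINT x|torus L. cx t x (v t x)) = 0"
      by (rule torus_integral_divergence_free[OF L vx_deriv[OF tt] continuous_on_slice[OF vx_cont] v_div[OF tt] v_per[OF tt] dx cs(3) cper])
        (use tt in auto)
    moreover have "(LINT x|torus L. ct t x + cx t x (v t x)) = (LINT x|torus L. ct t x) + (LINT x|torus L. cx t x (v t x))"
    proof (rule Bochner_Integration.integral_add)
      have "continuous_on UNIV (\<lambda>x. (ct t x + cx t x (v t x)) - ct t x)"
        by (intro continuous_on_diff cs continuous_on_slice[OF material_derivative_continuous(1)[OF assms(1)]]) (use tt in auto)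
      then show "integrable (torus L) (\<lambda>x. cx t x (v t x))" by (intro integrable_torus_continuous) simp
    qed (intro integrable_torus_continuous cs)
    ultimately show ?thesis by (auto intro: has_field_derivative_at_within)
  qed
  then have "((\<lambda>t. LINT x|torus L. ct t x + cx t x (v t x)) has_integral ((LINT x|torus L. c t0 x) - (LINT x|torus L. c 0 x))) {0..t0}"
    using t0 by (intro fundamental_theorem_of_calculus) (auto simp: has_real_derivative_iff_has_vector_derivative)
  then show ?thesis by (rule integral_unique)
qed

section \<open>The maximum principle for weak solutions\<close>

lemma continuous_on_derivative_apply:
  fixes f :: "real^'n \<Rightarrow> 'b::euclidean_space"
  assumes d: "\<And>y. (f has_derivative D y) (at y)" and c: "\<And>h. continuous_on UNIV (\<lambda>y. D y h)"
    and X: "continuous_on S X" and w: "continuous_on S w"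
  shows "continuous_on S (\<lambda>p. D (X p) (w p))"
proof -
  have e: "D (X p) (w p) = (\<Sum>i\<in>UNIV. w p $ i *\<^sub>R D (X p) (axis i 1))" for p
    by (rule has_derivative_axis_expansion[OF d])
  have "continuous_on S (\<lambda>p. \<Sum>i\<in>UNIV. w p $ i *\<^sub>R D (X p) (axis i 1))"
    by (intro continuous_on_sum continuous_on_scaleR continuous_on_component w continuous_on_compose2[OF c X]) auto
  then show ?thesis by (simp only: e)
qed

lemma norm_derivative_le:
  fixes f :: "real^'n \<Rightarrow> 'b::euclidean_space"
  assumes d: "(f has_derivative D) (at y)" and B: "\<And>i. norm (D (axis i 1)) \<le> B i"
  shows "norm (D h) \<le> (\<Sum>i\<in>UNIV. B i) * norm h"
proof -
  have "norm (D h) \<le> (\<Sum>i\<in>UNIV. norm (h $ i *\<^sub>R D (axis i 1)))"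
    unfolding has_derivative_axis_expansion[OF d, of h] by (rule norm_sum)
  also have "\<dots> \<le> (\<Sum>i\<in>UNIV. norm h * B i)"
    using B component_le_norm_cart[of h] by (intro sum_mono) (auto intro!: mult_mono)
  finally show ?thesis by (simp only: sum_distrib_left[symmetric] mult.commute[of _ "norm h"])
qed

text \<open>The test function displaced along \<open>u\<close> by the remaining time \<open>b - t\<close>. Its time derivative is minus the derivative of \<open>\<phi>\<close> in
  direction \<open>u\<close>, evaluated at the displaced point.\<close>

lemma moving_test:
  fixes \<phi> :: "real^'n \<Rightarrow> real" and u :: "real^'n \<Rightarrow> real^'n"
  assumes phi: "smooth_on UNIV \<phi>" "periodic L \<phi>" "\<And>y. (\<phi> has_derivative D y) (at y)" "\<And>h. continuous_on UNIV (\<lambda>y. D y h)"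
    and u: "smooth_on UNIV u" "periodic L u" "\<And>y. (u has_derivative U y) (at y)" "\<And>h. continuous_on UNIV (\<lambda>y. U y h)"
  shows "spacetime_test L (\<lambda>t x. \<phi> (x + (b - t) *\<^sub>R u x)) (\<lambda>t x. D (x + (b - t) *\<^sub>R u x) (- u x))
    (\<lambda>t x h. D (x + (b - t) *\<^sub>R u x) (h + (b - t) *\<^sub>R U x h))"
proof
  have cu: "continuous_on UNIV u" by (rule smooth_on_imp_continuous_on[OF u(1)])
  have cusnd: "continuous_on UNIV (\<lambda>p::real \<times> (real^'n). u (snd p))"
    by (rule continuous_on_compose2[OF cu]) (auto intro!: continuous_intros)
  have cX: "continuous_on UNIV (\<lambda>p::real \<times> (real^'n). snd p + (b - fst p) *\<^sub>R u (snd p))"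
    by (intro continuous_intros cusnd)
  have "smooth_on UNIV (\<lambda>p::real \<times> (real^'n). snd p + (b + (- 1) * fst p) *\<^sub>R u (snd p))"
    by (intro smooth_on_add smooth_on_scaleR smooth_on_const smooth_on_mult smooth_on_linear bounded_linear_fst
        bounded_linear_snd smooth_on_compose_UNIV[OF _ u(1)])
  from smooth_on_compose_UNIV[OF this phi(1)]
  show "smooth_on UNIV (\<lambda>(t, x). \<phi> (x + (b - t) *\<^sub>R u x))" by (simp add: case_prod_unfold)
  show "periodic L (\<lambda>x. \<phi> (x + (b - t) *\<^sub>R u x))" for t
    unfolding periodic_def
  proof (intro allI)
    fix x i
    have "x + axis i L + (b - t) *\<^sub>R u (x + axis i L) = (x + (b - t) *\<^sub>R u x) + axis i L"
      using u(2) by (simp add: periodic_def)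
    then show "\<phi> (x + axis i L + (b - t) *\<^sub>R u (x + axis i L)) = \<phi> (x + (b - t) *\<^sub>R u x)"
      using phi(2) unfolding periodic_def by metis
  qed
  show "((\<lambda>s. \<phi> (x + (b - s) *\<^sub>R u x)) has_real_derivative D (x + (b - t) *\<^sub>R u x) (- u x)) (at t)" for t x
  proof -
    have "((\<lambda>s. x + (b - s) *\<^sub>R u x) has_derivative (\<lambda>h. h *\<^sub>R (- u x))) (at t)"
      by (auto intro!: derivative_eq_intros)
    from has_derivative_compose[OF this phi(3)]
    have "((\<lambda>s. \<phi> (x + (b - s) *\<^sub>R u x)) has_derivative (\<lambda>h. D (x + (b - t) *\<^sub>R u x) (h *\<^sub>R (- u x)))) (at t)" .
    moreover have "(\<lambda>h. D (x + (b - t) *\<^sub>R u x) (h *\<^sub>R (- u x))) = (*) (D (x + (b - t) *\<^sub>R u x) (- u x))"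
      by (rule ext) (simp only: linear_scale[OF has_derivative_linear[OF phi(3)]] real_scaleR_def mult.commute)
    ultimately show ?thesis by (simp only: has_field_derivative_def)
  qed
  show "((\<lambda>x. \<phi> (x + (b - t) *\<^sub>R u x)) has_derivative (\<lambda>h. D (x + (b - t) *\<^sub>R u x) (h + (b - t) *\<^sub>R U x h))) (at x)" for t x
  proof -
    have "((\<lambda>x. x + (b - t) *\<^sub>R u x) has_derivative (\<lambda>h. h + (b - t) *\<^sub>R U x h)) (at x)"
      by (intro has_derivative_add has_derivative_ident has_derivative_scaleR_right u(3))
    from has_derivative_compose[OF this phi(3)] show ?thesis .
  qed
  show "continuous_on UNIV (\<lambda>(t, x). D (x + (b - t) *\<^sub>R u x) (- u x))"
    unfolding case_prod_unfold
    by (intro continuous_on_derivative_apply[OF phi(3,4)] cX continuous_intros cusnd)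
  show "continuous_on UNIV (\<lambda>(t, x). D (x + (b - t) *\<^sub>R u x) (h + (b - t) *\<^sub>R U x h))" for h
  proof -
    have "continuous_on UNIV (\<lambda>p::real \<times> (real^'n). U (snd p) h)"
      by (rule continuous_on_compose2[OF u(4)]) (auto intro!: continuous_intros)
    then show ?thesis unfolding case_prod_unfold
      by (intro continuous_on_derivative_apply[OF phi(3,4)] cX continuous_intros)
  qed
qed

context transport
begin

lemma compact_time_bound:
  fixes c :: "real \<Rightarrow> real^'n \<Rightarrow> 'b::euclidean_space"
  assumes c: "continuous_on ({0..<\<tau>} \<times> UNIV) (\<lambda>(t, x). c t x)" and p: "\<And>t. 0 \<le> t \<Longrightarrow> t < \<tau> \<Longrightarrow> periodic L (c t)"
    and t0: "t0 < \<tau>"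
  shows "\<exists>B\<ge>0. \<forall>t x. 0 \<le> t \<longrightarrow> t \<le> t0 \<longrightarrow> norm (c t x) \<le> B"
proof -
  have "compact ((\<lambda>(t, x). c t x) ` ({0..t0} \<times> cell L))"
    using t0 unfolding cell_def
    by (intro compact_continuous_image compact_Times compact_Icc compact_cbox continuous_on_subset[OF c]) auto
  then have "bounded ((\<lambda>(t, x). c t x) ` ({0..t0} \<times> cell L))" by (rule compact_imp_bounded)
  then obtain B where B0: "\<forall>y\<in>(\<lambda>(t, x). c t x) ` ({0..t0} \<times> cell L). norm y \<le> B"
    unfolding bounded_iff by blast
  have B: "norm (c t x) \<le> B" if "0 \<le> t" "t \<le> t0" "x \<in> cell L" for t x
  proof -
    have "(t, x) \<in> {0..t0} \<times> cell L" using that by simp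
    from bspec[OF B0 imageI[OF this]] show ?thesis by simp
  qed
  have "norm (c t x) \<le> max B 0" if t: "0 \<le> t" "t \<le> t0" for t x
  proof -
    obtain m where "x + (\<Sum>j\<in>UNIV. axis j (of_int (m j) * L)) \<in> cell L" using periodic_reduce[OF L] by blast
    from B[OF t this] show ?thesis using periodic_lattice[OF p, of t x m] t t0 by simp
  qed
  then show ?thesis by (intro exI[of _ "max B 0"]) simp
qed

lemma velocity_bounds:
  assumes t0: "t0 < \<tau>"
  obtains V K where "V \<ge> 0" "K \<ge> 0" "\<And>t x. 0 \<le> t \<Longrightarrow> t \<le> t0 \<Longrightarrow> norm (v t x) \<le> V"
    "\<And>t x h. 0 \<le> t \<Longrightarrow> t \<le> t0 \<Longrightarrow> norm (vx t x h) \<le> K * norm h"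
proof -
  obtain V where V: "V \<ge> 0" "\<And>t x. 0 \<le> t \<Longrightarrow> t \<le> t0 \<Longrightarrow> norm (v t x) \<le> V"
    using compact_time_bound[OF v_cont v_per t0] by blast
  have "\<exists>B\<ge>0. \<forall>t x. 0 \<le> t \<longrightarrow> t \<le> t0 \<longrightarrow> norm (vx t x (axis i 1)) \<le> B" for i
  proof (rule compact_time_bound[OF vx_cont _ t0, of "axis i 1"])
    show "periodic L (\<lambda>x. vx t x (axis i 1))" if "0 \<le> t" "t < \<tau>" for t
      by (rule periodic_has_derivative[OF v_per[OF that] vx_deriv[OF that]])
  qed
  then obtain B where B: "\<And>i. B i \<ge> 0" "\<And>i t x. 0 \<le> t \<Longrightarrow> t \<le> t0 \<Longrightarrow> norm (vx t x (axis i 1)) \<le> B i"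
    by metis
  have "norm (vx t x h) \<le> (\<Sum>i\<in>UNIV. B i) * norm h" if "0 \<le> t" "t \<le> t0" for t x h
    by (rule norm_derivative_le[OF vx_deriv B(2)]) (use that t0 in auto)
  then show thesis using that[OF V(1) _ V(2), of "\<Sum>i\<in>UNIV. B i"] B(1) by (simp add: sum_nonneg)
qed

lemma velocity_time_modulus:
  assumes t0: "t0 < \<tau>" and w: "\<omega> > 0"
  obtains \<delta> where "\<delta> > 0" "\<And>t s x. 0 \<le> t \<Longrightarrow> t \<le> t0 \<Longrightarrow> 0 \<le> s \<Longrightarrow> s \<le> t0 \<Longrightarrow> \<bar>t - s\<bar> < \<delta> \<Longrightarrow> norm (v t x - v s x) \<le> \<omega>"
proof -
  have "uniformly_continuous_on ({0..t0} \<times> cell L) (\<lambda>(t, x). v t x)"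
    using t0 unfolding cell_def
    by (intro compact_uniformly_continuous compact_Times compact_Icc compact_cbox continuous_on_subset[OF v_cont]) auto
  then obtain \<delta> where d: "\<delta> > 0" "\<And>p q. p \<in> {0..t0} \<times> cell L \<Longrightarrow> q \<in> {0..t0} \<times> cell L \<Longrightarrow> dist q p < \<delta> \<Longrightarrow>
      dist ((\<lambda>(t, x). v t x) q) ((\<lambda>(t, x). v t x) p) < \<omega>"
    using w unfolding uniformly_continuous_on_def by blast
  have "norm (v t x - v s x) \<le> \<omega>" if t: "0 \<le> t" "t \<le> t0" and s: "0 \<le> s" "s \<le> t0" and ts: "\<bar>t - s\<bar> < \<delta>" for t s x
  proof -
    obtain m where m: "x + (\<Sum>j\<in>UNIV. axis j (of_int (m j) * L)) \<in> cell L" using periodic_reduce[OF L] by blast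
    let ?y = "x + (\<Sum>j\<in>UNIV. axis j (of_int (m j) * L))"
    have "dist (t, ?y) (s, ?y) < \<delta>" using ts by (simp add: dist_Pair_Pair dist_real_def)
    then have "dist (v t ?y) (v s ?y) < \<omega>" using d(2)[of "(s, ?y)" "(t, ?y)"] t s m by simp
    then show ?thesis using periodic_lattice[OF v_per, of t x m] periodic_lattice[OF v_per, of s x m] t s t0
      by (simp add: dist_norm)
  qed
  then show thesis using that d(1) by blast
qed

text \<open>The test function \<open>\<phi>(x + (t2 - t) v(t2, x))\<close> solves the transport equation up to a residual of the order of the
  step size plus the oscillation \<open>\<omega>\<close> of the velocity in time, because its time derivative cancels the transport term to
  first order. Integrated over the step, the residual gains another factor \<open>t2 - t1\<close>.\<close>

lemma transport_step:
  assumes t: "0 \<le> t1" "t1 \<le> t2" "t2 < \<tau>" and s: "\<bar>s\<bar> \<le> 1"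
    and phi: "smooth_on UNIV \<phi>" "periodic L \<phi>" "\<And>y. (\<phi> has_derivative D y) (at y)" "\<And>h. continuous_on UNIV (\<lambda>y. D y h)"
    and P: "\<And>y h. \<bar>D y h\<bar> \<le> P * norm h" "P \<ge> 0"
    and V: "\<And>t x. 0 \<le> t \<Longrightarrow> t \<le> t2 \<Longrightarrow> norm (v t x) \<le> V" and K: "\<And>x h. norm (vx t2 x h) \<le> K * norm h" "K \<ge> 0"
    and w: "\<And>t x. t1 \<le> t \<Longrightarrow> t \<le> t2 \<Longrightarrow> norm (v t x - v t2 x) \<le> \<omega>"
    and C: "\<And>t. 0 \<le> t \<Longrightarrow> t < \<tau> \<Longrightarrow> (LINT x|torus L. \<bar>\<rho> t x\<bar>) \<le> C"
  shows "(LINT x|torus L. \<phi> x) - s * (LINT x|torus L. \<rho> t2 x * \<phi> x)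
    \<ge> (LINT x|torus L. \<phi> (x + (t2 - t1) *\<^sub>R v t2 x)) - s * (LINT x|torus L. \<rho> t1 x * \<phi> (x + (t2 - t1) *\<^sub>R v t2 x))
      - (t2 - t1) * ((L ^ CARD('n) + C) * (P * (\<omega> + (t2 - t1) * K * V)))"
proof -
  have t2: "0 \<le> t2" "t2 < \<tau>" and t1: "0 \<le> t1" "t1 < \<tau>" using t by auto
  have cvx: "continuous_on UNIV (\<lambda>y. vx t2 y h)" for h by (rule continuous_on_slice[OF vx_cont]) (use t2 in simp)
  let ?X = "\<lambda>t x. x + (t2 - t) *\<^sub>R v t2 x"
  let ?c = "\<lambda>t x. \<phi> (?X t x)" and ?ct = "\<lambda>t x. D (?X t x) (- v t2 x)"
    and ?cx = "\<lambda>t x h. D (?X t x) (h + (t2 - t) *\<^sub>R vx t2 x h)"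
  have st: "spacetime_test L ?c ?ct ?cx"
    by (rule moving_test[OF phi v_smooth_space[OF t2] v_per[OF t2] vx_deriv[OF t2] cvx])
  let ?R = "\<lambda>t x. ?ct t x + ?cx t x (v t x)"
  let ?r = "P * (\<omega> + (t2 - t1) * K * V)"
  have R: "\<bar>?R t x\<bar> \<le> ?r" if tt: "t1 \<le> t" "t \<le> t2" for t x
  proof -
    have lin: "linear (D (?X t x))" by (rule has_derivative_linear[OF phi(3)])
    have "?R t x = D (?X t x) ((v t x - v t2 x) + (t2 - t) *\<^sub>R vx t2 x (v t x))"
      unfolding linear_add[OF lin, symmetric] by (simp add: algebra_simps)
    then have "\<bar>?R t x\<bar> \<le> P * norm ((v t x - v t2 x) + (t2 - t) *\<^sub>R vx t2 x (v t x))" using P(1) by simp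
    also have "\<dots> \<le> ?r"
    proof (rule mult_left_mono[OF _ P(2)])
      have V0: "V \<ge> 0" using V[of t2 x] t2 by (auto intro: order_trans[OF norm_ge_zero])
      have "norm (vx t2 x (v t x)) \<le> K * norm (v t x)" by (rule K)
      also have "\<dots> \<le> K * V" using V[of t x] tt t K(2) by (intro mult_left_mono) auto
      finally have "(t2 - t) * norm (vx t2 x (v t x)) \<le> (t2 - t1) * (K * V)"
        using tt t K(2) V0 by (intro mult_mono) auto
      then have "norm ((t2 - t) *\<^sub>R vx t2 x (v t x)) \<le> (t2 - t1) * K * V" using tt by simp
      then show "norm ((v t x - v t2 x) + (t2 - t) *\<^sub>R vx t2 x (v t x)) \<le> \<omega> + (t2 - t1) * K * V"
        using w[OF tt, of x] by (intro norm_triangle_mono)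
    qed
    finally show ?thesis .
  qed
  let ?B = "\<lambda>t. LINT x|torus L. \<rho> t x * ?R t x" and ?W = "\<lambda>t. LINT x|torus L. ?R t x"
  have cB: "continuous_on {0..t2} ?B"
    by (rule continuous_on_subset[OF weak_identity(2)[OF st t2]]) (use t2 in auto)
  have cR: "continuous_on UNIV (?R t)" if "0 \<le> t" "t < \<tau>" for t
    by (rule continuous_on_slice[OF material_derivative_continuous(1)[OF st]]) (use that in simp)
  have cW: "continuous_on {0..t2} ?W"
  proof -
    have "continuous_on {0..t2} (\<lambda>t. integral (cbox 0 (\<chi> i. L)) (?R t))"
    proof (rule integral_continuous_on_param)
      show "continuous_on ({0..t2} \<times> cbox 0 (\<chi> i. L)) (\<lambda>(t, x). ?R t x)"
        by (rule continuous_on_subset[OF material_derivative_continuous(1)[OF st]]) (use t2 in auto)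
    qed
    moreover have "?W t = integral (cbox 0 (\<chi> i. L)) (?R t)" if "t \<in> {0..t2}" for t
      using LINT_torus_eq_integral[OF integrable_torus_continuous[OF cR], of t L] that t2 by (simp add: cell_def)
    ultimately show ?thesis by (subst continuous_on_cong[OF refl]) assumption+
  qed
  have split: "integral {0..t2} f - integral {0..t1} f = integral {t1..t2} f" if "continuous_on {0..t2} f" for f :: "real \<Rightarrow> real"
  proof -
    have "integral {0..t1} f + integral {t1..t2} f = integral {0..t2} f"
      using t that by (intro Henstock_Kurzweil_Integration.integral_combine integrable_continuous_real) auto
    then show ?thesis by linarith
  qed
  have A: "(LINT x|torus L. \<rho> t2 x * ?c t2 x) - (LINT x|torus L. \<rho> t1 x * ?c t1 x) = integral {t1..t2} ?B"
    using split[OF cB] weak_identity(1)[OF st t2] weak_identity(1)[OF st t1] by linarith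
  have Q: "(LINT x|torus L. ?c t2 x) - (LINT x|torus L. ?c t1 x) = integral {t1..t2} ?W"
    using split[OF cW] volume_identity[OF st t2] volume_identity[OF st t1] by linarith
  have sub: "{t1..t2} \<subseteq> {0..t2}" using t by auto
  have r0: "?r \<ge> 0" using R[of t2] t by (auto intro: order_trans[OF abs_ge_zero])
  have "\<bar>integral {t1..t2} (\<lambda>t. ?W t - s * ?B t)\<bar> \<le> integral {t1..t2} (\<lambda>t. (L ^ CARD('n) + C) * ?r)"
  proof (rule integral_abs_le)
    fix t assume "t \<in> {t1..t2}"
    then have tt: "t1 \<le> t" "t \<le> t2" "0 \<le> t" "t < \<tau>" using t by auto
    have one: "integrable (torus L) (\<lambda>x::real^'n. 1 :: real)" by (intro integrable_torus_continuous continuous_intros)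
    have "\<bar>?W t\<bar> \<le> ?r * L ^ CARD('n)"
      using torus_integral_mult_bound[OF one R[OF tt(1,2)]] torus_integral_const[OF L, of 1, where 'n='n] by simp
    moreover have "\<bar>?B t\<bar> \<le> ?r * C"
      by (rule order_trans[OF torus_integral_mult_bound[OF rho_int[OF tt(3,4)] R[OF tt(1,2)]] mult_left_mono[OF C[OF tt(3,4)] r0]])
    moreover have "\<bar>s * ?B t\<bar> \<le> 1 * \<bar>?B t\<bar>" unfolding abs_mult using s by (intro mult_right_mono) auto
    ultimately show "\<bar>?W t - s * ?B t\<bar> \<le> (L ^ CARD('n) + C) * ?r" by (simp add: algebra_simps)
  qed (intro continuous_intros continuous_on_subset[OF cB sub] continuous_on_subset[OF cW sub])+
  also have "\<dots> = (t2 - t1) * ((L ^ CARD('n) + C) * ?r)" using t by simp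
  also have "integral {t1..t2} (\<lambda>t. ?W t - s * ?B t) = integral {t1..t2} ?W - integral {t1..t2} (\<lambda>t. s * ?B t)"
    by (intro Henstock_Kurzweil_Integration.integral_diff integrable_continuous_real continuous_intros
        continuous_on_subset[OF cB sub] continuous_on_subset[OF cW sub])
  finally have fin: "\<bar>((LINT x|torus L. ?c t2 x) - (LINT x|torus L. ?c t1 x)) - s * ((LINT x|torus L. \<rho> t2 x * ?c t2 x) - (LINT x|torus L. \<rho> t1 x * ?c t1 x))\<bar>
      \<le> (t2 - t1) * ((L ^ CARD('n) + C) * ?r)"
    unfolding A Q by simp
  have "?c t2 x = \<phi> x" for x by simp
  then show ?thesis using fin unfolding right_diff_distrib abs_le_iff by simp
qed

lemma initial_pairing:
  assumes phi: "smooth_on UNIV \<phi>" "periodic L \<phi>" "\<And>y. (\<phi> has_derivative D y) (at y)" "\<And>h. continuous_on UNIV (\<lambda>y. D y h)"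
  shows "(LINT x|torus L. \<rho> 0 x * \<phi> x) = (LINT x|torus L. \<rho>0 x * \<phi> x)"
proof -
  have "spacetime_test L (\<lambda>t x. \<phi> (x + (0 - t) *\<^sub>R 0)) (\<lambda>t x. D (x + (0 - t) *\<^sub>R 0) (- 0)) (\<lambda>t x h. D (x + (0 - t) *\<^sub>R 0) (h + (0 - t) *\<^sub>R 0))"
    by (rule moving_test[OF phi, where u="\<lambda>x. 0" and U="\<lambda>x h. 0"])
      (auto simp: periodic_def intro: smooth_on_const)
  from weak_identity(1)[OF this, of 0] tau show ?thesis by simp
qed

lemma rho_mean: "0 \<le> t \<Longrightarrow> t < \<tau> \<Longrightarrow> (LINT x|torus L. \<rho> t x) = 0"
proof -
  assume t: "0 \<le> t" "t < \<tau>"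
  have "spacetime_test L (\<lambda>t x::real^'n. 1) (\<lambda>t x. 0) (\<lambda>t x h. 0)"
    by standard (auto simp: periodic_def case_prod_unfold intro: smooth_on_const)
  from weak_identity(1)[OF this t] show ?thesis using rho0_mean by simp
qed

text \<open>Transporting the test function backwards in \<open>N\<close> small steps keeps it nonnegative and reduces the claim to the initial
  time, where \<open>\<bar>\<rho>0\<bar> \<le> 1\<close>. The gradient of the test function grows by a factor \<open>1 + h K\<close> in each step, hence at most
  exponentially, and the accumulated error tends to zero with the step size. This replaces the flow of the velocity field.\<close>

lemma rho_test_bound:
  assumes t0: "0 \<le> t0" "t0 < \<tau>" and s: "\<bar>s\<bar> \<le> 1"
    and phi: "smooth_on UNIV \<phi>" "periodic L \<phi>" "\<And>x. 0 \<le> \<phi> x"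
  shows "(LINT x|torus L. \<phi> x) - s * (LINT x|torus L. \<rho> t0 x * \<phi> x) \<ge> 0"
proof -
  obtain V K where V: "V \<ge> 0" "K \<ge> 0" "\<And>t x. 0 \<le> t \<Longrightarrow> t \<le> t0 \<Longrightarrow> norm (v t x) \<le> V"
    "\<And>t x h. 0 \<le> t \<Longrightarrow> t \<le> t0 \<Longrightarrow> norm (vx t x h) \<le> K * norm h" using velocity_bounds[OF t0(2)] by blast
  obtain C where C: "C \<ge> 0" "\<And>t. 0 \<le> t \<Longrightarrow> t < \<tau> \<Longrightarrow> (LINT x|torus L. \<bar>\<rho> t x\<bar>) \<le> C" using rho_mass_bound by metis
  obtain D where D: "\<And>x. (\<phi> has_derivative D x) (at x)" "\<And>h. continuous_on UNIV (\<lambda>x. D x h)"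
    using smooth_on_derivative_exists[OF phi(1)] by (metis UNIV_I)
  have "\<exists>B\<ge>0. \<forall>x. norm (D x (axis i 1)) \<le> B" for i
  proof (rule periodic_bounded_torus[OF L periodic_has_derivative[OF phi(2) D(1)] D(2)])
    fix B assume "\<And>x. \<bar>D x (axis i 1)\<bar> \<le> B" "B \<ge> 0"
    then show ?thesis by (intro exI[of _ B]) simp
  qed
  then obtain Bi where Bi: "\<And>i. Bi i \<ge> 0" "\<And>i x. norm (D x (axis i 1)) \<le> Bi i" by metis
  define P where "P = (\<Sum>i\<in>UNIV. Bi i)"
  have P: "P \<ge> 0" "\<And>x h. \<bar>D x h\<bar> \<le> P * norm h"
    using Bi(1) norm_derivative_le[OF D(1) Bi(2)] by (auto simp: P_def sum_nonneg)
  define C' where "C' = L ^ CARD('n) + C"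
  have C': "C' \<ge> 0" using C(1) L by (simp add: C'_def)
  have main: "(LINT x|torus L. \<phi> x) - s * (LINT x|torus L. \<rho> t0 x * \<phi> x) \<ge> - (t0 * C' * exp (K * t0) * P) * (\<omega> + \<omega> * K * V)"
    if w: "\<omega> > 0" for \<omega>
  proof -
    obtain \<delta> where \<delta>: "\<delta> > 0" "\<And>t s x. 0 \<le> t \<Longrightarrow> t \<le> t0 \<Longrightarrow> 0 \<le> s \<Longrightarrow> s \<le> t0 \<Longrightarrow> \<bar>t - s\<bar> < \<delta> \<Longrightarrow> norm (v t x - v s x) \<le> \<omega>"
      using velocity_time_modulus[OF t0(2) w] by blast
    obtain N :: nat where N: "t0 / min \<delta> \<omega> < real N" using reals_Archimedean2 by blast
    have "0 \<le> t0 / min \<delta> \<omega>" using t0 \<delta>(1) w by simp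
    then have N0: "0 < real N" using N by linarith
    define h where "h = t0 / real N"
    have "t0 < real N * min \<delta> \<omega>" using N \<delta>(1) w by (simp add: pos_divide_less_eq)
    then have "h < min \<delta> \<omega>" unfolding h_def pos_divide_less_eq[OF N0] by (simp only: mult.commute)
    then have h: "0 \<le> h" "h < \<delta>" "h \<le> \<omega>" using t0 N0 by (auto simp: h_def)
    have Nh: "real N * h = t0" using N0 by (simp add: h_def)
    let ?q = "\<omega> + h * K * V"
    have q0: "?q \<ge> 0" using w h V by simp
    \<comment> \<open>The test function is generalised: each step replaces it by its displaced version.\<close>
    have ind: "k \<le> N \<Longrightarrow> smooth_on UNIV f \<Longrightarrow> periodic L f \<Longrightarrow> (\<And>x. 0 \<le> f x) \<Longrightarrow> (\<And>x. (f has_derivative F x) (at x)) \<Longrightarrow>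
        (\<And>h. continuous_on UNIV (\<lambda>x. F x h)) \<Longrightarrow> (\<And>x h. \<bar>F x h\<bar> \<le> p * norm h) \<Longrightarrow> p \<ge> 0 \<Longrightarrow>
        (LINT x|torus L. f x) - s * (LINT x|torus L. \<rho> (real k * h) x * f x) \<ge> - (real k * h * C' * (1 + h * K) ^ k * p) * ?q" for k f F p
    proof (induction k arbitrary: f F p)
      case 0
      have cf: "continuous_on UNIV f" by (rule smooth_on_imp_continuous_on[OF 0(2)])
      have i: "integrable (torus L) (\<lambda>x. \<rho>0 x * f x)" by (rule integrable_torus_continuous_mult[OF rho0 cf])
      have "0 \<le> (LINT x|torus L. f x - s * (\<rho>0 x * f x))"
      proof (rule integral_nonneg_AE)
        show "AE x in torus L. 0 \<le> f x - s * (\<rho>0 x * f x)"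
          using rho0_bd
        proof eventually_elim
          case (elim x)
          have "\<bar>s\<bar> * \<bar>\<rho>0 x\<bar> \<le> 1 * 1" using s elim by (intro mult_mono) auto
          then have "s * \<rho>0 x \<le> 1" by (simp add: abs_mult[symmetric] abs_le_iff)
          then have "(s * \<rho>0 x) * f x \<le> 1 * f x" using 0(4)[of x] by (intro mult_right_mono)
          then show ?case by (simp add: mult.assoc)
        qed
      qed
      also have "\<dots> = (LINT x|torus L. f x) - s * (LINT x|torus L. \<rho>0 x * f x)"
        using Bochner_Integration.integral_diff[OF integrable_torus_continuous[OF cf], of L "\<lambda>x. s * (\<rho>0 x * f x)"] i by simp
      finally show ?case using initial_pairing[OF 0(2,3,5,6)] by simp
    next
      case (Suc k)
      let ?t2 = "real (Suc k) * h" and ?t1 = "real k * h"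
      have diff: "?t2 - ?t1 = h" by (simp add: algebra_simps)
      have le: "?t2 \<le> t0" using Suc.prems(1) h(1) Nh mult_right_mono[of "real (Suc k)" "real N" h] by simp
      have t2: "0 \<le> ?t1" "?t1 \<le> ?t2" "?t2 < \<tau>" "0 \<le> ?t2" using h(1) le t0 by (auto intro: mult_right_mono)
      have cvx: "continuous_on UNIV (\<lambda>y. vx ?t2 y a)" for a by (rule continuous_on_slice[OF vx_cont]) (use t2 in simp)
      let ?f = "\<lambda>x. f (x + h *\<^sub>R v ?t2 x)" and ?F = "\<lambda>x a. F (x + h *\<^sub>R v ?t2 x) (a + h *\<^sub>R vx ?t2 x a)"
      have st: "spacetime_test L (\<lambda>t x. f (x + (?t2 - t) *\<^sub>R v ?t2 x)) (\<lambda>t x. F (x + (?t2 - t) *\<^sub>R v ?t2 x) (- v ?t2 x))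
          (\<lambda>t x a. F (x + (?t2 - t) *\<^sub>R v ?t2 x) (a + (?t2 - t) *\<^sub>R vx ?t2 x a))"
        by (rule moving_test[OF Suc.prems(2,3,5,6) v_smooth_space[OF t2(4,3)] v_per[OF t2(4,3)] vx_deriv[OF t2(4,3)] cvx])
      have sf: "smooth_on UNIV ?f"
        by (intro smooth_on_compose_UNIV[OF _ Suc.prems(2)] smooth_on_add smooth_on_ident smooth_on_scaleR smooth_on_const
            v_smooth_space[OF t2(4,3)])
      have pf: "periodic L ?f" using spacetime_test.cper[OF st, of ?t1] unfolding diff .
      have df: "(?f has_derivative ?F x) (at x)" for x using spacetime_test.dx[OF st, of ?t1 x] unfolding diff .
      have cF: "continuous_on UNIV (\<lambda>x. ?F x a)" for a
        using continuous_on_slice[of UNIV, unfolded UNIV_Times_UNIV, OF spacetime_test.cx_cont[OF st, of a] UNIV_I, of ?t1] unfolding diff .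
      have bF: "\<bar>?F x a\<bar> \<le> (p * (1 + h * K)) * norm a" for x a
      proof -
        have "norm (a + h *\<^sub>R vx ?t2 x a) \<le> norm a + h * (K * norm a)"
          using V(4)[OF t2(4) le, of x a] h(1) by (intro norm_triangle_mono) (auto intro: mult_left_mono)
        then have "p * norm (a + h *\<^sub>R vx ?t2 x a) \<le> p * (norm a + h * (K * norm a))"
          using Suc.prems(8) by (intro mult_left_mono)
        then show ?thesis using Suc.prems(7)[of "x + h *\<^sub>R v ?t2 x" "a + h *\<^sub>R vx ?t2 x a"] by (simp add: algebra_simps)
      qed
      have IH: "(LINT x|torus L. ?f x) - s * (LINT x|torus L. \<rho> ?t1 x * ?f x) \<ge> - (?t1 * C' * (1 + h * K) ^ k * (p * (1 + h * K))) * ?q"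
        by (rule Suc.IH[OF _ sf pf _ df cF bF]) (use Suc.prems V(2) h(1) in auto)
      have step: "(LINT x|torus L. f x) - s * (LINT x|torus L. \<rho> ?t2 x * f x)
        \<ge> (LINT x|torus L. ?f x) - s * (LINT x|torus L. \<rho> ?t1 x * ?f x) - h * (C' * (p * ?q))"
      proof -
        have "norm (v t x - v ?t2 x) \<le> \<omega>" if "?t1 \<le> t" "t \<le> ?t2" for t x
        proof (rule \<delta>(2))
          show "0 \<le> t" "t \<le> t0" using that t2(1) le by linarith+
          show "\<bar>t - ?t2\<bar> < \<delta>" using that diff h(2) by linarith
        qed (use t2 le in auto)
        from transport_step[OF t2(1,2,3) s Suc.prems(2,3,5,6,7,8) _ V(4)[OF t2(4) le] V(2) this C(2), of V]
        show ?thesis unfolding diff C'_def[symmetric] using V(3) le by force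
      qed
      have g1: "(1 + h * K) ^ Suc k \<ge> 1" using h(1) V(2) by (intro one_le_power) simp
      have "h * (C' * (p * ?q)) * 1 \<le> h * (C' * (p * ?q)) * (1 + h * K) ^ Suc k"
        using h(1) C' Suc.prems(8) q0 by (intro mult_left_mono[OF g1] mult_nonneg_nonneg) auto
      then have "- (?t1 * C' * (1 + h * K) ^ k * (p * (1 + h * K))) * ?q - h * (C' * (p * ?q))
          \<ge> - (?t1 * C' * (1 + h * K) ^ k * (p * (1 + h * K))) * ?q - h * (C' * (p * ?q)) * (1 + h * K) ^ Suc k" by simp
      also have "- (?t1 * C' * (1 + h * K) ^ k * (p * (1 + h * K))) * ?q - h * (C' * (p * ?q)) * (1 + h * K) ^ Suc k
          = - (?t2 * C' * (1 + h * K) ^ Suc k * p) * ?q" by (simp add: algebra_simps)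
      finally show ?case using IH step by linarith
    qed
    have "- (t0 * C' * (1 + h * K) ^ N * P) * ?q \<le> (LINT x|torus L. \<phi> x) - s * (LINT x|torus L. \<rho> t0 x * \<phi> x)"
      using ind[OF order_refl phi D P(2) P(1)] unfolding Nh .
    then have "- (t0 * C' * (1 + h * K) ^ N * P * ?q) \<le> (LINT x|torus L. \<phi> x) - s * (LINT x|torus L. \<rho> t0 x * \<phi> x)"
      unfolding minus_mult_left .
    moreover have "t0 * C' * (1 + h * K) ^ N * P * ?q \<le> t0 * C' * exp (K * t0) * P * (\<omega> + \<omega> * K * V)"
    proof -
      have "(1 + h * K) ^ N \<le> exp (h * K) ^ N" using h(1) V(2) by (intro power_mono) (auto simp: exp_ge_add_one_self)
      also have "\<dots> = exp (real N * (h * K))" by (rule exp_of_nat_mult[symmetric])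
      also have "real N * (h * K) = K * t0" unfolding Nh[symmetric] by (simp only: ac_simps)
      finally have 1: "(1 + h * K) ^ N \<le> exp (K * t0)" .
      have 2: "?q \<le> \<omega> + \<omega> * K * V" using h(3) V(1,2) by (intro add_left_mono mult_right_mono)
      show ?thesis
      proof (rule mult_mono[OF _ 2 _ q0])
        show "t0 * C' * (1 + h * K) ^ N * P \<le> t0 * C' * exp (K * t0) * P"
          using t0(1) C' P(1) by (intro mult_right_mono mult_left_mono 1 mult_nonneg_nonneg)
        show "0 \<le> t0 * C' * exp (K * t0) * P"
          using t0(1) C' P(1) by (intro mult_nonneg_nonneg) auto
      qed
    qed
    ultimately show ?thesis unfolding minus_mult_left[symmetric] by (rule order_trans[OF le_imp_neg_le, rotated])
  qed
  let ?M = "t0 * C' * exp (K * t0) * P * (1 + K * V)"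
  have M0: "?M \<ge> 0" using t0 C' P(1) V by simp
  have "0 \<le> (LINT x|torus L. \<phi> x) - s * (LINT x|torus L. \<rho> t0 x * \<phi> x)"
  proof (rule field_le_epsilon)
    fix e :: real assume e: "e > 0"
    then have "e / (?M + 1) > 0" using M0 by simp
    from main[OF this]
    have "- (t0 * C' * exp (K * t0) * P * (e / (?M + 1) + e / (?M + 1) * K * V)) \<le> (LINT x|torus L. \<phi> x) - s * (LINT x|torus L. \<rho> t0 x * \<phi> x)"
      unfolding minus_mult_left .
    moreover have "t0 * C' * exp (K * t0) * P * (d + d * K * V) = ?M * d" for d by (simp add: algebra_simps)
    ultimately have "- (?M * (e / (?M + 1))) \<le> (LINT x|torus L. \<phi> x) - s * (LINT x|torus L. \<rho> t0 x * \<phi> x)" by (simp only:)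
    moreover have "?M * (e / (?M + 1)) \<le> e" using M0 e by (simp add: field_simps)
    ultimately show "0 \<le> (LINT x|torus L. \<phi> x) - s * (LINT x|torus L. \<rho> t0 x * \<phi> x) + e" by linarith
  qed
  then show ?thesis .
qed

text \<open>Applied to \<open>1 - \<rho>\<close> and \<open>1 + \<rho>\<close>, \<open>rho_test_bound\<close> is nonnegativity against all nonnegative trigonometric polynomials.\<close>

lemma maximum_principle:
  assumes t: "0 \<le> t" "t < \<tau>"
  shows "AE x in torus L. \<bar>\<rho> t x\<bar> \<le> 1"
proof -
  have *: "AE x in torus L. 0 \<le> 1 - s * \<rho> t x" if s: "\<bar>s\<bar> \<le> 1" for s
  proof (rule AE_nonneg_if_trig_nonneg[OF L])
    have one: "integrable (torus L) (\<lambda>x::real^'n. 1 :: real)" by (intro integrable_torus_continuous continuous_intros)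
    then show "integrable (torus L) (\<lambda>x. 1 - s * \<rho> t x)" using rho_int[OF t] by simp
    fix p :: "real^'n \<Rightarrow> real" assume p: "trig L p" "\<And>x. 0 \<le> p x"
    have cp: "continuous_on UNIV p" by (rule smooth_on_imp_continuous_on[OF trig_smooth[OF p(1)]])
    have "(LINT x|torus L. (1 - s * \<rho> t x) * p x) = (LINT x|torus L. p x - s * (\<rho> t x * p x))"
      by (simp add: algebra_simps)
    also have "\<dots> = (LINT x|torus L. p x) - s * (LINT x|torus L. \<rho> t x * p x)"
      using Bochner_Integration.integral_diff[OF integrable_torus_continuous[OF cp], of L "\<lambda>x. s * (\<rho> t x * p x)"]
        integrable_torus_continuous_mult[OF rho_int[OF t] cp] by simp
    finally show "0 \<le> (LINT x|torus L. (1 - s * \<rho> t x) * p x)"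
      using rho_test_bound[OF t s trig_smooth[OF p(1)] trig_periodic[OF p(1) L] p(2)] by simp
  qed
  have "AE x in torus L. 0 \<le> 1 - 1 * \<rho> t x" "AE x in torus L. 0 \<le> 1 - (- 1) * \<rho> t x" by (rule *, simp)+
  then show ?thesis by eventually_elim (simp add: abs_le_iff)
qed

end

section \<open>Evolution of the profile energy\<close>

text \<open>\<open>F t\<close> is the profile at time \<open>t\<close>, \<open>Zt\<close> its energy and \<open>b\<close> the time derivative of \<open>F\<close>.\<close>

locale mixing = transport L E \<tau> v \<rho>0 \<rho> for L E \<tau> v \<rho>0 and \<rho> :: "real \<Rightarrow> real^'n \<Rightarrow> real" +
  fixes \<epsilon> :: real and i :: 'n and \<eta> \<Lambda> :: "real \<Rightarrow> real"
  assumes S: "smoothing L \<epsilon> \<eta> \<Lambda>"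
begin

definition F :: "real \<Rightarrow> real \<Rightarrow> real" where
  "F t = profile.f L i \<Lambda> (\<rho> t)"

definition b :: "real \<Rightarrow> real \<Rightarrow> real" where
  "b t s = - smoothing.conv L i (\<lambda>y. \<eta> y - 1 / L) (\<lambda>x. \<rho> t x * v t x $ i) s"

definition Zt :: "real \<Rightarrow> real" where
  "Zt t = profile.Z L i \<Lambda> (\<rho> t)"

lemmas eta_cont = smoothing.eta_cont[OF S] and Lam_cont = smoothing.Lam_cont[OF S]

lemma profile_at: "0 \<le> t \<Longrightarrow> t < \<tau> \<Longrightarrow> profile L \<epsilon> \<eta> \<Lambda> (\<rho> t)"
  unfolding profile_def profile_axioms_def using S rho_int maximum_principle rho_mean by blast

lemma profile_initial: "profile L \<epsilon> \<eta> \<Lambda> \<rho>0"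
  unfolding profile_def profile_axioms_def using S rho0 rho0_bd rho0_mean by blast

lemma F_conv: "0 \<le> t \<Longrightarrow> t < \<tau> \<Longrightarrow> F t s = L / L ^ CARD('n) * (LINT x|torus L. \<rho> t x * \<Lambda> (s - x $ i))"
  unfolding F_def using profile.f_def[OF profile_at, of t i] smoothing.conv_def[OF S, of i \<Lambda> "\<rho> t" s] by simp

lemma b_conv: "b t s = - (L / L ^ CARD('n) * (LINT x|torus L. (\<rho> t x * v t x $ i) * (\<eta> (s - x $ i) - 1 / L)))"
  unfolding b_def smoothing.conv_def[OF S] ..

lemma sawtooth_test:
  "spacetime_test L (\<lambda>t x. \<Lambda> (s - x $ i)) (\<lambda>t x. 0) (\<lambda>t x h. - ((\<eta> (s - x $ i) - 1 / L) * h $ i))"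
proof
  have "smooth_on UNIV (\<lambda>p::real \<times> (real^'n). s + (- 1) * (snd p $ i))"
    by (intro smooth_on_add smooth_on_const smooth_on_mult smooth_on_linear
        bounded_linear_compose[OF bounded_linear_vec_nth bounded_linear_snd])
  from smooth_on_compose_UNIV[OF this smoothing.Lam_smooth[OF S]]
  show "smooth_on UNIV (\<lambda>(t::real, x). \<Lambda> (s - x $ i))" by (simp add: case_prod_unfold)
  show "periodic L (\<lambda>x. \<Lambda> (s - x $ i))" for t :: real
  proof (rule periodic_coordinate[of "\<lambda>y. \<Lambda> (s - y)"])
    show "\<Lambda> (s - (y + L)) = \<Lambda> (s - y)" for y using smoothing.Lam_per[OF S, of "s - (y + L)"] by simp
  qed
  show "((\<lambda>t. \<Lambda> (s - x $ i)) has_real_derivative 0) (at t)" for t x by simp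
  show "((\<lambda>x. \<Lambda> (s - x $ i)) has_derivative (\<lambda>h. - ((\<eta> (s - x $ i) - 1 / L) * h $ i))) (at x)" for t :: real and x
  proof -
    have "((\<lambda>y. \<Lambda> (s - y)) has_real_derivative (\<eta> (s - y) - 1 / L) * - 1) (at y)" for y
      by (rule DERIV_chain2[OF smoothing.Lam_deriv[OF S]]) (auto intro!: derivative_eq_intros)
    then have "((\<lambda>x. \<Lambda> (s - x $ i)) has_derivative (\<lambda>h. (\<eta> (s - x $ i) - 1 / L) * - 1 * h $ i)) (at x)"
      by (rule has_derivative_coordinate[where g'="\<lambda>y. (\<eta> (s - y) - 1 / L) * - 1"])
    then show ?thesis by (simp only: mult_minus_right mult_minus_left mult_1_right)
  qed
  have ck: "continuous_on UNIV (\<lambda>p::real \<times> (real^'n). \<eta> (s - snd p $ i))"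
    by (rule continuous_on_compose2[OF eta_cont]) (auto intro!: continuous_intros)
  show "continuous_on UNIV (\<lambda>(t::real, x). - ((\<eta> (s - x $ i) - 1 / L) * h $ i))" for h :: "real^'n"
    unfolding case_prod_unfold by (intro continuous_intros ck)
qed auto

lemma v_int: "0 \<le> t \<Longrightarrow> t < \<tau> \<Longrightarrow> integrable (torus L) (\<lambda>x. \<rho> t x * v t x $ i)"
  by (intro integrable_torus_continuous_mult rho_int continuous_on_component v_cont_space)

lemma b_cont: "continuous_on ({0..<\<tau>} \<times> UNIV) (\<lambda>(t, s). b t s)"
proof -
  have "continuous_on ({0..<\<tau>} \<times> UNIV) (\<lambda>p. LINT x|torus L. \<rho> (fst p) x * (v (fst p) x $ i * (\<eta> (snd p - x $ i) - 1 / L)))"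
  proof (rule pairing_continuous[of _ "\<lambda>p x. v (fst p) x $ i * (\<eta> (snd p - x $ i) - 1 / L)" fst])
    have 1: "continuous_on (({0..<\<tau>} \<times> UNIV) \<times> UNIV) (\<lambda>q::(real \<times> real) \<times> (real^'n). (\<lambda>(t, x). v t x) (fst (fst q), snd q))"
      by (rule continuous_on_compose2[OF v_cont]) (auto intro!: continuous_intros)
    have 2: "continuous_on (({0..<\<tau>} \<times> UNIV) \<times> UNIV) (\<lambda>q::(real \<times> real) \<times> (real^'n). \<eta> (snd (fst q) - snd q $ i))"
      by (rule continuous_on_compose2[OF eta_cont]) (auto intro!: continuous_intros)
    show "continuous_on (({0..<\<tau>} \<times> UNIV) \<times> UNIV) (\<lambda>(p::real \<times> real, x). v (fst p) x $ i * (\<eta> (snd p - x $ i) - 1 / L))"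
      unfolding case_prod_unfold
      by (intro continuous_on_mult continuous_on_diff continuous_on_const 2 continuous_on_component 1[unfolded prod.case])
    fix p :: "real \<times> real" assume "p \<in> {0..<\<tau>} \<times> UNIV"
    then have p: "0 \<le> fst p" "fst p < \<tau>" by auto
    show "periodic L (\<lambda>x. v (fst p) x $ i * (\<eta> (snd p - x $ i) - 1 / L))"
      unfolding periodic_def
    proof (intro allI)
      fix x j
      have "\<eta> (snd p - (x + axis j L) $ i) = \<eta> (snd p - x $ i)"
        using periodic_coordinate[of "\<lambda>y. \<eta> (snd p - y)" L i] smoothing.eta_per[OF S, of "snd p - (_ + L)"]
        unfolding periodic_def by simp
      then show "v (fst p) (x + axis j L) $ i * (\<eta> (snd p - (x + axis j L) $ i) - 1 / L) = v (fst p) x $ i * (\<eta> (snd p - x $ i) - 1 / L)"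
        using v_per[OF p] unfolding periodic_def by metis
    qed
  qed (auto intro!: continuous_intros)
  then have "continuous_on ({0..<\<tau>} \<times> UNIV) (\<lambda>p. - (L / L ^ CARD('n) * (LINT x|torus L. \<rho> (fst p) x * (v (fst p) x $ i * (\<eta> (snd p - x $ i) - 1 / L)))))"
    by (intro continuous_on_minus continuous_on_mult continuous_on_const)
  then show ?thesis unfolding case_prod_unfold b_conv mult.assoc .
qed

lemma F_cont: "continuous_on ({0..<\<tau>} \<times> UNIV) (\<lambda>(t, s). F t s)"
proof -
  have "continuous_on ({0..<\<tau>} \<times> UNIV) (\<lambda>p. LINT x|torus L. \<rho> (fst p) x * \<Lambda> (snd p - x $ i))"
  proof (rule pairing_continuous[of _ "\<lambda>p x. \<Lambda> (snd p - x $ i)" fst])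
    have "continuous_on (({0..<\<tau>} \<times> UNIV) \<times> UNIV) (\<lambda>q::(real \<times> real) \<times> (real^'n). \<Lambda> (snd (fst q) - snd q $ i))"
      by (rule continuous_on_compose2[OF Lam_cont]) (auto intro!: continuous_intros)
    then show "continuous_on (({0..<\<tau>} \<times> UNIV) \<times> UNIV) (\<lambda>(p::real \<times> real, x). \<Lambda> (snd p - x $ i))"
      unfolding case_prod_unfold .
    show "periodic L (\<lambda>x. \<Lambda> (snd p - x $ i))" for p :: "real \<times> real"
      by (rule spacetime_test.cper[OF sawtooth_test])
  qed (auto intro!: continuous_intros)
  then have "continuous_on ({0..<\<tau>} \<times> UNIV) (\<lambda>p. L / L ^ CARD('n) * (LINT x|torus L. \<rho> (fst p) x * \<Lambda> (snd p - x $ i)))"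
    by (intro continuous_on_mult continuous_on_const)
  then show ?thesis unfolding case_prod_unfold
    by (subst continuous_on_cong[OF refl]) (auto simp: F_conv)
qed

text \<open>The transport equation tested with the sawtooth kernel centred at \<open>s\<close>.\<close>

lemma F_integral:
  assumes t: "0 \<le> t" "t < \<tau>"
  shows "F t s = F 0 s + integral {0..t} (\<lambda>r. b r s)"
proof -
  let ?I = "\<lambda>r. LINT x|torus L. \<rho> r x * (0 + - ((\<eta> (s - x $ i) - 1 / L) * v r x $ i))"
  have bI: "b r s = L / L ^ CARD('n) * ?I r" for r
  proof -
    have "?I r = (LINT x|torus L. - ((\<rho> r x * v r x $ i) * (\<eta> (s - x $ i) - 1 / L)))"
      by (simp add: algebra_simps)
    then show ?thesis unfolding b_conv by simp
  qed
  have "integral {0..t} ?I = (LINT x|torus L. \<rho> t x * \<Lambda> (s - x $ i)) - (LINT x|torus L. \<rho>0 x * \<Lambda> (s - x $ i))"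
    by (rule weak_identity(1)[OF sawtooth_test t])
  moreover have "0 = (LINT x|torus L. \<rho> 0 x * \<Lambda> (s - x $ i)) - (LINT x|torus L. \<rho>0 x * \<Lambda> (s - x $ i))"
    using weak_identity(1)[OF sawtooth_test[of s], of 0] tau by simp
  ultimately have "integral {0..t} ?I = (LINT x|torus L. \<rho> t x * \<Lambda> (s - x $ i)) - (LINT x|torus L. \<rho> 0 x * \<Lambda> (s - x $ i))"
    by linarith
  then have "L / L ^ CARD('n) * integral {0..t} ?I = F t s - F 0 s"
    unfolding F_conv[OF t] F_conv[OF order_refl tau] by (simp only: right_diff_distrib)
  then show ?thesis unfolding bI by simp
qed

lemma Zt_0: "Zt 0 = profile.Z L i \<Lambda> \<rho>0"
proof -
  have "profile.f L i \<Lambda> (\<rho> 0) s = profile.f L i \<Lambda> \<rho>0 s" for s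
    unfolding profile.f_def[OF profile_initial] profile.f_def[OF profile_at[OF order_refl tau]] smoothing.conv_def[OF S]
    using weak_identity(1)[OF sawtooth_test[of s], of 0] tau by simp
  then show ?thesis
    unfolding Zt_def profile.Z_def[OF profile_initial] profile.Z_def[OF profile_at[OF order_refl tau]] by simp
qed

lemma F_time_derivative:
  assumes t: "0 \<le> t" "t \<le> t1" "t1 < \<tau>"
  shows "((\<lambda>r. F r s) has_real_derivative b t s) (at t within {0..t1})"
proof -
  have "continuous_on {0..t1} (\<lambda>r. (\<lambda>(t, s). b t s) (r, s))"
    by (rule continuous_on_compose2[OF b_cont]) (use t in \<open>auto intro!: continuous_intros\<close>)
  then have "((\<lambda>r. integral {0..r} (\<lambda>r. b r s)) has_vector_derivative b t s) (at t within {0..t1})"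
    using t by (intro integral_has_vector_derivative) auto
  then have "((\<lambda>r. integral {0..r} (\<lambda>r. b r s)) has_real_derivative b t s) (at t within {0..t1})"
    by (simp add: has_real_derivative_iff_has_vector_derivative)
  then have "((\<lambda>r. F 0 s + integral {0..r} (\<lambda>r. b r s)) has_real_derivative 0 + b t s) (at t within {0..t1})"
    by (intro DERIV_add DERIV_const)
  then have "((\<lambda>r. F 0 s + integral {0..r} (\<lambda>r. b r s)) has_real_derivative b t s) (at t within {0..t1})" by simp
  then show ?thesis
  proof (rule has_field_derivative_transform_within[where d=1])
    fix r assume "r \<in> {0..t1}"
    then have "0 \<le> r" "r < \<tau>" using t by auto
    then show "F 0 s + integral {0..r} (\<lambda>r. b r s) = F r s" by (rule F_integral[symmetric])
  qed (use t in auto)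
qed

lemma Zt_derivative:
  assumes t: "0 \<le> t" "t \<le> t1" "t1 < \<tau>"
  shows "(Zt has_real_derivative - 2 * (LINT x|torus L. (\<rho> t x * v t x $ i) * profile.g L i \<eta> \<Lambda> (\<rho> t) (x $ i))) (at t within {0..t1})"
proof -
  have t': "0 \<le> t" "t < \<tau>" using t by auto
  have co: "continuous_on ({0..t1} \<times> cell L) (\<lambda>p::real \<times> (real^'n). F (fst p) (snd p $ i))"
    "continuous_on ({0..t1} \<times> cell L) (\<lambda>p::real \<times> (real^'n). b (fst p) (snd p $ i))"
  proof -
    have "continuous_on ({0..t1} \<times> cell L) (\<lambda>p::real \<times> (real^'n). (\<lambda>(t, s). F t s) (fst p, snd p $ i))"
      by (rule continuous_on_compose2[OF F_cont]) (use t in \<open>auto intro!: continuous_intros\<close>)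
    then show "continuous_on ({0..t1} \<times> cell L) (\<lambda>p::real \<times> (real^'n). F (fst p) (snd p $ i))" by simp
    have "continuous_on ({0..t1} \<times> cell L) (\<lambda>p::real \<times> (real^'n). (\<lambda>(t, s). b t s) (fst p, snd p $ i))"
      by (rule continuous_on_compose2[OF b_cont]) (use t in \<open>auto intro!: continuous_intros\<close>)
    then show "continuous_on ({0..t1} \<times> cell L) (\<lambda>p::real \<times> (real^'n). b (fst p) (snd p $ i))" by simp
  qed
  have cF: "continuous_on UNIV (F r)" if "0 \<le> r" "r < \<tau>" for r
    by (rule continuous_on_slice[OF F_cont]) (use that in simp)
  have cb: "continuous_on UNIV (b r)" if "0 \<le> r" "r < \<tau>" for r
    by (rule continuous_on_slice[OF b_cont]) (use that in simp)
  have iF: "integrable (torus L) (\<lambda>x::real^'n. (F r (x $ i))\<^sup>2)" if "0 \<le> r" "r < \<tau>" for r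
    using that by (intro integrable_torus_continuous continuous_on_power continuous_on_coordinate cF)
  have "((\<lambda>r. integral (cbox 0 (\<chi> i. L)) (\<lambda>x::real^'n. (F r (x $ i))\<^sup>2)) has_field_derivative
      integral (cbox 0 (\<chi> i. L)) (\<lambda>x. 2 * F t (x $ i) * b t (x $ i))) (at t within {0..t1})"
  proof (rule leibniz_rule_field_derivative)
    fix r and x :: "real^'n" assume r: "r \<in> {0..t1}"
    have "((\<lambda>r. F r (x $ i)) has_real_derivative b r (x $ i)) (at r within {0..t1})"
      by (rule F_time_derivative) (use r t in auto)
    from DERIV_power[OF this, of 2]
    show "((\<lambda>r. (F r (x $ i))\<^sup>2) has_real_derivative 2 * F r (x $ i) * b r (x $ i)) (at r within {0..t1})"
      by (simp add: mult_ac)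
  next
    fix r assume r: "r \<in> {0..t1}"
    show "(\<lambda>x::real^'n. (F r (x $ i))\<^sup>2) integrable_on cbox 0 (\<chi> i. L)"
      using r t by (intro integrable_continuous continuous_on_subset[OF continuous_on_power[OF continuous_on_coordinate[OF cF]]]) auto
  next
    show "continuous_on ({0..t1} \<times> cbox 0 (\<chi> i. L)) (\<lambda>(r, x::real^'n). 2 * F r (x $ i) * b r (x $ i))"
      unfolding case_prod_unfold cell_def[symmetric] by (intro continuous_on_mult continuous_on_const co)
  qed (use t in auto)
  moreover have "Zt r = integral (cbox 0 (\<chi> i. L)) (\<lambda>x::real^'n. (F r (x $ i))\<^sup>2)" if "r \<in> {0..t1}" for r
    using LINT_torus_eq_integral[OF iF, of r] profile.Z_def[OF profile_at, of r i] that t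
    by (simp add: Zt_def F_def cell_def)
  ultimately have "(Zt has_real_derivative integral (cbox 0 (\<chi> i. L)) (\<lambda>x::real^'n. 2 * F t (x $ i) * b t (x $ i))) (at t within {0..t1})"
    using t by (intro has_field_derivative_transform_within[where d=1 and g=Zt]) auto
  also have "integral (cbox 0 (\<chi> i. L)) (\<lambda>x::real^'n. 2 * F t (x $ i) * b t (x $ i)) = (LINT x|torus L. 2 * F t ((x::real^'n) $ i) * b t (x $ i))"
  proof -
    have "integrable (torus L) (\<lambda>x::real^'n. 2 * F t (x $ i) * b t (x $ i))"
      by (intro integrable_torus_continuous continuous_on_mult continuous_on_const continuous_on_coordinate cF cb t')
    from LINT_torus_eq_integral[OF this] show ?thesis by (simp add: cell_def)
  qed
  also have "\<dots> = (LINT x|torus L. - 2 * (F t ((x::real^'n) $ i) * smoothing.conv L i (\<lambda>y. \<eta> y - 1 / L) (\<lambda>x. \<rho> t x * v t x $ i) (x $ i)))"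
    unfolding b_def by (simp add: algebra_simps)
  also have "\<dots> = - 2 * (LINT x|torus L. (\<rho> t x * v t x $ i) * profile.g L i \<eta> \<Lambda> (\<rho> t) (x $ i))"
    using profile.flux_adjoint[OF profile_at[OF t'] v_int[OF t']] unfolding F_def by simp
  finally show ?thesis .
qed

lemma velocity_component_energy:
  assumes t: "0 \<le> t" "t < \<tau>"
  shows "(LINT x|torus L. (v t x $ i)\<^sup>2) \<le> E"
proof -
  have "(LINT x|torus L. (v t x $ i)\<^sup>2) \<le> (LINT x|torus L. (norm (v t x))\<^sup>2)"
  proof (rule integral_mono)
    show "(v t x $ i)\<^sup>2 \<le> (norm (v t x))\<^sup>2" for x
      using power_mono[OF component_le_norm_cart[of "v t x" i] abs_ge_zero, of 2] by simp
  qed (intro integrable_torus_continuous continuous_on_power continuous_on_component continuous_on_norm v_cont_space t)+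
  then show ?thesis using v_energy[OF t] by linarith
qed

text \<open>Since \<open>v\<close> is divergence-free, \<open>v_i g g'\<close> has integral zero, being the derivative of \<open>g^2/2\<close> along \<open>v\<close>. So \<open>\<rho>\<close> may be replaced by
  \<open>\<rho> - g'\<close> before applying Cauchy and Schwarz.\<close>

lemma flux_bound:
  assumes t: "0 \<le> t" "t < \<tau>"
  shows "(LINT x|torus L. (\<rho> t x * v t x $ i) * profile.g L i \<eta> \<Lambda> (\<rho> t) (x $ i))\<^sup>2
    \<le> E * (LINT x|torus L. ((\<rho> t x - profile.g' L i \<eta> (\<rho> t) (x $ i)) * profile.g L i \<eta> \<Lambda> (\<rho> t) (x $ i))\<^sup>2)"
proof -
  note P = profile_at[OF t]
  define g g' where "g = profile.g L i \<eta> \<Lambda> (\<rho> t)" and "g' = profile.g' L i \<eta> (\<rho> t)"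
  have cg: "continuous_on UNIV g" and cg': "continuous_on UNIV g'"
    unfolding g_def g'_def by (rule profile.g_cont[OF P], rule profile.g'_cont[OF P])
  have gp: "g (y + L) = g y" for y unfolding g_def by (rule profile.g_per[OF P])
  have gd: "(g has_real_derivative g' y) (at y)" for y unfolding g_def g'_def by (rule profile.g_deriv[OF P])
  have cv: "continuous_on UNIV (\<lambda>x. v t x $ i)" by (intro continuous_on_component v_cont_space t)
  have zero: "(LINT x|torus L. g (x $ i) * g' (x $ i) * v t x $ i) = 0"
  proof (rule torus_integral_divergence_free[OF L vx_deriv[OF t] _ v_div[OF t] v_per[OF t]])
    show "continuous_on UNIV (\<lambda>x. vx t x h)" for h by (rule continuous_on_slice[OF vx_cont]) (use t in simp)
    have half: "((\<lambda>y. (g y)\<^sup>2 / 2) has_real_derivative g y * g' y) (at y)" for y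
      using DERIV_cdivide[OF DERIV_power[OF gd[of y], of 2], of 2] by (simp add: mult.commute)
    show "((\<lambda>x::real^'n. (g (x $ i))\<^sup>2 / 2) has_derivative (\<lambda>h. g (x $ i) * g' (x $ i) * h $ i)) (at x)" for x
      by (rule has_derivative_coordinate[where g'="\<lambda>y. g y * g' y"]) (rule half)
    show "continuous_on UNIV (\<lambda>x::real^'n. g (x $ i) * g' (x $ i) * h $ i)" for h :: "real^'n"
      by (intro continuous_on_mult continuous_on_const continuous_on_coordinate cg cg')
    show "periodic L (\<lambda>x::real^'n. (g (x $ i))\<^sup>2 / 2)"
      by (rule periodic_coordinate[of "\<lambda>y. (g y)\<^sup>2 / 2"]) (simp add: gp)
  qed
  let ?a = "\<lambda>x. v t x $ i" and ?b = "\<lambda>x. (\<rho> t x - g' (x $ i)) * g (x $ i)"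
  have rm: "\<rho> t \<in> borel_measurable (torus L)" using rho_int[OF t] by simp
  have mg: "(\<lambda>x::real^'n. g (x $ i)) \<in> borel_measurable (torus L)" "(\<lambda>x::real^'n. g' (x $ i)) \<in> borel_measurable (torus L)"
    by (intro measurable_torus_continuous continuous_on_coordinate cg cg')+
  have ma: "?a \<in> borel_measurable (torus L)" by (rule measurable_torus_continuous[OF cv])
  have mb: "?b \<in> borel_measurable (torus L)" using rm mg by measurable
  have ia: "integrable (torus L) (\<lambda>x. (?a x)\<^sup>2)" by (intro integrable_torus_continuous continuous_on_power cv)
  have ib: "integrable (torus L) (\<lambda>x. (?b x)\<^sup>2)"
  proof (rule finite_measure.integrable_const_bound[OF finite_measure_torus, where B="(2 * L)\<^sup>2"])
    show "AE x in torus L. norm ((?b x)\<^sup>2) \<le> (2 * L)\<^sup>2"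
      using maximum_principle[OF t]
    proof eventually_elim
      case (elim x)
      have "\<bar>\<rho> t x - g' (x $ i)\<bar> \<le> 2" using elim profile.g'_bd[OF P, of i "x $ i"] unfolding g'_def by linarith
      then have "\<bar>?b x\<bar> \<le> 2 * L" unfolding abs_mult
        using profile.g_bd[OF P, of i "x $ i"] unfolding g_def by (intro mult_mono) auto
      then have "\<bar>?b x\<bar>\<^sup>2 \<le> (2 * L)\<^sup>2" by (rule power_mono) simp
      then show ?case by simp
    qed
    show "(\<lambda>x. (?b x)\<^sup>2) \<in> borel_measurable (torus L)" using mb by measurable
  qed
  have "(LINT x|torus L. (\<rho> t x * v t x $ i) * g (x $ i)) = (LINT x|torus L. ?a x * ?b x) + (LINT x|torus L. g (x $ i) * g' (x $ i) * v t x $ i)"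
  proof (subst Bochner_Integration.integral_add[symmetric])
    show "integrable (torus L) (\<lambda>x. ?a x * ?b x)" by (rule integrable_mult_square[OF ma mb ia ib])
    show "integrable (torus L) (\<lambda>x. g (x $ i) * g' (x $ i) * v t x $ i)"
      by (intro integrable_torus_continuous continuous_on_mult continuous_on_coordinate cg cg' cv)
  qed (simp add: algebra_simps)
  then have "(LINT x|torus L. (\<rho> t x * v t x $ i) * g (x $ i))\<^sup>2 = (LINT x|torus L. ?a x * ?b x)\<^sup>2" using zero by simp
  also have "\<dots> \<le> (LINT x|torus L. (?a x)\<^sup>2) * (LINT x|torus L. (?b x)\<^sup>2)" by (rule Cauchy_Schwarz_integral[OF ma mb ia ib])
  also have "\<dots> \<le> E * (LINT x|torus L. (?b x)\<^sup>2)"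
    by (intro mult_right_mono velocity_component_energy t) simp
  finally show ?thesis unfolding g_def g'_def .
qed

end

section \<open>Comparison with the extremal evolution\<close>

text \<open>With \<open>s = sqrt (1 - w)\<close> this is \<open>2 s (1 - s)\<close>, a bound for the integral of \<open>g^2 (1 - g'^2)\<close> relative to
  the maximal energy, when the energy is the fraction \<open>w\<close> of the maximal one.\<close>

definition slope_gap :: "real \<Rightarrow> real" where
  "slope_gap w = 2 * (sqrt (1 - w) - (1 - w))"

text \<open>The function \<open>sqrt 2 S(\<alpha>(r))\<close> in the variable \<open>w = r^2\<close>.\<close>

definition mixing_potential :: "real \<Rightarrow> real" where
  "mixing_potential w = sqrt 2 * S_fun (sqrt (1 - sqrt (1 - w)))"

lemma slope_gap_nonneg: "0 \<le> w \<Longrightarrow> w \<le> 1 \<Longrightarrow> 0 \<le> slope_gap w"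
proof -
  assume w: "0 \<le> w" "w \<le> 1"
  have "(1 - w)\<^sup>2 \<le> 1 - w" using w by (simp add: power2_eq_square mult_left_le)
  then have "1 - w \<le> sqrt (1 - w)" by (rule real_le_rsqrt)
  then show ?thesis by (simp add: slope_gap_def)
qed

lemma slope_gap_half: "slope_gap (1 / 2) > 0"
proof -
  have "1 / 2 < sqrt (1 / 2)" by (rule real_less_rsqrt) (simp add: power2_eq_square)
  then show ?thesis by (simp add: slope_gap_def)
qed

lemma slope_gap_concave:
  assumes "0 \<le> a" "a \<le> 1" and t: "0 \<le> t" "t \<le> 1" and b: "0 \<le> b" "b \<le> 1"
  shows "(1 - t) * slope_gap a + t * slope_gap b \<le> slope_gap ((1 - t) * a + t * b)"
proof -
  define x y where "x = sqrt (1 - a)" and "y = sqrt (1 - b)"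
  have xy: "x\<^sup>2 = 1 - a" "y\<^sup>2 = 1 - b" using assms by (auto simp: x_def y_def)
  have "(1 - t) * x + t * y \<le> sqrt (1 - ((1 - t) * a + t * b))"
  proof (rule real_le_rsqrt)
    have "1 - ((1 - t) * a + t * b) = (1 - t) * x\<^sup>2 + t * y\<^sup>2" unfolding xy by (simp add: algebra_simps)
    moreover have "(1 - t) * x\<^sup>2 + t * y\<^sup>2 - ((1 - t) * x + t * y)\<^sup>2 = (1 - t) * t * (x - y)\<^sup>2"
      by (simp add: power2_eq_square algebra_simps)
    moreover have "0 \<le> (1 - t) * t * (x - y)\<^sup>2" using t by simp
    ultimately show "((1 - t) * x + t * y)\<^sup>2 \<le> 1 - ((1 - t) * a + t * b)" by linarith
  qed
  then show ?thesis unfolding slope_gap_def x_def y_def by (simp add: algebra_simps)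
qed

lemma mixing_potential_cont: "continuous_on {0..1} mixing_potential"
  unfolding mixing_potential_def S_fun_def
proof -
  let ?a = "\<lambda>w::real. sqrt (1 - sqrt (1 - w))"
  have ca: "continuous_on {0..1} ?a" by (intro continuous_intros)
  have ra: "\<forall>w\<in>{0..1}. -1 \<le> ?a w \<and> ?a w \<le> 1"
  proof
    fix w :: real assume w: "w \<in> {0..1}"
    have "0 \<le> 1 - sqrt (1 - w)" "1 - sqrt (1 - w) \<le> 1" using w by auto
    then have "0 \<le> ?a w" "?a w \<le> 1" by auto
    then show "-1 \<le> ?a w \<and> ?a w \<le> 1" by linarith
  qed
  have cas: "continuous_on {0..1} (\<lambda>w. arcsin (?a w))" by (rule continuous_on_arcsin[OF ca ra])
  show "continuous_on {0..1} (\<lambda>w. sqrt 2 * ((arcsin (?a w) + ?a w * sqrt (1 - (?a w)\<^sup>2)) / 2))"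
    by (intro continuous_on_mult continuous_on_divide continuous_on_add continuous_on_diff continuous_on_power
        continuous_on_real_sqrt continuous_on_const ca cas) auto
qed

lemma mixing_potential_0: "mixing_potential 0 = 0"
  by (simp add: mixing_potential_def S_fun_def)

lemma S_fun_deriv:
  assumes "-1 < a" "a < 1"
  shows "(S_fun has_real_derivative sqrt (1 - a\<^sup>2)) (at a)"
proof -
  have a2: "a\<^sup>2 < 1" using assms by (simp add: abs_square_less_1 abs_less_iff)
  define c where "c = sqrt (1 - a\<^sup>2)"
  have c: "c > 0" "c\<^sup>2 = 1 - a\<^sup>2" using a2 by (auto simp: c_def)
  have d1: "(arcsin has_real_derivative inverse c) (at a)" unfolding c_def by (rule DERIV_arcsin[OF assms])
  have "((\<lambda>a. 1 - a\<^sup>2) has_real_derivative - (2 * a)) (at a)" by (auto intro!: derivative_eq_intros)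
  from DERIV_chain2[OF DERIV_real_sqrt this] a2
  have d2: "((\<lambda>a. sqrt (1 - a\<^sup>2)) has_real_derivative inverse c / 2 * - (2 * a)) (at a)" by (simp add: c_def)
  have d3: "((\<lambda>a. (arcsin a + a * sqrt (1 - a\<^sup>2)) / 2) has_real_derivative (inverse c + (1 * sqrt (1 - a\<^sup>2) + (inverse c / 2 * - (2 * a)) * a)) / 2) (at a)"
    by (intro DERIV_cdivide DERIV_add DERIV_mult d1 d2 DERIV_ident)
  have eq: "(inverse c + (1 * sqrt (1 - a\<^sup>2) + (inverse c / 2 * - (2 * a)) * a)) / 2 = c"
  proof -
    have "inverse c + (inverse c / 2 * - (2 * a)) * a = inverse c * (1 - a\<^sup>2)" by (simp add: algebra_simps power2_eq_square)
    also have "\<dots> = c" unfolding c(2)[symmetric] using c(1) by (simp add: power2_eq_square)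
    finally show ?thesis by (simp add: c_def[symmetric])
  qed
  have "S_fun = (\<lambda>a. (arcsin a + a * sqrt (1 - a\<^sup>2)) / 2)" by (rule ext) (rule S_fun_def)
  then show ?thesis using DERIV_cong[OF d3 eq] unfolding c_def by (simp only:)
qed

text \<open>This identity is the origin of \<open>S\<close> and \<open>\<alpha>\<close>: the potential is the time that the extremal evolution with speed
  \<open>2 sqrt (slope_gap w)\<close> takes to reach zero.\<close>

lemma mixing_potential_deriv:
  assumes w: "0 < w" "w < 1"
  shows "(mixing_potential has_real_derivative 1 / (2 * sqrt (slope_gap w))) (at w)"
proof -
  define s where "s = sqrt (1 - w)"
  have s: "0 < s" "s < 1" "s\<^sup>2 = 1 - w" using w by (auto simp: s_def)
  define a where "a = sqrt (1 - s)"
  have a: "0 < a" "a < 1" "a\<^sup>2 = 1 - s" using s by (auto simp: a_def)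
  have d1: "((\<lambda>w. sqrt (1 - w)) has_real_derivative inverse s / 2 * - 1) (at w)"
    unfolding s_def by (rule DERIV_chain2[OF DERIV_real_sqrt]) (use w in \<open>auto intro!: derivative_eq_intros\<close>)
  have d2: "((\<lambda>w. sqrt (1 - sqrt (1 - w))) has_real_derivative inverse a / 2 * (0 - inverse s / 2 * - 1)) (at w)"
    unfolding a_def
  proof (rule DERIV_chain2[where f=sqrt])
    show "((\<lambda>w. 1 - sqrt (1 - w)) has_real_derivative 0 - inverse s / 2 * - 1) (at w)"
      by (rule DERIV_diff[OF DERIV_const d1])
    show "(sqrt has_real_derivative inverse (sqrt (1 - s)) / 2) (at (1 - sqrt (1 - w)))"
      using DERIV_real_sqrt[of "1 - s"] s by (simp add: s_def)
  qed
  have "sqrt (1 - sqrt (1 - w)) = a" by (simp add: a_def s_def)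
  then have S: "(S_fun has_real_derivative sqrt (1 - a\<^sup>2)) (at (sqrt (1 - sqrt (1 - w))))"
    using S_fun_deriv[of a, OF less_trans[OF _ a(1)] a(2)] by simp
  have D: "(mixing_potential has_real_derivative sqrt 2 * (sqrt (1 - a\<^sup>2) * (inverse a / 2 * (0 - inverse s / 2 * - 1)))) (at w)"
    unfolding mixing_potential_def by (intro DERIV_cmult DERIV_chain2[OF S d2])
  have "sqrt (slope_gap w) = sqrt 2 * (sqrt s * a)"
  proof -
    have "slope_gap w = 2 * (s * a\<^sup>2)" unfolding slope_gap_def s_def[symmetric] s(3)[symmetric] a(3)
      using s(1) by (simp add: power2_eq_square algebra_simps)
    then show ?thesis using a(1) by (simp add: real_sqrt_mult)
  qed
  moreover have "sqrt (1 - a\<^sup>2) = sqrt s" by (simp add: a(3))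
  moreover have "sqrt 2 * (sqrt s * (inverse a / 2 * (0 - inverse s / 2 * - 1))) = 1 / (2 * (sqrt 2 * (sqrt s * a)))"
  proof -
    have "sqrt 2 * (sqrt s * (inverse a / 2 * (0 - inverse s / 2 * - 1))) * (2 * (sqrt 2 * (sqrt s * a)))
      = (sqrt 2 * sqrt 2) * (sqrt s * sqrt s) * (inverse a * a) * inverse s / 2" by (simp add: mult_ac)
    also have "\<dots> = 1" using a(1) s(1) by simp
    finally show ?thesis using a(1) s(1) by (simp add: eq_divide_eq)
  qed
  ultimately show ?thesis using D by (simp only:)
qed

text \<open>The potential of \<open>w\<close> changes at most at speed \<open>k\<close>, but its derivative is singular at both ends and the rate bound carries an
  error \<open>\<omega>\<close>. Contracting \<open>w\<close> towards \<open>1/2\<close> cures both: concavity raises the slope gap by a multiple of \<open>\<delta>\<close>, which absorbs \<open>\<omega>\<close>.\<close>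

lemma mixing_comparison:
  assumes t: "0 \<le> t" and d: "\<And>r. r \<in> {0..t} \<Longrightarrow> (w has_real_derivative w' r) (at r within {0..t})"
    and w: "\<And>r. r \<in> {0..t} \<Longrightarrow> 0 \<le> w r" "\<And>r. r \<in> {0..t} \<Longrightarrow> w r \<le> 1"
    and bd: "\<And>r. r \<in> {0..t} \<Longrightarrow> (w' r)\<^sup>2 \<le> 4 * k\<^sup>2 * (slope_gap (w r) + \<omega>)"
    and k: "0 \<le> k" and dl: "0 < \<delta>" "\<delta> < 1" and om: "\<omega> \<le> \<delta> * slope_gap (1 / 2)" "0 \<le> \<omega>"
  shows "mixing_potential ((1 - \<delta>) * w 0 + \<delta> / 2) - mixing_potential ((1 - \<delta>) * w t + \<delta> / 2) \<le> k * t"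
proof -
  let ?u = "\<lambda>r. (1 - \<delta>) * w r + \<delta> / 2"
  have u: "0 < ?u r" "?u r < 1" if r: "r \<in> {0..t}" for r
  proof -
    have "0 \<le> (1 - \<delta>) * w r" using w(1)[OF r] dl by simp
    then show "0 < ?u r" using dl by linarith
    have "(1 - \<delta>) * w r \<le> 1 - \<delta>" using w(2)[OF r] dl by (intro mult_left_le) auto
    then show "?u r < 1" using dl(1) by (simp only:)
  qed
  have D: "((\<lambda>r. mixing_potential (?u r)) has_real_derivative 1 / (2 * sqrt (slope_gap (?u r))) * ((1 - \<delta>) * w' r)) (at r within {0..t})"
    if r: "r \<in> {0..t}" for r
  proof (rule DERIV_chain2[where f=mixing_potential])
    show "(mixing_potential has_real_derivative 1 / (2 * sqrt (slope_gap (?u r)))) (at (?u r))"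
      by (rule mixing_potential_deriv[OF u[OF r]])
    have "(?u has_real_derivative (1 - \<delta>) * w' r + 0) (at r within {0..t})"
      by (intro DERIV_add DERIV_cmult d r DERIV_const)
    then show "(?u has_real_derivative (1 - \<delta>) * w' r) (at r within {0..t})" by simp
  qed
  have B: "norm (1 / (2 * sqrt (slope_gap (?u r))) * ((1 - \<delta>) * w' r)) \<le> k" if r: "r \<in> {0..t}" for r
  proof -
    have g0: "0 \<le> slope_gap (w r)" by (rule slope_gap_nonneg[OF w[OF r]])
    have "(1 - \<delta>) * slope_gap (w r) + \<delta> * slope_gap (1 / 2) \<le> slope_gap ((1 - \<delta>) * w r + \<delta> * (1 / 2))"
      by (rule slope_gap_concave) (use w[OF r] dl in auto)
    then have c: "(1 - \<delta>) * slope_gap (w r) + \<delta> * slope_gap (1 / 2) \<le> slope_gap (?u r)" by simp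
    have pos: "0 < slope_gap (?u r)"
      using c g0 dl slope_gap_half mult_nonneg_nonneg[of "1 - \<delta>" "slope_gap (w r)"] mult_pos_pos[OF dl(1) slope_gap_half] by linarith
    have "(1 - \<delta>)\<^sup>2 * (slope_gap (w r) + \<omega>) = (1 - \<delta>) * ((1 - \<delta>) * slope_gap (w r)) + (1 - \<delta>)\<^sup>2 * \<omega>"
      by (simp add: power2_eq_square algebra_simps)
    also have "\<dots> \<le> 1 * ((1 - \<delta>) * slope_gap (w r)) + 1 * \<omega>"
      using dl g0 om(2) by (intro add_mono mult_right_mono) (auto simp: power_le_one)
    also have "\<dots> \<le> slope_gap (?u r)" using c om(1) by linarith
    finally have m: "(1 - \<delta>)\<^sup>2 * (slope_gap (w r) + \<omega>) \<le> slope_gap (?u r)" .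
    have "((1 - \<delta>) * w' r)\<^sup>2 \<le> (1 - \<delta>)\<^sup>2 * (4 * k\<^sup>2 * (slope_gap (w r) + \<omega>))"
      unfolding power_mult_distrib by (intro mult_left_mono bd r) simp
    also have "\<dots> = 4 * k\<^sup>2 * ((1 - \<delta>)\<^sup>2 * (slope_gap (w r) + \<omega>))" by simp
    also have "\<dots> \<le> 4 * k\<^sup>2 * slope_gap (?u r)" by (intro mult_left_mono m) simp
    also have "\<dots> = (2 * k * sqrt (slope_gap (?u r)))\<^sup>2" using pos by (simp add: power_mult_distrib)
    finally have "\<bar>(1 - \<delta>) * w' r\<bar> \<le> 2 * k * sqrt (slope_gap (?u r))"
      using k pos by (simp add: abs_le_square_iff[symmetric])
    then show ?thesis using pos by (simp add: abs_mult divide_le_eq mult_ac)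
  qed
  have "norm (mixing_potential (?u 0) - mixing_potential (?u t)) \<le> k * norm (0 - t)"
    by (rule field_differentiable_bound[OF convex_real_interval(5) D B]) (use t in auto)
  then show ?thesis using t by simp
qed

text \<open>The slope inequality is used at the optimal weight \<open>b = 1 - sqrt (1 - w)\<close>. At \<open>w = 1\<close> the optimal weight is one and carries no
  information, so smaller weights are taken and tend to one.\<close>

lemma (in profile) slope_deficit:
  shows "Zg - (LINT x|torus L. (g ((x::real^'n) $ i) * g' (x $ i))\<^sup>2)
    \<le> (L ^ CARD('n) * L\<^sup>2 / 48) * slope_gap (Zg / (L ^ CARD('n) * L\<^sup>2 / 48))"
proof -
  let ?X = "LINT x|torus L. (g ((x::real^'n) $ i) * g' (x $ i))\<^sup>2"
  define H where "H = L ^ CARD('n) * L\<^sup>2 / 48"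
  have H: "H > 0" using L by (simp add: H_def)
  define s where "s = sqrt (1 - Zg / H)"
  have "Zg \<le> H" using Zg_le_Z Z_le by (simp add: H_def)
  then have "0 \<le> Zg / H" "Zg / H \<le> 1" using H Zg_nonneg by auto
  then have s: "0 \<le> s" "s \<le> 1" "s\<^sup>2 = 1 - Zg / H" by (auto simp: s_def)
  then have Zs: "Zg = H * (1 - s\<^sup>2)" using H by simp
  have slope: "(1 - b) * ?X - b * Zg + b\<^sup>2 * H \<ge> 0" if "0 \<le> b" "b \<le> 1" for b
    using g_slope[OF that] by (simp add: H_def)
  have "H * (1 - s)\<^sup>2 \<le> ?X"
  proof (cases "s = 0")
    case False
    have "s * (H * (1 - s)\<^sup>2) \<le> s * ?X"
      using slope[of "1 - s"] s unfolding Zs by (simp add: power2_eq_square algebra_simps)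
    then show ?thesis using False s(1) by simp
  next
    case True
    have b: "b * H \<le> ?X" if "0 \<le> b" "b < 1" for b
    proof -
      have "(1 - b) * (b * H) \<le> (1 - b) * ?X"
        using slope[of b] that unfolding Zs True by (simp add: power2_eq_square algebra_simps)
      then show ?thesis using that by simp
    qed
    have "1 * H \<le> ?X"
    proof (rule field_le_mult_one_interval)
      fix z :: real assume "0 < z" "z < 1"
      then show "z * (1 * H) \<le> ?X" using b[of z] by simp
    qed
    then show ?thesis using True by simp
  qed
  moreover have "Zg - H * (1 - s)\<^sup>2 = H * slope_gap (Zg / H)"
  proof -
    have "slope_gap (Zg / H) = 2 * (s - s\<^sup>2)" unfolding slope_gap_def s(3) s_def[symmetric] ..
    then have "H * slope_gap (Zg / H) = H * (2 * (s - s\<^sup>2))" by (simp only:)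
    then show ?thesis using Zs by (simp only: power2_eq_square) (simp add: algebra_simps)
  qed
  ultimately show ?thesis unfolding H_def[symmetric] by linarith
qed

lemma slope_gap_modulus:
  assumes "0 \<le> a" "a \<le> b" "b \<le> 1"
  shows "slope_gap a \<le> slope_gap b + 2 * sqrt (b - a)"
proof -
  define x y where "x = sqrt (1 - a)" and "y = sqrt (1 - b)"
  have xy: "0 \<le> y" "y \<le> x" "x \<le> 1" "x\<^sup>2 = 1 - a" "y\<^sup>2 = 1 - b" using assms by (auto simp: x_def y_def)
  have "slope_gap a = 2 * (x - x\<^sup>2)" "slope_gap b = 2 * (y - y\<^sup>2)"
    unfolding xy(4,5) using assms by (simp_all add: slope_gap_def x_def y_def)
  then have "slope_gap a - slope_gap b = 2 * ((x - y) * (1 - (x + y)))" by (simp add: power2_eq_square algebra_simps)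
  also have "\<dots> \<le> 2 * ((x - y) * 1)" using xy by (intro mult_left_mono) auto
  also have "x - y \<le> sqrt (b - a)"
  proof (rule real_le_rsqrt)
    have "(x - y)\<^sup>2 + 2 * (y * (x - y)) = x\<^sup>2 - y\<^sup>2" by (simp add: power2_eq_square algebra_simps)
    moreover have "0 \<le> y * (x - y)" using xy by simp
    ultimately show "(x - y)\<^sup>2 \<le> b - a" using xy(4,5) by linarith
  qed
  finally show ?thesis by simp
qed

section \<open>The lower bound for the mixing time\<close>

text \<open>The square of \<open>H_max\<close>, see \<open>H_max_eq\<close> below.\<close>

abbreviation max_energy :: "real \<Rightarrow> nat \<Rightarrow> real" where
  "max_energy L d \<equiv> L ^ d * L\<^sup>2 / 48"

text \<open>The first term is the effect of replacing \<open>Zg\<close> by \<open>Z\<close> in the slope gap, whose modulus of continuity is a square root; the second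
  one stems from \<open>oscillation_bound\<close>.\<close>

definition smoothing_error :: "real \<Rightarrow> nat \<Rightarrow> real \<Rightarrow> real" where
  "smoothing_error L d \<epsilon> = 2 * sqrt (2 * L * \<epsilon> * L ^ d / max_energy L d) + 8 * L * \<epsilon> * L ^ d / max_energy L d"

context mixing
begin

lemma H_pos: "max_energy L CARD('n) > 0" using L by simp

lemma energy_nonneg: "E \<ge> 0"
  by (rule order_trans[OF _ v_energy[OF order_refl tau]]) simp

lemma smoothing_error_nonneg: "0 \<le> smoothing_error L CARD('n) \<epsilon>"
  using L smoothing.eps_nonneg[OF S] unfolding smoothing_error_def by simp

lemma Zt_unit: "0 \<le> t \<Longrightarrow> t < \<tau> \<Longrightarrow> 0 \<le> Zt t / max_energy L CARD('n)" "0 \<le> t \<Longrightarrow> t < \<tau> \<Longrightarrow> Zt t / max_energy L CARD('n) \<le> 1"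
  using profile.Z_nonneg[OF profile_at, of t i] profile.Z_le[OF profile_at, of t i] L unfolding Zt_def
  by (simp_all add: divide_le_eq)

lemma mixing_rate:
  assumes t: "0 \<le> t" "t < \<tau>"
  shows "(- 2 * (LINT x|torus L. (\<rho> t x * v t x $ i) * profile.g L i \<eta> \<Lambda> (\<rho> t) (x $ i)) / max_energy L CARD('n))\<^sup>2
    \<le> 4 * (sqrt (E / max_energy L CARD('n)))\<^sup>2 * (slope_gap (Zt t / max_energy L CARD('n)) + smoothing_error L CARD('n) \<epsilon>)"
proof -
  let ?J = "LINT x|torus L. (\<rho> t x * v t x $ i) * profile.g L i \<eta> \<Lambda> (\<rho> t) (x $ i)"
  let ?D = "LINT x|torus L. ((\<rho> t x - profile.g' L i \<eta> (\<rho> t) (x $ i)) * profile.g L i \<eta> \<Lambda> (\<rho> t) (x $ i))\<^sup>2"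
  let ?Zg = "profile.Zg L i \<eta> \<Lambda> (\<rho> t)"
  note P = profile_at[OF t]
  note HP = H_pos
  have Zg: "?Zg \<le> Zt t" unfolding Zt_def by (rule profile.Zg_le_Z[OF P])
  have "?D \<le> max_energy L CARD('n) * slope_gap (?Zg / max_energy L CARD('n)) + 8 * L * \<epsilon> * L ^ CARD('n)"
    using profile.oscillation_bound[OF P, of i] profile.slope_deficit[OF P, of i] by linarith
  also have "max_energy L CARD('n) * slope_gap (?Zg / max_energy L CARD('n)) \<le> max_energy L CARD('n) * (slope_gap (Zt t / max_energy L CARD('n)) + 2 * sqrt (2 * L * \<epsilon> * L ^ CARD('n) / max_energy L CARD('n)))"
  proof (rule mult_left_mono)
    have "slope_gap (?Zg / max_energy L CARD('n)) \<le> slope_gap (Zt t / max_energy L CARD('n)) + 2 * sqrt (Zt t / max_energy L CARD('n) - ?Zg / max_energy L CARD('n))"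
    proof (rule slope_gap_modulus)
      show "0 \<le> ?Zg / max_energy L CARD('n)" using profile.Zg_nonneg[OF P, of i] HP by simp
      show "?Zg / max_energy L CARD('n) \<le> Zt t / max_energy L CARD('n)" using Zg HP by (rule divide_right_mono[OF _ less_imp_le])
      show "Zt t / max_energy L CARD('n) \<le> 1" by (rule Zt_unit[OF t])
    qed
    also have "Zt t / max_energy L CARD('n) - ?Zg / max_energy L CARD('n) \<le> 2 * L * \<epsilon> * L ^ CARD('n) / max_energy L CARD('n)"
      unfolding diff_divide_distrib[symmetric] Zt_def using profile.Z_diff[OF P, of i] HP
      by (rule divide_right_mono[OF _ less_imp_le])
    finally show "slope_gap (?Zg / max_energy L CARD('n)) \<le> slope_gap (Zt t / max_energy L CARD('n)) + 2 * sqrt (2 * L * \<epsilon> * L ^ CARD('n) / max_energy L CARD('n))" by simp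
  qed (use HP in simp)
  finally have D: "?D \<le> max_energy L CARD('n) * (slope_gap (Zt t / max_energy L CARD('n)) + 2 * sqrt (2 * L * \<epsilon> * L ^ CARD('n) / max_energy L CARD('n))) + 8 * L * \<epsilon> * L ^ CARD('n)" by simp
  also have "\<dots> = max_energy L CARD('n) * (slope_gap (Zt t / max_energy L CARD('n)) + smoothing_error L CARD('n) \<epsilon>)"
  proof -
    have c: "max_energy L CARD('n) * (c / max_energy L CARD('n)) = c" for c using HP by (metis less_irrefl nonzero_mult_div_cancel_left times_divide_eq_right)
    show ?thesis unfolding smoothing_error_def distrib_left c by (simp only: add.assoc)
  qed
  finally have D: "?D \<le> max_energy L CARD('n) * (slope_gap (Zt t / max_energy L CARD('n)) + smoothing_error L CARD('n) \<epsilon>)" .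
  have "?J\<^sup>2 \<le> E * (max_energy L CARD('n) * (slope_gap (Zt t / max_energy L CARD('n)) + smoothing_error L CARD('n) \<epsilon>))"
    using flux_bound[OF t] mult_left_mono[OF D energy_nonneg] by linarith
  then have "4 * ?J\<^sup>2 / (max_energy L CARD('n))\<^sup>2 \<le> 4 * (E * (max_energy L CARD('n) * (slope_gap (Zt t / max_energy L CARD('n)) + smoothing_error L CARD('n) \<epsilon>))) / (max_energy L CARD('n))\<^sup>2"
    using HP by (intro divide_right_mono mult_left_mono) auto
  also have "\<dots> = 4 * (E / max_energy L CARD('n)) * (slope_gap (Zt t / max_energy L CARD('n)) + smoothing_error L CARD('n) \<epsilon>)"
  proof -
    have "4 * (E * (h * X)) / h\<^sup>2 = 4 * (E / h) * X" if "h > 0" for h X :: real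
      using that by (simp add: power2_eq_square)
    from this[OF HP] show ?thesis .
  qed
  also have "E / max_energy L CARD('n) = (sqrt (E / max_energy L CARD('n)))\<^sup>2" using energy_nonneg HP by simp
  finally show ?thesis by (simp only: power_divide power_mult_distrib) simp
qed

lemma potential_drop:
  assumes t: "0 \<le> t1" "t1 < \<tau>" and dl: "0 < \<delta>" "\<delta> < 1" and om: "smoothing_error L CARD('n) \<epsilon> \<le> \<delta> * slope_gap (1 / 2)"
  shows "mixing_potential ((1 - \<delta>) * (profile.Z L i \<Lambda> \<rho>0 / max_energy L CARD('n)) + \<delta> / 2)
    - mixing_potential ((1 - \<delta>) * (Zt t1 / max_energy L CARD('n)) + \<delta> / 2) \<le> sqrt (E / max_energy L CARD('n)) * t1"
  unfolding Zt_0[symmetric]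
proof (rule mixing_comparison[where w="\<lambda>t. Zt t / max_energy L CARD('n)"])
  show "((\<lambda>t. Zt t / max_energy L CARD('n)) has_real_derivative
      (- 2 * (LINT x|torus L. (\<rho> r x * v r x $ i) * profile.g L i \<eta> \<Lambda> (\<rho> r) (x $ i)) / max_energy L CARD('n))) (at r within {0..t1})"
    if "r \<in> {0..t1}" for r
    by (rule DERIV_cdivide[OF Zt_derivative]) (use that t in auto)
  show "0 \<le> Zt r / max_energy L CARD('n)" "Zt r / max_energy L CARD('n) \<le> 1" if "r \<in> {0..t1}" for r
    by (rule Zt_unit, use that t in simp, use that t in simp)+
  show "(- 2 * (LINT x|torus L. (\<rho> r x * v r x $ i) * profile.g L i \<eta> \<Lambda> (\<rho> r) (x $ i)) / max_energy L CARD('n))\<^sup>2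
    \<le> 4 * (sqrt (E / max_energy L CARD('n)))\<^sup>2 * (slope_gap (Zt r / max_energy L CARD('n)) + smoothing_error L CARD('n) \<epsilon>)" if "r \<in> {0..t1}" for r
    by (rule mixing_rate) (use that t in auto)
  show "0 \<le> sqrt (E / max_energy L CARD('n))" using energy_nonneg H_pos by simp
qed (use t dl om smoothing_error_nonneg in auto)

end

lemma smoothing_exists:
  assumes "L > 0" "\<epsilon> > 0"
  shows "\<exists>\<eta> \<Lambda>. smoothing L \<epsilon> \<eta> \<Lambda> \<and> (\<forall>y. \<epsilon> < y \<longrightarrow> y < L - \<epsilon> \<longrightarrow> \<Lambda> y = 1 / 2 - y / L)"
proof -
  obtain \<eta> where m: "mollifier L \<epsilon> \<eta>" using mollifier_exists[OF assms] by blast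
  show ?thesis
  proof (rule sawtooth_exists[OF assms(1) m])
    fix \<Lambda> assume a: "\<And>y. (\<Lambda> has_real_derivative \<eta> y - 1 / L) (at y)" "smooth_on UNIV \<Lambda>"
      "\<And>y. \<Lambda> (y + L) = \<Lambda> y" "\<And>y. \<Lambda> (- y) = - \<Lambda> y" "\<And>y. \<bar>\<Lambda> y\<bar> \<le> 1"
      "\<And>y. \<epsilon> < y \<Longrightarrow> y < L - \<epsilon> \<Longrightarrow> \<Lambda> y = 1 / 2 - y / L"
    have "smoothing L \<epsilon> \<eta> \<Lambda>" unfolding smoothing_def by (intro conjI allI assms(1) m a)
    then show ?thesis using a(6) by blast
  qed
qed

text \<open>The three limits have a fixed order. For a given contraction and smoothing level the final time is approached, where the profile
  energy vanishes with the mixing norm. Then the smoothing is removed, which recovers the initial norm, and at last the contraction.\<close>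

lemma mixing_time_bound:
  fixes \<rho> :: "real \<Rightarrow> real^'n \<Rightarrow> real"
  assumes T: "transport L E \<tau> v \<rho>0 \<rho>" and I: "initial_profile L i \<epsilon> \<eta> \<Lambda> \<rho>0 \<gamma>"
    and mix: "((\<lambda>t. Hm1_norm L (\<rho> (real_of_ereal t))) \<longlongrightarrow> 0) (at_left (ereal \<tau>))"
    and z: "Hm1_norm L \<rho>0 = ereal (sqrt z)" "0 \<le> z" "z \<le> max_energy L CARD('n)"
    and zl: "(\<lambda>n. profile.Z L i (\<Lambda> n) \<rho>0) \<longlonglongrightarrow> z"
  shows "mixing_potential (z / max_energy L CARD('n)) \<le> sqrt (E / max_energy L CARD('n)) * \<tau>"
proof -
  interpret T: transport L E \<tau> v \<rho>0 \<rho> by (rule T)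
  interpret I: initial_profile L i \<epsilon> \<eta> \<Lambda> \<rho>0 \<gamma> by (rule I)
  define H where "H = max_energy L CARD('n)"
  have H: "H > 0" using T.L by (simp add: H_def)
  define k where "k = sqrt (E / H)"
  have M: "mixing L E \<tau> v \<rho>0 \<rho> (\<epsilon> n) (\<eta> n) (\<Lambda> n)" for n
    unfolding mixing_def mixing_axioms_def using T I.S by blast
  have k0: "0 \<le> k" unfolding k_def using mixing.energy_nonneg[OF M] H by simp
  have Z0: "0 \<le> profile.Z L i (\<Lambda> n) \<rho>0 / H" "profile.Z L i (\<Lambda> n) \<rho>0 / H \<le> 1" for n
    using profile.Z_nonneg[OF I.P, of i n] profile.Z_le[OF I.P, of i n] H by (auto simp: H_def)
  have zH: "0 \<le> z / H" "z / H \<le> 1" using z H by (auto simp: H_def)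
  have unit: "(1 - \<delta>) * a + \<delta> / 2 \<in> {0..1}" if "0 \<le> a" "a \<le> 1" "0 < \<delta>" "\<delta> < 1" for a \<delta> :: real
  proof -
    have "0 \<le> (1 - \<delta>) * a" "(1 - \<delta>) * a \<le> 1 - \<delta>" using that by (auto intro: mult_left_le)
    then show ?thesis using that(3) by auto
  qed
  \<comment> \<open>The limit is taken in the extended reals; only real times close to \<open>\<tau>\<close> are extracted from it.\<close>
  have small: "\<exists>t\<ge>0. t < \<tau> \<and> Hm1_norm L (\<rho> t) < ereal c" if c: "c > 0" for c
  proof -
    have "eventually (\<lambda>t. Hm1_norm L (\<rho> (real_of_ereal t)) < ereal c) (at_left (ereal \<tau>))"
      by (rule order_tendstoD(2)[OF mix]) (use c in simp)
    then obtain a where a: "a < ereal \<tau>" "\<And>y. a < y \<Longrightarrow> y < ereal \<tau> \<Longrightarrow> Hm1_norm L (\<rho> (real_of_ereal y)) < ereal c"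
      using eventually_at_left[of 0 "ereal \<tau>"] T.tau by auto
    have "max a 0 < ereal \<tau>" using a(1) T.tau by simp
    then obtain y where y: "max a 0 < y" "y < ereal \<tau>" using dense by blast
    then obtain t where t: "y = ereal t" by (cases y) auto
    show ?thesis using a(2)[of y] y unfolding t by (intro exI[of _ t]) auto
  qed
  have step: "mixing_potential ((1 - \<delta>) * (profile.Z L i (\<Lambda> n) \<rho>0 / H) + \<delta> / 2) \<le> k * \<tau> + mixing_potential (\<delta> / 2)"
    if dl: "0 < \<delta>" "\<delta> < 1" and om: "smoothing_error L CARD('n) (\<epsilon> n) \<le> \<delta> * slope_gap (1 / 2)" for \<delta> n
  proof (rule field_le_epsilon)
    fix e :: real assume e: "e > 0"
    have "\<delta> / 2 \<in> {0..1}" using dl by simp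
    then obtain d where d: "d > 0" "\<And>y. y \<in> {0..1} \<Longrightarrow> dist y (\<delta> / 2) < d \<Longrightarrow> dist (mixing_potential y) (mixing_potential (\<delta> / 2)) < e"
      using mixing_potential_cont e unfolding continuous_on_iff by blast
    obtain t where t: "0 \<le> t" "t < \<tau>" "Hm1_norm L (\<rho> t) < ereal (sqrt (d * H))"
      using small[of "sqrt (d * H)"] d(1) H by auto
    let ?Z = "profile.Z L i (\<Lambda> n) (\<rho> t)"
    note P = mixing.profile_at[OF M t(1,2), of n]
    have "ereal (sqrt ?Z) < ereal (sqrt (d * H))" using profile.Hm1_lower_bound[OF P, of i] t(3) by (rule le_less_trans)
    then have "?Z < d * H" by simp
    then have Zd: "?Z / H < d" using H by (simp add: divide_less_eq)
    have Zu: "0 \<le> ?Z / H" "?Z / H \<le> 1"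
      using profile.Z_nonneg[OF P, of i] profile.Z_le[OF P, of i] H by (auto simp: H_def)
    have "(1 - \<delta>) * (?Z / H) \<le> 1 * (?Z / H)" using dl Zu by (intro mult_right_mono) auto
    moreover have "0 \<le> (1 - \<delta>) * (?Z / H)" using dl Zu by (intro mult_nonneg_nonneg) auto
    ultimately have "dist ((1 - \<delta>) * (?Z / H) + \<delta> / 2) (\<delta> / 2) < d" using Zd unfolding dist_real_def by linarith
    from d(2)[OF unit[OF Zu dl] this]
    have "mixing_potential ((1 - \<delta>) * (?Z / H) + \<delta> / 2) \<le> mixing_potential (\<delta> / 2) + e"
      unfolding dist_real_def by linarith
    moreover have "mixing_potential ((1 - \<delta>) * (profile.Z L i (\<Lambda> n) \<rho>0 / H) + \<delta> / 2)
        - mixing_potential ((1 - \<delta>) * (?Z / H) + \<delta> / 2) \<le> k * t"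
      using mixing.potential_drop[OF M t(1,2) dl om, of i] unfolding mixing.Zt_def[OF M] H_def k_def .
    moreover have "k * t \<le> k * \<tau>" using t(2) k0 by (intro mult_left_mono) auto
    ultimately show "mixing_potential ((1 - \<delta>) * (profile.Z L i (\<Lambda> n) \<rho>0 / H) + \<delta> / 2) \<le> k * \<tau> + mixing_potential (\<delta> / 2) + e"
      by linarith
  qed
  have lim: "mixing_potential ((1 - \<delta>) * (z / H) + \<delta> / 2) \<le> k * \<tau> + mixing_potential (\<delta> / 2)"
    if dl: "0 < \<delta>" "\<delta> < 1" for \<delta>
  proof (rule LIMSEQ_le_const2)
    show "(\<lambda>n. mixing_potential ((1 - \<delta>) * (profile.Z L i (\<Lambda> n) \<rho>0 / H) + \<delta> / 2)) \<longlonglongrightarrow> mixing_potential ((1 - \<delta>) * (z / H) + \<delta> / 2)"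
    proof (rule continuous_on_tendsto_compose[OF mixing_potential_cont])
      show "(\<lambda>n. (1 - \<delta>) * (profile.Z L i (\<Lambda> n) \<rho>0 / H) + \<delta> / 2) \<longlonglongrightarrow> (1 - \<delta>) * (z / H) + \<delta> / 2"
        using H by (intro tendsto_intros zl) simp
      show "(1 - \<delta>) * (z / H) + \<delta> / 2 \<in> {0..1}" by (rule unit[OF zH dl])
      show "\<forall>\<^sub>F n in sequentially. (1 - \<delta>) * (profile.Z L i (\<Lambda> n) \<rho>0 / H) + \<delta> / 2 \<in> {0..1}"
        by (intro always_eventually allI unit Z0 dl)
    qed
    have "(\<lambda>n. smoothing_error L CARD('n) (\<epsilon> n)) \<longlonglongrightarrow> 2 * sqrt (2 * L * 0 * L ^ CARD('n) / H) + 8 * L * 0 * L ^ CARD('n) / H"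
      unfolding smoothing_error_def H_def[symmetric] using H by (intro tendsto_intros I.eps) simp_all
    then have "(\<lambda>n. smoothing_error L CARD('n) (\<epsilon> n)) \<longlonglongrightarrow> 0" by simp
    moreover have "0 < \<delta> * slope_gap (1 / 2)" using dl(1) slope_gap_half by (rule mult_pos_pos)
    ultimately have "\<forall>\<^sub>F n in sequentially. smoothing_error L CARD('n) (\<epsilon> n) < \<delta> * slope_gap (1 / 2)" by (rule order_tendstoD(2))
    then obtain N where "\<And>n. N \<le> n \<Longrightarrow> smoothing_error L CARD('n) (\<epsilon> n) < \<delta> * slope_gap (1 / 2)"
      unfolding eventually_sequentially by blast
    then show "\<exists>N. \<forall>n\<ge>N. mixing_potential ((1 - \<delta>) * (profile.Z L i (\<Lambda> n) \<rho>0 / H) + \<delta> / 2) \<le> k * \<tau> + mixing_potential (\<delta> / 2)"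
      by (intro exI[of _ N] allI impI step[OF dl] less_imp_le)
  qed
  define \<delta> where "\<delta> = (\<lambda>m::nat. 1 / (real m + 2))"
  have dm: "0 < \<delta> m" "\<delta> m < 1" for m by (simp_all add: \<delta>_def)
  have d0: "\<delta> \<longlonglongrightarrow> 0" unfolding \<delta>_def by real_asymp
  have "mixing_potential (z / H) \<le> k * \<tau> + mixing_potential 0"
  proof (rule LIMSEQ_le)
    show "\<exists>N. \<forall>m\<ge>N. mixing_potential ((1 - \<delta> m) * (z / H) + \<delta> m / 2) \<le> k * \<tau> + mixing_potential (\<delta> m / 2)"
      using lim[OF dm] by blast
    show "(\<lambda>m. mixing_potential ((1 - \<delta> m) * (z / H) + \<delta> m / 2)) \<longlonglongrightarrow> mixing_potential (z / H)"
    proof (rule continuous_on_tendsto_compose[OF mixing_potential_cont])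
      have "(\<lambda>m. (1 - \<delta> m) * (z / H) + \<delta> m / 2) \<longlonglongrightarrow> (1 - 0) * (z / H) + 0 / 2" by (intro tendsto_intros d0) simp
      then show "(\<lambda>m. (1 - \<delta> m) * (z / H) + \<delta> m / 2) \<longlonglongrightarrow> z / H" by simp
      show "\<forall>\<^sub>F m in sequentially. (1 - \<delta> m) * (z / H) + \<delta> m / 2 \<in> {0..1}"
        by (intro always_eventually allI unit zH dm)
    qed (use zH in simp)
    show "(\<lambda>m. k * \<tau> + mixing_potential (\<delta> m / 2)) \<longlonglongrightarrow> k * \<tau> + mixing_potential 0"
    proof (intro tendsto_add tendsto_const continuous_on_tendsto_compose[OF mixing_potential_cont])
      have "(\<lambda>m. \<delta> m / 2) \<longlonglongrightarrow> 0 / 2" by (intro tendsto_intros d0) simp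
      then show "(\<lambda>m. \<delta> m / 2) \<longlonglongrightarrow> 0" by simp
      have "0 \<le> \<delta> m / 2" "\<delta> m / 2 \<le> 1" for m using dm[of m] by auto
      then show "\<forall>\<^sub>F m in sequentially. \<delta> m / 2 \<in> {0..1}" by simp
    qed simp
  qed
  then show ?thesis unfolding mixing_potential_0 k_def H_def by simp
qed

lemma H_max_eq: "L > 0 \<Longrightarrow> H_max L d = sqrt (max_energy L d)"
proof -
  assume L: "L > 0"
  have "L ^ d * L\<^sup>2 = L powr (real d + 2)" using L by (simp add: powr_add powr_realpow powr_numeral)
  then have "sqrt (L ^ d * L\<^sup>2) = (L powr (real d + 2)) powr (1 / 2)" by (simp add: powr_half_sqrt)
  also have "\<dots> = L powr ((real d + 2) / 2)" by (simp add: powr_powr)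
  finally show ?thesis by (simp add: H_max_def real_sqrt_divide)
qed

theorem theorem1p3:
  fixes L E :: real and \<rho>0 :: "real ^ 'n \<Rightarrow> real"
  assumes "CARD('n) \<ge> 2" and "L > 0" and "E > 0"
    and "torus_Linf L \<rho>0"
    and "1 / L ^ CARD('n) * (LINT x|torus L. \<rho>0 x) = 0"
    and "torus_Linf_norm L \<rho>0 = 1"
    and "depends_on_one_variable \<rho>0"
  shows "Hm1_norm L \<rho>0 \<in> {0..ereal (H_max L CARD('n))} \<and>
    (let r0 = real_of_ereal (Hm1_norm L \<rho>0) / H_max L CARD('n)
     in T_mix L E \<rho>0 \<ge>
          ereal (E powr (- 1 / 2) * H_max L CARD('n) * sqrt 2 * S_fun (alpha_fun r0)))"
proof -
  note L = \<open>L > 0\<close> and E = \<open>E > 0\<close>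
  have per: "periodic L \<rho>0" and meas: "\<rho>0 \<in> borel_measurable lebesgue"
    using assms(4) by (auto simp: torus_Linf_def)
  have bd: "AE x in torus L. \<bar>\<rho>0 x\<bar> \<le> 1"
    using esssup_AE[of "\<lambda>x. ereal \<bar>\<rho>0 x\<bar>" "torus L"] assms(6) unfolding torus_Linf_norm_def by (simp add: one_ereal_def)
  have int: "integrable (torus L) \<rho>0"
    by (rule finite_measure.integrable_const_bound[OF finite_measure_torus, where B=1]) (use bd meas in \<open>auto intro: measurable_torus\<close>)
  have mean: "(LINT x|torus L. \<rho>0 x) = 0" using assms(5) L by simp
  obtain i \<gamma> where dep: "AE x in lebesgue. \<rho>0 x = \<gamma> (x $ i)" using assms(7) unfolding depends_on_one_variable_def by blast
  define \<epsilon> where "\<epsilon> = (\<lambda>n::nat. 1 / (real n + 1))"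
  have e0: "\<epsilon> \<longlonglongrightarrow> 0" unfolding \<epsilon>_def by real_asymp
  have "\<forall>n. \<exists>\<eta> \<Lambda>. smoothing L (\<epsilon> n) \<eta> \<Lambda> \<and> (\<forall>y. \<epsilon> n < y \<longrightarrow> y < L - \<epsilon> n \<longrightarrow> \<Lambda> y = 1 / 2 - y / L)"
    by (intro allI smoothing_exists L) (simp add: \<epsilon>_def)
  then obtain \<eta> \<Lambda> where sm: "\<And>n. smoothing L (\<epsilon> n) (\<eta> n) (\<Lambda> n)"
    "\<And>n y. \<epsilon> n < y \<Longrightarrow> y < L - \<epsilon> n \<Longrightarrow> \<Lambda> n y = 1 / 2 - y / L" by metis
  have P: "profile L (\<epsilon> n) (\<eta> n) (\<Lambda> n) \<rho>0" for n
    unfolding profile_def profile_axioms_def using sm(1) int bd mean by blast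
  have I: "initial_profile L i \<epsilon> \<eta> \<Lambda> \<rho>0 \<gamma>"
    unfolding initial_profile_def using P e0 sm(2) per dep by blast
  define H where "H = max_energy L CARD('n)"
  have H: "H > 0" using L by (simp add: H_def)
  have Hm: "H_max L CARD('n) = sqrt H" unfolding H_def by (rule H_max_eq[OF L])
  define z where "z = (LINT x|torus L. (initial_profile.F0 L i \<Lambda> \<rho>0 ((x::real^'n) $ i))\<^sup>2)"
  have nz: "Hm1_norm L \<rho>0 = ereal (sqrt z)" unfolding z_def by (rule initial_profile.Hm1_norm_eq[OF I])
  have zl: "(\<lambda>n. profile.Z L i (\<Lambda> n) \<rho>0) \<longlonglongrightarrow> z" unfolding z_def by (rule initial_profile.Z_lim[OF I])
  have z0: "0 \<le> z" unfolding z_def by simp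
  have z1: "z \<le> H" by (rule LIMSEQ_le_const2[OF zl]) (use profile.Z_le[OF P, of i] in \<open>auto simp: H_def\<close>)
  have "E powr (- 1 / 2) * sqrt H * sqrt 2 * S_fun (alpha_fun (sqrt z / sqrt H)) = mixing_potential (z / H) / sqrt (E / H)"
  proof -
    have "(sqrt z / sqrt H)\<^sup>2 = z / H" using z0 H by (simp add: power_divide)
    then have "mixing_potential (z / H) = sqrt 2 * S_fun (alpha_fun (sqrt z / sqrt H))"
      by (simp add: mixing_potential_def alpha_fun_def)
    moreover have "E powr (- 1 / 2) = 1 / sqrt E" using E powr_minus_divide[of E "1/2"] by (simp add: powr_half_sqrt)
    ultimately show ?thesis by (simp add: real_sqrt_divide)
  qed
  moreover have "ereal (mixing_potential (z / H) / sqrt (E / H)) \<le> T_mix L E \<rho>0"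
    unfolding T_mix_def
  proof (rule Inf_greatest, clarify)
    fix T v assume T: "0 < T" "perfectly_mixing L E T \<rho>0 v"
    show "ereal (mixing_potential (z / H) / sqrt (E / H)) \<le> T"
    proof (cases T)
      case (real \<tau>)
      obtain \<rho> where r: "admissible_velocity L E (ereal \<tau>) v" "transport_solution L (ereal \<tau>) v \<rho>0 \<rho>"
        "((\<lambda>t. Hm1_norm L (\<rho> (real_of_ereal t))) \<longlongrightarrow> 0) (at_left (ereal \<tau>))"
        using T(2) unfolding perfectly_mixing_def real by blast
      have "\<tau> > 0" using T(1) real by simp
      then have "transport L E \<tau> v \<rho>0 \<rho>" unfolding transport_def using L r(1,2) int bd mean by blast
      from mixing_time_bound[OF this I r(3) nz z0 _ zl] z1
      have "mixing_potential (z / H) \<le> sqrt (E / H) * \<tau>" by (simp add: H_def)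
      then show ?thesis unfolding real using E H by (simp add: divide_le_eq mult.commute)
    qed (use T(1) in auto)
  qed
  moreover have "sqrt z \<le> sqrt H" using z1 by simp
  ultimately show ?thesis unfolding nz Hm Let_def using z0 by simp
qed

end
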